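(* For every smooth irreducible surface $X \subset \mathbb{P}^3$ over $\mathbb{C}$, the locus $$\mathcal{W}_{\mathrm{N}}(X) = \{L \in \mathbb{P}^3 \smallsetminus X \mid M(\pi_L) \neq S_d\}, \qquad d = \deg X,$$ of non-uniform points is finite.
   Context: All varieties are over $\mathbb{C}$. Let $f: X \to Y$ be a generically finite dominant map of degree $d$ between irreducible complex algebraic varieties of the same dimension. Choose a dense open $U \subset Y$ over which $f$ is an étale covering and a point $y \in U$. Lifting loops gives a homomorphism $\rho: \pi_1(U,y) \to \operatorname{Aut}(f^{-1}(y)) \cong S_d$, where $S_d$ is the symmetric group on $d$ elements; its image $M(f)$ is the monodromy group of $f$ (up to identification independent of $U$ and $y$). For a point $L \in \mathbb{P}^3$, let $\pi_L : \mathbb{P}^3 \dashrightarrow \mathbb{P}^2_L$ be the projection from $L$, sending $x \neq L$ to the line $\langle x, L\rangle$, where $\mathbb{P}^2_L$ is the projective plane of lines of $\mathbb{P}^3$ through $L$. If $X \subset \mathbb{P}^3$ is an irreducible surface of degree $d$ and $L \notin X$, the restriction of $\pi_L$ to $X$ (also denoted $\pi_L$) is a finite surjective morphism $X \to \mathbb{P}^2_L$ of degree $d$, and $M(\pi_L) \subseteq S_d$ denotes its monodromy group. The point $L$ is called uniform if $M(\pi_L) = S_d$ and non-uniform otherwise. *)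

theory Defs
  imports "HOL-Analysis.Analysis" "HOL-Library.Poly_Mapping"
    "HOL-Computational_Algebra.Factorial_Ring" "HOL-Combinatorics.Permutations"
begin

section \<open>Polynomials in the homogeneous coordinates\<close>

type_synonym cpoly4 = "(4 \<Rightarrow>\<^sub>0 nat) \<Rightarrow>\<^sub>0 complex"

definition peval :: "cpoly4 \<Rightarrow> complex ^ 4 \<Rightarrow> complex" where
  "peval F a = (\<Sum>m\<in>Poly_Mapping.keys F.
     Poly_Mapping.lookup F m * (\<Prod>i\<in>UNIV. a $ i ^ Poly_Mapping.lookup m i))"

definition homogeneous :: "nat \<Rightarrow> cpoly4 \<Rightarrow> bool" where
  "homogeneous d F \<longleftrightarrow>
     (\<forall>m\<in>Poly_Mapping.keys F. (\<Sum>i\<in>UNIV. Poly_Mapping.lookup m i) = d)"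

text \<open>The differential of \<open>F\<close> at \<open>a\<close>, applied to the vector \<open>v\<close>.\<close>

definition pdiff :: "cpoly4 \<Rightarrow> complex ^ 4 \<Rightarrow> complex ^ 4 \<Rightarrow> complex" where
  "pdiff F a v = deriv (\<lambda>t. peval F (a + t *s v)) 0"


section \<open>Quotient topologies\<close>

definition quotient_topology :: "'a topology \<Rightarrow> ('a \<Rightarrow> 'b) \<Rightarrow> 'b topology" where
  "quotient_topology T q =
     topology (\<lambda>V. V \<subseteq> q ` topspace T \<and> openin T {x \<in> topspace T. q x \<in> V})"

lemma openin_quotient_topology:
  "openin (quotient_topology T q) V \<longleftrightarrow>
     V \<subseteq> q ` topspace T \<and> openin T {x \<in> topspace T. q x \<in> V}"
proof -
  have "istopology (\<lambda>V. V \<subseteq> q ` topspace T \<and> openin T {x \<in> topspace T. q x \<in> V})"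
    unfolding istopology_def
  proof (intro conjI allI impI; (elim conjE)?)
    fix S S' assume "openin T {x \<in> topspace T. q x \<in> S}" "openin T {x \<in> topspace T. q x \<in> S'}"
    then have "openin T ({x \<in> topspace T. q x \<in> S} \<inter> {x \<in> topspace T. q x \<in> S'})"
      by blast
    also have "{x \<in> topspace T. q x \<in> S} \<inter> {x \<in> topspace T. q x \<in> S'} =
        {x \<in> topspace T. q x \<in> S \<inter> S'}" by blast
    finally show "openin T {x \<in> topspace T. q x \<in> S \<inter> S'}" .
  next
    fix \<K> assume *: "\<forall>K\<in>\<K>. K \<subseteq> q ` topspace T \<and> openin T {x \<in> topspace T. q x \<in> K}"
    then have "openin T (\<Union>K\<in>\<K>. {x \<in> topspace T. q x \<in> K})" by blast
    also have "(\<Union>K\<in>\<K>. {x \<in> topspace T. q x \<in> K}) = {x \<in> topspace T. q x \<in> \<Union>\<K>}" by blast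
    finally show "openin T {x \<in> topspace T. q x \<in> \<Union>\<K>}" .
  qed blast+
  then show ?thesis
    unfolding quotient_topology_def by (simp add: topology_inverse')
qed

lemma topspace_quotient_topology: "topspace (quotient_topology T q) = q ` topspace T"
proof -
  have "{x \<in> topspace T. q x \<in> q ` topspace T} = topspace T" by blast
  then have "openin (quotient_topology T q) (q ` topspace T)"
    by (simp add: openin_quotient_topology)
  then show ?thesis
    by (meson openin_quotient_topology openin_subset openin_topspace subset_antisym)
qed

lemma quotient_map_quotient_topology: "quotient_map T (quotient_topology T q) q"
  by (auto simp: quotient_map_def topspace_quotient_topology openin_quotient_topology)


section \<open>Projective space and projection from a point\<close>

text \<open>
  A point of \<open>\<P>\<^sup>3\<close> is a one-dimensional linear subspace of \<open>\<complex>\<^sup>4\<close>, and a line of \<open>\<P>\<^sup>3\<close> is a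
  two-dimensional one. The constants \<open>vec.span\<close>, \<open>vec.subspace\<close>, \<open>vec.dim\<close> refer to the
  structure of complex (not real) vector space.
\<close>

definition proj3 :: "(complex ^ 4) set set" where
  "proj3 = {p. vec.subspace p \<and> vec.dim p = 1}"

text \<open>The plane \<open>\<P>\<^sup>2\<^sub>L\<close> of lines through the point \<open>L\<close>; it is \<open>\<P>(\<complex>\<^sup>4/L)\<close>.\<close>

definition lines_through :: "(complex ^ 4) set \<Rightarrow> (complex ^ 4) set set" where
  "lines_through L = {l. vec.subspace l \<and> vec.dim l = 2 \<and> L \<subseteq> l}"

definition proj_from :: "(complex ^ 4) set \<Rightarrow> (complex ^ 4) set \<Rightarrow> (complex ^ 4) set" where
  "proj_from L x = vec.span (x \<union> L)"

text \<open>The classical (Euclidean) topologies.\<close>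

definition proj3_topology :: "(complex ^ 4) set topology" where
  "proj3_topology = quotient_topology (top_of_set (- {0})) (\<lambda>a. vec.span {a})"

definition lines_topology :: "(complex ^ 4) set \<Rightarrow> (complex ^ 4) set topology" where
  "lines_topology L = quotient_topology (top_of_set (- L)) (\<lambda>a. vec.span (insert a L))"

text \<open>
  The homogeneous polynomial functions on \<open>\<complex>\<^sup>4/L\<close> are the homogeneous polynomials on \<open>\<complex>\<^sup>4\<close> that
  are invariant under translation by \<open>L\<close>; their zero loci are the Zariski closed subsets
  of \<open>\<P>(\<complex>\<^sup>4/L)\<close>.
\<close>

definition zariski_closed :: "(complex ^ 4) set \<Rightarrow> (complex ^ 4) set set \<Rightarrow> bool" where
  "zariski_closed L Z \<longleftrightarrow>
     (\<exists>S. (\<forall>G\<in>S. (\<exists>e. homogeneous e G) \<and> (\<forall>a. \<forall>v\<in>L. peval G (a + v) = peval G a)) \<and>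
          Z = {l \<in> lines_through L. \<forall>G\<in>S. \<forall>a\<in>l. peval G a = 0})"

definition zariski_dense_open :: "(complex ^ 4) set \<Rightarrow> (complex ^ 4) set set \<Rightarrow> bool" where
  "zariski_dense_open L U \<longleftrightarrow>
     U \<subseteq> lines_through L \<and> zariski_closed L (lines_through L - U) \<and>
     (\<forall>Z. zariski_closed L Z \<and> U \<subseteq> Z \<longrightarrow> Z = lines_through L)"


section \<open>Surfaces\<close>

text \<open>
  An irreducible surface of degree \<open>d\<close> in \<open>\<P>\<^sup>3\<close> is given by its equation, an irreducible
  homogeneous polynomial \<open>F\<close> of degree \<open>d\<close>, unique up to a nonzero scalar.
\<close>

definition surface :: "cpoly4 \<Rightarrow> (complex ^ 4) set set" where
  "surface F = {x \<in> proj3. \<forall>a\<in>x. peval F a = 0}"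

definition smooth_surface :: "cpoly4 \<Rightarrow> bool" where
  "smooth_surface F \<longleftrightarrow> (\<forall>x\<in>surface F. \<forall>a\<in>x - {0}. \<exists>v. pdiff F a v \<noteq> 0)"


section \<open>Monodromy\<close>

text \<open>
  For a covering \<open>f\<close> of \<open>B\<close> by \<open>E\<close> and \<open>y\<close> in \<open>B\<close>: the image of \<open>\<pi>\<^sub>1(B, y)\<close> in the group of
  permutations of the fibre over \<open>y\<close>. A loop \<open>\<gamma>\<close> acts by sending the starting point of each
  lift of \<open>\<gamma>\<close> to its end point.
\<close>

definition monodromy_group ::
  "'a topology \<Rightarrow> ('a \<Rightarrow> 'b) \<Rightarrow> 'b topology \<Rightarrow> 'b \<Rightarrow> ('a \<Rightarrow> 'a) set" where
  "monodromy_group E f B y =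
     {\<sigma>. \<sigma> permutes {x \<in> topspace E. f x = y} \<and>
         (\<exists>\<gamma>. pathin B \<gamma> \<and> \<gamma> 0 = y \<and> \<gamma> 1 = y \<and>
           (\<forall>x\<in>{x \<in> topspace E. f x = y}.
             \<exists>\<gamma>'. pathin E \<gamma>' \<and> (\<forall>t\<in>{0..1}. f (\<gamma>' t) = \<gamma> t) \<and> \<gamma>' 0 = x \<and> \<gamma>' 1 = \<sigma> x))}"

text \<open>
  The projection from \<open>L \<notin> X\<close>, restricted to the smooth surface \<open>X\<close> given by \<open>F\<close>, is finite,
  so over \<open>U\<close> it is an etale covering iff its differential is injective at the points
  over \<open>U\<close>. At \<open>x = [a]\<close> the tangent space of \<open>X\<close> is \<open>ker dF\<^sub>a / x\<close>, that of \<open>\<P>\<^sup>2\<^sub>L\<close> at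
  the line \<open>\<langle>x, L\<rangle>\<close> is \<open>\<complex>\<^sup>4 / \<langle>x, L\<rangle>\<close> (up to a twist), and the differential is induced by the
  identity of \<open>\<complex>\<^sup>4\<close>; hence its kernel is \<open>(ker dF\<^sub>a \<inter> \<langle>x, L\<rangle>) / x\<close>.
\<close>

definition etale_over ::
  "cpoly4 \<Rightarrow> (complex ^ 4) set \<Rightarrow> (complex ^ 4) set set \<Rightarrow> bool" where
  "etale_over F L U \<longleftrightarrow>
     (\<forall>x\<in>surface F. proj_from L x \<in> U \<longrightarrow>
        (\<forall>a\<in>x - {0}. \<forall>v\<in>proj_from L x. pdiff F a v = 0 \<longrightarrow> v \<in> x))"

definition proj_fibre ::
  "cpoly4 \<Rightarrow> (complex ^ 4) set \<Rightarrow> (complex ^ 4) set \<Rightarrow> (complex ^ 4) set set" where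
  "proj_fibre F L y = {x \<in> surface F. proj_from L x = y}"

definition proj_monodromy_group ::
  "cpoly4 \<Rightarrow> (complex ^ 4) set \<Rightarrow> (complex ^ 4) set set \<Rightarrow> (complex ^ 4) set
     \<Rightarrow> ((complex ^ 4) set \<Rightarrow> (complex ^ 4) set) set" where
  "proj_monodromy_group F L U y =
     monodromy_group
       (subtopology proj3_topology {x \<in> surface F. proj_from L x \<in> U})
       (proj_from L)
       (subtopology (lines_topology L) U) y"

text \<open>
  The monodromy group does not depend, up to identification of the fibres, on the
  choice of \<open>U\<close> and \<open>y\<close>; so \<open>L\<close> is uniform iff some choice of them gives all
  permutations of the fibre, which has \<open>d\<close> points.
\<close>

definition uniform_point :: "nat \<Rightarrow> cpoly4 \<Rightarrow> (complex ^ 4) set \<Rightarrow> bool" where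
  "uniform_point d F L \<longleftrightarrow>
     (\<exists>U y. zariski_dense_open L U \<and> etale_over F L U \<and> y \<in> U \<and>
        card (proj_fibre F L y) = d \<and>
        proj_monodromy_group F L U y = {\<sigma>. \<sigma> permutes proj_fibre F L y})"

definition non_uniform_locus :: "nat \<Rightarrow> cpoly4 \<Rightarrow> (complex ^ 4) set set" where
  "non_uniform_locus d F = {L \<in> proj3 - surface F. \<not> uniform_point d F L}"

end

theory Submission
  imports Defs "HOL-Complex_Analysis.Complex_Analysis" "HOL-Computational_Algebra.Fundamental_Theorem_Algebra"
begin

no_notation fps_nth (infixl "$" 75)

text \<open>
  Restrict the projection from \<open>L\<close> to a pencil of lines through \<open>L\<close>, with parameter \<open>t\<close>. Suppose that
  each branch line of the pencil touches the surface in one point only and to first order, and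
  let \<open>R t\<close> be the product of the differences \<open>x - y\<close> over the pairs of points over \<open>t\<close> whose
  transposition is not in the monodromy group. It is holomorphic and nonzero off the branch
  points. At a branch point the two points that collide are exchanged by a small loop, so that
  \<open>1 / R\<close> stays bounded, and the distances between points grow linearly as \<open>t\<close> tends to infinity, so
  that \<open>1 / R\<close> tends to \<open>0\<close> if some transposition is missing. By Liouville's theorem none is, and
  \<open>L\<close> is uniform.

  Such a pencil exists unless \<open>L\<close> is degenerate: infinitely many planes of a pencil of planes
  through \<open>L\<close> contain a line through \<open>L\<close> that is a flex tangent or a bitangent. Since the Gauss
  map of a smooth surface is finite, along a curve of such tangents the data of two centres
  determine the point of contact up to finitely many choices; infinitely many degenerate
  centres would therefore give a line that lies in infinitely many tangent planes.
\<close>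

text \<open>Uniformity asks for one open set and one base point only, and a loop in the parameter
  line of a pencil is already a loop in the open set of unramified lines. So full monodromy over one
  good pencil suffices, and neither the fundamental group of the open set nor the connectedness of a
  covering has to be known. The missing transpositions form a set of ordered pairs that continuation
  carries along, whence \<open>R\<close> is single-valued without any labelling of the points. The
  other obstacle is to handle families of tangents without dimension theory. The substitute is the
  uncountability of the constants: a polynomial function on an algebraic set has a finite or a
  cocountable image, and in the infinite case a holomorphic arc runs through the set, along which
  the defining equations may be differentiated. Cocountability lets countably many degenerate
  centres be compared at one common value, and arcs turn geometric claims into statements on
  covectors that annihilate independent vectors.\<close>

text \<open>Spaces with affine coordinates, so that polynomial functions can be treated uniformly on
  \<open>\<complex>\<close>, on \<open>\<complex>\<^sup>n\<close> and on products.\<close>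

class affine_space =
  fixes coords :: "('a \<Rightarrow> complex) set"
  assumes finite_coords: "finite coords"
    and coords_surj: "\<exists>a. \<forall>c\<in>coords. c a = \<phi> c"

instantiation complex :: affine_space
begin
definition "coords_complex = {\<lambda>x::complex. x}"
instance by standard (auto simp: coords_complex_def)
end

instantiation prod :: (affine_space, affine_space) affine_space
begin
definition "coords_prod = (\<lambda>c (z::'a \<times> 'b). c (fst z)) ` coords \<union> (\<lambda>c z. c (snd z)) ` coords"
instance
proof
  show "finite (coords :: ('a \<times> 'b \<Rightarrow> complex) set)"
    by (auto simp: coords_prod_def finite_coords)
  fix \<phi> :: "('a \<times> 'b \<Rightarrow> complex) \<Rightarrow> complex"
  obtain a b where "\<forall>c\<in>coords. c (a::'a) = \<phi> (\<lambda>z. c (fst z))"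
    and "\<forall>c\<in>coords. c (b::'b) = \<phi> (\<lambda>z. c (snd z))"
    using coords_surj[of "\<lambda>c. \<phi> (\<lambda>z. c (fst z))"] coords_surj[of "\<lambda>c. \<phi> (\<lambda>z. c (snd z))"]
    by blast
  then show "\<exists>a. \<forall>c\<in>coords. c a = \<phi> c"
    by (intro exI[of _ "(a, b)"]) (auto simp: coords_prod_def)
qed
end

instantiation vec :: (affine_space, finite) affine_space
begin
definition "coords_vec = (\<Union>i. (\<lambda>c (z::'a ^ 'b). c (z $ i)) ` coords)"
instance
proof
  show "finite (coords :: ('a ^ 'b \<Rightarrow> complex) set)"
    by (auto simp: coords_vec_def finite_coords)
  fix \<phi> :: "('a ^ 'b \<Rightarrow> complex) \<Rightarrow> complex"
  have "\<forall>i. \<exists>a. \<forall>c\<in>coords. c (a::'a) = \<phi> (\<lambda>z. c (z $ i))"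
    by (intro allI coords_surj)
  then obtain a where "\<And>i. \<forall>c\<in>coords. c (a i :: 'a) = \<phi> (\<lambda>z. c (z $ i))"
    by metis
  then show "\<exists>a. \<forall>c\<in>coords. c a = \<phi> c"
    by (intro exI[of _ "\<chi> i. a i"]) (auto simp: coords_vec_def)
qed
end

section \<open>Polynomial functions\<close>

text \<open>Functions instead of formal polynomials: evaluation, substitution, differentiation and
  division all become inductions over these four rules, on every such space at once.\<close>

inductive polyfun :: "('a::affine_space \<Rightarrow> complex) \<Rightarrow> bool" where
  polyfun_const [intro!, simp]: "polyfun (\<lambda>_. k)"
| polyfun_coord: "c \<in> coords \<Longrightarrow> polyfun c"
| polyfun_add [intro]: "polyfun f \<Longrightarrow> polyfun g \<Longrightarrow> polyfun (\<lambda>x. f x + g x)"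
| polyfun_mult [intro]: "polyfun f \<Longrightarrow> polyfun g \<Longrightarrow> polyfun (\<lambda>x. f x * g x)"

lemma polyfun_minus [intro]: "polyfun f \<Longrightarrow> polyfun (\<lambda>x. - f x)"
  using polyfun_mult[OF polyfun_const[of "-1"], of f] by simp

lemma polyfun_diff [intro]: "polyfun f \<Longrightarrow> polyfun g \<Longrightarrow> polyfun (\<lambda>x. f x - g x)"
  using polyfun_add[OF _ polyfun_minus, of f g] by simp

lemma polyfun_sum [intro]: "(\<And>i. i \<in> A \<Longrightarrow> polyfun (f i)) \<Longrightarrow> polyfun (\<lambda>x. \<Sum>i\<in>A. f i x)"
  by (induction A rule: infinite_finite_induct) auto

lemma polyfun_prod [intro]: "(\<And>i. i \<in> A \<Longrightarrow> polyfun (f i)) \<Longrightarrow> polyfun (\<lambda>x. \<Prod>i\<in>A. f i x)"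
  by (induction A rule: infinite_finite_induct) auto

lemma polyfun_power [intro]: "polyfun f \<Longrightarrow> polyfun (\<lambda>x. f x ^ n)"
  by (induction n) auto

lemma polyfun_divide [intro]: "polyfun f \<Longrightarrow> polyfun (\<lambda>x. f x / k)"
  using polyfun_mult[OF _ polyfun_const[of "inverse k"], of f] by (simp add: divide_inverse)

lemma polyfun_poly [intro]: "polyfun f \<Longrightarrow> polyfun (\<lambda>x. poly q (f x))"
  by (induction q) auto

lemma polyfun_compose:
  assumes "polyfun f" and "\<And>c. c \<in> coords \<Longrightarrow> polyfun (\<lambda>x. c (h x))"
  shows "polyfun (\<lambda>x. f (h x))"
  using assms(1) by induction (auto intro: assms(2))

lemma polyfun_fst: "polyfun f \<Longrightarrow> polyfun (\<lambda>z. f (fst z))"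
  by (rule polyfun_compose) (auto intro!: polyfun_coord simp: coords_prod_def)

lemma polyfun_snd: "polyfun f \<Longrightarrow> polyfun (\<lambda>z. f (snd z))"
  by (rule polyfun_compose) (auto intro!: polyfun_coord simp: coords_prod_def)

lemma polyfun_id [intro!, simp]: "polyfun (\<lambda>x::complex. x)"
  by (rule polyfun_coord) (simp add: coords_complex_def)

lemma polyfun_pair:
  assumes "polyfun f" and "\<And>c. c \<in> coords \<Longrightarrow> polyfun (\<lambda>x. c (g x))"
    and "\<And>c. c \<in> coords \<Longrightarrow> polyfun (\<lambda>x. c (h x))"
  shows "polyfun (\<lambda>x. f (g x, h x))"
  using assms(1) by (rule polyfun_compose) (auto simp: coords_prod_def assms)

lemma polyfun_vec_compose:
  fixes f :: "complex ^ 'n \<Rightarrow> complex"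
  assumes "polyfun f" and "\<And>i. polyfun (\<lambda>x. h x $ i)"
  shows "polyfun (\<lambda>x. f (h x))"
  using assms(1) by (rule polyfun_compose) (auto simp: coords_vec_def coords_complex_def assms)

lemma polyfun_nth: "polyfun (\<lambda>x::complex ^ 'n. x $ i)"
  by (rule polyfun_coord) (auto simp: coords_vec_def coords_complex_def)

subsection \<open>Uncountable families of polynomial functions are linearly dependent\<close>

text \<open>Gaussian elimination on the last coordinate: a vector \<open>b\<close> with a nonzero
  entry there is the pivot, the others are cleared, and the coefficient \<open>e\<close> of
  \<open>b\<close> is chosen afterwards.\<close>

lemma linear_dependence:
  fixes u :: "'i \<Rightarrow> nat \<Rightarrow> complex"
  assumes "finite A" "N < card A"
  shows "\<exists>c. (\<exists>a\<in>A. c a \<noteq> 0) \<and> (\<forall>i<N. (\<Sum>a\<in>A. c a * u a i) = 0)"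
  using assms
proof (induction N arbitrary: A u)
  case 0
  then show ?case by (intro exI[of _ "\<lambda>_. 1"]) (auto simp: card_gt_0_iff)
next
  case (Suc N)
  show ?case
  proof (cases "\<forall>a\<in>A. u a N = 0")
    case True
    with Suc.IH[of A u] Suc.prems obtain c where "\<exists>a\<in>A. c a \<noteq> 0"
      "\<And>i. i < N \<Longrightarrow> (\<Sum>a\<in>A. c a * u a i) = 0" by auto
    then show ?thesis using True by (intro exI[of _ c]) (auto simp: less_Suc_eq)
  next
    case False
    then obtain b where b: "b \<in> A" "u b N \<noteq> 0" by auto
    define v where "v a i = u a i - u a N / u b N * u b i" for a i
    obtain c where c: "\<exists>a\<in>A - {b}. c a \<noteq> 0"
      "\<And>i. i < N \<Longrightarrow> (\<Sum>a\<in>A - {b}. c a * v a i) = 0"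
      using Suc.IH[of "A - {b}" v] Suc.prems b(1) by (metis Suc_lessD card_Diff_singleton finite_Diff less_diff_conv Suc_eq_plus1)
    define e where "e = - (\<Sum>a\<in>A - {b}. c a * (u a N / u b N))"
    have split: "(\<Sum>a\<in>A. (c(b := e)) a * u a i) = e * u b i + (\<Sum>a\<in>A - {b}. c a * u a i)" for i
      using b(1) Suc.prems(1) by (subst sum.remove[of _ b]) (auto intro!: sum.cong)
    have eq: "(\<Sum>a\<in>A. (c(b := e)) a * u a i) = (\<Sum>a\<in>A - {b}. c a * v a i)" for i
    proof -
      have "(\<Sum>a\<in>A - {b}. c a * v a i)
          = (\<Sum>a\<in>A - {b}. c a * u a i) - (\<Sum>a\<in>A - {b}. c a * (u a N / u b N) * u b i)"
        unfolding v_def by (simp add: right_diff_distrib sum_subtractf mult.assoc)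
      then show ?thesis
        unfolding split unfolding e_def by (simp add: sum_distrib_right)
    qed
    have "(\<Sum>a\<in>A. (c(b := e)) a * u a i) = 0" if "i < Suc N" for i
    proof (cases "i = N")
      case True
      then show ?thesis unfolding eq by (intro sum.neutral) (simp add: v_def b)
    next
      case False
      then show ?thesis unfolding eq using c(2) that by simp
    qed
    then show ?thesis using c(1) by (intro exI[of _ "c(b := e)"]) auto
  qed
qed

text \<open>A monomial is a word in the finitely many coordinates, so the monomials can be
  enumerated. Spanning is phrased with initial segments of one fixed sequence, so that the length
  \<open>N\<close> alone has to be made uniform by pigeonhole.\<close>

lemma polyfun_countable_span:
  "\<exists>m :: nat \<Rightarrow> 'a::affine_space \<Rightarrow> complex.
     \<forall>f. polyfun f \<longrightarrow> (\<exists>N u. \<forall>x. f x = (\<Sum>i<N. u i * m i x))"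
proof -
  define mon where "mon l x = prod_list (map (\<lambda>c. c x) l)" for l :: "('a \<Rightarrow> complex) list" and x
  define e where "e = from_nat_into (lists (coords :: ('a \<Rightarrow> complex) set))"
  have e_surj: "\<exists>i. e i = l" if "l \<in> lists coords" for l
    unfolding e_def
    by (intro from_nat_into_surj that countable_lists countable_finite finite_coords)
  have e_in: "e i \<in> lists coords" for i
    unfolding e_def by (rule from_nat_into) (use lists.Nil in blast)
  define sp where "sp f \<longleftrightarrow> (\<exists>N u. \<forall>x. f x = (\<Sum>i<N. u i * mon (e i) x))" for f
  have sp_mon: "sp (\<lambda>x. k * mon l x)" if "l \<in> lists coords" for k l
  proof -
    from e_surj[OF that] obtain j where j: "e j = l" by (elim exE)
    have "(\<Sum>i<Suc j. (if i = j then k else 0) * mon (e i) x) = k * mon l x" for x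
      using j by (simp add: sum.neutral)
    then show ?thesis unfolding sp_def
      by (intro exI[of _ "Suc j"] exI[of _ "\<lambda>i. if i = j then k else 0"]) (simp add: j)
  qed
  have sp_add: "sp (\<lambda>x. f x + g x)" if "sp f" "sp g" for f g
  proof -
    from that obtain N u M v where f: "\<And>x. f x = (\<Sum>i<N. u i * mon (e i) x)"
      and g: "\<And>x. g x = (\<Sum>i<M. v i * mon (e i) x)"
      unfolding sp_def by metis
    have *: "(\<Sum>i<N. u i * mon (e i) x) = (\<Sum>i<max N K. (if i < N then u i else 0) * mon (e i) x)"
      for N K :: nat and u x
      by (rule sum.mono_neutral_cong_left) auto
    have "f x + g x = (\<Sum>i<max N M. ((if i < N then u i else 0) + (if i < M then v i else 0)) * mon (e i) x)" for x
      using f[of x] g[of x] *[where N=N and K=M and u=u and x=x] *[where N=M and K=N and u=v and x=x]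
      by (simp only: max.commute[of M N] sum.distrib distrib_right)
    then show ?thesis unfolding sp_def
      by (intro exI[of _ "max N M"] exI[of _ "\<lambda>i. (if i < N then u i else 0) + (if i < M then v i else 0)"]) auto
  qed
  have sp_0: "sp (\<lambda>x. 0)" unfolding sp_def by (rule exI[of _ 0]) simp
  have sp_sum: "sp (\<lambda>x. \<Sum>i\<in>A. f i x)" if "\<And>i. i \<in> A \<Longrightarrow> sp (f i)" for f :: "nat \<Rightarrow> 'a \<Rightarrow> complex" and A
    using that by (induction A rule: infinite_finite_induct) (auto intro: sp_0 sp_add)
  have sp_mult: "sp (\<lambda>x. f x * g x)" if "sp f" "sp g" for f g
  proof -
    from that obtain N u M v where f: "\<And>x. f x = (\<Sum>i<N. u i * mon (e i) x)"
      and g: "\<And>x. g x = (\<Sum>i<M. v i * mon (e i) x)"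
      unfolding sp_def by metis
    have eq: "(\<lambda>x. f x * g x) = (\<lambda>x. \<Sum>i<N. \<Sum>j<M. (u i * v j) * mon (e i @ e j) x)"
      unfolding f g sum_product by (intro ext sum.cong refl) (simp add: mon_def)
    show ?thesis unfolding eq
      by (intro sp_sum sp_mon) (use e_in in auto)
  qed
  have "sp f" if "polyfun f" for f
    using that
  proof induction
    case (polyfun_const k)
    then show ?case using sp_mon[of "[]" k] by (simp add: mon_def)
  next
    case (polyfun_coord c)
    then show ?case using sp_mon[of "[c]" 1] by (simp add: mon_def)
  qed (auto intro: sp_add sp_mult)
  then show ?thesis unfolding sp_def by (intro exI[of _ "\<lambda>i. mon (e i)"]) simp
qed

text \<open>Pigeonhole for a label with countably many values. It is the source of every uniform
  choice below: lengths, exponents, radii and pairs of centres.\<close>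

lemma uncountable_fibre:
  fixes n :: "'b \<Rightarrow> 'c::countable"
  assumes "uncountable A"
  obtains k where "uncountable {a\<in>A. n a = k}"
proof -
  have eq: "A = (\<Union>k\<in>UNIV. {a\<in>A. n a = k})" by auto
  have "countable (\<Union>k\<in>UNIV. {a\<in>A. n a = k})" if "\<And>k. countable {a\<in>A. n a = k}"
    by (rule countable_UN[OF countableI_type that])
  then show ?thesis using assms eq that by auto
qed

text \<open>Uncountably many of the functions use monomials from one segment of length
  \<open>k\<close>, and any \<open>k + 1\<close> of these are dependent.\<close>

lemma uncountable_polyfun_dependent:
  fixes p :: "'i \<Rightarrow> 'a::affine_space \<Rightarrow> complex"
  assumes "uncountable A" and "\<And>a. a \<in> A \<Longrightarrow> polyfun (p a)"
  obtains B c where "finite B" "B \<subseteq> A" "B \<noteq> {}" "\<And>a. a \<in> B \<Longrightarrow> c a \<noteq> 0"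
    "\<And>x. (\<Sum>a\<in>B. c a * p a x) = 0"
proof -
  obtain m :: "nat \<Rightarrow> 'a \<Rightarrow> complex"
    where m: "\<forall>f. polyfun f \<longrightarrow> (\<exists>N u. \<forall>x. f x = (\<Sum>i<N. u i * m i x))"
    using polyfun_countable_span by (elim exE)
  have "\<exists>N u. \<forall>x. p a x = (\<Sum>i<N. u i * m i x)" if "a \<in> A" for a
    using m[rule_format, OF assms(2)[OF that]] .
  then obtain N u where Nu: "\<And>a x. a \<in> A \<Longrightarrow> p a x = (\<Sum>i<N a. u a i * m i x)"
    by metis
  obtain k where k: "uncountable {a\<in>A. N a = k}"
    by (rule uncountable_fibre[OF assms(1), of N])
  then have "infinite {a\<in>A. N a = k}" using countable_finite by blast
  then obtain B where B: "B \<subseteq> {a\<in>A. N a = k}" "finite B" "card B = Suc k"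
    using infinite_arbitrarily_large by blast
  obtain c where c: "\<exists>a\<in>B. c a \<noteq> 0" "\<And>i. i < k \<Longrightarrow> (\<Sum>a\<in>B. c a * u a i) = 0"
    using linear_dependence[of B k u] B by auto
  \<comment> \<open>Vanishing coefficients are dropped because the polynomials built from such
    relations are shown to be nonzero by evaluation at an arbitrary element of the index
    set.\<close>
  define B' where "B' = {a\<in>B. c a \<noteq> 0}"
  have "(\<Sum>a\<in>B'. c a * p a x) = 0" for x
  proof -
    have "(\<Sum>a\<in>B'. c a * p a x) = (\<Sum>a\<in>B. c a * p a x)"
      unfolding B'_def using B(2) by (intro sum.mono_neutral_left) auto
    also have "\<dots> = (\<Sum>a\<in>B. \<Sum>i<k. c a * u a i * m i x)"
    proof (intro sum.cong refl)
      fix a assume "a \<in> B"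
      then have "a \<in> A" "N a = k" using B by auto
      then show "c a * p a x = (\<Sum>i<k. c a * u a i * m i x)"
        using Nu by (simp add: sum_distrib_left mult.assoc)
    qed
    also have "\<dots> = (\<Sum>i<k. (\<Sum>a\<in>B. c a * u a i) * m i x)"
      by (subst sum.swap) (simp add: sum_distrib_right)
    also have "\<dots> = 0" using c by simp
    finally show ?thesis .
  qed
  moreover have "finite B'" "B' \<subseteq> A" "B' \<noteq> {}" "\<And>a. a \<in> B' \<Longrightarrow> c a \<noteq> 0"
    unfolding B'_def using B c by auto
  ultimately show ?thesis using that by blast
qed

subsection \<open>Ideals of polynomial functions\<close>

definition polyideal :: "('a::affine_space \<Rightarrow> complex) set \<Rightarrow> bool" where
  "polyideal I \<longleftrightarrow> (\<forall>f\<in>I. polyfun f) \<and> (\<lambda>_. 0) \<in> I \<and>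
     (\<forall>f\<in>I. \<forall>g\<in>I. (\<lambda>x. f x + g x) \<in> I) \<and> (\<forall>h f. polyfun h \<longrightarrow> f \<in> I \<longrightarrow> (\<lambda>x. h x * f x) \<in> I)"

definition adjoin :: "('a::affine_space \<Rightarrow> complex) set \<Rightarrow> ('a \<Rightarrow> complex) \<Rightarrow> ('a \<Rightarrow> complex) set" where
  "adjoin I f = {\<lambda>x. a x + h x * f x | a h. a \<in> I \<and> polyfun h}"

lemma polyidealD:
  assumes "polyideal I"
  shows "f \<in> I \<Longrightarrow> polyfun f" "(\<lambda>_. 0) \<in> I" "f \<in> I \<Longrightarrow> g \<in> I \<Longrightarrow> (\<lambda>x. f x + g x) \<in> I"
    "polyfun h \<Longrightarrow> f \<in> I \<Longrightarrow> (\<lambda>x. h x * f x) \<in> I"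
  using assms unfolding polyideal_def by auto

lemma polyideal_minus: "polyideal I \<Longrightarrow> f \<in> I \<Longrightarrow> (\<lambda>x. - f x) \<in> I"
  using polyidealD(4)[of I "\<lambda>_. -1" f] by simp

lemma polyideal_sum:
  "polyideal I \<Longrightarrow> (\<And>i. i \<in> A \<Longrightarrow> f i \<in> I) \<Longrightarrow> (\<lambda>x. \<Sum>i\<in>A. f i x) \<in> I"
  by (induction A rule: infinite_finite_induct) (auto simp: polyidealD)

lemma polyideal_adjoin:
  assumes I: "polyideal I" and f: "polyfun f"
  shows "polyideal (adjoin I f)"
  unfolding polyideal_def
proof (intro conjI ballI allI impI)
  show "polyfun g" if "g \<in> adjoin I f" for g
    using that f by (auto simp: adjoin_def dest: polyidealD(1)[OF I])
  show "(\<lambda>_. 0) \<in> adjoin I f"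
    unfolding adjoin_def using polyidealD(2)[OF I]
    by (intro CollectI exI[of _ "\<lambda>_. 0"]) auto
  show "(\<lambda>x. g x + h x) \<in> adjoin I f" if gh: "g \<in> adjoin I f" "h \<in> adjoin I f" for g h
  proof -
    obtain a b r s where *: "a \<in> I" "b \<in> I" "polyfun r" "polyfun s"
      "g = (\<lambda>x. a x + r x * f x)" "h = (\<lambda>x. b x + s x * f x)"
      using gh unfolding adjoin_def by blast
    have "(\<lambda>x. a x + b x) \<in> I" "polyfun (\<lambda>x. r x + s x)"
      using * polyidealD(3)[OF I] by auto
    moreover have "(\<lambda>x. g x + h x) = (\<lambda>x. (a x + b x) + (r x + s x) * f x)"
      unfolding * by (auto simp: algebra_simps)
    ultimately show ?thesis unfolding adjoin_def
      by (intro CollectI exI[of _ "\<lambda>x. a x + b x"] exI[of _ "\<lambda>x. r x + s x"] conjI)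
  qed
  show "(\<lambda>x. h x * g x) \<in> adjoin I f" if h: "polyfun h" and g: "g \<in> adjoin I f" for g h
  proof -
    obtain a r where *: "a \<in> I" "polyfun r" "g = (\<lambda>x. a x + r x * f x)"
      using g unfolding adjoin_def by blast
    have "(\<lambda>x. h x * a x) \<in> I" "polyfun (\<lambda>x. h x * r x)"
      using * h polyidealD(4)[OF I] by auto
    moreover have "(\<lambda>x. h x * g x) = (\<lambda>x. (h x * a x) + (h x * r x) * f x)"
      unfolding * by (auto simp: algebra_simps)
    ultimately show ?thesis unfolding adjoin_def
      by (intro CollectI exI[of _ "\<lambda>x. h x * a x"] exI[of _ "\<lambda>x. h x * r x"] conjI)
  qed
qed

lemma adjoin_superset: "polyideal I \<Longrightarrow> I \<subseteq> adjoin I f"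
  unfolding adjoin_def by (intro subsetI CollectI, rule_tac x = x in exI) (auto intro!: exI[of _ "\<lambda>_. 0"])

lemma adjoin_member: "polyideal I \<Longrightarrow> f \<in> adjoin I f"
  unfolding adjoin_def
  by (intro CollectI exI[of _ "\<lambda>_. 0"] exI[of _ "\<lambda>_. 1"]) (auto simp: polyidealD(2))

definition multiplicative :: "('a::affine_space \<Rightarrow> complex) set \<Rightarrow> bool" where
  "multiplicative T \<longleftrightarrow> (\<lambda>_. 1) \<in> T \<and> (\<forall>f\<in>T. polyfun f) \<and> (\<forall>f\<in>T. \<forall>g\<in>T. (\<lambda>x. f x * g x) \<in> T)"

lemma multiplicative_mult: "multiplicative T \<Longrightarrow> f \<in> T \<Longrightarrow> g \<in> T \<Longrightarrow> (\<lambda>x. f x * g x) \<in> T"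
  unfolding multiplicative_def by blast

text \<open>Such an \<open>m\<close> corresponds to a maximal ideal of the ring localised at
  \<open>T\<close>. The powers of \<open>g\<close> as \<open>T\<close> yield points; adding the
  nonzero polynomials in \<open>f\<close> yields curves on which \<open>f\<close> is not
  constant.\<close>

locale maximal_disjoint =
  fixes m T :: "('a::affine_space \<Rightarrow> complex) set"
  assumes mult: "multiplicative T"
    and ideal: "polyideal m"
    and disjoint: "m \<inter> T = {}"
    and maximal: "\<And>J. polyideal J \<Longrightarrow> m \<subseteq> J \<Longrightarrow> J \<inter> T = {} \<Longrightarrow> J = m"
begin

lemma one_notin: "(\<lambda>_. 1) \<notin> m"
  using disjoint mult unfolding multiplicative_def by blast

text \<open>In the residue field of the localisation \<open>f\<close> is invertible: up to the
  element of \<open>T\<close>, the cofactor \<open>h\<close> is its inverse.\<close>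

lemma adjoin_meets:
  assumes "polyfun f" "f \<notin> m"
  obtains a h where "a \<in> m" "polyfun h" "(\<lambda>x. a x + h x * f x) \<in> T"
proof -
  have "adjoin m f \<inter> T \<noteq> {}"
    using maximal[OF polyideal_adjoin[OF ideal assms(1)] adjoin_superset[OF ideal]]
      adjoin_member[OF ideal] assms(2) by blast
  then obtain t where "t \<in> adjoin m f" "t \<in> T" by blast
  then show ?thesis unfolding adjoin_def by (auto intro: that)
qed

lemma prime:
  assumes f: "polyfun f" and g: "polyfun g" and fg: "(\<lambda>x. f x * g x) \<in> m"
  shows "f \<in> m \<or> g \<in> m"
proof (rule ccontr)
  assume "\<not> (f \<in> m \<or> g \<in> m)"
  then have "f \<notin> m" "g \<notin> m" by auto
  obtain a r where a: "a \<in> m" "polyfun r" "(\<lambda>x. a x + r x * f x) \<in> T"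
    by (rule adjoin_meets[OF f \<open>f \<notin> m\<close>])
  obtain b s where b: "b \<in> m" "polyfun s" "(\<lambda>x. b x + s x * g x) \<in> T"
    by (rule adjoin_meets[OF g \<open>g \<notin> m\<close>])
  have "(\<lambda>x. (a x + r x * f x) * (b x + s x * g x)) \<in> T"
    using multiplicative_mult[OF mult a(3) b(3)] .
  moreover have "(\<lambda>x. (a x + r x * f x) * (b x + s x * g x)) =
      (\<lambda>x. ((b x + s x * g x) * a x + (r x * f x) * b x) + (r x * s x) * (f x * g x))"
    by (auto simp: algebra_simps)
  moreover have "(\<lambda>x. (r x * s x) * (f x * g x)) \<in> m"
    using a b by (intro polyidealD(4)[OF ideal _ fg]) auto
  then have "(\<lambda>x. ((b x + s x * g x) * a x + (r x * f x) * b x) + (r x * s x) * (f x * g x)) \<in> m"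
    using a b f g polyidealD(1)[OF ideal]
    by (intro polyidealD(3)[OF ideal] polyidealD(4)[OF ideal _ a(1)] polyidealD(4)[OF ideal _ b(1)]) auto
  ultimately show False using disjoint by auto
qed

lemma prime_power: "polyfun f \<Longrightarrow> f \<notin> m \<Longrightarrow> (\<lambda>x. f x ^ n) \<notin> m"
  by (induction n) (use one_notin prime polyfun_power in auto)

lemma prime_prod:
  "finite A \<Longrightarrow> (\<And>i. i \<in> A \<Longrightarrow> polyfun (f i) \<and> f i \<notin> m) \<Longrightarrow> (\<lambda>x. \<Prod>i\<in>A. f i x) \<notin> m"
proof (induction A rule: finite_induct)
  case empty
  then show ?case using one_notin by simp
next
  case (insert i A)
  then show ?case using prime[of "f i" "\<lambda>x. \<Prod>i\<in>A. f i x"] by auto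
qed

text \<open>Clearing denominators in a linear relation between the cofactors \<open>h a\<close>, which exists
  because there are uncountably many of them.\<close>

lemma relation_from_uncountable:
  assumes A: "uncountable A" and X: "polyfun X"
    and \<tau>: "\<And>a. a \<in> A \<Longrightarrow> polyfun (\<tau> a)"
    and h: "\<And>a. a \<in> A \<Longrightarrow> \<exists>h. polyfun h \<and> (\<lambda>x. \<tau> a x - h x * (X x - a)) \<in> m"
  obtains B c where "finite B" "B \<subseteq> A" "B \<noteq> {}" "\<And>a. a \<in> B \<Longrightarrow> c a \<noteq> 0"
    "(\<lambda>x. \<Sum>a\<in>B. c a * \<tau> a x * (\<Prod>b\<in>B - {a}. X x - b)) \<in> m"
proof -
  have "\<forall>a\<in>A. \<exists>h. polyfun h \<and> (\<lambda>x. \<tau> a x - h x * (X x - a)) \<in> m" using h by blast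
  from bchoice[OF this]
  obtain h where h: "\<And>a. a \<in> A \<Longrightarrow> polyfun (h a) \<and> (\<lambda>x. \<tau> a x - h a x * (X x - a)) \<in> m"
    by blast

  obtain B c where B: "finite B" "B \<subseteq> A" "B \<noteq> {}" "\<And>a. a \<in> B \<Longrightarrow> c a \<noteq> 0"
    and dep: "\<And>x. (\<Sum>a\<in>B. c a * h a x) = 0"
    by (rule uncountable_polyfun_dependent[OF A, of h]) (use h in blast)+
  have "(\<lambda>x. \<Sum>a\<in>B. (c a * (\<Prod>b\<in>B - {a}. X x - b)) * (\<tau> a x - h a x * (X x - a))) \<in> m"
    by (intro polyideal_sum[OF ideal] polyidealD(4)[OF ideal] polyfun_mult polyfun_const
        polyfun_prod polyfun_diff X) (use B h in blast)
  also have "(\<lambda>x. \<Sum>a\<in>B. (c a * (\<Prod>b\<in>B - {a}. X x - b)) * (\<tau> a x - h a x * (X x - a))) =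
      (\<lambda>x. \<Sum>a\<in>B. c a * \<tau> a x * (\<Prod>b\<in>B - {a}. X x - b))"
  proof
    fix x
    have "(\<Sum>a\<in>B. (c a * (\<Prod>b\<in>B - {a}. X x - b)) * (\<tau> a x - h a x * (X x - a))) =
      (\<Sum>a\<in>B. c a * \<tau> a x * (\<Prod>b\<in>B - {a}. X x - b)) -
      (\<Sum>a\<in>B. (c a * h a x) * ((X x - a) * (\<Prod>b\<in>B - {a}. X x - b)))"
      unfolding sum_subtractf[symmetric] by (intro sum.cong refl) (simp add: algebra_simps)
    also have "(\<Sum>a\<in>B. (c a * h a x) * ((X x - a) * (\<Prod>b\<in>B - {a}. X x - b))) =
      (\<Sum>a\<in>B. (c a * h a x) * (\<Prod>b\<in>B. X x - b))"
      by (intro sum.cong refl arg_cong2[where f = "(*)"] prod.remove[OF B(1), symmetric])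
    also have "\<dots> = 0" by (simp add: sum_distrib_right[symmetric] dep)
    finally show "(\<Sum>a\<in>B. (c a * (\<Prod>b\<in>B - {a}. X x - b)) * (\<tau> a x - h a x * (X x - a))) =
      (\<Sum>a\<in>B. c a * \<tau> a x * (\<Prod>b\<in>B - {a}. X x - b))" by simp
  qed
  finally have "(\<lambda>x. \<Sum>a\<in>B. c a * \<tau> a x * (\<Prod>b\<in>B - {a}. X x - b)) \<in> m" .
  note fin = this
  show ?thesis by (rule that[of B c]) (fact B fin)+
qed

end

lemma maximal_disjoint_exists:
  assumes I: "polyideal I" and T: "multiplicative T" and "I \<inter> T = {}"
  obtains m where "I \<subseteq> m" "maximal_disjoint m T"
proof -
  define \<A> where "\<A> = {J. polyideal J \<and> I \<subseteq> J \<and> J \<inter> T = {}}"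
  have "\<exists>M\<in>\<A>. \<forall>X\<in>\<A>. M \<subseteq> X \<longrightarrow> X = M"
  proof (rule subset_Zorn_nonempty)
    show "\<A> \<noteq> {}" using assms by (auto simp: \<A>_def)
    fix \<C> assume ne: "\<C> \<noteq> {}" and ch: "subset.chain \<A> \<C>"
    have sub: "\<C> \<subseteq> \<A>" using ch by (auto simp: subset.chain_def)
    have "polyideal (\<Union>\<C>)"
      unfolding polyideal_def
    proof (intro conjI ballI allI impI)
      show "polyfun f" if "f \<in> \<Union>\<C>" for f
      proof -
        from that obtain A where A: "A \<in> \<C>" "f \<in> A" by blast
        then have "polyideal A" using sub by (auto simp: \<A>_def)
        then show ?thesis using A polyidealD(1) by blast
      qed
      obtain A where A: "A \<in> \<C>" using ne by blast
      then have "polyideal A" using sub by (auto simp: \<A>_def)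
      then show "(\<lambda>_. 0) \<in> \<Union>\<C>" using A polyidealD(2) by blast
      show "(\<lambda>x. f x + g x) \<in> \<Union>\<C>" if fg: "f \<in> \<Union>\<C>" "g \<in> \<Union>\<C>" for f g
      proof -
        obtain A B where AB: "A \<in> \<C>" "f \<in> A" "B \<in> \<C>" "g \<in> B" using fg by blast
        then have "A \<subseteq> B \<or> B \<subseteq> A" using ch by (auto simp: subset.chain_def)
        then obtain C where C: "C \<in> \<C>" "f \<in> C" "g \<in> C" using AB by blast
        then have "polyideal C" using sub by (auto simp: \<A>_def)
        then show ?thesis using polyidealD(3) C by blast
      qed
      show "(\<lambda>x. h x * f x) \<in> \<Union>\<C>" if "polyfun h" "f \<in> \<Union>\<C>" for f h
      proof -
        from that obtain A where A: "A \<in> \<C>" "f \<in> A" by blast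
        then have "polyideal A" using sub by (auto simp: \<A>_def)
        then show ?thesis using A polyidealD(4) that by blast
      qed
    qed
    then show "\<Union>\<C> \<in> \<A>" using ne sub by (auto simp: \<A>_def)
  qed
  then obtain M where M: "M \<in> \<A>" "\<And>X. X \<in> \<A> \<Longrightarrow> M \<subseteq> X \<Longrightarrow> X = M" by blast
  have "maximal_disjoint M T"
  proof
    show "J = M" if "polyideal J" "M \<subseteq> J" "J \<inter> T = {}" for J
      using M that by (auto simp: \<A>_def)
  qed (use M T in \<open>auto simp: \<A>_def\<close>)
  then show ?thesis using that M(1) by (auto simp: \<A>_def)
qed

section \<open>Generated ideals and the Nullstellensatz\<close>

definition generated :: "('a::affine_space \<Rightarrow> complex) set \<Rightarrow> ('a \<Rightarrow> complex) set" where
  "generated S = \<Inter>{I. polyideal I \<and> S \<subseteq> I}"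

lemma polyideal_generated:
  assumes "\<And>f. f \<in> S \<Longrightarrow> polyfun f"
  shows "polyideal (generated S)"
proof -
  have all: "polyideal {f::'a \<Rightarrow> complex. polyfun f}" unfolding polyideal_def by auto
  show ?thesis
    unfolding polyideal_def
  proof (intro conjI ballI allI impI)
    show "polyfun f" if "f \<in> generated S" for f
      using that all assms unfolding generated_def by blast
  qed (auto simp: generated_def intro: polyidealD)
qed

lemma generated_superset: "S \<subseteq> generated S"
  unfolding generated_def by blast

lemma generated_vanishes:
  assumes "f \<in> generated S" "\<And>g. g \<in> S \<Longrightarrow> polyfun g" "\<And>g. g \<in> S \<Longrightarrow> g x = 0"
  shows "f x = 0"
proof -
  have "polyideal {f. polyfun f \<and> f x = 0}" unfolding polyideal_def by auto
  moreover have "S \<subseteq> {f. polyfun f \<and> f x = 0}" using assms(2,3) by auto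
  ultimately have "generated S \<subseteq> {f. polyfun f \<and> f x = 0}" unfolding generated_def by auto
  then show ?thesis using assms(1) by auto
qed

text \<open>The Nullstellensatz, by Amitsur's argument: the residue field of a maximal ideal has
  countable dimension, so it is an algebraic extension of the uncountable field of constants.\<close>

lemma nullstellensatz:
  fixes J :: "('a::affine_space \<Rightarrow> complex) set"
  assumes J: "polyideal J" and g: "polyfun g" and pow: "\<And>n. (\<lambda>x. g x ^ n) \<notin> J"
  obtains a where "\<And>f. f \<in> J \<Longrightarrow> f a = 0" "g a \<noteq> 0"
proof -
  \<comment> \<open>Disjointness from the powers of \<open>g\<close> is what keeps \<open>g\<close>
    nonzero at the point to be found.\<close>
  define T where "T = range (\<lambda>n x. g x ^ n)"
  have T: "multiplicative T"
    unfolding multiplicative_def T_def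
  proof (intro conjI ballI)
    show "(\<lambda>_. 1) \<in> range (\<lambda>n x. g x ^ n)" by (rule range_eqI[of _ _ 0]) simp
    show "(\<lambda>x. f x * h x) \<in> range (\<lambda>n x. g x ^ n)"
      if "f \<in> range (\<lambda>n x. g x ^ n)" "h \<in> range (\<lambda>n x. g x ^ n)" for f h
      using that by (auto simp flip: power_add)
  qed (use g in auto)
  obtain m where m: "J \<subseteq> m" "maximal_disjoint m T"
    by (rule maximal_disjoint_exists[OF J T]) (use pow in \<open>auto simp: T_def\<close>)
  interpret maximal_disjoint m T by (fact m)
  have gm: "(\<lambda>x. g x ^ n) \<notin> m" for n using disjoint by (auto simp: T_def)
  have g_notin: "g \<notin> m" using gm[of 1] by simp
  have const: "k = 0" if "(\<lambda>_. k) \<in> m" for k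
    using polyidealD(4)[OF ideal, of "\<lambda>_. inverse k" "\<lambda>_. k"] that one_notin
    by (cases "k = 0") auto
  \<comment> \<open>Each coordinate has a value modulo \<open>m\<close>. Otherwise every
    \<open>c - r\<close> is invertible up to a power of \<open>g\<close>, and a linear relation
    among uncountably many inverses makes \<open>c\<close> algebraic over the constants.\<close>
  have "\<exists>r. (\<lambda>x. c x - r) \<in> m" if c: "c \<in> coords" for c
  proof (rule ccontr)
    assume no: "\<nexists>r. (\<lambda>x. c x - r) \<in> m"
    have pc: "polyfun c" using c by (rule polyfun_coord)
    have "\<exists>n h. polyfun h \<and> (\<lambda>x. g x ^ n - h x * (c x - r)) \<in> m" for r
    proof -
      obtain a h where ah: "a \<in> m" "polyfun h" "(\<lambda>x. a x + h x * (c x - r)) \<in> T"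
        by (rule adjoin_meets[of "\<lambda>x. c x - r"]) (use pc no in auto)
      then obtain n where "(\<lambda>x. a x + h x * (c x - r)) = (\<lambda>x. g x ^ n)" by (auto simp: T_def)
      then have eq: "a x + h x * (c x - r) = g x ^ n" for x by meson
      have "(\<lambda>x. g x ^ n - h x * (c x - r)) = a"
        by (rule ext) (simp add: eq[symmetric])
      then show ?thesis using ah by auto
    qed
    then have "\<forall>r. \<exists>n. \<exists>h. polyfun h \<and> (\<lambda>x. g x ^ n - h x * (c x - r)) \<in> m" by blast
    from choice[OF this] obtain n
      where n: "\<And>r. \<exists>h. polyfun h \<and> (\<lambda>x. g x ^ n r - h x * (c x - r)) \<in> m" by blast
    obtain k where k: "uncountable {r\<in>UNIV. n r = k}"
      using uncountable_fibre[of "UNIV :: complex set" n] uncountable_UNIV_complex by blast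
    obtain B e where B: "finite B" "B \<noteq> {}" "\<And>a. a \<in> B \<Longrightarrow> e a \<noteq> 0"
      and rel: "(\<lambda>x. \<Sum>a\<in>B. e a * g x ^ k * (\<Prod>b\<in>B - {a}. c x - b)) \<in> m"
      by (rule relation_from_uncountable[OF k pc, where \<tau> = "\<lambda>a x. g x ^ k"]) (use n g in auto)
    \<comment> \<open>The numerator of a sum of partial fractions; at an element of \<open>B\<close>
      only one summand survives, so this is not the zero polynomial.\<close>
    define q where "q = (\<Sum>a\<in>B. smult (e a) (\<Prod>b\<in>B - {a}. [:-b, 1:]))"
    have q: "poly q y = (\<Sum>a\<in>B. e a * (\<Prod>b\<in>B - {a}. y - b))" for y
      unfolding q_def by (simp add: poly_sum poly_prod)
    obtain a0 where a0: "a0 \<in> B" using B by blast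
    have "poly q a0 = e a0 * (\<Prod>b\<in>B - {a0}. a0 - b)"
      unfolding q using B a0
      by (subst sum.remove[of _ a0]) (auto intro!: sum.neutral)
    then have "q \<noteq> 0" using B a0 by auto
    have "(\<lambda>x. g x ^ k * poly q (c x)) \<in> m"
      using rel unfolding q by (simp add: sum_distrib_left mult_ac)
    then have qm: "(\<lambda>x. poly q (c x)) \<in> m"      using prime[OF polyfun_power[OF g] polyfun_poly[OF pc]] gm by blast
    \<comment> \<open>The polynomial splits into linear factors, so by primality some
      \<open>c - z\<close> would lie in \<open>m\<close>.\<close>
    have "p \<noteq> 0 \<Longrightarrow> (\<lambda>x. poly p (c x)) \<in> m \<Longrightarrow> False" for p
    proof (induction "degree p" arbitrary: p)
      case 0
      then obtain k where "p = [:k:]" using degree_eq_zeroE[of p] by metis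
      with 0 const[of k] show ?case by auto
    next
      case (Suc d)
      have "\<not> constant (poly p)" using Suc(2) constant_degree by (metis nat.distinct(1))
      then obtain z where "poly p z = 0" using Fundamental_Theorem_Algebra.fundamental_theorem_of_algebra by blast
      then obtain s where s: "p = [:-z, 1:] * s" by (metis dvdE poly_eq_0_iff_dvd)
      have "(\<lambda>x. (c x - z) * poly s (c x)) \<in> m" using Suc.prems(2) unfolding s by (simp add: algebra_simps)
      then have "(\<lambda>x. poly s (c x)) \<in> m"
        using prime[OF polyfun_diff[OF pc polyfun_const] polyfun_poly[OF pc]] no by blast
      moreover have "s \<noteq> 0" using Suc.prems s by auto
      moreover have "d = degree s" using Suc(2) \<open>s \<noteq> 0\<close> unfolding s by (subst (asm) degree_mult_eq) auto
      ultimately show ?case using Suc(1) by blast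
    qed
    with qm \<open>q \<noteq> 0\<close> show False by blast
  qed
  then have "\<forall>c\<in>coords. \<exists>r. (\<lambda>x. c x - r) \<in> m" by blast
  from bchoice[OF this] obtain r where r: "\<And>c. c \<in> coords \<Longrightarrow> (\<lambda>x. c x - r c) \<in> m" by blast
  obtain a where a: "\<And>c. c \<in> coords \<Longrightarrow> c a = r c" using coords_surj[of r] by blast
  have res: "(\<lambda>x. f x - f a) \<in> m" if "polyfun f" for f
    using that
  proof induction
    case (polyfun_const k)
    then show ?case using polyidealD(2)[OF ideal] by simp
  next
    case (polyfun_coord c)
    then show ?case using r a by auto
  next
    case (polyfun_add f h)
    then show ?case using polyidealD(3)[OF ideal polyfun_add.IH] by (simp add: algebra_simps)
  next
    case (polyfun_mult f h)
    have "(\<lambda>x. h x * (f x - f a) + f a * (h x - h a)) \<in> m"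
      using polyfun_mult by (intro polyidealD(3)[OF ideal] polyidealD(4)[OF ideal]) auto
    then show ?case by (simp add: algebra_simps)
  qed
  have van: "f a = 0" if "f \<in> m" for f
  proof -
    have "(\<lambda>x. f x + - (f x - f a)) \<in> m"
      using that res[OF polyidealD(1)[OF ideal that]]
      by (intro polyidealD(3)[OF ideal] polyideal_minus[OF ideal])
    then show ?thesis using const by simp
  qed
  have "g a \<noteq> 0" using res[OF g] g_notin by auto
  with van m(1) show ?thesis using that by blast
qed

subsection \<open>Simple roots depend holomorphically on parameters\<close>

lemma polyfun_has_derivative:
  fixes G :: "complex \<times> complex \<Rightarrow> complex"
  assumes "polyfun G"
  shows "\<exists>G1 G2. polyfun G1 \<and> polyfun G2 \<and>
    (\<forall>z. (G has_derivative (\<lambda>h. G1 z * fst h + G2 z * snd h)) (at z))"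
  using assms
proof induction
  case (polyfun_const k)
  show ?case by (intro exI[of _ "\<lambda>_. 0"]) auto
next
  case (polyfun_coord c)
  then consider "c = fst" | "c = snd"
    by (auto simp: coords_prod_def coords_complex_def fun_eq_iff)
  then show ?case
  proof cases
    case 1
    then show ?thesis
      by (intro exI[of _ "\<lambda>_. 1"] exI[of _ "\<lambda>_. 0"]) (auto intro!: derivative_eq_intros)
  next
    case 2
    then show ?thesis
      by (intro exI[of _ "\<lambda>_. 0"] exI[of _ "\<lambda>_. 1"]) (auto intro!: derivative_eq_intros)
  qed
next
  case (polyfun_add f g)
  then obtain f1 f2 g1 g2 where *: "polyfun f1" "polyfun f2" "polyfun g1" "polyfun g2"
    "\<And>z. (f has_derivative (\<lambda>h. f1 z * fst h + f2 z * snd h)) (at z)"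
    "\<And>z. (g has_derivative (\<lambda>h. g1 z * fst h + g2 z * snd h)) (at z)" by blast
  have "((\<lambda>x. f x + g x) has_derivative (\<lambda>h. (f1 z + g1 z) * fst h + (f2 z + g2 z) * snd h)) (at z)" for z
    by (rule has_derivative_eq_rhs[OF has_derivative_add[OF *(5,6)]]) (auto simp: algebra_simps)
  then show ?case
    by (intro exI[of _ "\<lambda>z. f1 z + g1 z"] exI[of _ "\<lambda>z. f2 z + g2 z"] conjI polyfun.polyfun_add *) auto
next
  case (polyfun_mult f g)
  then obtain f1 f2 g1 g2 where *: "polyfun f1" "polyfun f2" "polyfun g1" "polyfun g2"
    "\<And>z. (f has_derivative (\<lambda>h. f1 z * fst h + f2 z * snd h)) (at z)"
    "\<And>z. (g has_derivative (\<lambda>h. g1 z * fst h + g2 z * snd h)) (at z)" by blast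
  have "((\<lambda>x. f x * g x) has_derivative
      (\<lambda>h. (f z * g1 z + f1 z * g z) * fst h + (f z * g2 z + f2 z * g z) * snd h)) (at z)" for z
    by (rule has_derivative_eq_rhs[OF has_derivative_mult[OF *(5,6)]]) (auto simp: algebra_simps)
  then show ?case
    by (intro exI[of _ "\<lambda>z. f z * g1 z + f1 z * g z"] exI[of _ "\<lambda>z. f z * g2 z + f2 z * g z"]
        conjI polyfun.polyfun_add polyfun.polyfun_mult * polyfun_mult.hyps) auto
qed

lemma polyfun_continuous:
  assumes "polyfun f" "\<And>c. c \<in> coords \<Longrightarrow> continuous_on A (\<lambda>x. c (h x))"
  shows "continuous_on A (\<lambda>x. f (h x))"
  using assms(1) by induction (auto intro: continuous_intros assms(2))

lemma polyfun_continuous_pair: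
  fixes f :: "complex \<times> complex \<Rightarrow> complex"
  assumes "polyfun f" "continuous_on A g" "continuous_on A h"
  shows "continuous_on A (\<lambda>x. f (g x, h x))"
  by (rule polyfun_continuous[OF assms(1)]) (auto simp: coords_prod_def coords_complex_def assms(2,3))

text \<open>The implicit function theorem, from the inverse function theorem for the map sending
  \<open>(t, y)\<close> to \<open>(t, G (t, y))\<close>; \<open>\<phi> t\<close> is the second
  coordinate of the inverse at \<open>(t, 0)\<close>. Uniqueness of the nearby root is what later
  identifies points of an algebraic set as lying on one common arc.\<close>

lemma local_root:
  fixes G :: "complex \<times> complex \<Rightarrow> complex"
  assumes G: "polyfun G" and root: "G (t0, y0) = 0"
    and der: "((\<lambda>y. G (t0, y)) has_field_derivative D) (at y0)" and D: "D \<noteq> 0"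
  obtains e \<phi> where "e > 0" "\<phi> holomorphic_on ball t0 e" "\<phi> t0 = y0"
    "\<And>t. t \<in> ball t0 e \<Longrightarrow> G (t, \<phi> t) = 0"
    "\<And>t y. t \<in> ball t0 e \<Longrightarrow> y \<in> ball y0 e \<Longrightarrow> G (t, y) = 0 \<Longrightarrow> y = \<phi> t"
proof -
  obtain G1 G2 where pG: "polyfun G1" "polyfun G2"
    and dG: "\<And>z. (G has_derivative (\<lambda>h. G1 z * fst h + G2 z * snd h)) (at z)"
    using polyfun_has_derivative[OF G] by blast
  have "((\<lambda>y. G (t0, y)) has_derivative (\<lambda>h. G1 (t0, y0) * fst (0::complex, h) + G2 (t0, y0) * snd (0::complex, h))) (at y0)"
    by (rule has_derivative_compose[of "\<lambda>y. (t0, y)" _ _ _ G, OF _ dG])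
       (auto intro!: derivative_eq_intros)
  then have "((\<lambda>y. G (t0, y)) has_field_derivative G2 (t0, y0)) (at y0)"
    by (simp add: has_field_derivative_def)
  then have G2: "G2 (t0, y0) = D" using der DERIV_unique by blast
  define \<Psi> where "\<Psi> z = (fst z, G z)" for z
  define L where "L z h = (fst h, G1 z * fst h + G2 z * snd h)" for z h :: "complex \<times> complex"
  have bl: "bounded_linear (L z)" for z
    unfolding L_def by (intro bounded_linear_Pair bounded_linear_fst bounded_linear_add
        bounded_linear_const_mult bounded_linear_snd)
  define \<Psi>' where "\<Psi>' z = Blinfun (L z)" for z
  have \<Psi>'_apply: "blinfun_apply (\<Psi>' z) = L z" for z
    unfolding \<Psi>'_def by (rule bounded_linear_Blinfun_apply[OF bl])
  have d\<Psi>: "(\<Psi> has_derivative blinfun_apply (\<Psi>' z)) (at z)" for z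
    unfolding \<Psi>'_apply unfolding \<Psi>_def L_def
    by (intro has_derivative_Pair dG) (auto intro!: derivative_eq_intros)
  have cont: "continuous_on UNIV \<Psi>'"
  proof (rule continuous_on_blinfun_componentwise)
    have c: "continuous_on UNIV (\<lambda>z. G1 z)" "continuous_on UNIV (\<lambda>z. G2 z)"
      using polyfun_continuous_pair[OF pG(1) continuous_on_fst[OF continuous_on_id] continuous_on_snd[OF continuous_on_id]]
        polyfun_continuous_pair[OF pG(2) continuous_on_fst[OF continuous_on_id] continuous_on_snd[OF continuous_on_id]]
      by auto
    show "continuous_on UNIV (\<lambda>z. blinfun_apply (\<Psi>' z) i)" for i
      unfolding \<Psi>'_apply L_def by (intro continuous_intros c)
  qed
  \<comment> \<open>The inverse of the triangular Jacobian matrix at the base point, whose lower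
    right entry is \<open>D\<close>.\<close>
  define Linv where "Linv k = (fst k, (snd k - G1 (t0, y0) * fst k) / D)" for k :: "complex \<times> complex"
  have bLinv: "bounded_linear Linv"
    unfolding Linv_def divide_inverse
    by (intro bounded_linear_Pair bounded_linear_fst bounded_linear_mult_const bounded_linear_sub
        bounded_linear_const_mult bounded_linear_snd)
  have inv: "Blinfun Linv o\<^sub>L \<Psi>' (t0, y0) = id_blinfun"
    by (rule blinfun_eqI)
       (simp add: bounded_linear_Blinfun_apply[OF bLinv] \<Psi>'_apply, simp add: Linv_def L_def G2 D)
  obtain U V g g' where U: "open U" "U \<subseteq> UNIV" "(t0, y0) \<in> U" and V: "open V" "\<Psi> (t0, y0) \<in> V"
    and hom: "homeomorphism U V \<Psi> g"
    and dg: "\<And>z. z \<in> V \<Longrightarrow> (g has_derivative g' z) (at z)"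
    and g': "\<And>z. z \<in> V \<Longrightarrow> g' z = Hilbert_Choice.inv (blinfun_apply (\<Psi>' (g z)))"
    and bij: "\<And>z. z \<in> V \<Longrightarrow> bij (blinfun_apply (\<Psi>' (g z)))"
  proof (rule inverse_function_theorem[OF open_UNIV d\<Psi> cont UNIV_I inv], goal_cases)
    case (1 U V g g')
    show ?case
    proof (rule 1(1)[of U V g g'])
      show "(g has_derivative g' z) (at z)" if "z \<in> V" for z by (rule 1(8)[OF that])
      show "g' z = Hilbert_Choice.inv (blinfun_apply (\<Psi>' (g z)))" if "z \<in> V" for z by (rule 1(9)[OF that])
      show "bij (blinfun_apply (\<Psi>' (g z)))" if "z \<in> V" for z by (rule 1(10)[OF that])
    qed (rule 1(2) 1(3) 1(4) 1(5) 1(6) 1(7))+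
  qed
  obtain e1 where e1: "e1 > 0" "ball t0 e1 \<times> ball y0 e1 \<subseteq> U"
  proof -
    obtain A B where AB: "open A" "open B" "(t0, y0) \<in> A \<times> B" "A \<times> B \<subseteq> U"
      by (rule open_prod_elim[OF U(1,3)])
    have mem: "t0 \<in> A" "y0 \<in> B" using AB(3) by auto
    obtain r where r: "r > 0" "ball t0 r \<subseteq> A" by (rule openE[OF AB(1) mem(1)])
    obtain s where s: "s > 0" "ball y0 s \<subseteq> B" by (rule openE[OF AB(2) mem(2)])
    have "ball t0 (min r s) \<times> ball y0 (min r s) \<subseteq> A \<times> B" using r(2) s(2) by auto
    then show ?thesis using AB(4) r(1) s(1) that[of "min r s"] by auto
  qed
  have "open ((\<lambda>t. (t, 0)) -` V)"
    by (intro open_vimage V continuous_intros)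
  moreover have "t0 \<in> (\<lambda>t. (t, 0)) -` V" using V root by (simp add: \<Psi>_def)
  ultimately obtain e2 where e2: "e2 > 0" "ball t0 e2 \<subseteq> (\<lambda>t. (t, 0)) -` V"
    using openE by blast
  define e where "e = min e1 e2"
  define \<phi> where "\<phi> t = snd (g (t, 0))" for t
  have inV: "(t, 0) \<in> V" if "t \<in> ball t0 e" for t using that e2 by (auto simp: e_def)
  have g_eq: "g (t, 0) = (t, \<phi> t)" "G (t, \<phi> t) = 0" if "t \<in> ball t0 e" for t
  proof -
    have "\<Psi> (g (t, 0)) = (t, 0)" using hom inV[OF that] unfolding homeomorphism_def by blast
    then have "fst (g (t, 0)) = t" and G0: "G (g (t, 0)) = 0" by (simp_all add: \<Psi>_def)
    then show eq: "g (t, 0) = (t, \<phi> t)" by (simp add: \<phi>_def prod_eq_iff)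
    show "G (t, \<phi> t) = 0" using G0 unfolding eq .
  qed
  have uniq: "y = \<phi> t" if "t \<in> ball t0 e" "y \<in> ball y0 e" "G (t, y) = 0" for t y
  proof -
    have "(t, y) \<in> U" using that e1 by (auto simp: e_def)
    moreover have "\<Psi> (t, y) = (t, 0)" using that by (simp add: \<Psi>_def)
    ultimately have "g (t, 0) = (t, y)" using hom unfolding homeomorphism_def by metis
    then show ?thesis by (simp add: \<phi>_def)
  qed
  have epos: "e > 0" using e1 e2 by (simp add: e_def)
  have "\<phi> field_differentiable (at t)" if t: "t \<in> ball t0 e" for t
  proof -
    let ?z = "(t, 0) :: complex \<times> complex"
    have b: "bij (L (t, \<phi> t))" using bij[OF inV[OF t]] by (simp add: \<Psi>'_apply g_eq[OF t])
    \<comment> \<open>The Jacobian matrix is bijective at every point of the inverse's range, so the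
      derivative in the second variable cannot vanish there either.\<close>
    have nz: "G2 (t, \<phi> t) \<noteq> 0"
    proof
      assume "G2 (t, \<phi> t) = 0"
      then have "L (t, \<phi> t) (0, 1) = L (t, \<phi> t) (0, 0)" by (simp add: L_def)
      then have "(0, 1) = (0 :: complex, 0 :: complex)" using b by (meson bij_def injD)
      then show False by simp
    qed
    let ?k = "- G1 (t, \<phi> t) / G2 (t, \<phi> t)"
    have "L (t, \<phi> t) (h, ?k * h) = (h, 0)" for h using nz by (simp add: L_def field_simps)
    then have ginv: "g' ?z (h, 0) = (h, ?k * h)" for h
      using b unfolding g'[OF inV[OF t]] \<Psi>'_apply g_eq[OF t] by (metis bij_inv_eq_iff)
    have "((\<lambda>t. g (t, 0)) has_derivative (\<lambda>h. g' ?z (h, 0))) (at t)"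
      by (rule has_derivative_compose[of "\<lambda>t. (t, 0)" _ _ _ g, OF _ dg[OF inV[OF t]]])
         (auto intro!: derivative_eq_intros)
    then have "(\<phi> has_derivative (\<lambda>h. snd (g' ?z (h, 0)))) (at t)"
      unfolding \<phi>_def by (rule has_derivative_snd)
    then have "(\<phi> has_derivative (*) ?k) (at t)" unfolding ginv snd_conv .
    then show ?thesis unfolding field_differentiable_def has_field_derivative_def by blast
  qed
  then have "\<phi> holomorphic_on ball t0 e"
    by (simp add: holomorphic_on_def field_differentiable_at_within)
  moreover have "\<phi> t0 = y0" using uniq[of t0 y0] epos root by simp
  ultimately show ?thesis using that[OF epos, of \<phi>] g_eq uniq by blast
qed

subsection \<open>Holomorphic arcs in algebraic sets\<close>

text \<open>A \<open>complex poly poly\<close> is read as a polynomial in \<open>y\<close> over the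
  polynomials in \<open>t\<close>: evaluation at the constant \<open>[:y:]\<close> substitutes
  \<open>y\<close> and leaves a polynomial in \<open>t\<close>.\<close>

lemma polyfun_poly2:
  assumes "polyfun f" "polyfun c"
  shows "polyfun (\<lambda>x. poly (poly P [:c x:]) (f x))"
  by (induction P) (auto intro!: polyfun_add polyfun_mult polyfun_poly assms)

lemma DERIV_poly2:
  "((\<lambda>y. poly (poly P [:y:]) t) has_field_derivative poly (poly (pderiv P) [:y:]) t) (at y)"
  for P :: "complex poly poly"
proof (induction P)
  case (pCons a P)
  have "((\<lambda>y. poly a t + y * poly (poly P [:y:]) t) has_field_derivative
      poly (poly P [:y:]) t + y * poly (poly (pderiv P) [:y:]) t) (at y)"
    by (auto intro!: derivative_eq_intros pCons)
  then show ?case by (simp add: pderiv_pCons)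
qed auto

lemma polyfun_cong:
  assumes "polyfun f" "\<And>c. c \<in> coords \<Longrightarrow> c a = c b"
  shows "f a = f b"
  using assms(1) by induction (auto simp: assms(2))

lemma polyfun_holomorphic:
  assumes "polyfun f" "\<And>c. c \<in> coords \<Longrightarrow> (\<lambda>x. c (h x)) holomorphic_on A"
  shows "(\<lambda>x. f (h x)) holomorphic_on A"
  using assms(1) by induction (auto intro: holomorphic_intros assms(2))

text \<open>The plane is cut into countably many squares of side \<open>\<delta> / 2\<close>. For
  each function in turn, one square receives uncountably many of the points.\<close>

lemma uncountable_cluster:
  fixes H :: "('b \<Rightarrow> complex) set"
  assumes "finite H" "uncountable A" "\<delta> > 0"
  shows "\<exists>A'\<subseteq>A. uncountable A' \<and> (\<forall>h\<in>H. \<forall>s\<in>A'. \<forall>t\<in>A'. dist (h s) (h t) < \<delta>)"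
  using assms(1)
proof (induction H rule: finite_induct)
  case empty
  then show ?case using assms(2) by blast
next
  case (insert h H)
  then obtain B where B: "B \<subseteq> A" "uncountable B" "\<And>g s t. g \<in> H \<Longrightarrow> s \<in> B \<Longrightarrow> t \<in> B \<Longrightarrow> dist (g s) (g t) < \<delta>"
    by blast
  define key where "key t = (\<lfloor>Re (h t) / (\<delta> / 2)\<rfloor>, \<lfloor>Im (h t) / (\<delta> / 2)\<rfloor>)" for t
  obtain k where k: "uncountable {t\<in>B. key t = k}" using uncountable_fibre[OF B(2)] by blast
  have fl: "\<bar>x - y\<bar> < \<delta> / 2" if "\<lfloor>x / (\<delta> / 2)\<rfloor> = \<lfloor>y / (\<delta> / 2)\<rfloor>" for x y :: real
  proof -
    have "\<bar>x / (\<delta> / 2) - y / (\<delta> / 2)\<bar> < 1" using that by linarith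
    moreover have "\<bar>x / (\<delta> / 2) - y / (\<delta> / 2)\<bar> = \<bar>x - y\<bar> / (\<delta> / 2)"
      using assms(3) by (simp only: diff_divide_distrib[symmetric] abs_divide abs_of_pos half_gt_zero)
    ultimately show ?thesis using assms(3) pos_divide_less_eq[of "\<delta> / 2" "\<bar>x - y\<bar>" 1] by simp
  qed
  have "dist (h s) (h t) < \<delta>" if "key s = k" "key t = k" for s t
  proof -
    have "\<bar>Re (h s) - Re (h t)\<bar> < \<delta> / 2" "\<bar>Im (h s) - Im (h t)\<bar> < \<delta> / 2"
      using that fl[of "Re (h s)" "Re (h t)"] fl[of "Im (h s)" "Im (h t)"]
      by (simp_all add: key_def prod_eq_iff)
    then show ?thesis using cmod_le[of "h s - h t"] by (simp add: dist_norm)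
  qed
  then show ?case using B k by (intro exI[of _ "{t\<in>B. key t = k}"]) auto
qed

text \<open>The identity theorem for uncountable zero sets is applied on discs, and it asks for a
  domain of this kind.\<close>

lemma fsigma_ball:
  fixes x :: "'a::metric_space"
  shows "fsigma (ball x r)"
proof -
  have "ball x r = (\<Union>n. cball x (r - inverse (real (Suc n))))"
  proof (intro equalityI subsetI)
    fix y assume "y \<in> ball x r"
    then obtain n where "inverse (real (Suc n)) < r - dist x y"
      using reals_Archimedean[of "r - dist x y"] by auto
    then show "y \<in> (\<Union>n. cball x (r - inverse (real (Suc n))))" by (auto intro!: exI[of _ n])
  next
    fix y assume "y \<in> (\<Union>n. cball x (r - inverse (real (Suc n))))"
    then obtain n where "dist x y \<le> r - inverse (real (Suc n))" by auto
    moreover have "inverse (real (Suc n)) > 0" by simp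
    ultimately show "y \<in> ball x r" unfolding mem_ball by linarith
  qed
  then show ?thesis using fsigma.intros[of "\<lambda>n. cball x (r - inverse (real (Suc n)))"] by simp
qed

text \<open>As \<open>f\<close> takes infinitely many values, it can be kept transcendental modulo a
  prime ideal \<open>m\<close> that contains the equations but no power of \<open>g\<close>, and
  such that every coordinate is algebraic over the rational functions of \<open>f\<close> modulo
  \<open>m\<close>. The zero set of \<open>m\<close> is then a curve over the \<open>f\<close>-line:
  it has points over all but countably many \<open>t\<close>, and there the coordinates are simple
  roots of polynomials over \<open>t\<close>, hence locally holomorphic.\<close>

theorem algebraic_arc:
  fixes S :: "('a::affine_space \<Rightarrow> complex) set" and f g :: "'a \<Rightarrow> complex"
  defines "Z \<equiv> {a. (\<forall>p\<in>S. p a = 0) \<and> g a \<noteq> 0}"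
  assumes S: "\<And>p. p \<in> S \<Longrightarrow> polyfun p" and f: "polyfun f" and g: "polyfun g"
    and inf: "infinite (f ` Z)"
  shows "countable (- (f ` Z))"
    and "\<exists>t0 r \<sigma>. r > 0 \<and> (\<forall>t\<in>ball t0 r. \<sigma> t \<in> Z \<and> f (\<sigma> t) = t) \<and>
           (\<forall>p. polyfun p \<longrightarrow> (\<lambda>t. p (\<sigma> t)) holomorphic_on ball t0 r)"
proof -
  \<comment> \<open>Avoiding the polynomials in \<open>f\<close> keeps \<open>f\<close>
    transcendental modulo \<open>m\<close>; avoiding the powers of \<open>g\<close> keeps the
    inequation.\<close>
  define T where "T = {\<lambda>x. poly q (f x) * g x ^ n | q n. q \<noteq> 0}"
  have T_mem: "(\<lambda>x. poly q (f x) * g x ^ n) \<in> T" if "q \<noteq> 0" for q n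
    using that unfolding T_def by blast
  have T: "multiplicative T"
    unfolding multiplicative_def
  proof (intro conjI ballI)
    show "(\<lambda>_. 1) \<in> T" using T_mem[of 1 0] by simp
    show "polyfun h" if "h \<in> T" for h using that f g by (auto simp: T_def)
    show "(\<lambda>x. h x * k x) \<in> T" if hk: "h \<in> T" "k \<in> T" for h k
    proof -
      from hk obtain q n r l where "h = (\<lambda>x. poly q (f x) * g x ^ n)" "k = (\<lambda>x. poly r (f x) * g x ^ l)"
        "q \<noteq> 0" "r \<noteq> 0" unfolding T_def by blast
      then show ?thesis using T_mem[of "q * r" "n + l"] by (simp add: power_add mult_ac)
    qed
  qed
  have "generated S \<inter> T = {}"
  proof (rule ccontr)
    assume "generated S \<inter> T \<noteq> {}"
    then obtain q n where q: "q \<noteq> 0" "(\<lambda>x. poly q (f x) * g x ^ n) \<in> generated S"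
      unfolding T_def by blast
    have "poly q (f a) = 0" if "a \<in> Z" for a
      using generated_vanishes[OF q(2) S, of a] that by (auto simp: Z_def)
    then have "f ` Z \<subseteq> {t. poly q t = 0}" by blast
    then show False using inf poly_roots_finite[OF q(1)] finite_subset by blast
  qed
  then obtain m where m: "generated S \<subseteq> m" "maximal_disjoint m T"
    using maximal_disjoint_exists[OF polyideal_generated[OF S] T] by blast
  interpret maximal_disjoint m T by (fact m(2))
  have T_notin: "(\<lambda>x. poly q (f x) * g x ^ n) \<notin> m" if "q \<noteq> 0" for q n
    using T_mem[OF that] disjoint by blast
  have pf_notin: "(\<lambda>x. poly q (f x)) \<notin> m" if "q \<noteq> 0" for q
    using T_notin[OF that, of 0] by simp
  have g_notin: "(\<lambda>x. g x ^ n) \<notin> m" for n using T_notin[of 1 n] by simp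

  \<comment> \<open>Amitsur's argument once more, now over the rational functions of
    \<open>f\<close>: the relation among the cofactors has polynomials in \<open>f\<close> as
    coefficients, which makes the coordinate algebraic over them.\<close>
  have "\<exists>P. P \<noteq> 0 \<and> (\<lambda>x. poly (poly P [:c x:]) (f x)) \<in> m" if c: "c \<in> coords" for c
  proof (cases "\<exists>a. (\<lambda>x. c x - a) \<in> m")
    case True
    then obtain a where "(\<lambda>x. c x - a) \<in> m" by blast
    then show ?thesis by (intro exI[of _ "[:[:-a:], 1:]"]) simp
  next
    case False
    have pc: "polyfun c" using c by (rule polyfun_coord)
    have "\<exists>n q h. q \<noteq> 0 \<and> polyfun h \<and> (\<lambda>x. poly q (f x) * g x ^ n - h x * (c x - r)) \<in> m" for r
    proof -
      obtain a h where ah: "a \<in> m" "polyfun h" "(\<lambda>x. a x + h x * (c x - r)) \<in> T"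
        by (rule adjoin_meets[of "\<lambda>x. c x - r"]) (use pc False in auto)
      then obtain q n where q: "q \<noteq> 0" "(\<lambda>x. a x + h x * (c x - r)) = (\<lambda>x. poly q (f x) * g x ^ n)"
        unfolding T_def by blast
      then have eq: "a x + h x * (c x - r) = poly q (f x) * g x ^ n" for x by meson
      have "(\<lambda>x. poly q (f x) * g x ^ n - h x * (c x - r)) = a"
        by (rule ext) (simp add: eq[symmetric])
      then show ?thesis using ah q(1) by metis
    qed
    then have "\<forall>r. \<exists>n q. q \<noteq> 0 \<and> (\<exists>h. polyfun h \<and> (\<lambda>x. poly q (f x) * g x ^ n - h x * (c x - r)) \<in> m)"
      by blast
    from choice[OF this] obtain n where "\<forall>r. \<exists>q. q \<noteq> 0 \<and>
        (\<exists>h. polyfun h \<and> (\<lambda>x. poly q (f x) * g x ^ n r - h x * (c x - r)) \<in> m)" by blast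
    from choice[OF this] obtain q where q: "\<And>r. q r \<noteq> 0"
      "\<And>r. \<exists>h. polyfun h \<and> (\<lambda>x. poly (q r) (f x) * g x ^ n r - h x * (c x - r)) \<in> m" by blast
    obtain k where k: "uncountable {r\<in>UNIV. n r = k}"
      using uncountable_fibre[of "UNIV :: complex set" n] uncountable_UNIV_complex by blast
    obtain B e where B: "finite B" "B \<subseteq> {r\<in>UNIV. n r = k}" "B \<noteq> {}" "\<And>a. a \<in> B \<Longrightarrow> e a \<noteq> 0"
      and rel: "(\<lambda>x. \<Sum>a\<in>B. e a * (poly (q a) (f x) * g x ^ k) * (\<Prod>b\<in>B - {a}. c x - b)) \<in> m"
    proof (rule relation_from_uncountable[OF k pc, where \<tau> = "\<lambda>a x. poly (q a) (f x) * g x ^ k"])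
      show "polyfun (\<lambda>x. poly (q a) (f x) * g x ^ k)" for a
        by (intro polyfun_mult polyfun_poly polyfun_power f g)
      show "\<exists>h. polyfun h \<and> (\<lambda>x. poly (q a) (f x) * g x ^ k - h x * (c x - a)) \<in> m"
        if "a \<in> {r\<in>UNIV. n r = k}" for a using q(2)[of a] that by auto
    qed (rule that; assumption)
    define P where "P = (\<Sum>a\<in>B. smult (smult (e a) (q a)) (\<Prod>b\<in>B - {a}. [:[:-b:], 1:]))"
    have P: "poly P [:y:] = (\<Sum>a\<in>B. smult (e a) (q a) * (\<Prod>b\<in>B - {a}. [:y - b:]))" for y
      unfolding P_def by (simp add: poly_sum poly_prod)
    have P2: "poly (poly P [:y:]) t = (\<Sum>a\<in>B. e a * poly (q a) t * (\<Prod>b\<in>B - {a}. y - b))" for y t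
      unfolding P by (simp add: poly_sum poly_prod mult.assoc)
    obtain a0 where a0: "a0 \<in> B" using B by blast
    have "poly P [:a0:] = smult (e a0) (q a0) * (\<Prod>b\<in>B - {a0}. [:a0 - b:])"
      unfolding P using B a0 by (subst sum.remove[of _ a0]) (auto intro!: sum.neutral)
    then have "P \<noteq> 0" using B a0 q(1) by auto
    have "(\<lambda>x. g x ^ k * poly (poly P [:c x:]) (f x)) \<in> m"
      using rel unfolding P2 by (simp add: sum_distrib_left mult_ac)
    then have "(\<lambda>x. poly (poly P [:c x:]) (f x)) \<in> m"
      using prime[OF polyfun_power[OF g] polyfun_poly2[OF f pc]] g_notin by blast
    then show ?thesis using \<open>P \<noteq> 0\<close> by blast
  qed
  then have ex: "\<exists>P. P \<noteq> 0 \<and> (\<lambda>x. poly (poly P [:c x:]) (f x)) \<in> m" if "c \<in> coords" for c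
    using that by blast
  \<comment> \<open>A relation of minimal degree is separable modulo \<open>m\<close>.\<close>
  have "\<forall>c\<in>coords. \<exists>P. (\<lambda>x. poly (poly P [:c x:]) (f x)) \<in> m \<and>
      (\<lambda>x. poly (poly (pderiv P) [:c x:]) (f x)) \<notin> m"
  proof
    fix c :: "'a \<Rightarrow> complex" assume c: "c \<in> coords"
    define W where "W P \<longleftrightarrow> P \<noteq> 0 \<and> (\<lambda>x. poly (poly P [:c x:]) (f x)) \<in> m" for P
    have "\<exists>P. W P" using ex[OF c] by (simp add: W_def)
    then obtain P where P: "W P" "\<And>Q. W Q \<Longrightarrow> degree P \<le> degree Q"
      using ex_has_least_nat[of W _ degree] by blast
    have deg: "degree P \<noteq> 0"
    proof
      assume "degree P = 0"
      then obtain q where "P = [:q:]" by (metis degree_eq_zeroE)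
      then show False using P(1) pf_notin[of q] by (auto simp: W_def)
    qed
    have "\<not> W (pderiv P)"
      using P(2)[of "pderiv P"] deg by (auto simp: degree_pderiv)
    moreover have "pderiv P \<noteq> 0" using deg by (simp add: pderiv_eq_0_iff)
    ultimately show "\<exists>P. (\<lambda>x. poly (poly P [:c x:]) (f x)) \<in> m \<and>
      (\<lambda>x. poly (poly (pderiv P) [:c x:]) (f x)) \<notin> m"
      using P(1) unfolding W_def by blast
  qed
  from bchoice[OF this] obtain P where
    Pm: "\<And>c. c \<in> coords \<Longrightarrow> (\<lambda>x. poly (poly (P c) [:c x:]) (f x)) \<in> m" and
    P': "\<And>c. c \<in> coords \<Longrightarrow> (\<lambda>x. poly (poly (pderiv (P c)) [:c x:]) (f x)) \<notin> m" by blast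
  \<comment> \<open>Where this does not vanish, \<open>g\<close> is nonzero and each coordinate is a
    simple root of its relation.\<close>
  define \<Delta> where "\<Delta> x = g x * (\<Prod>c\<in>coords. poly (poly (pderiv (P c)) [:c x:]) (f x))" for x
  have pprod: "polyfun (\<lambda>x. \<Prod>c\<in>coords. poly (poly (pderiv (P c)) [:c x:]) (f x))"
    by (intro polyfun_prod polyfun_poly2 f polyfun_coord)
  have \<Delta>: "polyfun \<Delta>" unfolding \<Delta>_def by (intro polyfun_mult g pprod)
  have "(\<lambda>x. \<Prod>c\<in>coords. poly (poly (pderiv (P c)) [:c x:]) (f x)) \<notin> m"
    by (rule prime_prod[OF finite_coords]) (use P' f in \<open>auto intro: polyfun_poly2 polyfun_coord\<close>)
  then have "\<Delta> \<notin> m"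
    using prime[OF g pprod] g_notin[of 1] by (auto simp: \<Delta>_def[abs_def])
  then have \<Delta>_pow: "(\<lambda>x. \<Delta> x ^ n) \<notin> m" for n by (rule prime_power[OF \<Delta>])

  \<comment> \<open>By the Nullstellensatz, every other \<open>t\<close> is the
    \<open>f\<close>-value of a zero of \<open>m\<close> with nonzero \<open>\<Delta>\<close>.
    Uncountably many bad \<open>t\<close> would give a linear relation of cofactors, and thereby a
    nonzero polynomial in \<open>f\<close> inside \<open>m\<close>.\<close>
  define Bad where "Bad = {t. \<exists>n. (\<lambda>x. \<Delta> x ^ n) \<in> adjoin m (\<lambda>x. f x - t)}"
  have "countable Bad"
  proof (rule ccontr)
    assume unc: "uncountable Bad"
    have "\<forall>t\<in>Bad. \<exists>n. \<exists>h. polyfun h \<and> (\<lambda>x. \<Delta> x ^ n - h x * (f x - t)) \<in> m"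
    proof
      fix t assume "t \<in> Bad"
      then obtain n a h where *: "(\<lambda>x. \<Delta> x ^ n) = (\<lambda>x. a x + h x * (f x - t))" "a \<in> m" "polyfun h"
        unfolding Bad_def adjoin_def by blast
      then have eq: "\<Delta> x ^ n = a x + h x * (f x - t)" for x by meson
      have "(\<lambda>x. \<Delta> x ^ n - h x * (f x - t)) = a" by (rule ext) (simp add: eq)
      then show "\<exists>n. \<exists>h. polyfun h \<and> (\<lambda>x. \<Delta> x ^ n - h x * (f x - t)) \<in> m"
        using * by metis
    qed
    from bchoice[OF this] obtain n where
      n: "\<And>t. t \<in> Bad \<Longrightarrow> \<exists>h. polyfun h \<and> (\<lambda>x. \<Delta> x ^ n t - h x * (f x - t)) \<in> m" by blast
    obtain k where k: "uncountable {t\<in>Bad. n t = k}" using uncountable_fibre[OF unc] by blast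
    obtain B e where B: "finite B" "B \<noteq> {}" "\<And>a. a \<in> B \<Longrightarrow> e a \<noteq> 0"
      and rel: "(\<lambda>x. \<Sum>a\<in>B. e a * \<Delta> x ^ k * (\<Prod>b\<in>B - {a}. f x - b)) \<in> m"
      by (rule relation_from_uncountable[OF k f, where \<tau> = "\<lambda>a x. \<Delta> x ^ k"])
         (use n in \<open>auto intro!: polyfun_power \<Delta>\<close>)
    define q where "q = (\<Sum>a\<in>B. smult (e a) (\<Prod>b\<in>B - {a}. [:-b, 1:]))"
    have q: "poly q y = (\<Sum>a\<in>B. e a * (\<Prod>b\<in>B - {a}. y - b))" for y
      unfolding q_def by (simp add: poly_sum poly_prod)
    obtain a0 where a0: "a0 \<in> B" using B by blast
    have "poly q a0 = e a0 * (\<Prod>b\<in>B - {a0}. a0 - b)"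
      unfolding q using B a0
      by (subst sum.remove[of _ a0]) (auto intro!: sum.neutral)
    then have "q \<noteq> 0" using B a0 by auto
    have "(\<lambda>x. \<Delta> x ^ k * poly q (f x)) \<in> m"
      using rel unfolding q by (simp add: sum_distrib_left mult_ac)
    then have "(\<lambda>x. poly q (f x)) \<in> m"
      using prime[OF polyfun_power[OF \<Delta>] polyfun_poly[OF f]] \<Delta>_pow by blast
    then show False using pf_notin \<open>q \<noteq> 0\<close> by blast
  qed
  have "\<exists>a. (\<forall>p\<in>m. p a = 0) \<and> f a = t \<and> \<Delta> a \<noteq> 0" if t: "t \<notin> Bad" for t
  proof -
    have pft: "polyfun (\<lambda>x. f x - t)" using f by auto
    obtain a where a: "\<And>p. p \<in> adjoin m (\<lambda>x. f x - t) \<Longrightarrow> p a = 0" "\<Delta> a \<noteq> 0"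
      by (rule nullstellensatz[OF polyideal_adjoin[OF ideal pft] \<Delta>]) (use t in \<open>auto simp: Bad_def\<close>)
    show ?thesis
      using a(1)[OF adjoin_member[OF ideal]] a adjoin_superset[OF ideal] by (intro exI[of _ a]) auto
  qed
  then obtain pt where pt: "\<And>t p. t \<notin> Bad \<Longrightarrow> p \<in> m \<Longrightarrow> p (pt t) = 0"
    "\<And>t. t \<notin> Bad \<Longrightarrow> f (pt t) = t" "\<And>t. t \<notin> Bad \<Longrightarrow> \<Delta> (pt t) \<noteq> 0" by metis
  have Sm: "p \<in> m" if "p \<in> S" for p using that m(1) generated_superset by blast
  have "pt t \<in> Z" if "t \<notin> Bad" for t
    using pt that Sm by (auto simp: Z_def \<Delta>_def)
  then have "- (f ` Z) \<subseteq> Bad" using pt(2) by (metis ComplD imageI subsetI)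
  then show "countable (- (f ` Z))" using \<open>countable Bad\<close> countable_subset by blast

  \<comment> \<open>Radii of the form \<open>1 / Suc N\<close>, so that uncountably many
    \<open>t\<close> share one radius.\<close>
  have "\<exists>N::nat. \<exists>\<phi>. \<forall>c\<in>coords. \<phi> c holomorphic_on ball t (1 / Suc N) \<and>
      (\<forall>s\<in>ball t (1 / Suc N). \<forall>y\<in>ball (c (pt t)) (1 / Suc N). poly (poly (P c) [:y:]) s = 0 \<longrightarrow> y = \<phi> c s)"
    if t: "t \<notin> Bad" for t
  proof -
    have "\<forall>c\<in>coords. \<exists>e \<phi>. e > 0 \<and> \<phi> holomorphic_on ball t e \<and>
      (\<forall>s\<in>ball t e. \<forall>y\<in>ball (c (pt t)) e. poly (poly (P c) [:y:]) s = 0 \<longrightarrow> y = \<phi> s)"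
    proof
      fix c :: "'a \<Rightarrow> complex" assume c: "c \<in> coords"
      define G where "G z = poly (poly (P c) [:snd z:]) (fst z)" for z
      have G: "polyfun G" unfolding G_def
        by (intro polyfun_poly2 polyfun_fst[OF polyfun_id] polyfun_snd[OF polyfun_id])
      have r: "G (t, c (pt t)) = 0" using pt(1)[OF t Pm[OF c]] pt(2)[OF t] by (simp add: G_def)
      have der: "((\<lambda>y. G (t, y)) has_field_derivative poly (poly (pderiv (P c)) [:c (pt t):]) t) (at (c (pt t)))"
        unfolding G_def using DERIV_poly2 by simp
      have nz: "poly (poly (pderiv (P c)) [:c (pt t):]) t \<noteq> 0"
        using pt(3)[OF t] c unfolding \<Delta>_def pt(2)[OF t] mult_eq_0_iff prod_zero_iff[OF finite_coords]
        by blast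
      obtain e \<phi> where "e > 0" "\<phi> holomorphic_on ball t e"
        "\<And>s y. s \<in> ball t e \<Longrightarrow> y \<in> ball (c (pt t)) e \<Longrightarrow> G (s, y) = 0 \<Longrightarrow> y = \<phi> s"
        by (rule local_root[OF G r der nz]) blast
      then show "\<exists>e \<phi>. e > 0 \<and> \<phi> holomorphic_on ball t e \<and>
        (\<forall>s\<in>ball t e. \<forall>y\<in>ball (c (pt t)) e. poly (poly (P c) [:y:]) s = 0 \<longrightarrow> y = \<phi> s)"
        unfolding G_def by (intro exI[of _ e] exI[of _ \<phi>]) auto
    qed
    from bchoice[OF this] obtain e where "\<forall>c\<in>coords. \<exists>\<phi>. e c > 0 \<and> \<phi> holomorphic_on ball t (e c) \<and>
      (\<forall>s\<in>ball t (e c). \<forall>y\<in>ball (c (pt t)) (e c). poly (poly (P c) [:y:]) s = 0 \<longrightarrow> y = \<phi> s)" by blast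
    from bchoice[OF this] obtain \<phi> where e: "\<And>c. c \<in> coords \<Longrightarrow> e c > 0"
      "\<And>c. c \<in> coords \<Longrightarrow> \<phi> c holomorphic_on ball t (e c)"
      "\<And>c s y. c \<in> coords \<Longrightarrow> s \<in> ball t (e c) \<Longrightarrow> y \<in> ball (c (pt t)) (e c) \<Longrightarrow>
         poly (poly (P c) [:y:]) s = 0 \<Longrightarrow> y = \<phi> c s" by blast
    define d where "d = Min (insert 1 (e ` coords))"
    have "d > 0" "\<And>c. c \<in> coords \<Longrightarrow> d \<le> e c"
      using e(1) finite_coords[where 'a = 'a] by (auto simp: d_def)
    moreover obtain N where "1 / Suc N < d" using \<open>d > 0\<close> nat_approx_posE by blast
    ultimately have N: "\<And>c. c \<in> coords \<Longrightarrow> 1 / Suc N < e c" by (meson less_le_trans)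
    then have sub: "ball x (1 / Suc N) \<subseteq> ball x (e c)" if "c \<in> coords" for c and x :: complex
      using that by (intro subset_ball less_imp_le) auto
    show ?thesis
    proof (intro exI[of _ N] exI[of _ \<phi>] ballI conjI impI)
      fix c :: "'a \<Rightarrow> complex" assume c: "c \<in> coords"
      show "\<phi> c holomorphic_on ball t (1 / Suc N)"
        by (rule holomorphic_on_subset[OF e(2)[OF c] sub[OF c]])
      show "y = \<phi> c s" if "s \<in> ball t (1 / Suc N)" "y \<in> ball (c (pt t)) (1 / Suc N)"
        "poly (poly (P c) [:y:]) s = 0" for s y
        using that by (intro e(3)[OF c]) (rule subsetD[OF sub[OF c]], assumption | assumption)+
    qed
  qed
  then have "\<forall>t\<in>-Bad. \<exists>N::nat. \<exists>\<phi>. \<forall>c\<in>coords. \<phi> c holomorphic_on ball t (1 / Suc N) \<and>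
      (\<forall>s\<in>ball t (1 / Suc N). \<forall>y\<in>ball (c (pt t)) (1 / Suc N). poly (poly (P c) [:y:]) s = 0 \<longrightarrow> y = \<phi> c s)"
    by blast
  from bchoice[OF this] obtain N :: "complex \<Rightarrow> nat" where
    N: "\<And>t. t \<notin> Bad \<Longrightarrow> \<exists>\<phi>. \<forall>c\<in>coords. \<phi> c holomorphic_on ball t (1 / Suc (N t)) \<and>
      (\<forall>s\<in>ball t (1 / Suc (N t)). \<forall>y\<in>ball (c (pt t)) (1 / Suc (N t)).
         poly (poly (P c) [:y:]) s = 0 \<longrightarrow> y = \<phi> c s)" by blast
  have "uncountable (- Bad)"
    using \<open>countable Bad\<close> uncountable_UNIV_complex by (metis Compl_partition countable_Un)
  then obtain k where k: "uncountable {t\<in>-Bad. N t = k}" using uncountable_fibre by blast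
  define \<delta> where "\<delta> = 1 / real (Suc k)"
  have \<delta>: "\<delta> > 0" by (simp add: \<delta>_def)
  \<comment> \<open>Uncountably many points lie so close together, in parameter and in all
    coordinates, that the branches through the point over \<open>t0\<close> pass through each of
    them.\<close>
  obtain A where A: "A \<subseteq> {t\<in>-Bad. N t = k}" "uncountable A"
    and cl: "\<forall>h\<in>insert (\<lambda>t. t) ((\<lambda>c t. c (pt t)) ` coords). \<forall>s\<in>A. \<forall>t\<in>A. dist (h s) (h t) < \<delta>"
    using uncountable_cluster[OF _ k \<delta>, of "insert (\<lambda>t. t) ((\<lambda>c t. c (pt t)) ` coords)"] finite_coords[where 'a = 'a]
    by blast
  obtain t0 where t0: "t0 \<in> A" using A(2) by (metis countable_empty ex_in_conv)
  then have t0': "t0 \<notin> Bad" "N t0 = k" using A by auto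
  obtain \<phi> where \<phi>: "\<And>c. c \<in> coords \<Longrightarrow> \<phi> c holomorphic_on ball t0 \<delta>"
    "\<And>c s y. c \<in> coords \<Longrightarrow> s \<in> ball t0 \<delta> \<Longrightarrow> y \<in> ball (c (pt t0)) \<delta> \<Longrightarrow> poly (poly (P c) [:y:]) s = 0 \<Longrightarrow> y = \<phi> c s"
    using N[OF t0'(1)] unfolding t0'(2) \<delta>_def by blast
  have "\<forall>t. \<exists>a :: 'a. \<forall>c\<in>coords. c a = \<phi> c t"
    by (intro allI coords_surj[of "\<lambda>c. \<phi> c _"])
  from choice[OF this] obtain \<sigma> where \<sigma>: "\<And>c t. c \<in> coords \<Longrightarrow> c (\<sigma> t) = \<phi> c t" by blast
  have hol: "(\<lambda>t. p (\<sigma> t)) holomorphic_on ball t0 \<delta>" if "polyfun p" for p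
    by (rule polyfun_holomorphic[OF that]) (simp add: \<sigma> \<phi>)
  have A_ball: "t \<in> ball t0 \<delta>" if "t \<in> A" for t using cl t0 that by auto
  have A_pt: "p (\<sigma> t) = p (pt t)" if "t \<in> A" "polyfun p" for p t
  proof (rule polyfun_cong[OF that(2)])
    fix c :: "'a \<Rightarrow> complex" assume c: "c \<in> coords"
    have tB: "t \<notin> Bad" using that A by auto
    have "c (pt t) \<in> ball (c (pt t0)) \<delta>" using cl t0 that c by auto
    moreover have "poly (poly (P c) [:c (pt t):]) t = 0" using pt(1)[OF tB Pm[OF c]] pt(2)[OF tB] by simp
    ultimately show "c (\<sigma> t) = c (pt t)" using \<phi>(2)[OF c A_ball[OF that(1)]] \<sigma>[OF c] by metis
  qed
  \<comment> \<open>The identity theorem with uncountably many zeros: whatever equation holds at the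
    points over \<open>A\<close> holds along the whole arc.\<close>
  have ident: "h t = 0" if h: "h holomorphic_on ball t0 \<delta>" and z: "\<And>t. t \<in> A \<Longrightarrow> h t = 0"
    and t: "t \<in> ball t0 \<delta>" for h :: "complex \<Rightarrow> complex" and t
  proof -
    have "A \<subseteq> {t \<in> ball t0 \<delta>. h t = 0}" using A_ball z by auto
    then have "\<not> countable {t \<in> ball t0 \<delta>. h t = 0}"
      using A(2) countable_subset by blast
    then have "h constant_on ball t0 \<delta>"
      using holomorphic_countable_zeros[OF h open_ball connected_ball fsigma_ball] by argo
    then obtain k where k: "\<And>t. t \<in> ball t0 \<delta> \<Longrightarrow> h t = k" unfolding constant_on_def by blast
    show ?thesis using z[OF t0] k[OF A_ball[OF t0]] k[OF t] by simp
  qed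
  have A_Bad: "t \<notin> Bad" if "t \<in> A" for t using that A by blast
  have \<sigma>S: "p (\<sigma> t) = 0" if "p \<in> S" "t \<in> ball t0 \<delta>" for p t
    by (rule ident[OF hol[OF S[OF that(1)]] _ that(2)])
       (simp add: A_pt[OF _ S[OF that(1)]] pt(1)[OF A_Bad Sm[OF that(1)]])
  have \<sigma>f: "f (\<sigma> t) = t" if "t \<in> ball t0 \<delta>" for t
  proof -
    have "f (\<sigma> t) - t = 0"
      by (rule ident[OF _ _ that, of "\<lambda>t. f (\<sigma> t) - t"])
         (simp_all add: A_pt[OF _ f] pt(2)[OF A_Bad] holomorphic_on_diff[OF hol[OF f] holomorphic_on_ident])
    then show ?thesis by simp
  qed
  have "g (\<sigma> t0) \<noteq> 0" using A_pt[OF t0 g] pt(3)[OF t0'(1)] by (auto simp: \<Delta>_def)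
  moreover have "isCont (\<lambda>t. g (\<sigma> t)) t0"
    by (rule field_differentiable_imp_continuous_at[OF holomorphic_on_imp_differentiable_at[OF hol[OF g] open_ball]])
       (simp add: \<delta>)
  ultimately obtain \<epsilon> where \<epsilon>: "\<epsilon> > 0" "\<And>t. dist t0 t < \<epsilon> \<Longrightarrow> g (\<sigma> t) \<noteq> 0"
    using continuous_at_avoid by blast
  show "\<exists>t0 r \<sigma>. r > 0 \<and> (\<forall>t\<in>ball t0 r. \<sigma> t \<in> Z \<and> f (\<sigma> t) = t) \<and>
           (\<forall>p. polyfun p \<longrightarrow> (\<lambda>t. p (\<sigma> t)) holomorphic_on ball t0 r)"
  proof (intro exI[of _ t0] exI[of _ "min \<delta> \<epsilon>"] exI[of _ \<sigma>] conjI allI impI ballI)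
    show "(\<lambda>t. p (\<sigma> t)) holomorphic_on ball t0 (min \<delta> \<epsilon>)" if "polyfun p" for p
      by (rule holomorphic_on_subset[OF hol[OF that]]) auto
  qed (use \<delta> \<epsilon> \<sigma>S \<sigma>f in \<open>auto simp: Z_def\<close>)
qed

text \<open>The dichotomy for images: finite or cocountable. One inequation \<open>h\<close> is
  enough, since several are combined into a product.\<close>

corollary algebraic_image:
  fixes Z :: "'a::affine_space \<Rightarrow> bool"
  assumes Z: "\<And>a. Z a \<longleftrightarrow> (\<forall>p\<in>S. p a = 0) \<and> h a \<noteq> 0" and S: "\<And>p. p \<in> S \<Longrightarrow> polyfun p"
    and f: "polyfun f" and h: "polyfun h" and inf: "infinite {t. \<exists>a. Z a \<and> f a = t}"
  shows "countable {t. \<nexists>a. Z a \<and> f a = t}"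
proof -
  have eq: "f ` {a. (\<forall>p\<in>S. p a = 0) \<and> h a \<noteq> 0} = {t. \<exists>a. Z a \<and> f a = t}"
    unfolding Z by blast
  have "countable (- {t. \<exists>a. Z a \<and> f a = t})"
    unfolding eq[symmetric]
  proof (rule algebraic_arc(1))
    show "infinite (f ` {a. (\<forall>p\<in>S. p a = 0) \<and> h a \<noteq> 0})" using inf unfolding eq .
  qed (fact S f h)+
  then show ?thesis by (simp add: Compl_eq)
qed

corollary algebraic_arc_obtain:
  fixes Z :: "'a::affine_space \<Rightarrow> bool"
  assumes Z: "\<And>a. Z a \<longleftrightarrow> (\<forall>p\<in>S. p a = 0) \<and> h a \<noteq> 0" and S: "\<And>p. p \<in> S \<Longrightarrow> polyfun p"
    and f: "polyfun f" and h: "polyfun h" and inf: "infinite {t. \<exists>a. Z a \<and> f a = t}"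
  obtains t0 r \<sigma> where "r > 0" "\<And>t. t \<in> ball t0 r \<Longrightarrow> Z (\<sigma> t)" "\<And>t. t \<in> ball t0 r \<Longrightarrow> f (\<sigma> t) = t"
    "\<And>p. polyfun p \<Longrightarrow> (\<lambda>t. p (\<sigma> t)) holomorphic_on ball t0 r"
proof -
  have eq: "f ` {a. (\<forall>p\<in>S. p a = 0) \<and> h a \<noteq> 0} = {t. \<exists>a. Z a \<and> f a = t}"
    unfolding Z by blast
  have Zeq: "{a. (\<forall>p\<in>S. p a = 0) \<and> h a \<noteq> 0} = Collect Z" unfolding Z ..
  obtain t0 r \<sigma> where *: "r > 0" "\<forall>t\<in>ball t0 r. \<sigma> t \<in> Collect Z \<and> f (\<sigma> t) = t"
    "\<forall>p. polyfun p \<longrightarrow> (\<lambda>t. p (\<sigma> t)) holomorphic_on ball t0 r"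
  proof -
    have "\<exists>t0 r \<sigma>. r > 0 \<and> (\<forall>t\<in>ball t0 r. \<sigma> t \<in> {a. (\<forall>p\<in>S. p a = 0) \<and> h a \<noteq> 0} \<and> f (\<sigma> t) = t) \<and>
           (\<forall>p. polyfun p \<longrightarrow> (\<lambda>t. p (\<sigma> t)) holomorphic_on ball t0 r)"
    proof (rule algebraic_arc(2))
      show "infinite (f ` {a. (\<forall>p\<in>S. p a = 0) \<and> h a \<noteq> 0})" using inf unfolding eq .
    qed (fact S f h)+
    then show ?thesis unfolding Zeq using that by blast
  qed
  show ?thesis by (rule that[of r t0 \<sigma>]) (use * in auto)
qed

text \<open>A bounded image is never cocountable, so the dichotomy makes it finite.\<close>

lemma bounded_uncountable_Compl:
  fixes A :: "complex set"
  assumes "bounded A"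
  shows "uncountable (- A)"
proof -
  obtain B where B: "\<And>z. z \<in> A \<Longrightarrow> cmod z \<le> B" "B > 0" using assms bounded_pos by blast
  have "ball (complex_of_real (B + 1)) 1 \<subseteq> - A"
  proof
    fix z assume "z \<in> ball (complex_of_real (B + 1)) 1"
    then have "cmod (complex_of_real (B + 1) - z) < 1" by (simp add: dist_norm)
    moreover have "cmod (complex_of_real (B + 1)) = B + 1" using B(2) by (simp only: norm_of_real)
    moreover have "cmod (complex_of_real (B + 1)) - cmod z \<le> cmod (complex_of_real (B + 1) - z)"
      by (rule norm_triangle_ineq2)
    ultimately show "z \<in> - A" using B(1)[of z] by auto
  qed
  moreover have "uncountable (ball (complex_of_real (B + 1)) 1)" by (rule uncountable_ball) simp
  ultimately show ?thesis using countable_subset by blast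
qed

subsection \<open>Covectors and bases of the four-dimensional space\<close>

definition pairing :: "(4 \<Rightarrow> complex) \<Rightarrow> complex ^ 4 \<Rightarrow> complex" where
  "pairing \<eta> v = (\<Sum>i\<in>UNIV. \<eta> i * v $ i)"

lemma pairing_add [simp]: "pairing \<eta> (v + w) = pairing \<eta> v + pairing \<eta> w"
  and pairing_diff [simp]: "pairing \<eta> (v - w) = pairing \<eta> v - pairing \<eta> w"
  and pairing_scale [simp]: "pairing \<eta> (k *s v) = k * pairing \<eta> v"
  and pairing_0 [simp]: "pairing \<eta> 0 = 0"
  and pairing_axis [simp]: "pairing \<eta> (axis i 1) = \<eta> i"
  by (simp_all add: pairing_def distrib_left right_diff_distrib sum.distrib sum_subtractf
      sum_distrib_left mult_ac axis_def if_distrib cong: if_cong)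

lemma pairing_left_add: "pairing (\<lambda>i. \<eta> i + \<zeta> i) v = pairing \<eta> v + pairing \<zeta> v"
  and pairing_left_diff: "pairing (\<lambda>i. \<eta> i - \<zeta> i) v = pairing \<eta> v - pairing \<zeta> v"
  and pairing_left_scale: "pairing (\<lambda>i. k * \<eta> i) v = k * pairing \<eta> v"
  and pairing_left_0: "pairing (\<lambda>i. 0) v = 0"
  by (simp_all add: pairing_def distrib_right left_diff_distrib sum.distrib sum_subtractf
      sum_distrib_left mult.assoc)

definition rows4 :: "complex ^ 4 \<Rightarrow> complex ^ 4 \<Rightarrow> complex ^ 4 \<Rightarrow> complex ^ 4 \<Rightarrow> complex ^ 4 ^ 4" where
  "rows4 a b c e = (\<chi> i. if i = 1 then a else if i = 2 then b else if i = 3 then c else e)"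

text \<open>A determinant, so that being a basis is the nonvanishing of one polynomial function and
  can enter the inequation of an algebraic set.\<close>

definition basis4 :: "complex ^ 4 \<Rightarrow> complex ^ 4 \<Rightarrow> complex ^ 4 \<Rightarrow> complex ^ 4 \<Rightarrow> bool" where
  "basis4 a b c e \<longleftrightarrow> det (rows4 a b c e) \<noteq> 0"

lemma rows4_nth [simp]:
  "rows4 a b c e $ 1 = a" "rows4 a b c e $ 2 = b" "rows4 a b c e $ 3 = c" "rows4 a b c e $ 4 = e"
  by (simp_all add: rows4_def)

lemma basis4_covector:
  assumes "basis4 a b c e" "pairing \<eta> a = 0" "pairing \<eta> b = 0" "pairing \<eta> c = 0" "pairing \<eta> e = 0"
  shows "\<eta> = (\<lambda>_. 0)"
proof -
  obtain B where B: "B ** rows4 a b c e = mat 1"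
    using assms(1) by (metis basis4_def invertible_det_nz invertible_left_inverse)
  have "rows4 a b c e *v (\<chi> i. \<eta> i) = 0"
    unfolding vec_eq_iff forall_4 using assms(2-)
    by (simp add: matrix_vector_mult_def pairing_def mult.commute)
  then have "B *v (rows4 a b c e *v (\<chi> i. \<eta> i)) = 0" by (metis matrix_vector_mult_0_right)
  then have "(\<chi> i. \<eta> i) = 0" by (simp add: matrix_vector_mul_assoc B matrix_vector_mul_lid)
  then show ?thesis by (simp add: vec_eq_iff fun_eq_iff)
qed

lemma basis4_iff:
  "basis4 a b c e \<longleftrightarrow> (\<forall>x y z w. x *s a + y *s b + z *s c + w *s e = 0 \<longrightarrow> x = 0 \<and> y = 0 \<and> z = 0 \<and> w = 0)"
proof -
  have "basis4 a b c e \<longleftrightarrow> (\<exists>B. rows4 a b c e ** B = mat 1)"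
    unfolding basis4_def invertible_det_nz[symmetric] invertible_right_inverse ..
  also have "\<dots> \<longleftrightarrow> (\<forall>k. (\<Sum>i\<in>UNIV. k i *s row i (rows4 a b c e)) = 0 \<longrightarrow> (\<forall>i. k i = 0))"
    by (rule matrix_right_invertible_independent_rows)
  also have "\<dots> \<longleftrightarrow> (\<forall>k :: 4 \<Rightarrow> complex. k 1 *s a + k 2 *s b + k 3 *s c + k 4 *s e = 0 \<longrightarrow>
      k 1 = 0 \<and> k 2 = 0 \<and> k 3 = 0 \<and> k 4 = (0::complex))"
    by (simp add: sum_4 forall_4 row_def)
  also have "\<dots> \<longleftrightarrow> (\<forall>x y z w. x *s a + y *s b + z *s c + w *s e = 0 \<longrightarrow> x = 0 \<and> y = 0 \<and> z = 0 \<and> w = 0)"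
    (is "?L \<longleftrightarrow> ?R")
  proof
    assume L: ?L
    show ?R
    proof (intro allI impI)
      fix x y z w assume "x *s a + y *s b + z *s c + w *s e = 0"
      then show "x = 0 \<and> y = 0 \<and> z = 0 \<and> w = 0"
        using L[rule_format, of "\<lambda>i. if i = 1 then x else if i = 2 then y else if i = 3 then z else w"]
        by simp
    qed
  qed blast
  finally show ?thesis .
qed

lemma basis4_independent:
  "basis4 a b c e \<Longrightarrow> x *s a + y *s b + z *s c + w *s e = 0 \<Longrightarrow> x = 0 \<and> y = 0 \<and> z = 0 \<and> w = 0"
  unfolding basis4_iff by blast

lemma not_in_span_finite:
  assumes "finite A" "card A < 4"
  obtains v :: "complex ^ 4" where "v \<notin> vec.span A"
proof -
  have "vec.span A \<noteq> UNIV"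
  proof
    assume "vec.span A = UNIV"
    then have "vec.dim (UNIV :: (complex ^ 4) set) \<le> card A"
      using vec.dim_le_card[of UNIV A] assms(1) by auto
    then show False using assms(2) unfolding vec_dim_card by simp
  qed
  then show ?thesis using that by blast
qed

lemma basis4_from_span:
  assumes "a \<noteq> 0" "b \<notin> vec.span {a}" "c \<notin> vec.span {a, b}" "e \<notin> vec.span {a, b, c}"
  shows "basis4 a b c e"
  unfolding basis4_iff
proof (intro allI impI)
  fix x y z w assume eq: "x *s a + y *s b + z *s c + w *s e = 0"
  have in_span: "v \<in> vec.span A" if "k *s v + u = 0" "k \<noteq> 0" "u \<in> vec.span A" for k and v u :: "complex ^ 4" and A
  proof -
    have "k *s v = - u" using that(1) by (simp add: eq_neg_iff_add_eq_0)
    then have "inverse k *s (k *s v) = inverse k *s (- u)" by simp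
    then have "v = inverse k *s (- u)" using that(2) by (simp only: vector_smult_assoc left_inverse vector_smult_lid not_False_eq_True)
    then show ?thesis using that(3) by (simp add: vec.span_scale vec.span_neg)
  qed
  have w: "w = 0"
  proof (rule ccontr)
    assume "w \<noteq> 0"
    then have "e \<in> vec.span {a, b, c}"
      using eq \<open>w \<noteq> 0\<close> by (intro in_span[of w e "x *s a + y *s b + z *s c"] vec.span_add vec.span_scale vec.span_base)
        (simp_all add: algebra_simps)
    then show False using assms(4) by contradiction
  qed
  have z: "z = 0"
  proof (rule ccontr)
    assume "z \<noteq> 0"
    then have "c \<in> vec.span {a, b}"
      using eq w \<open>z \<noteq> 0\<close> by (intro in_span[of z c "x *s a + y *s b"] vec.span_add vec.span_scale vec.span_base)
        (simp_all add: algebra_simps)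
    then show False using assms(3) by contradiction
  qed
  have y: "y = 0"
  proof (rule ccontr)
    assume "y \<noteq> 0"
    then have "b \<in> vec.span {a}"
      using eq w z \<open>y \<noteq> 0\<close> by (intro in_span[of y b "x *s a"] vec.span_add vec.span_scale vec.span_base)
        (simp_all add: algebra_simps)
    then show False using assms(2) by contradiction
  qed
  show "x = 0 \<and> y = 0 \<and> z = 0 \<and> w = 0" using eq w z y assms(1) by simp
qed

lemma basis4_extend3:
  assumes "a \<noteq> 0" "b \<notin> vec.span {a}" "c \<notin> vec.span {a, b}"
  obtains e where "basis4 a b c e"
proof -
  have "card {a, b, c} < 4" by (simp add: card_insert_if)
  then obtain e where "e \<notin> vec.span {a, b, c}" using not_in_span_finite[of "{a, b, c}"] by auto
  then show ?thesis using that basis4_from_span[OF assms] by blast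
qed

lemma basis4_extend2:
  assumes "a \<noteq> 0" "b \<notin> vec.span {a}"
  obtains c e where "basis4 a b c e"
proof -
  have "card {a, b} < 4" by (simp add: card_insert_if)
  then obtain c where "c \<notin> vec.span {a, b}" using not_in_span_finite[of "{a, b}"] by auto
  then show ?thesis using that basis4_extend3[OF assms] by metis
qed

lemma basis4_scale: "k \<noteq> 0 \<Longrightarrow> basis4 (k *s a) b c e \<longleftrightarrow> basis4 a b c e"
  unfolding basis4_def rows4_def using det_row_mul[of 1 k "\<lambda>_. a"] by simp

lemma polyfun_det_rows4:
  assumes "\<And>i. polyfun (\<lambda>z. a z $ i)" "\<And>i. polyfun (\<lambda>z. b z $ i)"
    "\<And>i. polyfun (\<lambda>z. c z $ i)" "\<And>i. polyfun (\<lambda>z. e z $ i)"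
  shows "polyfun (\<lambda>z. det (rows4 (a z) (b z) (c z) (e z)))"
proof -
  have "polyfun (\<lambda>z. rows4 (a z) (b z) (c z) (e z) $ i $ j)" for i j
    using exhaust_4[of i] assms by auto
  then show ?thesis
    unfolding det_def by (intro polyfun_sum polyfun_mult polyfun_const polyfun_prod)
qed

text \<open>Linearity in the last row. A requirement that a vector complete three given ones to a
  basis thereby becomes a covector to be avoided, as \<open>generic_vector\<close> expects.\<close>

lemma det_rows4_covector:
  "\<exists>\<eta>. \<forall>v. det (rows4 a b c v) = pairing \<eta> v"
proof -
  define r where "r i = (if i = (1::4) then a else if i = 2 then b else c)" for i
  have rows: "rows4 a b c v = (\<chi> i. if i = 4 then v else r i)" for v
    unfolding vec_eq_iff[of "rows4 a b c v"] forall_4 by (simp add: r_def)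
  have expand: "v = (\<Sum>j\<in>UNIV. v $ j *s axis j 1)" for v :: "complex ^ 4"
    by (simp add: vec_eq_iff axis_def if_distrib cong: if_cong)
  have "det (rows4 a b c v) = pairing (\<lambda>j. det (rows4 a b c (axis j 1))) v" for v
  proof -
    have "det (rows4 a b c v) = det (\<chi> i. if i = 4 then (\<Sum>j\<in>UNIV. v $ j *s axis j 1) else r i)"
      unfolding rows by (simp only: expand[of v, symmetric])
    also have "\<dots> = (\<Sum>j\<in>UNIV. det (\<chi> i. if i = 4 then v $ j *s axis j 1 else r i))"
      by (rule det_linear_row_sum[of UNIV 4 "\<lambda>_ j. v $ j *s axis j 1" r]) simp
    also have "\<dots> = pairing (\<lambda>j. det (rows4 a b c (axis j 1))) v"
      unfolding rows pairing_def
      by (intro sum.cong refl) (use det_row_mul[of 4 _ "\<lambda>_. axis _ 1" r] in \<open>simp add: mult.commute\<close>)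
    finally show ?thesis .
  qed
  then show ?thesis by blast
qed

text \<open>Each covector vanishes at no more than three points of the rational normal curve.\<close>

lemma generic_vector:
  fixes \<eta> :: "'i \<Rightarrow> 4 \<Rightarrow> complex"
  assumes "countable A" "\<And>i. i \<in> A \<Longrightarrow> \<eta> i \<noteq> (\<lambda>_. 0)"
  obtains v where "\<And>i. i \<in> A \<Longrightarrow> pairing (\<eta> i) v \<noteq> 0"
proof -
  define q where "q i = [:\<eta> i 1, \<eta> i 2, \<eta> i 3, \<eta> i 4:]" for i
  define v where "v t = (\<chi> j::4. if j = 1 then 1 else if j = 2 then t else if j = 3 then t\<^sup>2 else t ^ 3)" for t :: complex
  have v: "pairing (\<eta> i) (v t) = poly (q i) t" for i t
    by (simp add: pairing_def sum_4 v_def q_def algebra_simps power2_eq_square power3_eq_cube)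
  have "q i \<noteq> 0" if "i \<in> A" for i
  proof
    assume "q i = 0"
    then have "\<forall>j. \<eta> i j = 0" unfolding forall_4 by (simp add: q_def)
    then show False using assms(2)[OF that] by auto
  qed
  then have "countable (\<Union>i\<in>A. {t. poly (q i) t = 0})"
    by (intro countable_UN[OF assms(1)] countable_finite poly_roots_finite)
  then have "(\<Union>i\<in>A. {t. poly (q i) t = 0}) \<noteq> UNIV" using uncountable_UNIV_complex by auto
  then obtain t where "t \<notin> (\<Union>i\<in>A. {t. poly (q i) t = 0})" by blast
  then show ?thesis using that[of "v t"] by (auto simp: v)
qed

text \<open>The dichotomy concerns images under polynomial functions, so finiteness of a point set
  is tested on its coordinates.\<close>

lemma finite_coordinatewise:
  fixes A :: "(complex ^ 'n) set"
  assumes "\<And>j. finite ((\<lambda>x. x $ j) ` A)"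
  shows "finite A"
proof -
  have "finite (vec_nth ` A)"
  proof (rule finite_subset)
    show "vec_nth ` A \<subseteq> Pi\<^sub>E UNIV (\<lambda>j. (\<lambda>x. x $ j) ` A)" by (auto simp: PiE_def)
    show "finite (Pi\<^sub>E UNIV (\<lambda>j. (\<lambda>x. x $ j) ` A))" using assms by (intro finite_PiE) auto
  qed
  then show ?thesis by (rule finite_imageD) (simp add: inj_on_def vec_nth_inject)
qed

subsection \<open>Gradients\<close>

definition curve_deriv :: "(complex \<Rightarrow> complex ^ 'n) \<Rightarrow> complex ^ 'n \<Rightarrow> complex \<Rightarrow> bool" where
  "curve_deriv x x' t \<longleftrightarrow> (\<forall>i. ((\<lambda>s. x s $ i) has_field_derivative x' $ i) (at t))"

lemma curve_deriv_const: "curve_deriv (\<lambda>_. a) 0 t"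
  by (simp add: curve_deriv_def)

lemma curve_deriv_add: "curve_deriv x x' t \<Longrightarrow> curve_deriv y y' t \<Longrightarrow> curve_deriv (\<lambda>s. x s + y s) (x' + y') t"
  by (auto simp: curve_deriv_def intro!: derivative_intros)

lemma curve_deriv_scale:
  "(k has_field_derivative k') (at t) \<Longrightarrow> curve_deriv x x' t \<Longrightarrow>
   curve_deriv (\<lambda>s. k s *s x s) (k' *s x t + k t *s x') t"
  by (auto simp: curve_deriv_def intro!: derivative_eq_intros)

lemma curve_deriv_line: "curve_deriv (\<lambda>s. a + s *s b) b t"
  by (auto simp: curve_deriv_def intro!: derivative_eq_intros)

text \<open>The chain rule along curves is built into the notion of gradient, and the gradient is
  again polynomial, so that a second application gives the Hessian.\<close>

lemma polyfun_gradient: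
  fixes f :: "complex ^ 'n \<Rightarrow> complex"
  assumes "polyfun f"
  shows "\<exists>g. (\<forall>i. polyfun (g i)) \<and> (\<forall>x x' t. curve_deriv x x' t \<longrightarrow>
    ((\<lambda>s. f (x s)) has_field_derivative (\<Sum>i\<in>UNIV. g i (x t) * x' $ i)) (at t))"
  using assms
proof induction
  case (polyfun_const k)
  show ?case by (intro exI[of _ "\<lambda>_ _. 0"]) auto
next
  case (polyfun_coord c)
  then obtain j where c: "c = (\<lambda>x. x $ j)" by (auto simp: coords_vec_def coords_complex_def)
  have "(\<Sum>i\<in>UNIV. (if i = j then 1 else 0) * x' $ i) = x' $ j" for x' :: "complex ^ 'n"
    by (simp add: if_distrib[of "\<lambda>u. u * _"] cong: if_cong)
  then show ?case unfolding c
    by (intro exI[of _ "\<lambda>i _. if i = j then 1 else 0"]) (auto simp: curve_deriv_def)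
next
  case (polyfun_add f h)
  then obtain a b where a: "\<And>i. polyfun (a i)" "\<And>x x' t. curve_deriv x x' t \<Longrightarrow>
      ((\<lambda>s. f (x s)) has_field_derivative (\<Sum>i\<in>UNIV. a i (x t) * x' $ i)) (at t)"
    and b: "\<And>i. polyfun (b i)" "\<And>x x' t. curve_deriv x x' t \<Longrightarrow>
      ((\<lambda>s. h (x s)) has_field_derivative (\<Sum>i\<in>UNIV. b i (x t) * x' $ i)) (at t)" by blast
  show ?case
    by (intro exI[of _ "\<lambda>i x. a i x + b i x"] conjI allI impI polyfun.polyfun_add a b
        DERIV_cong[OF DERIV_add[OF a(2) b(2)]])
       (auto simp: sum.distrib distrib_right)
next
  case (polyfun_mult f h)
  then obtain a b where a: "\<And>i. polyfun (a i)" "\<And>x x' t. curve_deriv x x' t \<Longrightarrow>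
      ((\<lambda>s. f (x s)) has_field_derivative (\<Sum>i\<in>UNIV. a i (x t) * x' $ i)) (at t)"
    and b: "\<And>i. polyfun (b i)" "\<And>x x' t. curve_deriv x x' t \<Longrightarrow>
      ((\<lambda>s. h (x s)) has_field_derivative (\<Sum>i\<in>UNIV. b i (x t) * x' $ i)) (at t)" by blast
  show ?case
    by (intro exI[of _ "\<lambda>i x. a i x * h x + f x * b i x"] conjI allI impI polyfun.polyfun_add
        polyfun.polyfun_mult polyfun_mult.hyps a b DERIV_cong[OF DERIV_mult[OF a(2) b(2)]])
       (auto simp: sum.distrib distrib_right distrib_left sum_distrib_left mult_ac)
qed

definition vderiv :: "(complex \<Rightarrow> complex ^ 'n) \<Rightarrow> complex \<Rightarrow> complex ^ 'n" where
  "vderiv x t = (\<chi> i. deriv (\<lambda>s. x s $ i) t)"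

lemma curve_deriv_holomorphic:
  assumes "\<And>i. (\<lambda>s. x s $ i) holomorphic_on A" "open A" "t \<in> A"
  shows "curve_deriv x (vderiv x t) t"
  using assms by (auto simp: curve_deriv_def vderiv_def intro: holomorphic_derivI)

lemma DERIV_local_const:
  assumes "(h has_field_derivative D) (at t)" "open A" "t \<in> A" "\<And>s. s \<in> A \<Longrightarrow> h s = k"
  shows "D = (0::complex)"
proof -
  have "((\<lambda>_. k) has_field_derivative D) (at t)"
    by (rule has_field_derivative_transform_within_open[OF assms(1,2,3,4)])
  then show ?thesis using DERIV_const DERIV_unique by blast
qed

lemma DERIV_local_ident:
  assumes "(h has_field_derivative D) (at t)" "open A" "t \<in> A" "\<And>s. s \<in> A \<Longrightarrow> h s = s"
  shows "D = (1::complex)"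
proof -
  have "((\<lambda>s. s) has_field_derivative D) (at t)"
    by (rule has_field_derivative_transform_within_open[OF assms(1,2,3,4)])
  then show ?thesis using DERIV_ident DERIV_unique by blast
qed

lemma infinite_ball: "r > 0 \<Longrightarrow> infinite (ball t r)" for t :: complex
  by (metis countable_finite uncountable_ball)

section \<open>Smooth forms, Euler's relation and the Gauss map\<close>

text \<open>The degree is \<open>Suc e\<close>, so that \<open>e\<close> is the degree of the
  gradient \<open>g\<close>, and \<open>e > 0\<close> excludes planes, whose Gauss map is constant.
  \<open>H\<close> is the Hessian.\<close>

locale smooth_form =
  fixes F :: "complex ^ 4 \<Rightarrow> complex" and e :: nat
    and g :: "4 \<Rightarrow> complex ^ 4 \<Rightarrow> complex" and H :: "4 \<Rightarrow> 4 \<Rightarrow> complex ^ 4 \<Rightarrow> complex"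
  assumes polyfun_F: "polyfun F"
    and polyfun_g: "\<And>i. polyfun (g i)"
    and polyfun_H: "\<And>i j. polyfun (H i j)"
    and homogeneous_F: "\<And>k x. F (k *s x) = k ^ Suc e * F x"
    and gradient_F: "\<And>x x' t. curve_deriv x x' t \<Longrightarrow>
      ((\<lambda>s. F (x s)) has_field_derivative pairing (\<lambda>i. g i (x t)) x') (at t)"
    and gradient_g: "\<And>i x x' t. curve_deriv x x' t \<Longrightarrow>
      ((\<lambda>s. g i (x s)) has_field_derivative pairing (\<lambda>j. H i j (x t)) x') (at t)"
    and smooth: "\<And>x. F x = 0 \<Longrightarrow> x \<noteq> 0 \<Longrightarrow> (\<lambda>i. g i x) \<noteq> (\<lambda>_. 0)"
begin

definition dF :: "complex ^ 4 \<Rightarrow> complex ^ 4 \<Rightarrow> complex" where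
  "dF x v = pairing (\<lambda>i. g i x) v"

lemma dF_simps [simp]:
  "dF x (v + w) = dF x v + dF x w" "dF x (v - w) = dF x v - dF x w" "dF x (k *s v) = k * dF x v" "dF x 0 = 0"
  by (simp_all add: dF_def)

lemma DERIV_F: "curve_deriv x x' t \<Longrightarrow> ((\<lambda>s. F (x s)) has_field_derivative dF (x t) x') (at t)"
  unfolding dF_def by (rule gradient_F)

lemma F_0: "F 0 = 0"
  using homogeneous_F[of 0 0] by simp

lemma euler: "dF x x = of_nat (Suc e) * F x"
proof -
  have "((\<lambda>s. F (0 + s *s x)) has_field_derivative dF (0 + 1 *s x) x) (at 1)"
    by (rule DERIV_F[OF curve_deriv_line])
  then have "((\<lambda>s. s ^ Suc e * F x) has_field_derivative dF x x) (at 1)"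
    by (simp only: add_0 homogeneous_F) simp
  moreover have "((\<lambda>s. s ^ Suc e * F x) has_field_derivative of_nat (Suc e) * F x) (at 1)"
    by (auto intro!: derivative_eq_intros)
  ultimately show ?thesis by (rule DERIV_unique)
qed

lemma g_homogeneous:
  assumes "k \<noteq> 0"
  shows "g i (k *s x) = k ^ e * g i x"
proof -
  let ?c = "\<lambda>s. x + s *s axis i 1 :: complex ^ 4"
  have "((\<lambda>s. F (k *s x + s *s (k *s axis i 1))) has_field_derivative dF (k *s x + 0 *s (k *s axis i 1)) (k *s axis i 1)) (at 0)"
    by (rule DERIV_F[OF curve_deriv_line])
  moreover have "(\<lambda>s. F (k *s x + s *s (k *s axis i 1))) = (\<lambda>s. k ^ Suc e * F (?c s))"
    by (simp only: homogeneous_F[symmetric]) (simp add: vec.scale_right_distrib mult.commute)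
  ultimately have "((\<lambda>s. k ^ Suc e * F (?c s)) has_field_derivative k * g i (k *s x)) (at 0)"
    by (simp add: dF_def)
  moreover have "((\<lambda>s. k ^ Suc e * F (?c s)) has_field_derivative k ^ Suc e * dF (?c 0) (axis i 1)) (at 0)"
    by (intro DERIV_cmult DERIV_F curve_deriv_line)
  ultimately have "k * g i (k *s x) = k ^ Suc e * dF (?c 0) (axis i 1)" by (rule DERIV_unique)
  then show ?thesis using assms by (simp add: dF_def)
qed

lemma dF_homogeneous: "k \<noteq> 0 \<Longrightarrow> dF (k *s x) v = k ^ e * dF x v"
  by (simp add: dF_def g_homogeneous pairing_left_scale)

lemma H_homogeneous:
  assumes "k \<noteq> 0"
  shows "k * H i j (k *s x) = k ^ e * H i j x"
proof -
  let ?c = "\<lambda>s. x + s *s axis j 1 :: complex ^ 4"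
  have "((\<lambda>s. g i (k *s x + s *s (k *s axis j 1))) has_field_derivative
      pairing (\<lambda>l. H i l (k *s x + 0 *s (k *s axis j 1))) (k *s axis j 1)) (at 0)"
    by (rule gradient_g[OF curve_deriv_line])
  moreover have "(\<lambda>s. g i (k *s x + s *s (k *s axis j 1))) = (\<lambda>s. k ^ e * g i (?c s))"
    by (simp only: g_homogeneous[OF assms, symmetric]) (simp add: vec.scale_right_distrib mult.commute)
  ultimately have "((\<lambda>s. k ^ e * g i (?c s)) has_field_derivative k * H i j (k *s x)) (at 0)"
    by simp
  moreover have "((\<lambda>s. k ^ e * g i (?c s)) has_field_derivative k ^ e * pairing (\<lambda>l. H i l (?c 0)) (axis j 1)) (at 0)"
    by (intro DERIV_cmult gradient_g curve_deriv_line)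
  ultimately have "k * H i j (k *s x) = k ^ e * pairing (\<lambda>l. H i l (?c 0)) (axis j 1)" by (rule DERIV_unique)
  then show ?thesis by simp
qed

lemma euler_g: "pairing (\<lambda>j. H i j x) x = of_nat e * g i x"
proof -
  have "((\<lambda>s. g i (0 + s *s x)) has_field_derivative pairing (\<lambda>j. H i j (0 + 1 *s x)) x) (at 1)"
    by (rule gradient_g[OF curve_deriv_line])
  then have "((\<lambda>s. g i (s *s x)) has_field_derivative pairing (\<lambda>j. H i j x) x) (at 1)" by simp
  then have "((\<lambda>s. s ^ e * g i x) has_field_derivative pairing (\<lambda>j. H i j x) x) (at 1)"
    by (rule has_field_derivative_transform_within_open[of _ _ _ "-{0}"]) (auto simp: g_homogeneous)
  moreover have "((\<lambda>s. s ^ e * g i x) has_field_derivative of_nat e * g i x) (at 1)"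
    by (auto intro!: derivative_eq_intros)
  ultimately show ?thesis by (rule DERIV_unique)
qed

lemma continuous_polyfun: "polyfun f \<Longrightarrow> continuous_on A (f :: complex ^ 4 \<Rightarrow> complex)"
  by (rule polyfun_continuous[of f A "\<lambda>x. x", simplified])
     (auto simp: coords_vec_def coords_complex_def intro!: continuous_intros)

lemma g_0: "e > 0 \<Longrightarrow> g i 0 = 0"
proof -
  assume "e > 0"
  then have "(1::real) < 2 ^ e" by (intro one_less_power) auto
  then have "norm ((2::complex) ^ e) \<noteq> 1" by (simp add: norm_power)
  then have "(2::complex) ^ e \<noteq> 1" by (metis norm_one)
  then show ?thesis using g_homogeneous[of 2 i 0] by auto
qed

text \<open>The Gauss map is finite: the affine variety below is bounded by homogeneity, and a bounded
  algebraic set has finite image under every coordinate.\<close>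

lemma gauss_finite:
  assumes e: "e > 0" and \<eta>: "\<eta> \<noteq> (\<lambda>_. 0)"
  shows "finite {x. F x = 0 \<and> (\<forall>i. g i x = \<eta> i)}" (is "finite ?A")
proof -
  obtain k where k: "\<eta> k \<noteq> 0" using \<eta> by auto
  \<comment> \<open>The points of the unit sphere on the surface whose gradient is proportional to
    \<open>\<eta>\<close>. By smoothness \<open>g k\<close> has no zero among them, so compactness
    gives a lower bound \<open>m\<close>, and rescaling a point of the variety to the sphere bounds
    its norm.\<close>
  define K where "K = {x. F x = 0 \<and> (\<forall>i. g i x * \<eta> k = g k x * \<eta> i)} \<inter> sphere 0 1"
  have "closed {x. F x = 0 \<and> (\<forall>i. g i x * \<eta> k = g k x * \<eta> i)}"
    by (intro closed_Collect_conj closed_Collect_all closed_Collect_eq continuous_intros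
        continuous_polyfun polyfun_F polyfun_g)
  then have "compact K" unfolding K_def by (intro closed_Int_compact compact_sphere)
  have nz: "g k x \<noteq> 0" if "x \<in> K" for x
  proof
    assume "g k x = 0"
    then have "(\<lambda>i. g i x) = (\<lambda>_. 0)" using that k by (auto simp: K_def fun_eq_iff)
    moreover have "x \<noteq> 0" using that by (auto simp: K_def)
    ultimately show False using smooth[of x] that by (auto simp: K_def)
  qed
  obtain m where m: "m > 0" "\<And>x. x \<in> K \<Longrightarrow> m \<le> cmod (g k x)"
  proof (cases "K = {}")
    case False
    have "continuous_on K (\<lambda>x. cmod (g k x))" by (intro continuous_intros continuous_polyfun polyfun_g)
    then obtain x0 where "x0 \<in> K" "\<And>x. x \<in> K \<Longrightarrow> cmod (g k x0) \<le> cmod (g k x)"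
      using continuous_attains_inf[OF \<open>compact K\<close> False] by blast
    then show ?thesis using nz[of x0] that[of "cmod (g k x0)"] by auto
  qed (use that[of 1] in auto)
  have bound: "norm x \<le> max 1 (cmod (\<eta> k) / m)" if x: "x \<in> ?A" for x
  proof (cases "x = 0")
    case False
    define s where "s = complex_of_real (1 / norm x)"
    have s: "s \<noteq> 0" using False by (simp add: s_def)
    have sx: "s *s x = (1 / norm x) *\<^sub>R x" unfolding vec_eq_iff vector_smult_component vector_scaleR_component
      by (simp add: s_def scaleR_conv_of_real)
    have gs: "g i (s *s x) = s ^ e * \<eta> i" for i using x by (simp add: g_homogeneous[OF s])
    have "s *s x \<in> K"
      unfolding K_def using x False
      by (auto simp: homogeneous_F gs) (simp add: sx)
    then have "m \<le> cmod (s ^ e * \<eta> k)" using m(2) gs by metis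
    also have "\<dots> = cmod (\<eta> k) / norm x ^ e" by (simp add: s_def norm_mult norm_power norm_divide power_divide)
    finally have "m * norm x ^ e \<le> cmod (\<eta> k)" using False by (simp add: field_simps)
    then have le: "norm x ^ e \<le> cmod (\<eta> k) / m" using m(1) by (simp add: field_simps)
    show ?thesis
    proof (cases "norm x \<le> 1")
      case False
      then have "norm x \<le> norm x ^ e" using e by (intro self_le_power) auto
      then show ?thesis using le by linarith
    qed simp
  qed simp
  show ?thesis
  proof (rule finite_coordinatewise, rule ccontr)
    fix j assume inf: "infinite ((\<lambda>x. x $ j) ` ?A)"
    define S where "S = insert F (range (\<lambda>i x. g i x - \<eta> i))"
    have "countable {t. \<nexists>a. (F a = 0 \<and> (\<forall>i. g i a = \<eta> i)) \<and> a $ j = t}"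
    proof (rule algebraic_image[where S = S and h = "\<lambda>_. 1"])
      show "(F a = 0 \<and> (\<forall>i. g i a = \<eta> i)) \<longleftrightarrow> (\<forall>p\<in>S. p a = 0) \<and> (1::complex) \<noteq> 0" for a
        by (auto simp: S_def)
      show "polyfun p" if "p \<in> S" for p
        using that by (auto simp: S_def intro: polyfun_F polyfun_g polyfun_diff)
      have "{t. \<exists>a. (F a = 0 \<and> (\<forall>i. g i a = \<eta> i)) \<and> a $ j = t} = (\<lambda>x. x $ j) ` ?A" by blast
      then show "infinite {t. \<exists>a. (F a = 0 \<and> (\<forall>i. g i a = \<eta> i)) \<and> a $ j = t}" using inf by metis
    qed (auto intro: polyfun_nth)
    moreover have "{t. \<nexists>a. (F a = 0 \<and> (\<forall>i. g i a = \<eta> i)) \<and> a $ j = t} = - ((\<lambda>x. x $ j) ` ?A)" by blast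
    moreover have "bounded ((\<lambda>x. x $ j) ` ?A)"
      unfolding bounded_iff
    proof (intro exI ballI)
      fix z assume "z \<in> (\<lambda>x. x $ j) ` ?A"
      then obtain x where x: "x \<in> ?A" "z = x $ j" by blast
      then show "norm z \<le> max 1 (cmod (\<eta> k) / m)"
        unfolding x(2) by (intro order_trans[OF Finite_Cartesian_Product.norm_nth_le bound[OF x(1)]])
    qed
    ultimately have "countable (- ((\<lambda>x. x $ j) ` ?A))" "bounded ((\<lambda>x. x $ j) ` ?A)" by simp_all
    then show False using bounded_uncountable_Compl[of "(\<lambda>x. x $ j) ` ?A"] by simp
  qed
qed

end

lemma pairing_span:
  assumes "\<And>a. a \<in> A \<Longrightarrow> pairing \<eta> a = 0" "v \<in> vec.span A"
  shows "pairing \<eta> v = 0"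
proof -
  have "vec.subspace {v. pairing \<eta> v = 0}"
    by (intro vec.subspaceI) auto
  then have "vec.span A \<subseteq> {v. pairing \<eta> v = 0}"
    by (rule vec.span_minimal[rotated]) (use assms(1) in auto)
  then show ?thesis using assms(2) by auto
qed

lemma polyfun_univariate:
  fixes f :: "complex \<Rightarrow> complex"
  assumes "polyfun f"
  shows "\<exists>q. \<forall>z. f z = poly q z"
  using assms
proof induction
  case (polyfun_const k)
  show ?case by (intro exI[of _ "[:k:]"]) simp
next
  case (polyfun_coord c)
  then show ?case by (intro exI[of _ "[:0, 1:]"]) (simp add: coords_complex_def)
next
  case (polyfun_add f h)
  then obtain p q where "\<And>z. f z = poly p z" "\<And>z. h z = poly q z" by blast
  then show ?case by (intro exI[of _ "p + q"]) simp
next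
  case (polyfun_mult f h)
  then obtain p q where "\<And>z. f z = poly p z" "\<And>z. h z = poly q z" by blast
  then show ?case by (intro exI[of _ "p * q"]) simp
qed

context smooth_form
begin

lemma polyfun_dF:
  assumes "\<And>i. polyfun (\<lambda>a. x a $ i)" "\<And>i. polyfun (\<lambda>a. v a $ i)"
  shows "polyfun (\<lambda>a. dF (x a) (v a))"
  unfolding dF_def pairing_def
  by (intro polyfun_sum polyfun_mult polyfun_vec_compose[OF polyfun_g] assms)

lemma DERIV_dF:
  assumes "curve_deriv x x' t" "curve_deriv v v' t"
  shows "((\<lambda>s. dF (x s) (v s)) has_field_derivative
    pairing (\<lambda>i. pairing (\<lambda>j. H i j (x t)) x') (v t) + dF (x t) v') (at t)"
proof -
  have "((\<lambda>s. g i (x s) * v s $ i) has_field_derivative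
      pairing (\<lambda>j. H i j (x t)) x' * v t $ i + v' $ i * g i (x t)) (at t)" for i
    using gradient_g[OF assms(1)] assms(2) unfolding curve_deriv_def by (intro DERIV_mult) auto
  then show ?thesis
    unfolding dF_def pairing_def[of _ "v _"] pairing_def[of _ v']
    by (rule DERIV_cong[OF DERIV_sum]) (simp add: sum.distrib mult.commute)
qed

lemma dF_curve_zero:
  assumes "curve_deriv x x' t" "open A" "t \<in> A" "\<And>s. s \<in> A \<Longrightarrow> F (x s) = 0"
  shows "dF (x t) x' = 0"
  by (rule DERIV_local_const[OF DERIV_F[OF assms(1)] assms(2,3,4)])

text \<open>The derivative of \<open>dF x x = 0\<close> along the arc; the term
  \<open>dF x x'\<close> drops out because the velocity is tangent to the surface.\<close>

lemma tangent_deriv_point: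
  assumes "curve_deriv x x' t" "open A" "t \<in> A" "\<And>s. s \<in> A \<Longrightarrow> F (x s) = 0"
  shows "pairing (\<lambda>i. pairing (\<lambda>j. H i j (x t)) x') (x t) = 0"
proof -
  have "pairing (\<lambda>i. pairing (\<lambda>j. H i j (x t)) x') (x t) + dF (x t) x' = 0"
    by (rule DERIV_local_const[OF DERIV_dF[OF assms(1,1)] assms(2,3), where k = 0]) (simp add: euler assms(4))
  then show ?thesis using dF_curve_zero[OF assms] by simp
qed

lemma tangent_deriv_fixed:
  assumes "curve_deriv x x' t" "open A" "t \<in> A" "\<And>s. s \<in> A \<Longrightarrow> dF (x s) v = k"
  shows "pairing (\<lambda>i. pairing (\<lambda>j. H i j (x t)) x') v = 0"
proof -
  have "pairing (\<lambda>i. pairing (\<lambda>j. H i j (x t)) x') v + dF (x t) 0 = 0"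
    by (rule DERIV_local_const[OF DERIV_dF[OF assms(1) curve_deriv_const] assms(2,3), where k = k]) (simp add: assms(4))
  then show ?thesis by simp
qed

text \<open>If \<open>F\<close> vanished on the whole affine line, homogeneity would carry the zeros
  to \<open>L + y *s M\<close> for every \<open>y \<noteq> 0\<close>, and the limit at
  \<open>y = 0\<close> would put \<open>L\<close> on the surface.\<close>

lemma finite_on_line:
  assumes "F L \<noteq> 0"
  shows "finite {z. F (z *s L + M) = 0}"
proof -
  have "polyfun (\<lambda>z. F (z *s L + M))"
    by (rule polyfun_vec_compose[OF polyfun_F]) auto
  then obtain q where q: "\<And>z. F (z *s L + M) = poly q z" using polyfun_univariate by blast
  have "q \<noteq> 0"
  proof
    assume "q = 0"
    then have zero: "F (L + y *s M) = 0" if "y \<noteq> 0" for y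
    proof -
      have "L + y *s M = y *s (inverse y *s L + M)" using that by (simp add: vec.scale_right_distrib)
      then show ?thesis using q \<open>q = 0\<close> by (simp only: homogeneous_F) simp
    qed
    have "((\<lambda>y. F (L + y *s M)) \<longlongrightarrow> F (L + 0 *s M)) (at 0)"
      using DERIV_isCont[OF DERIV_F[OF curve_deriv_line]] unfolding isCont_def by blast
    moreover have "((\<lambda>y. F (L + y *s M)) \<longlongrightarrow> 0) (at 0)"
      by (rule tendsto_eventually) (simp add: eventually_at_filter zero)
    ultimately have "F (L + 0 *s M) = 0" by (rule LIM_unique)
    then show False using assms by simp
  qed
  then show ?thesis unfolding q by (rule poly_roots_finite)
qed

text \<open>Along an arc of contact points, the gradient and its derivative both annihilate
  \<open>L\<close>, \<open>M\<close> and the point. The normalisation forbids that they be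
  proportional, so the contact point lies on the line through \<open>L\<close> and \<open>M\<close>.
  That line meets the surface in finitely many points, and the point determines the value
  \<open>c\<close>.\<close>

lemma line_in_tangent_planes_finite:
  assumes e: "e > 0" and L: "F L \<noteq> 0" and LM: "\<And>k. M \<noteq> k *s L"
  shows "finite {c. \<exists>x. F x = 0 \<and> dF x L = 0 \<and> dF x M = 0 \<and> dF x v0 = 1 \<and> dF x v1 = c}"
proof (rule ccontr)
  define Z where "Z x \<longleftrightarrow> F x = 0 \<and> dF x L = 0 \<and> dF x M = 0 \<and> dF x v0 = 1" for x
  assume "infinite {c. \<exists>x. F x = 0 \<and> dF x L = 0 \<and> dF x M = 0 \<and> dF x v0 = 1 \<and> dF x v1 = c}"
  then have inf: "infinite {c. \<exists>x. Z x \<and> dF x v1 = c}" by (simp add: Z_def conj_assoc)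
  have pdF: "polyfun (\<lambda>x. dF x v)" for v
    by (rule polyfun_dF) (auto intro: polyfun_nth)
  obtain t0 r x where r: "r > 0" and Zx: "\<And>t. t \<in> ball t0 r \<Longrightarrow> Z (x t)"
    and f: "\<And>t. t \<in> ball t0 r \<Longrightarrow> dF (x t) v1 = t"
    and hol: "\<And>p. polyfun p \<Longrightarrow> (\<lambda>t. p (x t)) holomorphic_on ball t0 r"
  proof (rule algebraic_arc_obtain[where Z = Z and f = "\<lambda>x. dF x v1" and h = "\<lambda>_. 1"
        and S = "{F, \<lambda>x. dF x L, \<lambda>x. dF x M, \<lambda>x. dF x v0 - 1}"])
    show "polyfun p" if "p \<in> {F, \<lambda>x. dF x L, \<lambda>x. dF x M, \<lambda>x. dF x v0 - 1}" for p
      using that by (auto intro: polyfun_F pdF polyfun_diff)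
  qed (use inf pdF in \<open>auto simp: Z_def\<close>)
  have cd: "curve_deriv x (vderiv x t) t" if "t \<in> ball t0 r" for t
    by (rule curve_deriv_holomorphic[OF hol[OF polyfun_nth] open_ball that])
  have line: "\<exists>z. x t = dF (x t) v0 *s (x t) \<and> F (z *s L + M) = 0 \<and> (\<exists>b. b \<noteq> 0 \<and> x t = b *s (z *s L + M))"
    if t: "t \<in> ball t0 r" for t
  proof -
    define \<xi> where "\<xi> = (\<lambda>i. g i (x t))"
    define \<zeta> where "\<zeta> = (\<lambda>i. pairing (\<lambda>j. H i j (x t)) (vderiv x t))"
    have dFp: "dF (x t) v = pairing \<xi> v" for v by (simp add: dF_def \<xi>_def)
    have fixd: "pairing \<zeta> v = 0" if "\<And>s. s \<in> ball t0 r \<Longrightarrow> dF (x s) v = k" for v k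
      unfolding \<zeta>_def by (rule tangent_deriv_fixed[OF cd[OF t] open_ball t that])
    have \<zeta>: "pairing \<zeta> L = 0" "pairing \<zeta> M = 0" "pairing \<zeta> v0 = 0"
      using Zx by (auto intro!: fixd simp: Z_def)
    have \<zeta>x: "pairing \<zeta> (x t) = 0"
      unfolding \<zeta>_def by (rule tangent_deriv_point[OF cd[OF t] open_ball t]) (use Zx in \<open>auto simp: Z_def\<close>)
    have \<zeta>1: "pairing \<zeta> v1 = 1"
    proof -
      have "pairing \<zeta> v1 + dF (x t) 0 = 1"
        unfolding \<zeta>_def by (rule DERIV_local_ident[OF DERIV_dF[OF cd[OF t] curve_deriv_const] open_ball t f])
      then show ?thesis by simp
    qed
    have \<xi>: "pairing \<xi> L = 0" "pairing \<xi> M = 0" "pairing \<xi> v0 = 1" "pairing \<xi> (x t) = 0"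
      using Zx[OF t] euler[of "x t"] by (simp_all add: Z_def dFp[symmetric])
    have "x t \<in> vec.span {L, M}"
    proof (rule ccontr)
      assume out: "x t \<notin> vec.span {L, M}"
      have "L \<noteq> 0" using L F_0 by auto
      moreover have "M \<notin> vec.span {L}" using LM by (auto simp: vec.span_singleton)
      ultimately obtain v where b: "basis4 L M (x t) v" using basis4_extend3[OF _ _ out] by blast
      \<comment> \<open>Both covectors annihilate three vectors of the basis; this combination
        annihilates \<open>v\<close> too. Evaluation at \<open>v0\<close> and at \<open>v1\<close>
        then shows that \<open>\<zeta>\<close> and \<open>\<xi>\<close> vanish at
        \<open>v\<close>.\<close>
      have "(\<lambda>i. pairing \<zeta> v * \<xi> i - pairing \<xi> v * \<zeta> i) = (\<lambda>_. 0)"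
        by (rule basis4_covector[OF b]) (simp_all add: pairing_left_diff pairing_left_scale \<xi> \<zeta> \<zeta>x)
      then have *: "pairing \<zeta> v * pairing \<xi> w - pairing \<xi> v * pairing \<zeta> w = 0" for w
        using pairing_left_diff[of "\<lambda>i. pairing \<zeta> v * \<xi> i" "\<lambda>i. pairing \<xi> v * \<zeta> i" w]
        by (simp add: pairing_left_scale pairing_left_0)
      have "pairing \<zeta> v = 0" using *[of v0] \<xi> \<zeta> by simp
      moreover have "pairing \<xi> v = 0" using *[of v1] \<zeta>1 calculation by simp
      ultimately have "\<xi> = (\<lambda>_. 0)" using basis4_covector[OF b] \<xi> by blast
      then show False using \<xi>(3) pairing_left_0 by simp
    qed
    then obtain a b where ab: "x t = a *s L + b *s M"
      by (auto simp: vec.span_insert vec.span_singleton) (metis add.commute diff_add_cancel)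
    have xnz: "x t \<noteq> 0"
    proof
      assume "x t = 0"
      then show False using \<xi>(3) g_0[OF e] by (simp add: \<xi>_def pairing_left_0)
    qed
    have b: "b \<noteq> 0"
    proof
      assume "b = 0"
      then have "x t = a *s L" "a \<noteq> 0" using ab xnz by auto
      then show False using Zx[OF t] L by (simp add: Z_def homogeneous_F)
    qed
    then have xt: "x t = b *s ((a / b) *s L + M)" using ab by (simp add: vec.scale_right_distrib)
    then have "F (x t) = b ^ Suc e * F ((a / b) *s L + M)" using homogeneous_F by metis
    then have "F ((a / b) *s L + M) = 0" using Zx[OF t] b by (simp add: Z_def)
    then show ?thesis using b xt \<xi>(3) unfolding dFp by (intro exI[of _ "a / b"]) auto
  qed
  then have "\<forall>t\<in>ball t0 r. \<exists>z. F (z *s L + M) = 0 \<and> (\<exists>b. b \<noteq> 0 \<and> x t = b *s (z *s L + M))" by blast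
  from bchoice[OF this] obtain z where z: "\<And>t. t \<in> ball t0 r \<Longrightarrow> F (z t *s L + M) = 0"
    "\<And>t. t \<in> ball t0 r \<Longrightarrow> \<exists>b. b \<noteq> 0 \<and> x t = b *s (z t *s L + M)" by blast
  \<comment> \<open>The parameter is a quotient of two values of the gradient, from which the
    unknown factor \<open>b\<close> cancels; so it depends on the point of the line alone.\<close>
  have "t = dF (z t *s L + M) v1 / dF (z t *s L + M) v0" if t: "t \<in> ball t0 r" for t
  proof -
    obtain b where b: "b \<noteq> 0" "x t = b *s (z t *s L + M)" using z(2)[OF t] by blast
    have "t = b ^ e * dF (z t *s L + M) v1" "1 = b ^ e * dF (z t *s L + M) v0"
      using f[OF t] Zx[OF t] unfolding Z_def b(2) dF_homogeneous[OF b(1)] by auto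
    then show ?thesis by (metis mult_eq_0_iff nonzero_mult_divide_mult_cancel_left div_by_1 one_neq_zero)
  qed
  then have "inj_on z (ball t0 r)" by (intro inj_onI) metis
  moreover have "finite (z ` ball t0 r)"
    by (rule finite_subset[OF _ finite_on_line[OF L, of M]]) (use z(1) in auto)
  ultimately have "finite (ball t0 r)" using finite_imageD by blast
  then show False using infinite_ball[OF r] by blast
qed

lemma not_in_span_point:
  assumes "F L \<noteq> 0" "F x = 0"
  shows "L \<notin> vec.span {x}"
proof
  assume "L \<in> vec.span {x}"
  then obtain k where "L = k *s x" by (auto simp: vec.span_singleton)
  then show False using assms by (simp add: homogeneous_F)
qed

text \<open>Finite fibres of the projective Gauss map: the gradient has degree \<open>e\<close>, so
  scaling by an \<open>e\<close>-th root turns proportional gradients into equal ones.\<close>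

lemma proportional_gradients_finite:
  fixes xs :: "'k \<Rightarrow> complex ^ 4"
  assumes e: "e > 0" and inj: "\<And>k l c. xs k = c *s xs l \<Longrightarrow> k = l"
    and xs: "\<And>k. F (xs k) = 0" "\<And>k. xs k \<noteq> 0" and \<eta>: "\<eta> \<noteq> (\<lambda>_. 0)"
  shows "finite {k. \<exists>c. \<forall>i. g i (xs k) = c * \<eta> i}" (is "finite ?K")
proof -
  have "\<forall>k\<in>?K. \<exists>l. l \<noteq> 0 \<and> (\<forall>i. g i (l *s xs k) = \<eta> i)"
  proof
    fix k assume "k \<in> ?K"
    then obtain c where c: "\<And>i. g i (xs k) = c * \<eta> i" by blast
    have "c \<noteq> 0" using smooth[OF xs(1,2)[of k]] c by (auto simp: fun_eq_iff)
    then obtain l where "l \<noteq> 0" "inverse c = l ^ e" using exists_complex_root_nonzero[of "inverse c" e] e by auto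
    then show "\<exists>l. l \<noteq> 0 \<and> (\<forall>i. g i (l *s xs k) = \<eta> i)"
      using c \<open>c \<noteq> 0\<close> by (intro exI[of _ l]) (simp add: g_homogeneous flip: \<open>inverse c = l ^ e\<close>)
  qed
  from bchoice[OF this] obtain l where l: "\<And>k. k \<in> ?K \<Longrightarrow> l k \<noteq> 0"
    "\<And>k i. k \<in> ?K \<Longrightarrow> g i (l k *s xs k) = \<eta> i" by blast
  have "finite ((\<lambda>k. l k *s xs k) ` ?K)"
  proof (rule finite_subset[OF _ gauss_finite[OF e \<eta>]])
    show "(\<lambda>k. l k *s xs k) ` ?K \<subseteq> {x. F x = 0 \<and> (\<forall>i. g i x = \<eta> i)}"
      using l(2) xs(1) homogeneous_F by auto
  qed
  moreover have "inj_on (\<lambda>k. l k *s xs k) ?K"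
  proof (rule inj_onI)
    fix k k' assume k: "k \<in> ?K" "k' \<in> ?K" "l k *s xs k = l k' *s xs k'"
    then have "inverse (l k) *s (l k *s xs k) = inverse (l k) *s (l k' *s xs k')" by simp
    then have "xs k = (inverse (l k) * l k') *s xs k'" using l(1)[OF k(1)] by simp
    then show "k = k'" by (rule inj)
  qed
  ultimately show ?thesis using finite_imageD by blast
qed

text \<open>For fixed \<open>v0\<close>, \<open>v1\<close> and \<open>c\<close>, the points \<open>x\<close> below are finite in number: along an arc, the
  derivative of the gradient annihilates \<open>v0\<close>, \<open>v1\<close>, \<open>x\<close> and \<open>L\<close>, so the Gauss map is constant.
  If infinitely many centres are degenerate, then for all but countably many \<open>c\<close> two of
  them share such a point, so that some fixed line lies in infinitely many tangent planes.\<close>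

lemma no_degenerate_sequence:
  fixes Q :: "complex ^ 4 \<Rightarrow> complex ^ 4 \<Rightarrow> complex \<times> complex \<Rightarrow> bool"
    and ell :: "nat \<Rightarrow> complex ^ 4" and xs :: "nat \<Rightarrow> nat \<Rightarrow> complex ^ 4"
  assumes e: "e > 0"
    and Q: "\<And>x L m. Q x L m \<longleftrightarrow> (\<forall>p\<in>S. p (x, L, m) = 0) \<and> h (x, L, m) \<noteq> 0"
    and S: "\<And>p. p \<in> S \<Longrightarrow> polyfun p" and h: "polyfun h"
    and tangent: "\<And>x L m. Q x L m \<Longrightarrow> F x = 0 \<and> dF x L = 0"
    and scale: "\<And>x L m k. Q x L m \<Longrightarrow> k \<noteq> 0 \<Longrightarrow> \<exists>m'. Q (k *s x) L m'"
    and arc: "\<And>x L m A t. open A \<Longrightarrow> t \<in> A \<Longrightarrow> (\<And>s. s \<in> A \<Longrightarrow> Q (x s) (L s) (m s)) \<Longrightarrow>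
        (\<And>i. (\<lambda>s. x s $ i) holomorphic_on A) \<Longrightarrow> (\<And>i. (\<lambda>s. L s $ i) holomorphic_on A) \<Longrightarrow>
        (\<lambda>s. fst (m s)) holomorphic_on A \<Longrightarrow> (\<lambda>s. snd (m s)) holomorphic_on A \<Longrightarrow>
        pairing (\<lambda>i. pairing (\<lambda>j. H i j (x t)) (vderiv x t)) (L t) = 0"
    and ell: "\<And>n. F (ell n) \<noteq> 0" "\<And>n n' k. n \<noteq> n' \<Longrightarrow> ell n \<noteq> k *s ell n'"
    and xs: "\<And>n k. xs n k \<noteq> 0" "\<And>n k. \<exists>m. Q (xs n k) (ell n) m"
    and xs_inj: "\<And>n k l c. xs n k = c *s xs n l \<Longrightarrow> k = l"
  shows False
proof -
  define \<xi> where "\<xi> n k = (\<lambda>i. g i (xs n k))" for n k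
  have dF\<xi>: "dF (xs n k) v = pairing (\<xi> n k) v" for n k v by (simp add: \<xi>_def dF_def)
  have Fxs: "F (xs n k) = 0" "dF (xs n k) (ell n) = 0" for n k using xs(2) tangent by blast+
  have \<xi>_nz: "\<xi> n k \<noteq> (\<lambda>_. 0)" for n k unfolding \<xi>_def by (rule smooth[OF Fxs(1) xs(1)])
  have prop_fin: "finite {k'. \<exists>c. \<forall>i. \<xi> n k' i = c * \<xi> n k i}" for n k
    using proportional_gradients_finite[OF e xs_inj[of n] Fxs(1) xs(1) \<xi>_nz[of n k]] by (simp add: \<xi>_def)
  \<comment> \<open>No tangent plane in the given countable family contains \<open>v0\<close>, so
    each contact point can be scaled to satisfy \<open>dF x v0 = 1\<close>.\<close>
  obtain v0 where v0: "\<And>n k. pairing (\<xi> n k) v0 \<noteq> 0"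
    using generic_vector[of "UNIV :: (nat \<times> nat) set" "\<lambda>(n, k). \<xi> n k"] \<xi>_nz by auto
  have "\<exists>\<eta>. \<forall>v. det (rows4 (xs n k) (ell n) v0 v) = pairing \<eta> v" for n k by (rule det_rows4_covector)
  then obtain D where D: "\<And>n k v. det (rows4 (xs n k) (ell n) v0 v) = pairing (D n k) v" by metis
  \<comment> \<open>The contact point and the centre lie in the tangent plane while
    \<open>v0\<close> does not, so the three vectors are independent.\<close>
  have D_nz: "D n k \<noteq> (\<lambda>_. 0)" for n k
  proof -
    have "v0 \<notin> vec.span {xs n k, ell n}"
    proof
      assume "v0 \<in> vec.span {xs n k, ell n}"
      then have "pairing (\<xi> n k) v0 = 0"
        by (rule pairing_span[rotated]) (auto simp: dF\<xi>[symmetric] Fxs euler)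
      then show False using v0 by blast
    qed
    then obtain v where "basis4 (xs n k) (ell n) v0 v"
      using basis4_extend3[OF xs(1) not_in_span_point[OF ell(1) Fxs(1)]] by blast
    then show ?thesis using D[of n k v] by (auto simp: basis4_def pairing_left_0)
  qed
  \<comment> \<open>It is zero exactly when the two gradients are proportional, and its value at
    \<open>v1\<close> is zero exactly when they have equal values of \<open>\<rho>\<close>. A
    \<open>v1\<close> generic for the nonzero ones separates the gradients.\<close>
  define \<zeta> where "\<zeta> n k l = (\<lambda>i. pairing (\<xi> n l) v0 * \<xi> n k i - pairing (\<xi> n k) v0 * \<xi> n l i)" for n k l
  define C where "C = range (\<lambda>(n, k). D n k) \<union> (range (\<lambda>(n, k, l). \<zeta> n k l) - {\<lambda>_. 0})"
  have "countable C" unfolding C_def by (intro countable_Un countable_Diff countable_image countableI_type)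
  moreover have "\<eta> \<noteq> (\<lambda>_. 0)" if "\<eta> \<in> C" for \<eta> using that D_nz by (auto simp: C_def) metis
  ultimately obtain v1 where v1: "\<And>\<eta>. \<eta> \<in> C \<Longrightarrow> pairing \<eta> v1 \<noteq> 0"
    using generic_vector[of C "\<lambda>\<eta>. \<eta>"] by blast
  have v1_D: "basis4 (xs n k) (ell n) v0 v1" for n k
    unfolding basis4_def D by (rule v1) (auto simp: C_def)

  \<comment> \<open>An affine model of the degenerate tangents from the centre \<open>ell n\<close>:
    the condition on \<open>v0\<close> fixes the scale of the point up to \<open>e\<close>-th roots
    of unity, and \<open>dF x v1\<close> is the remaining parameter of the dual curve.\<close>
  define R where "R n a \<longleftrightarrow> Q (fst a) (ell n) (snd a) \<and> dF (fst a) v0 = 1 \<and> basis4 (fst a) (ell n) v0 v1" for n a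
  define \<rho> where "\<rho> n k = pairing (\<xi> n k) v1 / pairing (\<xi> n k) v0" for n k
  have \<rho>_in: "\<exists>a. R n a \<and> dF (fst a) v1 = \<rho> n k" for n k
  proof -
    obtain l where l: "l \<noteq> 0" "inverse (pairing (\<xi> n k) v0) = l ^ e"
      using exists_complex_root_nonzero[of "inverse (pairing (\<xi> n k) v0)" e] e v0[of n k] by auto
    obtain m where "Q (xs n k) (ell n) m" using xs(2) by blast
    then obtain m' where "Q (l *s xs n k) (ell n) m'" using scale l(1) by blast
    then show ?thesis
      using v0[of n k] v1_D basis4_scale[OF l(1)] l
      by (intro exI[of _ "(l *s xs n k, m')"])
         (simp add: R_def dF_homogeneous dF\<xi> \<rho>_def divide_inverse mult.commute flip: l(2))
  qed
  \<comment> \<open>Equal values of \<open>\<rho>\<close> mean proportional gradients, of which only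
    finitely many occur; hence infinitely many values.\<close>
  have \<rho>_inf: "infinite (range (\<rho> n))" for n
  proof
    assume fin: "finite (range (\<rho> n))"
    have "finite {l. \<rho> n l = \<rho> n k}" for k
    proof (rule finite_subset[OF _ prop_fin[of n k]], rule subsetI, rule CollectI)
      fix l assume "l \<in> {l. \<rho> n l = \<rho> n k}"
      then have "pairing (\<xi> n l) v1 * pairing (\<xi> n k) v0 = pairing (\<xi> n k) v1 * pairing (\<xi> n l) v0"
        using v0 by (simp add: \<rho>_def frac_eq_eq)
      then have "pairing (\<zeta> n k l) v1 = 0"
        unfolding \<zeta>_def pairing_left_diff pairing_left_scale by (simp add: mult.commute)
      then have "\<zeta> n k l \<notin> C" using v1 by blast
      moreover have "\<zeta> n k l \<in> range (\<lambda>(n, k, l). \<zeta> n k l)"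
        by (rule range_eqI[of _ _ "(n, k, l)"]) simp
      ultimately have z: "\<zeta> n k l = (\<lambda>_. 0)" unfolding C_def by blast
      have "\<xi> n l i = pairing (\<xi> n l) v0 / pairing (\<xi> n k) v0 * \<xi> n k i" for i
        using fun_cong[OF z, of i] v0[of n k] by (simp add: \<zeta>_def field_simps)
      then show "\<exists>c. \<forall>i. \<xi> n l i = c * \<xi> n k i" by blast
    qed
    then have "finite (\<Union>y\<in>range (\<rho> n). {l. \<rho> n l = y})"
      by (intro finite_UN_I[OF fin]) auto
    moreover have "(\<Union>y\<in>range (\<rho> n). {l. \<rho> n l = y}) = UNIV" by auto
    ultimately show False by simp
  qed
  have pdF: "polyfun (\<lambda>a :: (complex ^ 4) \<times> 'z. dF (fst a) v)" for v :: "complex ^ 4" and dummy :: "'z::affine_space"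
    by (rule polyfun_dF) (auto intro!: polyfun_fst polyfun_nth)
  have C0: "countable {c. \<nexists>a. R n a \<and> dF (fst a) v1 = c}" for n
  proof (rule algebraic_image[where S = "insert (\<lambda>a. dF (fst a) v0 - 1) ((\<lambda>p a. p (fst a, ell n, snd a)) ` S)"
        and h = "\<lambda>a. h (fst a, ell n, snd a) * det (rows4 (fst a) (ell n) v0 v1)"])
    have comp: "polyfun (\<lambda>a. p (fst a, ell n, snd a))" if "polyfun p" for p :: "(complex ^ 4) \<times> (complex ^ 4) \<times> complex \<times> complex \<Rightarrow> complex"
      using that by (rule polyfun_compose) (auto simp: coords_prod_def intro: polyfun_fst polyfun_snd polyfun_coord)
    show "polyfun p" if "p \<in> insert (\<lambda>a. dF (fst a) v0 - 1) ((\<lambda>p a. p (fst a, ell n, snd a)) ` S)" for p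
      using that S by (auto intro!: polyfun_diff pdF comp)
    show "polyfun (\<lambda>a. h (fst a, ell n, snd a) * det (rows4 (fst a) (ell n) v0 v1))"
      by (intro polyfun_mult comp h polyfun_det_rows4 polyfun_const polyfun_fst polyfun_nth)
    have "range (\<rho> n) \<subseteq> {t. \<exists>a. R n a \<and> dF (fst a) v1 = t}" using \<rho>_in by blast
    then show "infinite {t. \<exists>a. R n a \<and> dF (fst a) v1 = t}" using \<rho>_inf finite_subset by blast
  qed (auto simp: R_def Q basis4_def pdF)

  \<comment> \<open>The centre is quantified inside, so that one finite set serves all centres at
    once.\<close>
  define A where "A c = {x. \<exists>L m. Q x L m \<and> dF x v0 = 1 \<and> dF x v1 = c \<and> basis4 x L v0 v1}" for c
  have A_fin: "finite (A c)" for c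
  proof (rule finite_coordinatewise, rule ccontr)
    fix j assume inf: "infinite ((\<lambda>x. x $ j) ` A c)"
    define Z where "Z a \<longleftrightarrow> Q (fst a) (fst (snd a)) (snd (snd a)) \<and> dF (fst a) v0 = 1 \<and> dF (fst a) v1 = c \<and>
      basis4 (fst a) (fst (snd a)) v0 v1" for a :: "(complex ^ 4) \<times> (complex ^ 4) \<times> complex \<times> complex"
    have "(\<lambda>x. x $ j) ` A c = {t. \<exists>a. Z a \<and> fst a $ j = t}"
      unfolding A_def Z_def by force
    with inf have inf: "infinite {t. \<exists>a. Z a \<and> fst a $ j = t}" by simp
    obtain t0 r \<sigma> where r: "r > 0" and Z: "\<And>t. t \<in> ball t0 r \<Longrightarrow> Z (\<sigma> t)"
      and f: "\<And>t. t \<in> ball t0 r \<Longrightarrow> fst (\<sigma> t) $ j = t"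
      and hol: "\<And>p. polyfun p \<Longrightarrow> (\<lambda>t. p (\<sigma> t)) holomorphic_on ball t0 r"
    proof (rule algebraic_arc_obtain[where Z = Z and f = "\<lambda>a. fst a $ j"
          and S = "S \<union> {\<lambda>a. dF (fst a) v0 - 1, \<lambda>a. dF (fst a) v1 - c}"
          and h = "\<lambda>a. h a * det (rows4 (fst a) (fst (snd a)) v0 v1)"])
      show "polyfun p" if "p \<in> S \<union> {\<lambda>a. dF (fst a) v0 - 1, \<lambda>a. dF (fst a) v1 - c}" for p
        using that S by (auto intro!: polyfun_diff pdF)
      show "polyfun (\<lambda>a. h a * det (rows4 (fst a) (fst (snd a)) v0 v1))"
        by (intro polyfun_mult h polyfun_det_rows4 polyfun_const polyfun_fst polyfun_snd polyfun_nth)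
      show "polyfun (\<lambda>a::(complex ^ 4) \<times> (complex ^ 4) \<times> complex \<times> complex. fst a $ j)"
        by (intro polyfun_fst polyfun_nth)
    qed (use inf in \<open>auto simp: Z_def Q basis4_def\<close>)
    define x where "x t = fst (\<sigma> t)" for t
    define L where "L t = fst (snd (\<sigma> t))" for t
    define m where "m t = snd (snd (\<sigma> t))" for t
    have holx: "(\<lambda>t. x t $ i) holomorphic_on ball t0 r" for i
      unfolding x_def by (rule hol) (intro polyfun_fst polyfun_nth)
    have holL: "(\<lambda>t. L t $ i) holomorphic_on ball t0 r" for i
      unfolding L_def by (rule hol) (intro polyfun_fst polyfun_snd polyfun_nth)
    have holm: "(\<lambda>t. fst (m t)) holomorphic_on ball t0 r" "(\<lambda>t. snd (m t)) holomorphic_on ball t0 r"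
      unfolding m_def by (rule hol; intro polyfun_fst polyfun_snd polyfun_id)+
    have Zx: "Q (x t) (L t) (m t)" "dF (x t) v0 = 1" "dF (x t) v1 = c" "basis4 (x t) (L t) v0 v1"
      if "t \<in> ball t0 r" for t
      using Z[OF that] by (simp_all add: Z_def x_def L_def m_def)
    have "((\<lambda>s. g i (x s)) has_field_derivative 0) (at t)" if t: "t \<in> ball t0 r" for t i
    proof -
      have cd: "curve_deriv x (vderiv x t) t"
        by (rule curve_deriv_holomorphic[OF holx open_ball t])
      have "(\<lambda>i. pairing (\<lambda>j. H i j (x t)) (vderiv x t)) = (\<lambda>_. 0)"
      proof (rule basis4_covector[OF Zx(4)[OF t]])
        show "pairing (\<lambda>i. pairing (\<lambda>j. H i j (x t)) (vderiv x t)) (x t) = 0"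
          by (rule tangent_deriv_point[OF cd open_ball t]) (use Zx(1) tangent in blast)
        show "pairing (\<lambda>i. pairing (\<lambda>j. H i j (x t)) (vderiv x t)) (L t) = 0"
          by (rule arc[OF open_ball t Zx(1) holx holL holm])
        show "pairing (\<lambda>i. pairing (\<lambda>j. H i j (x t)) (vderiv x t)) v0 = 0"
          by (rule tangent_deriv_fixed[OF cd open_ball t Zx(2)])
        show "pairing (\<lambda>i. pairing (\<lambda>j. H i j (x t)) (vderiv x t)) v1 = 0"
          by (rule tangent_deriv_fixed[OF cd open_ball t Zx(3)])
      qed
      then show ?thesis using gradient_g[OF cd, of i] by (simp add: fun_eq_iff)
    qed
    then have "\<exists>k. \<forall>t\<in>ball t0 r. g i (x t) = k" for i
      by (intro has_field_derivative_zero_constant convex_ball) (auto intro: has_field_derivative_at_within)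
    then obtain \<eta> where \<eta>: "\<And>i t. t \<in> ball t0 r \<Longrightarrow> g i (x t) = \<eta> i" by metis
    have "t0 \<in> ball t0 r" using r by simp
    then have "pairing \<eta> v0 = 1" using Zx(2) \<eta> by (metis (no_types, lifting) dF_def pairing_def sum.cong)
    then have "\<eta> \<noteq> (\<lambda>_. 0)" by (auto simp: pairing_left_0)
    then have fin: "finite {x. F x = 0 \<and> (\<forall>i. g i x = \<eta> i)}" by (rule gauss_finite[OF e])
    have "finite (x ` ball t0 r)"
    proof (rule finite_subset[OF _ fin])
      have "F (x t) = 0" if "t \<in> ball t0 r" for t using Zx(1)[OF that] tangent by blast
      then show "x ` ball t0 r \<subseteq> {x. F x = 0 \<and> (\<forall>i. g i x = \<eta> i)}" using \<eta> by auto
    qed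
    moreover have "inj_on x (ball t0 r)" by (intro inj_onI) (metis f x_def)
    ultimately show False using finite_imageD infinite_ball[OF r] by blast
  qed
  \<comment> \<open>The values attained from every centre; what is removed is a countable union of
    countable sets.\<close>
  define N where "N = - (\<Union>n. {c. \<nexists>a. R n a \<and> dF (fst a) v1 = c})"
  have N_unc: "uncountable N"
  proof
    assume "countable N"
    moreover have "countable (- N)" unfolding N_def double_complement by (intro countable_UN C0) auto
    ultimately have "countable (N \<union> - N)" by (rule countable_Un)
    then show False using uncountable_UNIV_complex by simp
  qed
  have "\<forall>c\<in>N. \<exists>nn :: nat \<times> nat. \<exists>x. fst nn \<noteq> snd nn \<and> F x = 0 \<and> dF x (ell (fst nn)) = 0 \<and>
      dF x (ell (snd nn)) = 0 \<and> dF x v0 = 1 \<and> dF x v1 = c"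
  proof
    fix c assume "c \<in> N"
    then have "\<forall>n. \<exists>a. R n a \<and> dF (fst a) v1 = c" by (auto simp: N_def)
    from choice[OF this] obtain a where a: "\<And>n. R n (a n)" "\<And>n. dF (fst (a n)) v1 = c" by blast
    have "fst (a n) \<in> A c" for n using a(1)[of n] a(2)[of n] unfolding R_def A_def by blast
    then have "range (\<lambda>n. fst (a n)) \<subseteq> A c" by blast
    then have "finite (range (\<lambda>n. fst (a n)))" using A_fin finite_subset by blast
    then have "\<not> inj (\<lambda>n. fst (a n))" using finite_imageD infinite_UNIV_nat by blast
    then obtain n n' where nn: "n \<noteq> n'" "fst (a n) = fst (a n')" by (auto simp: inj_def)
    have "dF (fst (a n)) (ell n) = 0" "dF (fst (a n)) (ell n') = 0" "F (fst (a n)) = 0" "dF (fst (a n)) v0 = 1"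
      using a(1)[of n] a(1)[of n'] nn(2) tangent unfolding R_def by metis+
    then show "\<exists>nn :: nat \<times> nat. \<exists>x. fst nn \<noteq> snd nn \<and> F x = 0 \<and> dF x (ell (fst nn)) = 0 \<and>
      dF x (ell (snd nn)) = 0 \<and> dF x v0 = 1 \<and> dF x v1 = c"
      using nn(1) a(2)[of n] by (intro exI[of _ "(n, n')"] exI[of _ "fst (a n)"]) simp
  qed
  from bchoice[OF this] obtain nn where nn: "\<And>c. c \<in> N \<Longrightarrow> \<exists>x. fst (nn c) \<noteq> snd (nn c) \<and> F x = 0 \<and>
      dF x (ell (fst (nn c))) = 0 \<and> dF x (ell (snd (nn c))) = 0 \<and> dF x v0 = 1 \<and> dF x v1 = c" by blast
  \<comment> \<open>There are countably many pairs of centres, so a single pair works for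
    uncountably many values \<open>c\<close>.\<close>
  obtain k where k: "uncountable {c\<in>N. nn c = k}" using uncountable_fibre[OF N_unc] by blast
  then have "{c\<in>N. nn c = k} \<noteq> {}" using countable_empty by metis
  then obtain c0 where "c0 \<in> N" "nn c0 = k" by blast
  then have neq: "fst k \<noteq> snd k" using nn by blast
  have "{c\<in>N. nn c = k} \<subseteq> {c. \<exists>x. F x = 0 \<and> dF x (ell (fst k)) = 0 \<and> dF x (ell (snd k)) = 0 \<and> dF x v0 = 1 \<and> dF x v1 = c}"
    using nn by auto
  moreover have "finite {c. \<exists>x. F x = 0 \<and> dF x (ell (fst k)) = 0 \<and> dF x (ell (snd k)) = 0 \<and> dF x v0 = 1 \<and> dF x v1 = c}"
    by (rule line_in_tangent_planes_finite[OF e ell(1)]) (use ell(2)[of "snd k" "fst k"] neq in auto)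
  ultimately show False using k countable_finite finite_subset by blast
qed

end

section \<open>Pencils of planes through a centre\<close>

text \<open>The parameters are nested: the second, usually \<open>c\<close>, selects the plane
  spanned by \<open>e1 + c *s e3\<close>, \<open>e2\<close> and \<open>L\<close>; the first selects
  a line through \<open>L\<close> in this plane, and the third a point of the line.\<close>

definition pencil :: "complex ^ 4 \<Rightarrow> complex ^ 4 \<Rightarrow> complex ^ 4 \<Rightarrow> complex ^ 4 \<Rightarrow>
    complex \<times> complex \<times> complex \<Rightarrow> complex ^ 4" where
  "pencil e1 e2 e3 L z = e1 + fst z *s e2 + fst (snd z) *s e3 + snd (snd z) *s L"

lemma polyfun_pencil: "polyfun (\<lambda>a. pencil e1 e2 e3 L (fst a) $ i)"
  unfolding pencil_def
  by (simp, intro polyfun_add polyfun_mult polyfun_const polyfun_fst polyfun_snd polyfun_id)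

lemma pencil_curve:
  assumes "\<tau> holomorphic_on A" "\<omega> holomorphic_on A" "open A" "s \<in> A"
  shows "curve_deriv (\<lambda>s. pencil e1 e2 e3 L (\<tau> s, s, \<omega> s)) (deriv \<tau> s *s e2 + e3 + deriv \<omega> s *s L) s"
proof -
  have *: "(\<tau> has_field_derivative deriv \<tau> s) (at s)" "(\<omega> has_field_derivative deriv \<omega> s) (at s)"
    using assms by (auto intro: holomorphic_derivI)
  show ?thesis unfolding curve_deriv_def pencil_def
    by (auto intro!: derivative_eq_intros * simp: algebra_simps)
qed

lemma pencil_nonzero: "basis4 e1 e2 e3 L \<Longrightarrow> pencil e1 e2 e3 L z \<noteq> 0"
  using basis4_independent[of e1 e2 e3 L 1 "fst z" "fst (snd z)" "snd (snd z)"]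
  by (auto simp: pencil_def)

lemma pencil_not_proportional:
  assumes "basis4 e1 e2 e3 L" "pencil e1 e2 e3 L (t, c, w) = k *s pencil e1 e2 e3 L (t', c', w')"
  shows "c = c'"
proof -
  have "(1 - k) *s e1 + (t - k * t') *s e2 + (c - k * c') *s e3 + (w - k * w') *s L
      = pencil e1 e2 e3 L (t, c, w) - k *s pencil e1 e2 e3 L (t', c', w')"
    by (simp add: pencil_def vec_eq_iff algebra_simps)
  also have "\<dots> = 0" using assms(2) by simp
  finally have "1 - k = 0 \<and> t - k * t' = 0 \<and> c - k * c' = 0 \<and> w - k * w' = 0"
    by (rule basis4_independent[OF assms(1)])
  then show ?thesis by auto
qed

text \<open>The vectors \<open>L\<close>, \<open>x\<close> and \<open>x'\<close> are independent,
  since \<open>x\<close> has \<open>e1\<close>-coefficient 1 while \<open>x'\<close> has none and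
  has \<open>e3\<close>-coefficient 1. The covectors annihilating them form a line, and the value at
  \<open>e2\<close> is a coordinate on it.\<close>

lemma covectors_proportional:
  assumes b: "basis4 e1 e2 e3 L" and x: "x = pencil e1 e2 e3 L (t, c, w)" and x': "x' = a *s e2 + e3 + b *s L"
    and \<xi>: "pairing \<xi> L = 0" "pairing \<xi> x = 0" "pairing \<xi> x' = 0" "\<xi> \<noteq> (\<lambda>_. 0)"
    and \<zeta>: "pairing \<zeta> L = 0" "pairing \<zeta> x = 0" "pairing \<zeta> x' = 0"
  obtains k where "\<And>i. \<zeta> i = k * \<xi> i"
proof -
  have zero: "\<eta> = (\<lambda>_. 0)" if "pairing \<eta> L = 0" "pairing \<eta> x = 0" "pairing \<eta> x' = 0" "pairing \<eta> e2 = 0" for \<eta>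
  proof (rule basis4_covector[OF b _ that(4) _ that(1)])
    show "pairing \<eta> e3 = 0" using that unfolding x' by simp
    then show "pairing \<eta> e1 = 0" using that unfolding x pencil_def by simp
  qed
  have nz: "pairing \<xi> e2 \<noteq> 0" using zero[of \<xi>] \<xi> by blast
  have "(\<lambda>i. \<zeta> i - pairing \<zeta> e2 / pairing \<xi> e2 * \<xi> i) = (\<lambda>_. 0)"
    by (rule zero; unfold pairing_left_diff pairing_left_scale) (use \<xi> \<zeta> nz in simp_all)
  then show ?thesis using that[of "pairing \<zeta> e2 / pairing \<xi> e2"] by (auto simp: fun_eq_iff)
qed

context smooth_form
begin

lemma polyfun_F_pencil: "polyfun (\<lambda>a. F (pencil e1 e2 e3 L (fst a)))"
  by (intro polyfun_vec_compose[OF polyfun_F] polyfun_pencil)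

lemma polyfun_dF_pencil: "polyfun (\<lambda>a. dF (pencil e1 e2 e3 L (fst a)) v)"
  by (intro polyfun_dF polyfun_pencil polyfun_const)

text \<open>The plane parameter is the parameter of the arc itself, so the velocity of the moving
  point has \<open>e3\<close>-coefficient 1. The additional unknown \<open>m\<close> leaves room for
  a second point on the line.\<close>

lemma pencil_arc:
  fixes Z :: "complex \<times> complex \<times> complex \<Rightarrow> complex \<Rightarrow> bool"
  assumes Z: "\<And>z m. Z z m \<longleftrightarrow> (\<forall>p\<in>S. p (z, m) = 0) \<and> h (z, m) \<noteq> 0"
    and S: "\<And>p. p \<in> S \<Longrightarrow> polyfun p" and h: "polyfun h"
    and inf: "infinite {c. \<exists>t w m. Z (t, c, w) m}"
  obtains t0 r \<tau> \<omega> \<mu> where "r > 0" "\<And>s. s \<in> ball t0 r \<Longrightarrow> Z (\<tau> s, s, \<omega> s) (\<mu> s)"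
    "\<tau> holomorphic_on ball t0 r" "\<omega> holomorphic_on ball t0 r" "\<mu> holomorphic_on ball t0 r"
proof -
  have eq: "{c. \<exists>t w m. Z (t, c, w) m} = {c. \<exists>a. Z (fst a) (snd a) \<and> fst (snd (fst a)) = c}"
    by force
  obtain t0 r \<sigma> where *: "r > 0" "\<And>t. t \<in> ball t0 r \<Longrightarrow> Z (fst (\<sigma> t)) (snd (\<sigma> t))"
    "\<And>t. t \<in> ball t0 r \<Longrightarrow> fst (snd (fst (\<sigma> t))) = t"
    "\<And>p. polyfun p \<Longrightarrow> (\<lambda>t. p (\<sigma> t)) holomorphic_on ball t0 r"
  proof (rule algebraic_arc_obtain[where Z = "\<lambda>a. Z (fst a) (snd a)" and S = S and h = h and f = "\<lambda>a. fst (snd (fst a))"])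
    show "polyfun (\<lambda>a :: (complex \<times> complex \<times> complex) \<times> complex. fst (snd (fst a)))"
      by (intro polyfun_fst polyfun_snd polyfun_id)
  qed (use Z S h inf eq in auto)
  show ?thesis
  proof (rule that[OF *(1), of t0 "\<lambda>s. fst (fst (\<sigma> s))" "\<lambda>s. snd (snd (fst (\<sigma> s)))" "\<lambda>s. snd (\<sigma> s)"])
    show "Z (fst (fst (\<sigma> s)), s, snd (snd (fst (\<sigma> s)))) (snd (\<sigma> s))" if "s \<in> ball t0 r" for s
      using *(2)[OF that] *(3)[OF that] by (metis prod.collapse)
    show "(\<lambda>s. fst (fst (\<sigma> s))) holomorphic_on ball t0 r"
      "(\<lambda>s. snd (snd (fst (\<sigma> s)))) holomorphic_on ball t0 r" "(\<lambda>s. snd (\<sigma> s)) holomorphic_on ball t0 r"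
      by (rule *(4); intro polyfun_fst polyfun_snd polyfun_id)+
  qed
qed

text \<open>A Bertini argument. Along an arc of contact points the velocity is tangent, so the
  gradient annihilates \<open>e3\<close> besides \<open>L\<close> and \<open>e2\<close>, and then
  \<open>e1\<close> by Euler's relation, against smoothness.\<close>

lemma tangent_planes_finite:
  assumes b: "basis4 e1 e2 e3 L"
  shows "finite {c. \<exists>t w. F (pencil e1 e2 e3 L (t, c, w)) = 0 \<and> dF (pencil e1 e2 e3 L (t, c, w)) L = 0 \<and>
     dF (pencil e1 e2 e3 L (t, c, w)) e2 = 0}"
proof (rule ccontr)
  let ?P = "pencil e1 e2 e3 L"
  define Z where "Z z m \<longleftrightarrow> F (?P z) = 0 \<and> dF (?P z) L = 0 \<and> dF (?P z) e2 = 0" for z and m :: complex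
  assume "\<not> ?thesis"
  then have inf: "infinite {c. \<exists>t w m. Z (t, c, w) m}" by (simp add: Z_def)
  obtain t0 r \<tau> \<omega> \<mu> where r: "r > 0" and Zs: "\<And>s. s \<in> ball t0 r \<Longrightarrow> Z (\<tau> s, s, \<omega> s) (\<mu> s)"
    and hol: "\<tau> holomorphic_on ball t0 r" "\<omega> holomorphic_on ball t0 r" "\<mu> holomorphic_on ball t0 r"
  proof (rule pencil_arc[where Z = Z and h = "\<lambda>_. 1" and
        S = "{\<lambda>a. F (?P (fst a)), \<lambda>a. dF (?P (fst a)) L, \<lambda>a. dF (?P (fst a)) e2}"])
    note obt = that
    show thesis if "r > 0" "\<And>s. s \<in> ball t0 r \<Longrightarrow> Z (\<tau> s, s, \<omega> s) (\<mu> s)"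
      "\<tau> holomorphic_on ball t0 r" "\<omega> holomorphic_on ball t0 r" "\<mu> holomorphic_on ball t0 r" for t0 r \<tau> \<omega> \<mu>
      by (rule obt[OF that])
  qed (use inf polyfun_F_pencil polyfun_dF_pencil in \<open>auto simp: Z_def\<close>)
  let ?x = "\<lambda>s. ?P (\<tau> s, s, \<omega> s)"
  have t0: "t0 \<in> ball t0 r" using r by simp
  have "dF (?x t0) (deriv \<tau> t0 *s e2 + e3 + deriv \<omega> t0 *s L) = 0"
    by (rule dF_curve_zero[OF pencil_curve[OF hol(1,2) open_ball t0] open_ball t0]) (use Zs in \<open>auto simp: Z_def\<close>)
  then have e3: "dF (?x t0) e3 = 0" using Zs[OF t0] by (simp add: Z_def)
  have "dF (?x t0) (?x t0) = 0" using Zs[OF t0] euler by (simp add: Z_def)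
  then have e1: "dF (?x t0) e1 = 0" using Zs[OF t0] e3 by (simp add: Z_def pencil_def)
  have "(\<lambda>i. g i (?x t0)) = (\<lambda>_. 0)"
    by (rule basis4_covector[OF b]) (use Zs[OF t0] e1 e3 in \<open>auto simp: Z_def dF_def\<close>)
  then show False using smooth pencil_nonzero[OF b] Zs[OF t0] unfolding Z_def by blast
qed

lemma basis4_swap: "basis4 e1 e2 e3 L \<Longrightarrow> basis4 (e1 + c *s e3) e3 e2 L"
  unfolding basis4_iff
proof (intro allI impI)
  fix x y z w
  assume b: "\<forall>x y z w. x *s e1 + y *s e2 + z *s e3 + w *s L = 0 \<longrightarrow> x = 0 \<and> y = 0 \<and> z = 0 \<and> w = 0"
    and eq: "x *s (e1 + c *s e3) + y *s e3 + z *s e2 + w *s L = 0"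
  have "x *s e1 + z *s e2 + (x * c + y) *s e3 + w *s L = x *s (e1 + c *s e3) + y *s e3 + z *s e2 + w *s L"
    by (simp add: vec_eq_iff algebra_simps)
  then have "x *s e1 + z *s e2 + (x * c + y) *s e3 + w *s L = 0" using eq by (rule trans)
  then have "x = 0 \<and> z = 0 \<and> x * c + y = 0 \<and> w = 0" using b by blast
  then show "x = 0 \<and> y = 0 \<and> z = 0 \<and> w = 0" by auto
qed

text \<open>The same argument with \<open>e2\<close> and \<open>e3\<close> exchanged: the plane is
  fixed and the line through \<open>L\<close> moves, so an arc of tangent lines would make the plane
  itself tangent.\<close>

lemma ramification_finite:
  assumes b: "basis4 e1 e2 e3 L"
    and no: "\<And>t w. F (pencil e1 e2 e3 L (t, c, w)) = 0 \<Longrightarrow> dF (pencil e1 e2 e3 L (t, c, w)) L = 0 \<Longrightarrow>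
      dF (pencil e1 e2 e3 L (t, c, w)) e2 \<noteq> 0"
  shows "finite {t. \<exists>w. F (pencil e1 e2 e3 L (t, c, w)) = 0 \<and> dF (pencil e1 e2 e3 L (t, c, w)) L = 0}"
proof (rule ccontr)
  let ?P = "pencil (e1 + c *s e3) e3 e2 L"
  have P: "pencil e1 e2 e3 L (t, c, w) = ?P (0, t, w)" for t w
    by (simp add: pencil_def algebra_simps)
  \<comment> \<open>The plane is absorbed into the base vector \<open>e1 + c *s e3\<close>, and the
    first parameter of the exchanged pencil is pinned to 0 by an equation.\<close>
  define Z where "Z z m \<longleftrightarrow> F (?P z) = 0 \<and> dF (?P z) L = 0 \<and> fst z = 0" for z and m :: complex
  assume "\<not> ?thesis"
  then have "infinite {t. \<exists>w. F (?P (0, t, w)) = 0 \<and> dF (?P (0, t, w)) L = 0}" by (simp add: P)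
  moreover have "{t. \<exists>w. F (?P (0, t, w)) = 0 \<and> dF (?P (0, t, w)) L = 0} = {t. \<exists>a w m. Z (a, t, w) m}"
    by (auto simp: Z_def)
  ultimately have inf: "infinite {t. \<exists>a w m. Z (a, t, w) m}" by simp
  obtain t0 r \<tau> \<omega> \<mu> where r: "r > 0" and Zs: "\<And>s. s \<in> ball t0 r \<Longrightarrow> Z (\<tau> s, s, \<omega> s) (\<mu> s)"
    and hol: "\<tau> holomorphic_on ball t0 r" "\<omega> holomorphic_on ball t0 r" "\<mu> holomorphic_on ball t0 r"
  proof (rule pencil_arc[where Z = Z and h = "\<lambda>_. 1" and
        S = "{\<lambda>a. F (?P (fst a)), \<lambda>a. dF (?P (fst a)) L, \<lambda>a. fst (fst a)}"])
    note obt = that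
    show thesis if "r > 0" "\<And>s. s \<in> ball t0 r \<Longrightarrow> Z (\<tau> s, s, \<omega> s) (\<mu> s)"
      "\<tau> holomorphic_on ball t0 r" "\<omega> holomorphic_on ball t0 r" "\<mu> holomorphic_on ball t0 r" for t0 r \<tau> \<omega> \<mu>
      by (rule obt[OF that])
    show "polyfun p" if "p \<in> {\<lambda>a :: (complex \<times> complex \<times> complex) \<times> complex. F (?P (fst a)), \<lambda>a. dF (?P (fst a)) L, \<lambda>a. fst (fst a)}" for p
      using that polyfun_F_pencil polyfun_dF_pencil by (auto intro: polyfun_fst[OF polyfun_fst[OF polyfun_id]])
  qed (use inf in \<open>auto simp: Z_def\<close>)
  let ?x = "\<lambda>s. ?P (\<tau> s, s, \<omega> s)"
  have t0: "t0 \<in> ball t0 r" using r by simp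
  have "dF (?x t0) (deriv \<tau> t0 *s e3 + e2 + deriv \<omega> t0 *s L) = 0"
    by (rule dF_curve_zero[OF pencil_curve[OF hol(1,2) open_ball t0] open_ball t0]) (use Zs in \<open>unfold Z_def, blast\<close>)
  moreover have "deriv \<tau> t0 = 0"
    by (rule DERIV_local_const[OF holomorphic_derivI[OF hol(1) open_ball t0] open_ball t0, of 0]) (use Zs in \<open>auto simp: Z_def\<close>)
  moreover have "dF (?x t0) L = 0" using Zs[OF t0] unfolding Z_def by blast
  ultimately have "dF (?x t0) e2 = 0" by simp
  moreover have "?x t0 = pencil e1 e2 e3 L (t0, c, \<omega> t0)" using Zs[OF t0] by (simp add: P Z_def)
  ultimately show False using no[of t0 "\<omega> t0"] Zs[OF t0] by (simp add: Z_def)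
qed

subsection \<open>Degenerate centres\<close>

text \<open>Either the line through \<open>x\<close> and \<open>L\<close> has contact of order at
  least three at \<open>x\<close>, since the second derivative in direction \<open>L\<close>
  vanishes too, or it touches the surface at a second point.\<close>

definition degenerate_tangent :: "complex ^ 4 \<Rightarrow> complex ^ 4 \<Rightarrow> bool" where
  "degenerate_tangent L x \<longleftrightarrow> F x = 0 \<and> dF x L = 0 \<and>
     (pairing (\<lambda>i. pairing (\<lambda>j. H i j x) L) L = 0 \<or> (\<exists>s. s \<noteq> 0 \<and> F (x + s *s L) = 0 \<and> dF (x + s *s L) L = 0))"

text \<open>More than a vanishing second derivative: the Hessian applied to \<open>L\<close> is a
  multiple of the gradient, with factor \<open>fst m\<close>. Along a one-parameter family of flex
  tangents this holds automatically, and it is preserved by differentiation.\<close>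

definition flex :: "complex ^ 4 \<Rightarrow> complex ^ 4 \<Rightarrow> complex \<times> complex \<Rightarrow> bool" where
  "flex x L m \<longleftrightarrow> F x = 0 \<and> dF x L = 0 \<and> (\<forall>j. (\<Sum>i\<in>UNIV. L $ i * H i j x) = fst m * g j x)"

text \<open>The surface has the same tangent plane at both points of contact; \<open>fst m\<close>
  leads to the second point and \<open>snd m\<close> is the ratio of the gradients.
  \<open>F L \<noteq> 0\<close> is included because it forces \<open>snd m\<close> to be
  nonzero.\<close>

definition bitangent :: "complex ^ 4 \<Rightarrow> complex ^ 4 \<Rightarrow> complex \<times> complex \<Rightarrow> bool" where
  "bitangent x L m \<longleftrightarrow> F x = 0 \<and> dF x L = 0 \<and> F (x + fst m *s L) = 0 \<and>
     (\<forall>j. g j (x + fst m *s L) = snd m * g j x) \<and> fst m \<noteq> 0 \<and> F L \<noteq> 0"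

lemma hessian_swap:
  "pairing (\<lambda>i. pairing (\<lambda>j. H i j x) v) L = pairing (\<lambda>j. \<Sum>i\<in>UNIV. L $ i * H i j x) v"
  by (simp add: pairing_def sum_distrib_left sum_distrib_right mult_ac) (rule sum.swap)

text \<open>On an arc, the Hessian applied to \<open>L\<close> annihilates \<open>L\<close> by the
  flex condition, the point by Euler's relation, and the velocity because \<open>dF x L = 0\<close>
  persists. The gradient annihilates the same three vectors.\<close>

lemma many_flexes:
  assumes b: "basis4 e1 e2 e3 L"
    and inf: "infinite {c. \<exists>t w. F (pencil e1 e2 e3 L (t, c, w)) = 0 \<and> dF (pencil e1 e2 e3 L (t, c, w)) L = 0 \<and>
      pairing (\<lambda>i. pairing (\<lambda>j. H i j (pencil e1 e2 e3 L (t, c, w))) L) L = 0}"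
  shows "infinite {c. \<exists>t w m. flex (pencil e1 e2 e3 L (t, c, w)) L m}"
proof -
  let ?P = "pencil e1 e2 e3 L"
  define HL where "HL x = pairing (\<lambda>i. pairing (\<lambda>j. H i j x) L) L" for x
  define Z where "Z z m \<longleftrightarrow> F (?P z) = 0 \<and> dF (?P z) L = 0 \<and> HL (?P z) = 0" for z and m :: complex
  have inf: "infinite {c. \<exists>t w m. Z (t, c, w) m}" using inf by (simp add: Z_def HL_def)
  have pHL: "polyfun (\<lambda>a. HL (?P (fst a)))"
    unfolding HL_def pairing_def
    by (intro polyfun_sum polyfun_mult polyfun_const polyfun_vec_compose[OF polyfun_H] polyfun_pencil)
  obtain t0 r \<tau> \<omega> \<mu> where r: "r > 0" and Zs: "\<And>s. s \<in> ball t0 r \<Longrightarrow> Z (\<tau> s, s, \<omega> s) (\<mu> s)"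
    and hol: "\<tau> holomorphic_on ball t0 r" "\<omega> holomorphic_on ball t0 r" "\<mu> holomorphic_on ball t0 r"
  proof (rule pencil_arc[where Z = Z and h = "\<lambda>_. 1" and
        S = "{\<lambda>a. F (?P (fst a)), \<lambda>a. dF (?P (fst a)) L, \<lambda>a. HL (?P (fst a))}"])
    note obt = that
    show thesis if "r > 0" "\<And>s. s \<in> ball t0 r \<Longrightarrow> Z (\<tau> s, s, \<omega> s) (\<mu> s)"
      "\<tau> holomorphic_on ball t0 r" "\<omega> holomorphic_on ball t0 r" "\<mu> holomorphic_on ball t0 r" for t0 r \<tau> \<omega> \<mu>
      by (rule obt[OF that])
  qed (use inf polyfun_F_pencil polyfun_dF_pencil pHL in \<open>auto simp: Z_def\<close>)
  let ?x = "\<lambda>s. ?P (\<tau> s, s, \<omega> s)"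
  let ?x' = "\<lambda>s. deriv \<tau> s *s e2 + e3 + deriv \<omega> s *s L"
  have "\<exists>m. flex (?x t) L m" if t: "t \<in> ball t0 r" for t
  proof -
    have cd: "curve_deriv ?x (?x' t) t" by (rule pencil_curve[OF hol(1,2) open_ball t])
    have x: "F (?x t) = 0" "dF (?x t) L = 0" "HL (?x t) = 0" using Zs[OF t] by (simp_all add: Z_def)
    define \<zeta> where "\<zeta> = (\<lambda>j. \<Sum>i\<in>UNIV. L $ i * H i j (?x t))"
    have "pairing \<zeta> v = pairing (\<lambda>i. pairing (\<lambda>j. H i j (?x t)) v) L" for v
      unfolding \<zeta>_def by (rule hessian_swap[symmetric])
    note \<zeta> = this
    have "pairing \<zeta> L = 0" using x(3) by (simp add: \<zeta> HL_def)
    moreover have "pairing \<zeta> (?x t) = 0"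
    proof -
      have "pairing \<zeta> (?x t) = of_nat e * dF (?x t) L"
        unfolding \<zeta> euler_g dF_def by (rule pairing_left_scale)
      then show ?thesis using x by simp
    qed
    moreover have "pairing \<zeta> (?x' t) = 0"
      unfolding \<zeta> by (rule tangent_deriv_fixed[OF cd open_ball t]) (use Zs in \<open>auto simp: Z_def\<close>)
    moreover have "pairing (\<lambda>i. g i (?x t)) L = 0" "pairing (\<lambda>i. g i (?x t)) (?x t) = 0" "pairing (\<lambda>i. g i (?x t)) (?x' t) = 0"
      using x euler[of "?x t"] dF_curve_zero[OF cd open_ball t] Zs by (auto simp: Z_def dF_def)
    moreover have "(\<lambda>i. g i (?x t)) \<noteq> (\<lambda>_. 0)" by (rule smooth[OF x(1) pencil_nonzero[OF b]])
    ultimately obtain k where "\<And>i. \<zeta> i = k * g i (?x t)"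
      using covectors_proportional[OF b refl refl, where \<xi> = "\<lambda>i. g i (?x t)" and \<zeta> = \<zeta>] by blast
    then show ?thesis using x by (intro exI[of _ "(k, 0)"]) (simp add: flex_def \<zeta>_def)
  qed
  then have "ball t0 r \<subseteq> {c. \<exists>t w m. flex (?P (t, c, w)) L m}" by blast
  then show ?thesis using infinite_ball[OF r] finite_subset by blast
qed

text \<open>The velocities of the two contact points differ by a multiple of \<open>L\<close>, so
  both gradients annihilate \<open>L\<close>, the first point and its velocity.\<close>

lemma many_bitangents:
  assumes b: "basis4 e1 e2 e3 L" and L: "F L \<noteq> 0"
    and inf: "infinite {c. \<exists>t w s. F (pencil e1 e2 e3 L (t, c, w)) = 0 \<and> dF (pencil e1 e2 e3 L (t, c, w)) L = 0 \<and>
      s \<noteq> 0 \<and> F (pencil e1 e2 e3 L (t, c, w + s)) = 0 \<and> dF (pencil e1 e2 e3 L (t, c, w + s)) L = 0}"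
  shows "infinite {c. \<exists>t w m. bitangent (pencil e1 e2 e3 L (t, c, w)) L m}"
proof -
  let ?P = "pencil e1 e2 e3 L"
  define sh where "sh a = (fst (fst a), fst (snd (fst a)), snd (snd (fst a)) + snd a)" for a :: "(complex \<times> complex \<times> complex) \<times> complex"
  define Z where "Z z m \<longleftrightarrow> F (?P z) = 0 \<and> dF (?P z) L = 0 \<and> m \<noteq> 0 \<and> F (?P (sh (z, m))) = 0 \<and> dF (?P (sh (z, m))) L = 0" for z and m :: complex
  have inf: "infinite {c. \<exists>t w m. Z (t, c, w) m}" using inf by (simp add: Z_def sh_def)
  have psh: "polyfun (\<lambda>a. ?P (sh a) $ i)" for i
    unfolding pencil_def sh_def
    by (simp, intro polyfun_add polyfun_mult polyfun_const polyfun_fst polyfun_snd polyfun_id)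
  obtain t0 r \<tau> \<omega> \<mu> where r: "r > 0" and Zs: "\<And>s. s \<in> ball t0 r \<Longrightarrow> Z (\<tau> s, s, \<omega> s) (\<mu> s)"
    and hol: "\<tau> holomorphic_on ball t0 r" "\<omega> holomorphic_on ball t0 r" "\<mu> holomorphic_on ball t0 r"
  proof (rule pencil_arc[where Z = Z and h = snd and
        S = "{\<lambda>a. F (?P (fst a)), \<lambda>a. dF (?P (fst a)) L, \<lambda>a. F (?P (sh a)), \<lambda>a. dF (?P (sh a)) L}"])
    note obt = that
    show thesis if "r > 0" "\<And>s. s \<in> ball t0 r \<Longrightarrow> Z (\<tau> s, s, \<omega> s) (\<mu> s)"
      "\<tau> holomorphic_on ball t0 r" "\<omega> holomorphic_on ball t0 r" "\<mu> holomorphic_on ball t0 r" for t0 r \<tau> \<omega> \<mu>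
      by (rule obt[OF that])
    show "polyfun p" if "p \<in> {\<lambda>a. F (?P (fst a)), \<lambda>a. dF (?P (fst a)) L, \<lambda>a. F (?P (sh a)), \<lambda>a. dF (?P (sh a)) L}" for p
      using that polyfun_F_pencil polyfun_dF_pencil psh
      by (auto intro: polyfun_vec_compose[OF polyfun_F] polyfun_dF)
    show "polyfun (snd :: (complex \<times> complex \<times> complex) \<times> complex \<Rightarrow> complex)"
      using polyfun_snd[OF polyfun_id] by simp
  qed (use inf in \<open>auto simp: Z_def\<close>)
  let ?x = "\<lambda>s. ?P (\<tau> s, s, \<omega> s)"
  let ?y = "\<lambda>s. ?P (\<tau> s, s, \<omega> s + \<mu> s)"
  have y: "?y s = ?x s + \<mu> s *s L" for s by (simp add: pencil_def vec_eq_iff algebra_simps)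
  have "\<exists>m. bitangent (?x t) L m" if t: "t \<in> ball t0 r" for t
  proof -
    define a where "a = deriv \<tau> t" define b1 where "b1 = deriv \<omega> t"
    define b2 where "b2 = deriv (\<lambda>s. \<omega> s + \<mu> s) t"
    have cdx: "curve_deriv ?x (a *s e2 + e3 + b1 *s L) t"
      unfolding a_def b1_def by (rule pencil_curve[OF hol(1,2) open_ball t])
    have cdy: "curve_deriv ?y (a *s e2 + e3 + b2 *s L) t"
      unfolding a_def b2_def by (rule pencil_curve[OF hol(1) holomorphic_on_add[OF hol(2,3)] open_ball t])
    have x: "F (?x t) = 0" "dF (?x t) L = 0" "\<mu> t \<noteq> 0" "F (?y t) = 0" "dF (?y t) L = 0"
      using Zs[OF t] by (simp_all add: Z_def sh_def)
    have dx: "dF (?x t) (a *s e2 + e3 + b1 *s L) = 0"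
      by (rule dF_curve_zero[OF cdx open_ball t]) (use Zs in \<open>auto simp: Z_def\<close>)
    have "dF (?y t) (a *s e2 + e3 + b2 *s L) = 0"
      by (rule dF_curve_zero[OF cdy open_ball t]) (use Zs in \<open>auto simp: Z_def sh_def\<close>)
    then have dy: "dF (?y t) (a *s e2 + e3 + b1 *s L) = 0" using x(5) by simp
    have "dF (?y t) (?y t) = 0" using euler x(4) by simp
    then have yx: "dF (?y t) (?x t) = 0" using x(5) unfolding y[of t] by simp
    have "(\<lambda>i. g i (?x t)) \<noteq> (\<lambda>_. 0)" by (rule smooth[OF x(1) pencil_nonzero[OF b]])
    then obtain k where "\<And>i. g i (?y t) = k * g i (?x t)"
      using covectors_proportional[OF b refl refl, where \<xi> = "\<lambda>i. g i (?x t)" and \<zeta> = "\<lambda>i. g i (?y t)"]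
        x dx dy yx euler[of "?x t"] unfolding dF_def by (metis mult_zero_right)
    then show ?thesis using x L y[of t] by (intro exI[of _ "(\<mu> t, k)"]) (simp add: bitangent_def)
  qed
  then have "ball t0 r \<subseteq> {c. \<exists>t w m. bitangent (?P (t, c, w)) L m}" by blast
  then show ?thesis using infinite_ball[OF r] finite_subset by blast
qed

text \<open>The basis is existentially quantified, so that a nondegenerate centre has finitely many
  bad planes in every pencil and the pencil may still be chosen.\<close>

definition degenerate_centre :: "complex ^ 4 \<Rightarrow> bool" where
  "degenerate_centre L \<longleftrightarrow> (\<exists>e1 e2 e3. basis4 e1 e2 e3 L \<and>
     infinite {c. \<exists>t w. degenerate_tangent L (pencil e1 e2 e3 L (t, c, w))})"

lemma degenerate_centre_cases:
  assumes L: "F L \<noteq> 0" and "degenerate_centre L"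
  shows "(\<exists>e1 e2 e3. basis4 e1 e2 e3 L \<and> infinite {c. \<exists>t w m. flex (pencil e1 e2 e3 L (t, c, w)) L m}) \<or>
    (\<exists>e1 e2 e3. basis4 e1 e2 e3 L \<and> infinite {c. \<exists>t w m. bitangent (pencil e1 e2 e3 L (t, c, w)) L m})"
proof -
  obtain e1 e2 e3 where b: "basis4 e1 e2 e3 L"
    and inf: "infinite {c. \<exists>t w. degenerate_tangent L (pencil e1 e2 e3 L (t, c, w))}"
    using assms(2) unfolding degenerate_centre_def by blast
  let ?P = "pencil e1 e2 e3 L"
  have sh: "?P (t, c, w) + s *s L = ?P (t, c, w + s)" for t c w s
    by (simp add: pencil_def vec_eq_iff algebra_simps)
  let ?A = "{c. \<exists>t w. F (?P (t, c, w)) = 0 \<and> dF (?P (t, c, w)) L = 0 \<and>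
      pairing (\<lambda>i. pairing (\<lambda>j. H i j (?P (t, c, w))) L) L = 0}"
  let ?B = "{c. \<exists>t w s. F (?P (t, c, w)) = 0 \<and> dF (?P (t, c, w)) L = 0 \<and>
      s \<noteq> 0 \<and> F (?P (t, c, w + s)) = 0 \<and> dF (?P (t, c, w + s)) L = 0}"
  have "{c. \<exists>t w. degenerate_tangent L (?P (t, c, w))} \<subseteq> ?A \<union> ?B"
    unfolding degenerate_tangent_def sh by blast
  then have "infinite ?A \<or> infinite ?B" using inf finite_subset by blast
  then show ?thesis using many_flexes[OF b] many_bitangents[OF b L] b by blast
qed

lemma nonproportional_sequence:
  assumes b: "basis4 e1 e2 e3 L"
    and inf: "infinite {c. \<exists>t w m. Q (pencil e1 e2 e3 L (t, c, w)) L m}"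
  shows "\<exists>xs :: nat \<Rightarrow> complex ^ 4. (\<forall>k. xs k \<noteq> 0 \<and> (\<exists>m. Q (xs k) L m)) \<and> (\<forall>k l a. xs k = a *s xs l \<longrightarrow> k = l)"
proof -
  obtain c :: "nat \<Rightarrow> complex" where c: "inj c" "range c \<subseteq> {c. \<exists>t w m. Q (pencil e1 e2 e3 L (t, c, w)) L m}"
    using infinite_countable_subset[OF inf] by blast
  then have "\<forall>k. \<exists>tw. \<exists>m. Q (pencil e1 e2 e3 L (fst tw, c k, snd tw)) L m" by fastforce
  from choice[OF this] obtain tw where tw: "\<And>k. \<exists>m. Q (pencil e1 e2 e3 L (fst (tw k), c k, snd (tw k))) L m" by blast
  show ?thesis
  proof (intro exI[of _ "\<lambda>k. pencil e1 e2 e3 L (fst (tw k), c k, snd (tw k))"] conjI allI impI)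
    show "k = l" if "pencil e1 e2 e3 L (fst (tw k), c k, snd (tw k)) = a *s pencil e1 e2 e3 L (fst (tw l), c l, snd (tw l))" for k l a
      using pencil_not_proportional[OF b that] c(1) by (simp add: inj_eq)
  qed (use tw pencil_nonzero[OF b] in auto)
qed

lemma finite_centres:
  assumes Q: "\<And>(ell :: nat \<Rightarrow> complex ^ 4) (xs :: nat \<Rightarrow> nat \<Rightarrow> complex ^ 4). (\<And>n. F (ell n) \<noteq> 0) \<Longrightarrow> (\<And>n n' k. n \<noteq> n' \<Longrightarrow> ell n \<noteq> k *s ell n') \<Longrightarrow>
      (\<And>n k. xs n k \<noteq> 0) \<Longrightarrow> (\<And>n k. \<exists>m. Q (xs n k) (ell n) m) \<Longrightarrow>
      (\<And>n k l c. xs n k = c *s xs n l \<Longrightarrow> k = l) \<Longrightarrow> False"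
    and \<L>: "\<And>L. L \<in> \<L> \<Longrightarrow> F L \<noteq> 0"
      "\<And>L. L \<in> \<L> \<Longrightarrow> \<exists>e1 e2 e3. basis4 e1 e2 e3 L \<and> infinite {c. \<exists>t w m. Q (pencil e1 e2 e3 L (t, c, w)) L m}"
      "\<And>L L' k. L \<in> \<L> \<Longrightarrow> L' \<in> \<L> \<Longrightarrow> L \<noteq> L' \<Longrightarrow> L \<noteq> k *s L'"
  shows "finite \<L>"
proof (rule ccontr)
  assume "infinite \<L>"
  then obtain ell :: "nat \<Rightarrow> complex ^ 4" where ell: "inj ell" "range ell \<subseteq> \<L>"
    using infinite_countable_subset by blast
  have "\<forall>n. \<exists>xs :: nat \<Rightarrow> complex ^ 4. (\<forall>k. xs k \<noteq> 0 \<and> (\<exists>m. Q (xs k) (ell n) m)) \<and> (\<forall>k l a. xs k = a *s xs l \<longrightarrow> k = l)"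
  proof
    fix n
    obtain e1 e2 e3 where *: "basis4 e1 e2 e3 (ell n)"
      "infinite {c. \<exists>t w m. Q (pencil e1 e2 e3 (ell n) (t, c, w)) (ell n) m}"
      using \<L>(2)[of "ell n"] ell(2) by blast
    show "\<exists>xs :: nat \<Rightarrow> complex ^ 4. (\<forall>k. xs k \<noteq> 0 \<and> (\<exists>m. Q (xs k) (ell n) m)) \<and> (\<forall>k l a. xs k = a *s xs l \<longrightarrow> k = l)"
      by (rule nonproportional_sequence[where Q = Q, OF *])
  qed
  from choice[OF this] obtain xs :: "nat \<Rightarrow> nat \<Rightarrow> complex ^ 4" where
    xs: "\<forall>n. (\<forall>k. xs n k \<noteq> 0 \<and> (\<exists>m. Q (xs n k) (ell n) m)) \<and> (\<forall>k l a. xs n k = a *s xs n l \<longrightarrow> k = l)" by blast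
  show False
  proof (rule Q[of ell xs])
    show "F (ell n) \<noteq> 0" for n using \<L>(1) ell(2) by blast
    show "ell n \<noteq> k *s ell n'" if "n \<noteq> n'" for n n' k
      by (rule \<L>(3)) (use ell that in \<open>auto simp: inj_eq\<close>)
    show "xs n k \<noteq> 0" for n k using xs by blast
    show "\<exists>m. Q (xs n k) (ell n) m" for n k using xs by blast
    show "k = l" if "xs n k = c *s xs n l" for n k l c using xs that by blast
  qed
qed

lemma polyfun_HL:
  "polyfun (\<lambda>a. \<Sum>i\<in>UNIV. fst (snd a) $ i * H i j (fst a))" for j
  by (intro polyfun_sum polyfun_mult polyfun_fst polyfun_snd polyfun_nth polyfun_vec_compose[OF polyfun_H])

text \<open>For the arc condition, the factor of proportionality moves the derivative onto the
  point: the pairing equals \<open>fst m * dF x x'\<close>, and the velocity is tangent.\<close>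

lemma no_flex_sequence:
  fixes ell :: "nat \<Rightarrow> complex ^ 4" and xs :: "nat \<Rightarrow> nat \<Rightarrow> complex ^ 4"
  assumes e: "e > 0" and "\<And>n. F (ell n) \<noteq> 0" "\<And>n n' k. n \<noteq> n' \<Longrightarrow> ell n \<noteq> k *s ell n'"
    "\<And>n k. xs n k \<noteq> 0" "\<And>n k. \<exists>m. flex (xs n k) (ell n) m" "\<And>n k l c. xs n k = c *s xs n l \<Longrightarrow> k = l"
  shows False
proof (rule no_degenerate_sequence[where Q = flex and h = "\<lambda>_. 1" and ell = ell and xs = xs, OF e])
  let ?S = "{\<lambda>a. F (fst a), \<lambda>a. dF (fst a) (fst (snd a))} \<union>
    range (\<lambda>j a. (\<Sum>i\<in>UNIV. fst (snd a) $ i * H i j (fst a)) - fst (snd (snd a)) * g j (fst a))"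
  show "flex x L m \<longleftrightarrow> (\<forall>p\<in>?S. p (x, L, m) = 0) \<and> (1::complex) \<noteq> 0" for x L m
    by (auto simp: flex_def)
  show "polyfun p" if "p \<in> ?S" for p
    using that polyfun_HL
    by (auto intro!: polyfun_diff polyfun_mult polyfun_dF polyfun_fst polyfun_snd polyfun_nth polyfun_F polyfun_g)
  show "F x = 0 \<and> dF x L = 0" if "flex x L m" for x L m using that by (simp add: flex_def)
  show "\<exists>m'. flex (k *s x) L m'" if f: "flex x L m" and k: "k \<noteq> 0" for x L m k
  proof -
    have "k * (\<Sum>i\<in>UNIV. L $ i * H i j (k *s x)) = k ^ e * (fst m * g j x)" for j
    proof -
      have "k * (\<Sum>i\<in>UNIV. L $ i * H i j (k *s x)) = (\<Sum>i\<in>UNIV. L $ i * (k * H i j (k *s x)))"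
        by (simp add: sum_distrib_left mult_ac)
      also have "\<dots> = k ^ e * (\<Sum>i\<in>UNIV. L $ i * H i j x)"
        by (simp add: H_homogeneous[OF k] sum_distrib_left mult_ac)
      finally show ?thesis using f by (simp add: flex_def)
    qed
    then have "(\<Sum>i\<in>UNIV. L $ i * H i j (k *s x)) = (fst m / k) * g j (k *s x)" for j
      using k by (simp add: g_homogeneous[OF k] field_simps)
    then show ?thesis using f k
      by (intro exI[of _ "(fst m / k, 0)"]) (simp add: flex_def homogeneous_F dF_homogeneous)
  qed
  show "pairing (\<lambda>i. pairing (\<lambda>j. H i j (x t)) (vderiv x t)) (L t) = 0"
    if A: "open A" "t \<in> A" and fl: "\<And>s. s \<in> A \<Longrightarrow> flex (x s) (L s) (m s)"
      and hol: "\<And>i. (\<lambda>s. x s $ i) holomorphic_on A" for x L m A t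
  proof -
    have "(\<Sum>i\<in>UNIV. L t $ i * H i j (x t)) = fst (m t) * g j (x t)" for j
      using fl[OF A(2)] by (simp add: flex_def)
    then have "pairing (\<lambda>i. pairing (\<lambda>j. H i j (x t)) (vderiv x t)) (L t) = fst (m t) * dF (x t) (vderiv x t)"
      unfolding hessian_swap dF_def by (simp add: pairing_left_scale)
    also have "dF (x t) (vderiv x t) = 0"
      by (rule dF_curve_zero[OF curve_deriv_holomorphic[OF hol A] A]) (use fl in \<open>auto simp: flex_def\<close>)
    finally show ?thesis by simp
  qed
qed (use assms in auto)

text \<open>For the arc condition, the common tangent plane annihilates the velocities of both
  contact points as well as \<open>L\<close>; their difference gives \<open>dF x L' = 0\<close>, and
  differentiating \<open>dF x L = 0\<close> leaves the required pairing.\<close>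

lemma no_bitangent_sequence:
  fixes ell :: "nat \<Rightarrow> complex ^ 4" and xs :: "nat \<Rightarrow> nat \<Rightarrow> complex ^ 4"
  assumes e: "e > 0" and "\<And>n. F (ell n) \<noteq> 0" "\<And>n n' k. n \<noteq> n' \<Longrightarrow> ell n \<noteq> k *s ell n'"
    "\<And>n k. xs n k \<noteq> 0" "\<And>n k. \<exists>m. bitangent (xs n k) (ell n) m" "\<And>n k l c. xs n k = c *s xs n l \<Longrightarrow> k = l"
  shows False
proof (rule no_degenerate_sequence[where Q = bitangent and h = "\<lambda>a. fst (snd (snd a)) * F (fst (snd a))" and ell = ell and xs = xs, OF e])
  let ?y = "\<lambda>a. fst a + fst (snd (snd a)) *s fst (snd a)"
  let ?S = "{\<lambda>a. F (fst a), \<lambda>a. dF (fst a) (fst (snd a)), \<lambda>a. F (?y a)} \<union>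
    range (\<lambda>j a. g j (?y a) - snd (snd (snd a)) * g j (fst a))"
  show "bitangent x L m \<longleftrightarrow> (\<forall>p\<in>?S. p (x, L, m) = 0) \<and> fst (snd (snd (x, L, m))) * F (fst (snd (x, L, m))) \<noteq> 0" for x L m
    by (auto simp: bitangent_def)
  have py: "polyfun (\<lambda>a. ?y a $ i)" for i
    by (simp, intro polyfun_add polyfun_mult polyfun_fst polyfun_snd polyfun_nth polyfun_id)
  show "polyfun p" if "p \<in> ?S" for p
    using that py
    by (auto intro!: polyfun_diff polyfun_mult polyfun_dF polyfun_fst polyfun_snd polyfun_nth polyfun_F polyfun_g
        polyfun_vec_compose[OF polyfun_F, of ?y] polyfun_vec_compose[OF polyfun_g, of ?y])
  show "polyfun (\<lambda>a :: (complex ^ 4) \<times> (complex ^ 4) \<times> complex \<times> complex. fst (snd (snd a)) * F (fst (snd a)))"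
    by (intro polyfun_mult polyfun_fst polyfun_snd polyfun_F polyfun_id)
  show "F x = 0 \<and> dF x L = 0" if "bitangent x L m" for x L m using that by (simp add: bitangent_def)
  show "\<exists>m'. bitangent (k *s x) L m'" if f: "bitangent x L m" and k: "k \<noteq> 0" for x L m k
  proof -
    have eq: "k *s x + (k * fst m) *s L = k *s (x + fst m *s L)" by (simp add: vec.scale_right_distrib)
    have "bitangent (k *s x) L (k * fst m, snd m)"
      unfolding bitangent_def fst_conv snd_conv eq homogeneous_F dF_homogeneous[OF k] g_homogeneous[OF k]
      using f[unfolded bitangent_def] k by (simp add: mult.left_commute)
    then show ?thesis ..
  qed
  show "pairing (\<lambda>i. pairing (\<lambda>j. H i j (x t)) (vderiv x t)) (L t) = 0"
    if A: "open A" "t \<in> A" and bt: "\<And>s. s \<in> A \<Longrightarrow> bitangent (x s) (L s) (m s)"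
      and hol: "\<And>i. (\<lambda>s. x s $ i) holomorphic_on A" "\<And>i. (\<lambda>s. L s $ i) holomorphic_on A"
        "(\<lambda>s. fst (m s)) holomorphic_on A" for x L m A t
  proof -
    let ?x' = "vderiv x t" and ?L' = "vderiv L t" and ?m' = "deriv (\<lambda>s. fst (m s)) t"
    let ?z = "\<lambda>s. x s + fst (m s) *s L s"
    have cdx: "curve_deriv x ?x' t" by (rule curve_deriv_holomorphic[OF hol(1) A])
    have cdL: "curve_deriv L ?L' t" by (rule curve_deriv_holomorphic[OF hol(2) A])
    have cdz: "curve_deriv ?z (?x' + (?m' *s L t + fst (m t) *s ?L')) t"
      by (intro curve_deriv_add cdx curve_deriv_scale cdL holomorphic_derivI[OF hol(3) A])
    note b = bt[OF A(2), unfolded bitangent_def]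
    have dx: "dF (x t) ?x' = 0" by (rule dF_curve_zero[OF cdx A]) (use bt in \<open>auto simp: bitangent_def\<close>)
    have "dF (?z t) (?x' + (?m' *s L t + fst (m t) *s ?L')) = 0"
      by (rule dF_curve_zero[OF cdz A]) (use bt in \<open>auto simp: bitangent_def\<close>)
    moreover have dz: "dF (?z t) v = snd (m t) * dF (x t) v" for v
      using b unfolding dF_def by (simp add: pairing_left_scale)
    ultimately have "snd (m t) * (fst (m t) * dF (x t) ?L') = 0" using dx b by simp
    \<comment> \<open>Otherwise the gradient vanishes at the second point, which is therefore 0 by
      smoothness; then \<open>L\<close> is a multiple of \<open>x t\<close> and lies on the
      surface.\<close>
    moreover have "snd (m t) \<noteq> 0"
    proof
      assume "snd (m t) = 0"
      then have "(\<lambda>i. g i (?z t)) = (\<lambda>_. 0)" using b by auto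
      then have z0: "?z t = 0" using smooth b by blast
      have "L t = (- 1 / fst (m t)) *s x t"
      proof -
        have "x t = - fst (m t) *s L t" using z0 by (simp add: eq_neg_iff_add_eq_0)
        then show ?thesis using b by simp
      qed
      then have "F (L t) = 0" using b homogeneous_F by (metis mult_zero_right)
      then show False using b by blast
    qed
    ultimately have dL': "dF (x t) ?L' = 0" using b by simp
    have "pairing (\<lambda>i. pairing (\<lambda>j. H i j (x t)) ?x') (L t) + dF (x t) ?L' = 0"
      by (rule DERIV_local_const[OF DERIV_dF[OF cdx cdL] A, where k = 0]) (use bt in \<open>auto simp: bitangent_def\<close>)
    then show ?thesis using dL' by simp
  qed
qed (use assms in auto)

theorem degenerate_centres_finite:
  assumes e: "e > 0" and \<L>: "\<And>L. L \<in> \<L> \<Longrightarrow> F L \<noteq> 0" "\<And>L. L \<in> \<L> \<Longrightarrow> degenerate_centre L"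
      "\<And>L L' k. L \<in> \<L> \<Longrightarrow> L' \<in> \<L> \<Longrightarrow> L \<noteq> L' \<Longrightarrow> L \<noteq> k *s L'"
  shows "finite \<L>"
proof -
  let ?fl = "{L\<in>\<L>. \<exists>e1 e2 e3. basis4 e1 e2 e3 L \<and> infinite {c. \<exists>t w m. flex (pencil e1 e2 e3 L (t, c, w)) L m}}"
  let ?bt = "{L\<in>\<L>. \<exists>e1 e2 e3. basis4 e1 e2 e3 L \<and> infinite {c. \<exists>t w m. bitangent (pencil e1 e2 e3 L (t, c, w)) L m}}"
  have "finite ?fl"
  proof (rule finite_centres[where Q = flex])
    show False if "\<And>n. F (ell n) \<noteq> 0" "\<And>n n' k. n \<noteq> n' \<Longrightarrow> ell n \<noteq> k *s ell n'"
      "\<And>n k. xs n k \<noteq> 0" "\<And>n k. \<exists>m. flex (xs n k) (ell n) m" "\<And>n k l c. xs n k = c *s xs n l \<Longrightarrow> k = l"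
      for ell :: "nat \<Rightarrow> complex ^ 4" and xs :: "nat \<Rightarrow> nat \<Rightarrow> complex ^ 4"
      by (rule no_flex_sequence[OF e that])
  qed (use \<L> in auto)
  moreover have "finite ?bt"
  proof (rule finite_centres[where Q = bitangent])
    show False if "\<And>n. F (ell n) \<noteq> 0" "\<And>n n' k. n \<noteq> n' \<Longrightarrow> ell n \<noteq> k *s ell n'"
      "\<And>n k. xs n k \<noteq> 0" "\<And>n k. \<exists>m. bitangent (xs n k) (ell n) m" "\<And>n k l c. xs n k = c *s xs n l \<Longrightarrow> k = l"
      for ell :: "nat \<Rightarrow> complex ^ 4" and xs :: "nat \<Rightarrow> nat \<Rightarrow> complex ^ 4"
      by (rule no_bitangent_sequence[OF e that])
  qed (use \<L> in auto)
  moreover have "\<L> \<subseteq> ?fl \<union> ?bt" using degenerate_centre_cases[OF \<L>(1,2)] by auto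
  ultimately show ?thesis using finite_subset by blast
qed

lemma basis4_rotate:
  assumes "basis4 L a b c"
  shows "basis4 a b c L"
  unfolding basis4_iff
proof (intro allI impI)
  fix x y z w assume "x *s a + y *s b + z *s c + w *s L = 0"
  then have "w *s L + x *s a + y *s b + z *s c = 0" by (simp add: algebra_simps)
  then show "x = 0 \<and> y = 0 \<and> z = 0 \<and> w = 0" using basis4_independent[OF assms] by blast
qed

text \<open>The lines join \<open>L\<close> to \<open>p + t *s q\<close>, and the line through
  \<open>q\<close> is the one at infinity. It is fixed first, because the fibre there must be
  unramified; the plane containing it is chosen afterwards, so as to be neither tangent nor to
  contain a degenerate tangent.\<close>

theorem good_pencil:
  assumes L: "F L \<noteq> 0" and nd: "\<not> degenerate_centre L"
  obtains p q v where "basis4 p v q L"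
    "\<And>t w. F (p + t *s q + w *s L) = 0 \<Longrightarrow> dF (p + t *s q + w *s L) L = 0 \<Longrightarrow>
      dF (p + t *s q + w *s L) q \<noteq> 0 \<and> \<not> degenerate_tangent L (p + t *s q + w *s L)"
    "\<And>w. F (q + w *s L) = 0 \<Longrightarrow> dF (q + w *s L) L \<noteq> 0"
    "finite {t. \<exists>w. F (p + t *s q + w *s L) = 0 \<and> dF (p + t *s q + w *s L) L = 0}"
proof -
  have "L \<noteq> 0" using L F_0 by auto
  moreover obtain a where "a \<notin> vec.span {L}" using not_in_span_finite[of "{L}"] by auto
  ultimately obtain b c where "basis4 L a b c" using basis4_extend2 by blast
  then have abc: "basis4 a b c L" by (rule basis4_rotate)
  \<comment> \<open>In an auxiliary pencil, \<open>k\<close> avoids the tangent planes, so that its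
    plane has finitely many ramified lines; \<open>t\<close> then avoids these.\<close>
  obtain k where k: "k \<notin> {k. \<exists>t w. F (pencil a b c L (t, k, w)) = 0 \<and> dF (pencil a b c L (t, k, w)) L = 0 \<and>
     dF (pencil a b c L (t, k, w)) b = 0}"
    using ex_new_if_finite[OF infinite_UNIV_char_0 tangent_planes_finite[OF abc]] by blast
  have "finite {t. \<exists>w. F (pencil a b c L (t, k, w)) = 0 \<and> dF (pencil a b c L (t, k, w)) L = 0}"
    by (rule ramification_finite[OF abc]) (use k in blast)
  then obtain t where t: "t \<notin> {t. \<exists>w. F (pencil a b c L (t, k, w)) = 0 \<and> dF (pencil a b c L (t, k, w)) L = 0}"
    using ex_new_if_finite[OF infinite_UNIV_char_0] by blast
  define q where "q = a + t *s b + k *s c"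
  have q: "dF (q + w *s L) L \<noteq> 0" if "F (q + w *s L) = 0" for w
    using t that by (auto simp: pencil_def q_def)
  have "q \<notin> vec.span {L}"
  proof
    assume "q \<in> vec.span {L}"
    then obtain l where "q = l *s L" by (auto simp: vec.span_singleton)
    then have "1 *s a + t *s b + k *s c + (- l) *s L = 0" by (simp add: q_def)
    then show False using basis4_independent[OF abc] by fastforce
  qed
  then obtain e3 e1 where "basis4 L q e3 e1" using basis4_extend2[OF \<open>L \<noteq> 0\<close>] by blast
  then have "basis4 q e3 e1 L" by (rule basis4_rotate)
  then have "basis4 e1 q e3 L"
    unfolding basis4_iff
  proof (intro allI impI)
    fix x y z w assume b: "\<forall>x y z w. x *s q + y *s e3 + z *s e1 + w *s L = 0 \<longrightarrow> x = 0 \<and> y = 0 \<and> z = 0 \<and> w = 0"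
      and "x *s e1 + y *s q + z *s e3 + w *s L = 0"
    then have "y *s q + z *s e3 + x *s e1 + w *s L = 0" by (simp add: algebra_simps)
    then show "x = 0 \<and> y = 0 \<and> z = 0 \<and> w = 0" using b by blast
  qed
  note b = this
  let ?P = "pencil e1 q e3 L"
  have "finite {c. \<exists>t w. degenerate_tangent L (?P (t, c, w))}"
    using nd b unfolding degenerate_centre_def by blast
  then have "finite ({c. \<exists>t w. degenerate_tangent L (?P (t, c, w))} \<union>
    {c. \<exists>t w. F (?P (t, c, w)) = 0 \<and> dF (?P (t, c, w)) L = 0 \<and> dF (?P (t, c, w)) q = 0})"
    using tangent_planes_finite[OF b] by simp
  from ex_new_if_finite[OF infinite_UNIV_char_0 this]
  \<comment> \<open>Both exceptional sets are finite: the first by nondegeneracy of the centre,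
    applied to this very basis, the second by \<open>tangent_planes_finite\<close>.\<close>
  obtain c where c: "c \<notin> {c. \<exists>t w. degenerate_tangent L (?P (t, c, w))} \<union>
    {c. \<exists>t w. F (?P (t, c, w)) = 0 \<and> dF (?P (t, c, w)) L = 0 \<and> dF (?P (t, c, w)) q = 0}"
    by (elim exE)
  have c1: "\<not> degenerate_tangent L (?P (t, c, w))" for t w using c by blast
  have c2: "dF (?P (t, c, w)) q \<noteq> 0" if "F (?P (t, c, w)) = 0" "dF (?P (t, c, w)) L = 0" for t w
    using c that by blast
  have P: "?P (t, c, w) = (e1 + c *s e3) + t *s q + w *s L" for t w by (simp add: pencil_def algebra_simps)
  have fin: "finite {t. \<exists>w. F (?P (t, c, w)) = 0 \<and> dF (?P (t, c, w)) L = 0}"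
    by (rule ramification_finite[OF b c2])
  show ?thesis
  proof (rule that[of "e1 + c *s e3" e3 q])
    show "basis4 (e1 + c *s e3) e3 q L" by (rule basis4_swap[OF b])
    show "dF (e1 + c *s e3 + t *s q + w *s L) q \<noteq> 0 \<and> \<not> degenerate_tangent L (e1 + c *s e3 + t *s q + w *s L)"
      if "F (e1 + c *s e3 + t *s q + w *s L) = 0" "dF (e1 + c *s e3 + t *s q + w *s L) L = 0" for t w
      using c1[of t w] c2[of t w] that unfolding P by blast
    show "finite {t. \<exists>w. F (e1 + c *s e3 + t *s q + w *s L) = 0 \<and> dF (e1 + c *s e3 + t *s q + w *s L) L = 0}"
      using fin unfolding P .
  qed (rule q)
qed

end

section \<open>Counting roots, following branches, removing singularities\<close>

lemma card_roots_simple: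
  fixes p :: "complex poly"
  assumes "p \<noteq> 0" "\<And>a. poly p a = 0 \<Longrightarrow> poly (pderiv p) a \<noteq> 0"
  shows "card {x. poly p x = 0} = degree p"
  using assms
proof (induction "degree p" arbitrary: p)
  case 0
  then obtain k where "p = [:k:]" by (metis degree_eq_zeroE)
  then show ?case using 0 by auto
next
  case (Suc n)
  have "\<not> constant (poly p)" using Suc(2) constant_degree[of p] by simp
  then obtain z where z: "poly p z = 0" using Fundamental_Theorem_Algebra.fundamental_theorem_of_algebra by blast
  then obtain q where q: "p = [:-z, 1:] * q" by (metis dvdE poly_eq_0_iff_dvd)
  have q0: "q \<noteq> 0" using q Suc.prems(1) by auto
  have p': "poly (pderiv p) a = (a - z) * poly (pderiv q) a + poly q a" for a
    unfolding q pderiv_mult by (simp add: pderiv_pCons algebra_simps)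
  have zq: "poly q z \<noteq> 0" using Suc.prems(2)[OF z] p'[of z] by simp
  have deg: "n = degree q" using Suc(2) q0 unfolding q by (subst (asm) degree_mult_eq) auto
  have "poly (pderiv q) a \<noteq> 0" if "poly q a = 0" for a
  proof
    assume "poly (pderiv q) a = 0"
    then have "poly (pderiv p) a = 0" using p'[of a] that by simp
    moreover have "poly p a = 0" using that unfolding q by simp
    ultimately show False using Suc.prems(2) by blast
  qed
  then have "card {x. poly q x = 0} = degree q" using Suc(1)[OF deg q0] by blast
  moreover have "{x. poly p x = 0} = insert z {x. poly q x = 0}" unfolding q by auto
  ultimately show ?case using zq poly_roots_finite[OF q0] deg Suc(2) by simp
qed

text \<open>Division by the linear factor of \<open>w\<close> leaves the same zeros, now all simple:
  the derivative of the quotient at \<open>w\<close> is half the second derivative of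
  \<open>p\<close>.\<close>

lemma card_roots_double:
  fixes p :: "complex poly"
  assumes p: "p \<noteq> 0" "poly p w = 0" "poly (pderiv p) w = 0" "poly (pderiv (pderiv p)) w \<noteq> 0"
    and simple: "\<And>a. poly p a = 0 \<Longrightarrow> a \<noteq> w \<Longrightarrow> poly (pderiv p) a \<noteq> 0"
  shows "Suc (card {x. poly p x = 0}) = degree p"
proof -
  obtain q where q: "p = [:-w, 1:] * q" by (metis dvdE poly_eq_0_iff_dvd p(2))
  have q0: "q \<noteq> 0" using q p(1) by auto
  have p': "poly (pderiv p) a = (a - w) * poly (pderiv q) a + poly q a" for a
    unfolding q pderiv_mult by (simp add: pderiv_pCons algebra_simps)
  have p'': "poly (pderiv (pderiv p)) w = 2 * poly (pderiv q) w"
    unfolding q pderiv_mult pderiv_add by (simp add: pderiv_pCons pderiv_add)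
  have qw: "poly q w = 0" using p'[of w] p(3) by simp
  have "poly (pderiv q) a \<noteq> 0" if "poly q a = 0" for a
  proof (cases "a = w")
    case True
    then show ?thesis using p'' p(4) by simp
  next
    case False
    have "poly p a = 0" using that unfolding q by simp
    then show ?thesis using simple[OF _ False] p'[of a] that by auto
  qed
  then have "card {x. poly q x = 0} = degree q" using card_roots_simple[OF q0] by blast
  moreover have "{x. poly p x = 0} = {x. poly q x = 0}" unfolding q using qw by auto
  moreover have "degree p = Suc (degree q)" using q0 unfolding q by (subst degree_mult_eq) auto
  ultimately show ?thesis by simp
qed

text \<open>The factor 3 leaves a distance of at least \<open>\<eta>\<close> after both points have
  moved by less than \<open>\<eta>\<close>; \<open>\<eta> \<le> 1\<close> makes its powers decrease
  with the exponent.\<close>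

lemma separated:
  fixes W :: "complex set"
  assumes "finite W"
  obtains \<eta> where "\<eta> > 0" "\<eta> \<le> 1" "\<And>w w'. w \<in> W \<Longrightarrow> w' \<in> W \<Longrightarrow> w \<noteq> w' \<Longrightarrow> 3 * \<eta> \<le> cmod (w - w')"
proof -
  define D where "D = insert 1 ((\<lambda>(w, w'). cmod (w - w')) ` {(w, w') \<in> W \<times> W. w \<noteq> w'})"
  have "finite {(w, w') \<in> W \<times> W. w \<noteq> w'}"
    by (rule finite_subset[of _ "W \<times> W"]) (use assms in auto)
  then have D: "finite D" "D \<noteq> {}" by (auto simp: D_def)
  have "Min D > 0" unfolding Min_gr_iff[OF D] by (auto simp: D_def)
  moreover have "Min D \<le> 1" using D by (auto simp: D_def)
  moreover have "Min D \<le> cmod (w - w')" if "w \<in> W" "w' \<in> W" "w \<noteq> w'" for w w'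
    by (rule Min_le[OF D(1)]) (use that in \<open>force simp: D_def\<close>)
  ultimately show ?thesis using that[of "Min D / 3"] by simp
qed

lemma branches:
  fixes G :: "complex \<times> complex \<Rightarrow> complex"
  assumes G: "polyfun G" and W: "finite W" and \<eta>: "\<eta> > 0"
    and root: "\<And>w. w \<in> W \<Longrightarrow> G (t1, w) = 0"
    and simple: "\<And>w. w \<in> W \<Longrightarrow> \<exists>D. D \<noteq> 0 \<and> ((\<lambda>y. G (t1, y)) has_field_derivative D) (at w)"
  obtains e r where "e > 0" "\<And>w. w \<in> W \<Longrightarrow> r w holomorphic_on ball t1 e" "\<And>w. w \<in> W \<Longrightarrow> r w t1 = w"
    "\<And>w t. w \<in> W \<Longrightarrow> t \<in> ball t1 e \<Longrightarrow> G (t, r w t) = 0"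
    "\<And>w t. w \<in> W \<Longrightarrow> t \<in> ball t1 e \<Longrightarrow> cmod (r w t - w) < \<eta>"
proof -
  have "\<forall>w\<in>W. \<exists>e>0. \<exists>\<phi>. \<phi> holomorphic_on ball t1 e \<and> \<phi> t1 = w \<and>
      (\<forall>t\<in>ball t1 e. G (t, \<phi> t) = 0 \<and> cmod (\<phi> t - w) < \<eta>)"
  proof
    fix w assume w: "w \<in> W"
    obtain D where D: "D \<noteq> 0" "((\<lambda>y. G (t1, y)) has_field_derivative D) (at w)" using simple[OF w] by blast
    obtain e \<phi> where e: "e > 0" "\<phi> holomorphic_on ball t1 e" "\<phi> t1 = w" "\<And>t. t \<in> ball t1 e \<Longrightarrow> G (t, \<phi> t) = 0"
      by (rule local_root[OF G root[OF w] D(2,1)]) blast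
    have "isCont \<phi> t1"
      by (rule field_differentiable_imp_continuous_at[OF holomorphic_on_imp_differentiable_at[OF e(2) open_ball]])
         (simp add: e)
    then obtain k where k: "k > 0" "\<And>t. dist t t1 < k \<Longrightarrow> dist (\<phi> t) (\<phi> t1) < \<eta>"
      using \<eta> unfolding continuous_at_eps_delta by blast
    show "\<exists>e>0. \<exists>\<phi>. \<phi> holomorphic_on ball t1 e \<and> \<phi> t1 = w \<and>
      (\<forall>t\<in>ball t1 e. G (t, \<phi> t) = 0 \<and> cmod (\<phi> t - w) < \<eta>)"
    proof (intro exI[of _ "min e k"] exI[of _ \<phi>] conjI ballI)
      show "\<phi> holomorphic_on ball t1 (min e k)" by (rule holomorphic_on_subset[OF e(2)]) auto
      show "cmod (\<phi> t - w) < \<eta>" if "t \<in> ball t1 (min e k)" for t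
        using k(2)[of t] that e(3) by (simp add: dist_norm norm_minus_commute)
    qed (use e k in auto)
  qed
  from bchoice[OF this] obtain e where "\<forall>w\<in>W. e w > 0 \<and> (\<exists>\<phi>. \<phi> holomorphic_on ball t1 (e w) \<and> \<phi> t1 = w \<and>
      (\<forall>t\<in>ball t1 (e w). G (t, \<phi> t) = 0 \<and> cmod (\<phi> t - w) < \<eta>))" by blast
  then have e0: "\<forall>w\<in>W. e w > 0" and "\<forall>w\<in>W. \<exists>\<phi>. \<phi> holomorphic_on ball t1 (e w) \<and> \<phi> t1 = w \<and>
      (\<forall>t\<in>ball t1 (e w). G (t, \<phi> t) = 0 \<and> cmod (\<phi> t - w) < \<eta>)" by blast+
  from bchoice[OF this(2)] obtain r where r: "\<forall>w\<in>W. r w holomorphic_on ball t1 (e w) \<and> r w t1 = w \<and>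
      (\<forall>t\<in>ball t1 (e w). G (t, r w t) = 0 \<and> cmod (r w t - w) < \<eta>)" by blast
  define d where "d = Min (insert 1 (e ` W))"
  have d: "d > 0" "\<And>w. w \<in> W \<Longrightarrow> d \<le> e w" using e0 W by (auto simp: d_def)
  have sub: "ball t1 d \<subseteq> ball t1 (e w)" if "w \<in> W" for w using d(2)[OF that] by (rule subset_ball)
  show ?thesis
  proof (rule that[of d r])
    show "r w holomorphic_on ball t1 d" if "w \<in> W" for w
      using r that holomorphic_on_subset[OF _ sub[OF that]] by blast
  qed (use d r sub in blast)+
qed

text \<open>Hadamard's lemma for polynomials; for a product, the difference is split as in the
  product rule.\<close>

lemma division_fst:
  fixes h :: "complex \<times> complex \<Rightarrow> complex"
  assumes "polyfun h"
  shows "\<exists>k. polyfun k \<and> (\<forall>x y. h (x, y) = h (0, y) + x * k (x, y))"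
  using assms
proof induction
  case (polyfun_const c)
  show ?case by (intro exI[of _ "\<lambda>_. 0"]) auto
next
  case (polyfun_coord c)
  then consider "c = fst" | "c = snd" by (auto simp: coords_prod_def coords_complex_def fun_eq_iff)
  then show ?case
  proof cases
    case 1 then show ?thesis by (intro exI[of _ "\<lambda>_. 1"]) auto
  next
    case 2 then show ?thesis by (intro exI[of _ "\<lambda>_. 0"]) auto
  qed
next
  case (polyfun_add f g)
  then obtain k l where k: "polyfun k" "\<And>x y. f (x, y) = f (0, y) + x * k (x, y)"
    and l: "polyfun l" "\<And>x y. g (x, y) = g (0, y) + x * l (x, y)" by blast
  have "f (x, y) + g (x, y) = f (0, y) + g (0, y) + x * (k (x, y) + l (x, y))" for x y
    using k(2)[of x y] l(2)[of x y] by (simp add: algebra_simps)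
  then show ?case by (intro exI[of _ "\<lambda>z. k z + l z"] conjI allI polyfun.polyfun_add k(1) l(1))
next
  case (polyfun_mult f g)
  then obtain k l where k: "polyfun k" "\<And>x y. f (x, y) = f (0, y) + x * k (x, y)"
    and l: "polyfun l" "\<And>x y. g (x, y) = g (0, y) + x * l (x, y)" by blast
  have *: "f (x, y) * g (x, y) = f (0, y) * g (0, y) + x * (f (x, y) * l (x, y) + k (x, y) * g (0, y))" for x y
  proof -
    have "f (x, y) * g (x, y) = f (x, y) * (g (0, y) + x * l (x, y))" using l(2)[of x y] by simp
    also have "\<dots> = (f (0, y) + x * k (x, y)) * g (0, y) + x * (f (x, y) * l (x, y))"
      using k(2)[of x y] by (simp add: algebra_simps)
    finally show ?thesis by (simp add: algebra_simps)
  qed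
  have sw: "polyfun (\<lambda>z::complex \<times> complex. g (0, snd z))"
    by (rule polyfun_pair[OF polyfun_mult.hyps(2)])
       (auto simp: coords_complex_def intro: polyfun_snd[OF polyfun_id])
  show ?case
    by (intro exI[of _ "\<lambda>z. f z * l z + k z * g (0, snd z)"] conjI allI polyfun.polyfun_add
        polyfun.polyfun_mult k(1) l(1) sw polyfun_mult.hyps) (simp only: snd_conv *[symmetric])
qed

lemma polyfun_pair_complex:
  fixes f :: "complex \<times> complex \<Rightarrow> complex"
  assumes "polyfun f" "polyfun a" "polyfun b"
  shows "polyfun (\<lambda>z. f (a z, b z))"
  by (rule polyfun_pair[OF assms(1)]) (auto simp: coords_complex_def assms(2,3))

lemma division_snd:
  fixes h :: "complex \<times> complex \<Rightarrow> complex"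
  assumes "polyfun h"
  shows "\<exists>k. polyfun k \<and> (\<forall>x y. h (x, y) = h (x, 0) + y * k (x, y))"
proof -
  have "polyfun (\<lambda>z. h (snd z, fst z))"
    by (rule polyfun_pair_complex[OF assms]; intro polyfun_fst[OF polyfun_id] polyfun_snd[OF polyfun_id])
  from division_fst[OF this]
  obtain k where k: "polyfun k" "\<forall>x y. h (y, x) = h (y, 0) + x * k (x, y)"
    unfolding fst_conv snd_conv by (elim exE conjE)
  have "polyfun (\<lambda>z. k (snd z, fst z))"
    by (rule polyfun_pair_complex[OF k(1)]; intro polyfun_fst[OF polyfun_id] polyfun_snd[OF polyfun_id])
  moreover have "\<forall>x y. h (x, y) = h (x, 0) + y * k (snd (x, y), fst (x, y))"
    unfolding fst_conv snd_conv using k(2) by blast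
  ultimately show ?thesis by blast
qed

text \<open>Substituting \<open>t = b + z\<^sup>2\<close>, \<open>w = w0 + z y\<close> resolves a simple branch point.\<close>

lemma quadratic_substitution:
  fixes f :: "complex \<times> complex \<Rightarrow> complex"
  assumes f: "polyfun f" and P: "\<And>w. poly p w = f (b, w)"
    and p: "poly p w0 = 0" "poly (pderiv p) w0 = 0"
    and ft: "((\<lambda>t. f (t, w0)) has_field_derivative a) (at b)"
  obtains G where "polyfun G" "\<And>z y. f (b + z\<^sup>2, w0 + z * y) = z\<^sup>2 * G (z, y)"
    "\<And>y. G (0, y) = a + poly (pderiv (pderiv p)) w0 / 2 * y\<^sup>2"
proof -
  define h where "h z = f (b + fst z, w0 + snd z)" for z
  have h: "polyfun h" unfolding h_def
    by (rule polyfun_pair_complex[OF f]; intro polyfun_add polyfun_const polyfun_fst[OF polyfun_id] polyfun_snd[OF polyfun_id])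
  obtain k where k: "polyfun k" "\<And>x y. h (x, y) = h (0, y) + x * k (x, y)" using division_fst[OF h] by blast
  obtain A where A: "polyfun A" "\<And>x y. k (x, y) = k (0, y) + x * A (x, y)" using division_fst[OF k(1)] by blast
  obtain B where B: "polyfun B" "\<And>x y. k (x, y) = k (x, 0) + y * B (x, y)" using division_snd[OF k(1)] by blast
  \<comment> \<open>The quotient at the base point is the partial derivative in
    \<open>t\<close>.\<close>
  have ka: "k (0, 0) = a"
  proof -
    have "((\<lambda>x. f (b + x, w0)) has_field_derivative a) (at 0)"
      using DERIV_shift[of "\<lambda>t. f (t, w0)" a 0 b] ft by (simp add: add.commute)
    moreover have "(\<lambda>x. f (b + x, w0)) = (\<lambda>x. h (0, 0) + x * (k (0, 0) + x * A (x, 0)))"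
    proof
      fix x
      have "f (b + x, w0) = h (x, 0)" by (simp add: h_def)
      then show "f (b + x, w0) = h (0, 0) + x * (k (0, 0) + x * A (x, 0))" using k(2)[of x 0] A(2)[of x 0] by simp
    qed
    moreover have "((\<lambda>x. h (0, 0) + x * (k (0, 0) + x * A (x, 0))) has_field_derivative k (0, 0)) (at 0)"
    proof -
      have "polyfun (\<lambda>x. A (x, 0))" by (rule polyfun_pair_complex[OF A(1)]) auto
      then obtain q where "\<forall>x. A (x, 0) = poly q x" using polyfun_univariate by blast
      then show ?thesis by (auto intro!: derivative_eq_intros)
    qed
    ultimately show ?thesis using DERIV_unique by metis
  qed
  define q where "q = pcompose p [:w0, 1:]"
  have q: "poly q y = h (0, y)" for y by (simp add: q_def poly_pcompose h_def P)
  have q0: "poly q 0 = 0" using p by (simp add: q_def poly_pcompose)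
  have q1: "poly (pderiv q) 0 = 0" using p by (simp add: q_def pderiv_pcompose poly_pcompose pderiv_pCons)
  have q2: "poly (pderiv (pderiv q)) 0 = poly (pderiv (pderiv p)) w0"
    by (simp add: q_def pderiv_pcompose poly_pcompose pderiv_pCons pderiv_mult)
  obtain c0 q' where c0: "q = pCons c0 q'" by (cases q)
  obtain c1 q'' where c1: "q' = pCons c1 q''" by (cases q')
  obtain c2 q3 where c2: "q'' = pCons c2 q3" by (cases q'')
  \<comment> \<open>The double root kills the first two Taylor coefficients at \<open>w0\<close>;
    the next one is half the second derivative.\<close>
  have cs: "c0 = 0" "c1 = 0" "2 * c2 = poly (pderiv (pderiv p)) w0"
    using q0 q1 q2 by (simp_all add: c0 c1 c2 pderiv_pCons pderiv_add)
  have hq: "h (0, y) = c2 * y\<^sup>2 + y ^ 3 * poly q3 y" for y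
    unfolding q[symmetric] by (simp add: c0 c1 c2 cs algebra_simps power2_eq_square power3_eq_cube)
  \<comment> \<open>The quotient of \<open>h (z\<^sup>2, z * y)\<close> by \<open>z\<^sup>2\<close>:
    the first two terms come from \<open>h (0, z * y)\<close>, the bracket from
    \<open>k (z\<^sup>2, z * y)\<close> expanded once in each variable.\<close>
  define G where "G z = c2 * (snd z)\<^sup>2 + fst z * (snd z) ^ 3 * poly q3 (fst z * snd z) +
      (a + (fst z * snd z) * B (0, fst z * snd z) + (fst z)\<^sup>2 * A ((fst z)\<^sup>2, fst z * snd z))" for z
  have pz: "polyfun (fst :: complex \<times> complex \<Rightarrow> complex)" "polyfun (snd :: complex \<times> complex \<Rightarrow> complex)"
    using polyfun_fst[OF polyfun_id] polyfun_snd[OF polyfun_id] by simp_all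
  have "polyfun (\<lambda>z. A ((fst z)\<^sup>2, fst z * snd z))"
    by (rule polyfun_pair_complex[OF A(1)]; intro polyfun_power polyfun_mult pz)
  moreover have "polyfun (\<lambda>z. B (0, fst z * snd z))"
    by (rule polyfun_pair_complex[OF B(1)]; intro polyfun_const polyfun_mult pz)
  ultimately have "polyfun G" unfolding G_def
    by (intro polyfun_add polyfun_mult polyfun_const polyfun_power polyfun_poly pz)
  moreover have "f (b + z\<^sup>2, w0 + z * y) = z\<^sup>2 * G (z, y)" for z y
  proof -
    have "f (b + z\<^sup>2, w0 + z * y) = h (z\<^sup>2, z * y)" by (simp add: h_def)
    also have "\<dots> = h (0, z * y) + z\<^sup>2 * (a + (z * y) * B (0, z * y) + z\<^sup>2 * A (z\<^sup>2, z * y))"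
      using k(2)[of "z\<^sup>2" "z * y"] A(2)[of "z\<^sup>2" "z * y"] B(2)[of 0 "z * y"] ka by simp
    also have "\<dots> = z\<^sup>2 * G (z, y)"
      unfolding hq G_def by (simp add: algebra_simps power2_eq_square power3_eq_cube)
    finally show ?thesis .
  qed
  moreover have "G (0, y) = a + poly (pderiv (pderiv p)) w0 / 2 * y\<^sup>2" for y
    unfolding G_def using cs(3) by (simp add: field_simps)
  ultimately show ?thesis using that by blast
qed

lemma removable_finite:
  assumes "finite E" "h holomorphic_on - E" "\<And>b. b \<in> E \<Longrightarrow> \<exists>B. eventually (\<lambda>z. cmod (h z) \<le> B) (at b)"
  shows "\<exists>k. k holomorphic_on UNIV \<and> (\<forall>z. z \<notin> E \<longrightarrow> k z = h z)"
  using assms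
proof (induction E arbitrary: h rule: finite_induct)
  case empty
  then show ?case by auto
next
  case (insert b E)
  have op: "open (- E)" using insert(1) by (simp add: finite_imp_closed open_Compl)
  have bi: "b \<in> interior (- E)" using op insert(2) by (simp add: interior_open)
  have hol: "h holomorphic_on (- E - {b})" using insert(4) by (simp add: Compl_insert)
  have "\<exists>B. eventually (\<lambda>z. norm (h z) \<le> B) (at b)" using insert(5) by blast
  then obtain k where k: "k holomorphic_on - E" "\<And>z. z \<in> - E - {b} \<Longrightarrow> k z = h z"
    using holomorphic_on_extend_bounded[OF hol bi] by blast
  have "\<exists>B. eventually (\<lambda>z. cmod (k z) \<le> B) (at c)" if c: "c \<in> E" for c
  proof -
    obtain B where B: "eventually (\<lambda>z. cmod (h z) \<le> B) (at c)" using insert(5) c by blast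
    have "finite (insert b E)" using insert(1) by simp
    then have "eventually (\<lambda>z. z \<notin> insert b E) (at c)"
      using islimpt_finite[of "insert b E" c] by (simp add: islimpt_iff_eventually)
    with B have "eventually (\<lambda>z. cmod (k z) \<le> B) (at c)"
      by eventually_elim (use k(2) in auto)
    then show ?thesis by blast
  qed
  from insert(3)[OF k(1) this] obtain l where "l holomorphic_on UNIV" "\<And>z. z \<notin> E \<Longrightarrow> l z = k z" by blast
  then show ?case using k(2) by (intro exI[of _ l]) auto
qed

subsection \<open>Monodromy of a simple pencil\<close>

text \<open>The function \<open>fi\<close> is \<open>f\<close> in the coordinates \<open>1 / t\<close> and \<open>w / t\<close> at infinity.\<close>

locale simple_pencil =
  fixes f ft fi :: "complex \<times> complex \<Rightarrow> complex" and P :: "complex \<Rightarrow> complex poly" and d :: nat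
  assumes polyfun_f: "polyfun f" and polyfun_fi: "polyfun fi"
    and P: "\<And>t w. poly (P t) w = f (t, w)" and deg: "\<And>t. degree (P t) = d" and P_nz: "\<And>t. P t \<noteq> 0"
    and ft: "\<And>t w. ((\<lambda>t. f (t, w)) has_field_derivative ft (t, w)) (at t)"
    and simple: "\<And>t w. f (t, w) = 0 \<Longrightarrow> poly (pderiv (P t)) w = 0 \<Longrightarrow>
      poly (pderiv (pderiv (P t))) w \<noteq> 0 \<and> ft (t, w) \<noteq> 0"
    and unique: "\<And>t w w'. f (t, w) = 0 \<Longrightarrow> poly (pderiv (P t)) w = 0 \<Longrightarrow>
      f (t, w') = 0 \<Longrightarrow> poly (pderiv (P t)) w' = 0 \<Longrightarrow> w = w'"
    and fin: "finite {t. \<exists>w. f (t, w) = 0 \<and> poly (pderiv (P t)) w = 0}"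
    and fi: "\<And>t w. t \<noteq> 0 \<Longrightarrow> f (t, w) = t ^ d * fi (1 / t, w / t)"
    and fi_roots: "finite {\<rho>. fi (0, \<rho>) = 0}" "card {\<rho>. fi (0, \<rho>) = 0} = d"
    and fi_simple: "\<And>\<rho>. fi (0, \<rho>) = 0 \<Longrightarrow> \<exists>D. D \<noteq> 0 \<and> ((\<lambda>\<rho>. fi (0, \<rho>)) has_field_derivative D) (at \<rho>)"
begin

definition E :: "complex set" where "E = {t. \<exists>w. f (t, w) = 0 \<and> poly (pderiv (P t)) w = 0}"

definition roots :: "complex \<Rightarrow> complex set" where "roots t = {w. f (t, w) = 0}"

lemma finite_E: "finite E" unfolding E_def by (rule fin)

lemma open_E: "open (- E)" using finite_E by (simp add: finite_imp_closed open_Compl)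

lemma finite_roots: "finite (roots t)"
  unfolding roots_def P[symmetric] using poly_roots_finite[OF P_nz] .

lemma card_roots: "t \<notin> E \<Longrightarrow> card (roots t) = d"
  using card_roots_simple[OF P_nz, of t] by (auto simp: roots_def E_def P deg)

lemma card_roots_le: "card (roots t) \<le> d"
  unfolding roots_def P[symmetric] using card_poly_roots_bound[OF P_nz[of t]] deg by simp

lemma roots_eqI: "A \<subseteq> roots t \<Longrightarrow> card A = d \<Longrightarrow> roots t = A"
  using card_seteq[OF finite_roots, of A t] card_roots_le by simp

lemma DERIV_f: "((\<lambda>w. f (t, w)) has_field_derivative poly (pderiv (P t)) w) (at w)"
  unfolding P[symmetric] by (rule poly_DERIV)

text \<open>Monodromy as a relation: some path off \<open>E\<close> has, for every root, a lift with
  the prescribed end. Lifts are only asserted to exist and \<open>\<beta>\<close> is free outside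
  \<open>roots t\<close>, so composition is mere concatenation of paths.\<close>

definition transport :: "complex \<Rightarrow> complex \<Rightarrow> (complex \<Rightarrow> complex) \<Rightarrow> bool" where
  "transport t t' \<beta> \<longleftrightarrow> (\<exists>\<gamma>. path \<gamma> \<and> path_image \<gamma> \<subseteq> - E \<and> pathstart \<gamma> = t \<and> pathfinish \<gamma> = t' \<and>
     (\<forall>x\<in>roots t. \<exists>l. path l \<and> pathstart l = x \<and> pathfinish l = \<beta> x \<and> (\<forall>s\<in>{0..1}. f (\<gamma> s, l s) = 0)))"

lemma transport_roots:
  assumes "transport t t' \<beta>" "x \<in> roots t"
  shows "\<beta> x \<in> roots t'"
proof -
  obtain \<gamma> l where *: "pathfinish \<gamma> = t'" "pathfinish l = \<beta> x" "\<forall>s\<in>{0..1}. f (\<gamma> s, l s) = 0"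
    using assms unfolding transport_def by blast
  have "f (\<gamma> 1, l 1) = 0" by (rule *(3)[rule_format]) simp
  then show ?thesis using *(1,2) by (simp add: roots_def pathfinish_def)
qed

lemma transport_comp:
  assumes "transport t t' \<beta>" "transport t' t'' \<beta>'"
  shows "transport t t'' (\<lambda>x. \<beta>' (\<beta> x))"
proof -
  obtain \<gamma> where \<gamma>: "path \<gamma>" "path_image \<gamma> \<subseteq> - E" "pathstart \<gamma> = t" "pathfinish \<gamma> = t'"
    and l: "\<And>x. x \<in> roots t \<Longrightarrow> \<exists>l. path l \<and> pathstart l = x \<and> pathfinish l = \<beta> x \<and> (\<forall>s\<in>{0..1}. f (\<gamma> s, l s) = 0)"
    using assms(1) unfolding transport_def by blast
  obtain \<gamma>' where \<gamma>': "path \<gamma>'" "path_image \<gamma>' \<subseteq> - E" "pathstart \<gamma>' = t'" "pathfinish \<gamma>' = t''"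
    and l': "\<And>x. x \<in> roots t' \<Longrightarrow> \<exists>l. path l \<and> pathstart l = x \<and> pathfinish l = \<beta>' x \<and> (\<forall>s\<in>{0..1}. f (\<gamma>' s, l s) = 0)"
    using assms(2) unfolding transport_def by blast
  show ?thesis
    unfolding transport_def
  proof (rule exI[of _ "\<gamma> +++ \<gamma>'"], intro conjI ballI)
    fix x assume x: "x \<in> roots t"
    obtain k where k: "path k" "pathstart k = x" "pathfinish k = \<beta> x" "\<forall>s\<in>{0..1}. f (\<gamma> s, k s) = 0"
      using l[OF x] by blast
    obtain k' where k': "path k'" "pathstart k' = \<beta> x" "pathfinish k' = \<beta>' (\<beta> x)" "\<forall>s\<in>{0..1}. f (\<gamma>' s, k' s) = 0"
      using l'[OF transport_roots[OF assms(1) x]] by blast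
    show "\<exists>l. path l \<and> pathstart l = x \<and> pathfinish l = \<beta>' (\<beta> x) \<and> (\<forall>s\<in>{0..1}. f ((\<gamma> +++ \<gamma>') s, l s) = 0)"
    proof (intro exI[of _ "k +++ k'"] conjI ballI)
      show "path (k +++ k')" by (rule path_join_imp[OF k(1) k'(1)]) (simp add: k k')
      show "f ((\<gamma> +++ \<gamma>') s, (k +++ k') s) = 0" if "s \<in> {0..1}" for s
        using k(4)[rule_format, of "2 * s"] k'(4)[rule_format, of "2 * s - 1"] that by (auto simp: joinpaths_def)
    qed (simp_all add: k k')
  qed (use \<gamma> \<gamma>' in \<open>auto simp: path_image_join\<close>)
qed

lemma transport_cong:
  "transport t t' \<beta> \<Longrightarrow> (\<And>x. x \<in> roots t \<Longrightarrow> \<beta> x = \<beta>' x) \<Longrightarrow> transport t t' \<beta>'"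
  unfolding transport_def by (metis (no_types, lifting))

lemma transport_refl: "t \<notin> E \<Longrightarrow> transport t t (\<lambda>x. x)"
  unfolding transport_def
proof (rule exI[of _ "\<lambda>_. t"], intro conjI ballI)
  fix x assume "x \<in> roots t"
  then show "\<exists>l. path l \<and> pathstart l = x \<and> pathfinish l = x \<and> (\<forall>s\<in>{0..1}. f (t, l s) = 0)"
    by (intro exI[of _ "\<lambda>_. x"]) (simp add: path_def pathstart_def pathfinish_def roots_def)
qed (auto simp: path_def pathstart_def pathfinish_def path_image_def)

text \<open>The \<open>d\<close> simple roots continue to \<open>d\<close> branches that stay apart;
  since no fibre has more than \<open>d\<close> roots, the branches exhaust it.\<close>

lemma local_frame:
  assumes t1: "t1 \<notin> E"
  obtains e r where "e > 0" "ball t1 e \<subseteq> - E" "\<And>w. w \<in> roots t1 \<Longrightarrow> r w holomorphic_on ball t1 e"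
    "\<And>w. w \<in> roots t1 \<Longrightarrow> r w t1 = w" "\<And>t. t \<in> ball t1 e \<Longrightarrow> bij_betw (\<lambda>w. r w t) (roots t1) (roots t)"
proof -
  obtain \<eta> where \<eta>: "\<eta> > 0" "\<And>w w'. w \<in> roots t1 \<Longrightarrow> w' \<in> roots t1 \<Longrightarrow> w \<noteq> w' \<Longrightarrow> 3 * \<eta> \<le> cmod (w - w')"
    using separated[OF finite_roots[of t1]] by metis
  obtain e r where e: "e > 0" "\<And>w. w \<in> roots t1 \<Longrightarrow> r w holomorphic_on ball t1 e" "\<And>w. w \<in> roots t1 \<Longrightarrow> r w t1 = w"
    "\<And>w t. w \<in> roots t1 \<Longrightarrow> t \<in> ball t1 e \<Longrightarrow> f (t, r w t) = 0"
    "\<And>w t. w \<in> roots t1 \<Longrightarrow> t \<in> ball t1 e \<Longrightarrow> cmod (r w t - w) < \<eta>"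
  proof (rule branches[OF polyfun_f finite_roots[of t1] \<eta>(1), of t1])
    show "f (t1, w) = 0" if "w \<in> roots t1" for w using that by (simp add: roots_def)
    show "\<exists>D. D \<noteq> 0 \<and> ((\<lambda>y. f (t1, y)) has_field_derivative D) (at w)" if "w \<in> roots t1" for w
      using that t1 DERIV_f[of t1 w] by (auto simp: roots_def E_def)
  qed (rule that; assumption)
  obtain e' where e': "e' > 0" "ball t1 e' \<subseteq> - E" using openE[OF open_E, of t1] t1 by auto
  show ?thesis
  proof (rule that[of "min e e'" r])
    show "bij_betw (\<lambda>w. r w t) (roots t1) (roots t)" if t: "t \<in> ball t1 (min e e')" for t
    proof -
      have inj: "inj_on (\<lambda>w. r w t) (roots t1)"
      proof (rule inj_onI, rule ccontr)
        fix w w' assume w: "w \<in> roots t1" "w' \<in> roots t1" "r w t = r w' t" "w \<noteq> w'"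
        have "cmod (w - w') \<le> cmod (r w t - w) + cmod (r w' t - w')"
          using norm_triangle_ineq4[of "r w t - w" "r w' t - w'"] w(3) by (simp add: norm_minus_commute)
        also have "\<dots> < 2 * \<eta>" using e(5)[OF w(1), of t] e(5)[OF w(2), of t] t by simp
        finally show False using \<eta>(2)[OF w(1,2,4)] \<eta>(1) by simp
      qed
      have "roots t = (\<lambda>w. r w t) ` roots t1"
        by (rule roots_eqI) (use e(4) t inj card_roots[OF t1] in \<open>auto simp: roots_def card_image\<close>)
      then show ?thesis using inj by (simp add: bij_betw_def)
    qed
    show "r w holomorphic_on ball t1 (min e e')" if "w \<in> roots t1" for w
      by (rule holomorphic_on_subset[OF e(2)[OF that]]) auto
  qed (use e e' in auto)
qed

lemma transport_frame:
  assumes B: "ball t1 e \<subseteq> - E" and t: "t \<in> ball t1 e" "t' \<in> ball t1 e"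
    and r: "\<And>w. w \<in> W \<Longrightarrow> r w holomorphic_on ball t1 e"
    and bij: "\<And>t. t \<in> ball t1 e \<Longrightarrow> bij_betw (\<lambda>w. r w t) W (roots t)"
    and \<beta>: "\<And>w. w \<in> W \<Longrightarrow> \<beta> (r w t) = r w t'"
  shows "transport t t' \<beta>"
proof -
  have seg: "path_image (linepath t t') \<subseteq> ball t1 e"
    using t by (simp add: closed_segment_subset)
  have mem: "linepath t t' s \<in> ball t1 e" if "s \<in> {0..1}" for s
    using seg that unfolding path_image_def by blast
  show ?thesis
    unfolding transport_def
  proof (rule exI[of _ "linepath t t'"], intro conjI ballI)
    fix x assume "x \<in> roots t"
    then obtain w where w: "w \<in> W" "x = r w t" using bij[OF t(1)] by (auto simp: bij_betw_def)
    have "path (r w \<circ> linepath t t')"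
      by (rule path_continuous_image[OF path_linepath continuous_on_subset[OF holomorphic_on_imp_continuous_on[OF r[OF w(1)]] seg]])
    moreover have "f (linepath t t' s, (r w \<circ> linepath t t') s) = 0" if "s \<in> {0..1}" for s
      using bij[OF mem[OF that]] w(1) by (auto simp: bij_betw_def roots_def)
    ultimately show "\<exists>l. path l \<and> pathstart l = x \<and> pathfinish l = \<beta> x \<and> (\<forall>s\<in>{0..1}. f (linepath t t' s, l s) = 0)"
      using w \<beta>[OF w(1)]
      by (intro exI[of _ "r w \<circ> linepath t t'"]) (auto simp: pathstart_compose pathfinish_compose)
  qed (use seg B in auto)
qed

text \<open>Conjugation by the transport along a segment: whether two branches can be transposed
  does not depend on the point of the frame.\<close>

lemma transpose_frame:
  assumes B: "ball t1 e \<subseteq> - E" and t: "t \<in> ball t1 e" "t' \<in> ball t1 e"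
    and r: "\<And>w. w \<in> W \<Longrightarrow> r w holomorphic_on ball t1 e"
    and bij: "\<And>t. t \<in> ball t1 e \<Longrightarrow> bij_betw (\<lambda>w. r w t) W (roots t)"
    and w: "w \<in> W" "w' \<in> W" and tr: "transport t t (Transposition.transpose (r w t) (r w' t))"
  shows "transport t' t' (Transposition.transpose (r w t') (r w' t'))"
proof -
  define \<beta> where "\<beta> s s' x = r (inv_into W (\<lambda>w. r w s) x) s'" for s s' x
  have inj: "inj_on (\<lambda>w. r w s) W" if "s \<in> ball t1 e" for s using bij[OF that] by (simp add: bij_betw_def)
  have \<beta>: "\<beta> s s' (r u s) = r u s'" if "s \<in> ball t1 e" "u \<in> W" for s s' u
    unfolding \<beta>_def by (simp add: inv_into_f_f[OF inj[OF that(1)] that(2)])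
  have tf: "transport s s' (\<beta> s s')" if "s \<in> ball t1 e" "s' \<in> ball t1 e" for s s'
    by (rule transport_frame[OF B that r bij \<beta>[OF that(1)]])
  have eq: "r u s = r u' s \<longleftrightarrow> u = u'" if "s \<in> ball t1 e" "u \<in> W" "u' \<in> W" for s u u'
    using inj[OF that(1)] that by (auto dest: inj_onD)
  have "transport t' t' (\<lambda>x. \<beta> t t' (Transposition.transpose (r w t) (r w' t) (\<beta> t' t x)))"
    by (rule transport_comp[OF transport_comp[OF tf[OF t(2,1)] tr] tf[OF t]])
  then show ?thesis
  proof (rule transport_cong)
    fix x assume "x \<in> roots t'"
    then obtain u where u: "u \<in> W" "x = r u t'" using bij[OF t(2)] by (auto simp: bij_betw_def)
    show "\<beta> t t' (Transposition.transpose (r w t) (r w' t) (\<beta> t' t x)) = Transposition.transpose (r w t') (r w' t') x"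
      unfolding u(2) \<beta>[OF t(2) u(1)]
      by (simp only: Transposition.transpose_def eq[OF t(1) u(1) w(1)] eq[OF t(1) u(1) w(2)] eq[OF t(2) u(1) w(1)]
          eq[OF t(2) u(1) w(2)] if_distrib[of "\<beta> t t'"] \<beta>[OF t(1) w(1)] \<beta>[OF t(1) w(2)] \<beta>[OF t(1) u(1)])
  qed
qed

definition N :: "complex \<Rightarrow> (complex \<times> complex) set" where
  "N t = {(x, y). x \<in> roots t \<and> y \<in> roots t \<and> x \<noteq> y \<and> \<not> transport t t (Transposition.transpose x y)}"

text \<open>A product over a set of ordered pairs that is intrinsic to \<open>t\<close>, hence a
  single-valued function, without labels or choices of sign. A discriminant from which the realised
  transpositions are left out.\<close>

definition R :: "complex \<Rightarrow> complex" where
  "R t = (\<Prod>(x, y)\<in>N t. x - y)"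

lemma finite_N: "finite (N t)"
  by (rule finite_subset[of _ "roots t \<times> roots t"]) (auto simp: N_def finite_roots)

lemma card_N: "card (N t) \<le> d * d"
proof -
  have "card (N t) \<le> card (roots t \<times> roots t)"
    by (rule card_mono) (auto simp: N_def finite_roots)
  also have "\<dots> \<le> d * d" unfolding card_cartesian_product by (intro mult_le_mono card_roots_le)
  finally show ?thesis .
qed

lemma R_nz: "R t \<noteq> 0"
  unfolding R_def using finite_N by (auto simp: N_def)

lemma R_lower:
  assumes "0 \<le> m" "\<And>x y. (x, y) \<in> N t \<Longrightarrow> m \<le> cmod (x - y)"
  shows "m ^ card (N t) \<le> cmod (R t)"
proof -
  have "m ^ card (N t) = (\<Prod>z\<in>N t. m)" by simp
  also have "\<dots> \<le> (\<Prod>z\<in>N t. cmod (fst z - snd z))"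
    by (rule prod_mono) (use assms in auto)
  also have "\<dots> = cmod (R t)" by (simp add: R_def prod_norm case_prod_unfold)
  finally show ?thesis .
qed

text \<open>A local frame maps \<open>N t1\<close> onto \<open>N t\<close>, so \<open>R\<close> is
  locally a fixed product of differences of holomorphic branches.\<close>

lemma R_holomorphic: "R holomorphic_on - E"
proof -
  have "R field_differentiable (at t1)" if t1: "t1 \<notin> E" for t1
  proof -
    obtain e r where e: "e > 0" "ball t1 e \<subseteq> - E" "\<And>w. w \<in> roots t1 \<Longrightarrow> r w holomorphic_on ball t1 e"
      "\<And>w. w \<in> roots t1 \<Longrightarrow> r w t1 = w" "\<And>t. t \<in> ball t1 e \<Longrightarrow> bij_betw (\<lambda>w. r w t) (roots t1) (roots t)"
      by (rule local_frame[OF t1]) (rule that; assumption)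
    have t1b: "t1 \<in> ball t1 e" using e(1) by simp
    have "R t = (\<Prod>(x, y)\<in>N t1. r x t - r y t)" if t: "t \<in> ball t1 e" for t
    proof -
      have inj: "inj_on (\<lambda>w. r w t) (roots t1)" and im: "roots t = (\<lambda>w. r w t) ` roots t1"
        using e(5)[OF t] by (auto simp: bij_betw_def)
      have tr: "transport t t (Transposition.transpose (r x t) (r y t)) \<longleftrightarrow> transport t1 t1 (Transposition.transpose x y)"
        if "x \<in> roots t1" "y \<in> roots t1" for x y
        using transpose_frame[OF e(2) t t1b e(3,5) that] transpose_frame[OF e(2) t1b t e(3,5) that] e(4)[OF that(1)] e(4)[OF that(2)]
        by auto
      have Nt: "N t = (\<lambda>(x, y). (r x t, r y t)) ` N t1"
      proof (intro equalityI subsetI)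
        fix z assume z: "z \<in> N t"
        obtain a b where ab: "z = (a, b)" by (cases z)
        with z have "a \<in> roots t" "b \<in> roots t" by (auto simp: N_def)
        then obtain x y where xy: "x \<in> roots t1" "y \<in> roots t1" "a = r x t" "b = r y t" unfolding im by blast
        then have "(x, y) \<in> N t1" using z tr[OF xy(1,2)] unfolding ab N_def by auto
        then show "z \<in> (\<lambda>(x, y). (r x t, r y t)) ` N t1" using xy ab by force
      next
        fix z assume "z \<in> (\<lambda>(x, y). (r x t, r y t)) ` N t1"
        then obtain x y where xy: "(x, y) \<in> N t1" "z = (r x t, r y t)" by auto
        then have m: "x \<in> roots t1" "y \<in> roots t1" "x \<noteq> y" by (auto simp: N_def)
        then have "r x t \<noteq> r y t" using inj by (auto dest: inj_onD)
        then show "z \<in> N t" using xy tr[OF m(1,2)] m im by (auto simp: N_def)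
      qed
      have "inj_on (\<lambda>(x, y). (r x t, r y t)) (N t1)"
        using inj by (auto simp: inj_on_def N_def)
      then show ?thesis unfolding R_def Nt by (subst prod.reindex) (auto simp: case_prod_unfold)
    qed
    then have ev: "R t = (\<Prod>z\<in>N t1. r (fst z) t - r (snd z) t)" if "t \<in> ball t1 e" for t
      using that by (simp add: case_prod_unfold)
    have "(\<lambda>t. \<Prod>z\<in>N t1. r (fst z) t - r (snd z) t) holomorphic_on ball t1 e"
      by (intro holomorphic_on_prod holomorphic_on_diff e(3)) (auto simp: N_def)
    then have "R holomorphic_on ball t1 e" by (rule holomorphic_transform) (simp add: ev)
    then show ?thesis using t1b by (rule holomorphic_on_imp_differentiable_at[OF _ open_ball])
  qed
  then show ?thesis by (auto simp: holomorphic_on_def intro: field_differentiable_at_within)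
qed

text \<open>The colliding roots are \<open>X z\<close> and \<open>X (- z)\<close> with
  \<open>z\<^sup>2 = t - b\<close>. Half a turn of \<open>z\<close> exchanges them and brings every
  other root back, so this pair is absent from \<open>N t\<close>; all other pairs keep a distance
  of at least \<open>\<eta>\<close>.\<close>

lemma R_near_branch_point:
  assumes b: "b \<in> E"
  shows "\<exists>B. eventually (\<lambda>t. cmod (1 / R t) \<le> B) (at b)"
proof -
  obtain w0 where w0: "f (b, w0) = 0" "poly (pderiv (P b)) w0 = 0" using b by (auto simp: E_def)
  define p2 where "p2 = poly (pderiv (pderiv (P b))) w0"
  define a where "a = ft (b, w0)"
  have nz: "p2 \<noteq> 0" "a \<noteq> 0" using simple[OF w0] by (simp_all add: p2_def a_def)
  obtain G where G: "polyfun G" "\<And>z y. f (b + z\<^sup>2, w0 + z * y) = z\<^sup>2 * G (z, y)" "\<And>y. G (0, y) = a + p2 / 2 * y\<^sup>2"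
    using quadratic_substitution[OF polyfun_f P _ w0(2) ft] w0(1) unfolding a_def p2_def P by metis
  \<comment> \<open>The leading coefficient of the colliding branches in \<open>z\<close>, a root of
    \<open>G (0, y)\<close>; it is nonzero because \<open>a\<close> is.\<close>
  define y0 where "y0 = csqrt (- 2 * a / p2)"
  have y0: "y0\<^sup>2 = - 2 * a / p2" "y0 \<noteq> 0" using nz by (simp_all add: y0_def)
  have Gy0: "G (0, y0) = 0" unfolding G(3) y0(1) using nz by simp
  have dG: "((\<lambda>y. G (0, y)) has_field_derivative p2 * y0) (at y0)"
    unfolding G(3) by (auto intro!: derivative_eq_intros)
  obtain \<eta> where \<eta>: "\<eta> > 0" "\<eta> \<le> 1" "\<And>w w'. w \<in> roots b \<Longrightarrow> w' \<in> roots b \<Longrightarrow> w \<noteq> w' \<Longrightarrow> 3 * \<eta> \<le> cmod (w - w')"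
    using separated[OF finite_roots[of b]] by metis
  \<comment> \<open>Two values within distance less than \<open>cmod y0\<close> of \<open>y0\<close>
    cannot be opposite, which later separates \<open>X z\<close> from
    \<open>X (- z)\<close>.\<close>
  obtain e0 \<phi>' where \<phi>': "e0 > 0" "\<And>w. w \<in> {y0} \<Longrightarrow> \<phi>' w holomorphic_on ball 0 e0" "\<And>w. w \<in> {y0} \<Longrightarrow> \<phi>' w 0 = w"
    "\<And>w t. w \<in> {y0} \<Longrightarrow> t \<in> ball 0 e0 \<Longrightarrow> G (t, \<phi>' w t) = 0"
    "\<And>w t. w \<in> {y0} \<Longrightarrow> t \<in> ball 0 e0 \<Longrightarrow> cmod (\<phi>' w t - w) < cmod y0"
  proof (rule branches[OF G(1), of "{y0}" "cmod y0" 0])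
    show "\<exists>D. D \<noteq> 0 \<and> ((\<lambda>y. G (0, y)) has_field_derivative D) (at w)" if "w \<in> {y0}" for w
      using that dG nz y0 by (intro exI[of _ "p2 * y0"]) auto
    show "finite {y0}" "0 < cmod y0" using y0 by simp_all
    show "G (0, w) = 0" if "w \<in> {y0}" for w using that Gy0 by simp
  qed (rule that; assumption)
  define \<phi> where "\<phi> = \<phi>' y0"
  have \<phi>: "\<phi> holomorphic_on ball 0 e0" "\<And>z. z \<in> ball 0 e0 \<Longrightarrow> G (z, \<phi> z) = 0"
    "\<And>z. z \<in> ball 0 e0 \<Longrightarrow> cmod (\<phi> z - y0) < cmod y0" unfolding \<phi>_def using \<phi>' by auto
  define W where "W = roots b - {w0}"
  have W: "finite W" "Suc (card W) = card (roots b)"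
    unfolding W_def by (rule finite_Diff[OF finite_roots], rule card_Suc_Diff1[OF finite_roots]) (simp add: roots_def w0)
  \<comment> \<open>The double root \<open>w0\<close> is the only multiple root over
    \<open>b\<close>, so \<open>d - 2\<close> simple ones remain.\<close>
  have cardW: "Suc (Suc (card W)) = d"
  proof -
    have "poly (pderiv (P b)) a \<noteq> 0" if "poly (P b) a = 0" "a \<noteq> w0" for a
      using unique[OF w0, of a] that unfolding P by blast
    then have "Suc (card {x. poly (P b) x = 0}) = degree (P b)"
      using w0(1) nz(1) unfolding p2_def by (intro card_roots_double[OF P_nz _ w0(2)]) (auto simp: P)
    then show ?thesis using W(2) unfolding P roots_def deg by simp
  qed
  obtain e1 r where r: "e1 > 0" "\<And>w. w \<in> W \<Longrightarrow> r w holomorphic_on ball b e1" "\<And>w. w \<in> W \<Longrightarrow> r w b = w"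
    "\<And>w t. w \<in> W \<Longrightarrow> t \<in> ball b e1 \<Longrightarrow> f (t, r w t) = 0"
    "\<And>w t. w \<in> W \<Longrightarrow> t \<in> ball b e1 \<Longrightarrow> cmod (r w t - w) < \<eta>"
  proof (rule branches[OF polyfun_f W(1) \<eta>(1), of b])
    show "f (b, w) = 0" if "w \<in> W" for w using that by (simp add: W_def roots_def)
    show "\<exists>D. D \<noteq> 0 \<and> ((\<lambda>y. f (b, y)) has_field_derivative D) (at w)" if "w \<in> W" for w
      using that unique[OF w0, of w] DERIV_f[of b w] by (auto simp: W_def roots_def)
  qed (rule that; assumption)
  obtain e2 where e2: "e2 > 0" "\<And>t. t \<in> ball b e2 \<Longrightarrow> t \<noteq> b \<Longrightarrow> t \<notin> E"
  proof -
    have "open (- (E - {b}))" by (intro open_Compl finite_imp_closed finite_Diff finite_E)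
    then obtain k where "k > 0" "ball b k \<subseteq> - (E - {b})" using openE[of "- (E - {b})" b] by auto
    then show ?thesis using that[of k] by blast
  qed
  \<comment> \<open>Together with \<open>cmod (\<phi> z) < 2 * cmod y0\<close> this keeps
    \<open>X z\<close> within \<open>\<eta>\<close> of \<open>w0\<close>.\<close>
  define \<epsilon> where "\<epsilon> = min e0 (\<eta> / (2 * cmod y0))"
  have \<epsilon>: "\<epsilon> > 0" "\<epsilon> \<le> e0" "\<epsilon> * (2 * cmod y0) \<le> \<eta>" using \<phi>'(1) \<eta>(1) y0(2)
    by (auto simp: \<epsilon>_def min_def field_simps)
  define X where "X z = w0 + z * \<phi> z" for z
  have X_root: "f (b + z\<^sup>2, X z) = 0" if "cmod z < \<epsilon>" for z
    using \<phi>(2)[of z] that \<epsilon>(2) unfolding X_def G(2) by simp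
  have X_near: "cmod (X z - w0) < \<eta>" if "cmod z < \<epsilon>" for z
  proof (cases "z = 0")
    case False
    have "cmod (\<phi> z) < 2 * cmod y0"
      using \<phi>(3)[of z] that \<epsilon>(2) norm_triangle_sub[of "\<phi> z" y0] by simp
    then have "cmod z * cmod (\<phi> z) < cmod z * (2 * cmod y0)" using False by simp
    also have "\<dots> \<le> \<epsilon> * (2 * cmod y0)" using that by (intro mult_right_mono) auto
    finally show ?thesis using \<epsilon>(3) by (simp add: X_def norm_mult)
  qed (simp add: X_def \<eta>)
  have X_neq: "X z \<noteq> X (- z)" if "cmod z < \<epsilon>" "z \<noteq> 0" for z
  proof
    assume "X z = X (- z)"
    then have "\<phi> z + \<phi> (- z) = 0" using that(2) by (simp add: X_def add_eq_0_iff2) (metis add.inverse_inverse mult_minus_right mult_left_cancel neg_equal_iff_equal)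
    then have "(y0 - \<phi> z) + (y0 - \<phi> (- z)) = 2 * y0" by (simp add: algebra_simps)
    then have "2 * cmod y0 = cmod ((y0 - \<phi> z) + (y0 - \<phi> (- z)))" by (simp add: norm_mult)
    also have "\<dots> \<le> cmod (\<phi> z - y0) + cmod (\<phi> (- z) - y0)" by (metis norm_minus_commute norm_triangle_ineq)
    also have "\<dots> < 2 * cmod y0" using \<phi>(3)[of z] \<phi>(3)[of "- z"] that(1) \<epsilon>(2) by simp
    finally show False by simp
  qed
  define \<delta> where "\<delta> = min (min e1 e2) (\<epsilon>\<^sup>2)"
  have \<delta>: "\<delta> > 0" using r(1) e2(1) \<epsilon>(1) by (simp add: \<delta>_def)
  have main: "cmod (1 / R t) \<le> 1 / \<eta> ^ (d * d)" if t: "t \<in> ball b \<delta>" "t \<noteq> b" for t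
  proof -
    define z where "z = csqrt (t - b)"
    have z2: "b + z\<^sup>2 = t" by (simp add: z_def)
    have z0: "z \<noteq> 0" using t(2) z2 by auto
    have zr: "(cmod z)\<^sup>2 < \<delta>" using t(1) z2 by (metis add_diff_cancel_left' dist_commute dist_norm mem_ball norm_power)
    then have "(cmod z)\<^sup>2 < \<epsilon>\<^sup>2" by (simp add: \<delta>_def)
    then have z\<epsilon>: "cmod z < \<epsilon>" using \<epsilon>(1) by (meson less_imp_le power2_less_imp_less)
    have tE: "t \<notin> E" using e2(2)[of t] t by (simp add: \<delta>_def)
    have te1: "s \<in> ball b e1" if "s \<in> ball b \<delta>" for s using that by (simp add: \<delta>_def)
    have rw0: "2 * \<eta> < cmod (r w s - w0)" if "w \<in> W" "s \<in> ball b \<delta>" for w s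
    proof -
      have "3 * \<eta> \<le> cmod (w - w0)" using \<eta>(3)[of w w0] that(1) w0 by (auto simp: W_def roots_def)
      also have "\<dots> \<le> cmod (r w s - w0) + cmod (r w s - w)"
        using norm_triangle_ineq4[of "r w s - w0" "r w s - w"] by simp
      finally show ?thesis using r(5)[OF that(1) te1[OF that(2)]] by simp
    qed
    have rr: "\<eta> \<le> cmod (r w s - r w' s)" if "w \<in> W" "w' \<in> W" "w \<noteq> w'" "s \<in> ball b \<delta>" for w w' s
    proof -
      have "3 * \<eta> \<le> cmod (w - w')" using \<eta>(3)[of w w'] that by (auto simp: W_def)
      also have "w - w' = (r w s - r w' s) - ((r w s - w) - (r w' s - w'))" by simp
      also have "cmod \<dots> \<le> cmod (r w s - r w' s) + (cmod (r w s - w) + cmod (r w' s - w'))"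
        by (meson add_left_mono norm_triangle_ineq4 order_trans)
      finally show ?thesis using r(5)[OF that(1) te1[OF that(4)]] r(5)[OF that(2) te1[OF that(4)]] by simp
    qed
    have rX: "\<eta> \<le> cmod (r w s - X z')" if "w \<in> W" "s \<in> ball b \<delta>" "cmod z' < \<epsilon>" for w s z'
    proof -
      have "cmod (r w s - w0) \<le> cmod (r w s - X z') + cmod (X z' - w0)"
        using norm_triangle_ineq[of "r w s - X z'" "X z' - w0"] by simp
      then show ?thesis using rw0[OF that(1,2)] X_near[OF that(3)] by simp
    qed
    have inj: "inj_on (\<lambda>w. r w t) W"
      using rr[OF _ _ _ t(1)] \<eta>(1) by (intro inj_onI) (metis diff_self norm_zero not_le)
    have Xn: "X z' \<notin> (\<lambda>w. r w t) ` W" if "cmod z' < \<epsilon>" for z'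
      using rX[OF _ t(1) that] \<eta>(1) by (metis (no_types, lifting) diff_self imageE norm_zero not_le)
    have z\<epsilon>': "cmod (- z) < \<epsilon>" using z\<epsilon> by simp
    have roots_t: "roots t = insert (X z) (insert (X (- z)) ((\<lambda>w. r w t) ` W))"
    proof (rule roots_eqI)
      show "insert (X z) (insert (X (- z)) ((\<lambda>w. r w t) ` W)) \<subseteq> roots t"
        using X_root[OF z\<epsilon>] X_root[OF z\<epsilon>'] r(4) te1[OF t(1)] z2 by (auto simp: roots_def)
      show "card (insert (X z) (insert (X (- z)) ((\<lambda>w. r w t) ` W))) = d"
        using W(1) Xn[OF z\<epsilon>] Xn[OF z\<epsilon>'] X_neq[OF z\<epsilon> z0] cardW by (simp add: card_image[OF inj])
    qed
    have swap: "transport t t (Transposition.transpose (X z) (X (- z)))"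
    proof -
      \<comment> \<open>Half a turn of \<open>z\<close>, whose square is a full loop around the
        branch point.\<close>
      define c where "c s = z * exp (\<i> * of_real (pi * s))" for s :: real
      define \<gamma> where "\<gamma> s = b + (c s)\<^sup>2" for s
      have c: "continuous_on {0..1} c" unfolding c_def by (intro continuous_intros)
      have cn: "cmod (c s) = cmod z" for s by (simp add: c_def norm_mult)
      have c01: "c 0 = z" "c 1 = - z" by (simp_all add: c_def mult.commute[of \<i>])
      have \<gamma>b: "\<gamma> s \<in> ball b \<delta>" for s using zr cn[of s] by (simp add: \<gamma>_def dist_norm norm_power)
      have \<gamma>nb: "\<gamma> s \<noteq> b" for s using cn[of s] z0 by (auto simp: \<gamma>_def)
      have \<gamma>01: "\<gamma> 0 = t" "\<gamma> 1 = t" by (simp_all add: \<gamma>_def c01 z2)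
      have \<gamma>c: "continuous_on {0..1} \<gamma>" unfolding \<gamma>_def by (intro continuous_intros c)
      show ?thesis
        unfolding transport_def
      proof (rule exI[of _ \<gamma>], intro conjI ballI)
      show "path \<gamma>" using \<gamma>c by (simp add: path_def)
      show "path_image \<gamma> \<subseteq> - E" using e2(2) \<gamma>b \<gamma>nb by (auto simp: path_image_def \<delta>_def)
      show "pathstart \<gamma> = t" "pathfinish \<gamma> = t" using \<gamma>01 by (simp_all add: pathstart_def pathfinish_def)
      fix x assume x: "x \<in> roots t"
      have Xpath: "\<exists>l. path l \<and> pathstart l = X (k * z) \<and> pathfinish l = X (- k * z) \<and> (\<forall>s\<in>{0..1}. f (\<gamma> s, l s) = 0)"
        if k: "k = 1 \<or> k = - 1" for k
      proof (intro exI[of _ "\<lambda>s. X (k * c s)"] conjI ballI)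
        have ck: "cmod (k * c s) < \<epsilon>" for s using k cn[of s] z\<epsilon> by (auto simp: norm_mult)
        have "continuous_on {0..1} (\<lambda>s. \<phi> (k * c s))"
        proof (rule continuous_on_compose2[OF holomorphic_on_imp_continuous_on[OF \<phi>(1)]])
          have "k * c s \<in> ball 0 e0" for s using ck[of s] \<epsilon>(2) by simp
          then show "(\<lambda>s. k * c s) ` {0..1} \<subseteq> ball 0 e0" by blast
        qed (intro continuous_intros c)
        then show "path (\<lambda>s. X (k * c s))" unfolding path_def X_def by (intro continuous_intros c)
        show "f (\<gamma> s, X (k * c s)) = 0" for s
          using X_root[OF ck[of s]] k by (auto simp: \<gamma>_def power_mult_distrib)
      qed (auto simp: pathstart_def pathfinish_def c01)
      consider "x = X z" | "x = X (- z)" | w where "w \<in> W" "x = r w t" using x unfolding roots_t by blast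
      then show "\<exists>l. path l \<and> pathstart l = x \<and> pathfinish l = Transposition.transpose (X z) (X (- z)) x \<and> (\<forall>s\<in>{0..1}. f (\<gamma> s, l s) = 0)"
      proof cases
        case 1
        then show ?thesis using Xpath[of 1] by simp
      next
        case 2
        then show ?thesis using Xpath[of "-1"] by simp
      next
        case 3
        then have "x \<noteq> X z" "x \<noteq> X (- z)" using Xn[OF z\<epsilon>] Xn[OF z\<epsilon>'] by blast+
        then have tx: "Transposition.transpose (X z) (X (- z)) x = x" by (simp add: Transposition.transpose_def)
        have "continuous_on {0..1} (\<lambda>s. r w (\<gamma> s))"
          by (rule continuous_on_compose2[OF holomorphic_on_imp_continuous_on[OF r(2)[OF 3(1)]] \<gamma>c]) (use te1 \<gamma>b in auto)
        then show ?thesis unfolding tx using 3 \<gamma>01 r(4)[OF 3(1) te1[OF \<gamma>b]]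
          by (intro exI[of _ "\<lambda>s. r w (\<gamma> s)"]) (simp add: path_def pathstart_def pathfinish_def)
      qed
    qed
    qed
    have "\<eta> \<le> cmod (x - y)" if "(x, y) \<in> N t" for x y
    proof -
      have xy: "x \<in> roots t" "y \<in> roots t" "x \<noteq> y" "\<not> transport t t (Transposition.transpose x y)"
        using that by (auto simp: N_def)
      have "\<not> (x \<in> {X z, X (- z)} \<and> y \<in> {X z, X (- z)})"
        using xy(3,4) swap by (auto simp: transpose_commute)
      then consider w where "w \<in> W" "x = r w t" "y \<in> {X z, X (- z)}" | w where "w \<in> W" "y = r w t" "x \<in> {X z, X (- z)}"
        | w w' where "w \<in> W" "w' \<in> W" "x = r w t" "y = r w' t"
        using xy(1,2) unfolding roots_t by blast
      then show ?thesis
      proof cases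
        case 1
        then show ?thesis using rX[OF 1(1) t(1) z\<epsilon>] rX[OF 1(1) t(1) z\<epsilon>'] by auto
      next
        case 2
        then show ?thesis using rX[OF 2(1) t(1) z\<epsilon>] rX[OF 2(1) t(1) z\<epsilon>'] by (auto simp: norm_minus_commute)
      next
        case 3
        then show ?thesis using rr[OF 3(1,2) _ t(1)] xy(3) by auto
      qed
    qed
    then have "\<eta> ^ card (N t) \<le> cmod (R t)" using \<eta>(1) by (intro R_lower) auto
    moreover have "\<eta> ^ (d * d) \<le> \<eta> ^ card (N t)" using card_N \<eta>(1,2) by (intro power_decreasing) auto
    ultimately have "\<eta> ^ (d * d) \<le> cmod (R t)" by simp
    then show ?thesis using \<eta>(1) by (simp add: norm_divide frac_le)
  qed
  have "eventually (\<lambda>t. cmod (1 / R t) \<le> 1 / \<eta> ^ (d * d)) (at b)"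
    unfolding eventually_at using main \<delta> by (intro exI[of _ \<delta>]) (auto simp: dist_commute)
  then show ?thesis by blast
qed

text \<open>Near infinity the roots are \<open>t * r w (1 / t)\<close>, where the branches
  \<open>r w\<close> start from the \<open>d\<close> distinct roots at infinity; the factor
  \<open>t\<close> makes their distances grow linearly.\<close>

lemma roots_far_apart:
  obtains K m where "K > 0" "m > 0" "\<And>t. K < cmod t \<Longrightarrow> t \<notin> E"
    "\<And>t x y. K < cmod t \<Longrightarrow> x \<in> roots t \<Longrightarrow> y \<in> roots t \<Longrightarrow> x \<noteq> y \<Longrightarrow> m * cmod t \<le> cmod (x - y)"
proof -
  define W where "W = {\<rho>. fi (0, \<rho>) = 0}"
  have W: "finite W" "card W = d" using fi_roots by (simp_all add: W_def)
  obtain \<eta> where \<eta>: "\<eta> > 0" "\<And>w w'. w \<in> W \<Longrightarrow> w' \<in> W \<Longrightarrow> w \<noteq> w' \<Longrightarrow> 3 * \<eta> \<le> cmod (w - w')"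
    using separated[OF W(1)] by metis
  obtain e r where r: "e > 0" "\<And>w. w \<in> W \<Longrightarrow> r w holomorphic_on ball 0 e" "\<And>w. w \<in> W \<Longrightarrow> r w 0 = w"
    "\<And>w t. w \<in> W \<Longrightarrow> t \<in> ball 0 e \<Longrightarrow> fi (t, r w t) = 0"
    "\<And>w t. w \<in> W \<Longrightarrow> t \<in> ball 0 e \<Longrightarrow> cmod (r w t - w) < \<eta>"
  proof (rule branches[OF polyfun_fi W(1) \<eta>(1), of 0])
    show "fi (0, w) = 0" if "w \<in> W" for w using that by (simp add: W_def)
    show "\<exists>D. D \<noteq> 0 \<and> ((\<lambda>y. fi (0, y)) has_field_derivative D) (at w)" if "w \<in> W" for w
      using that fi_simple by (simp add: W_def)
  qed (rule that; assumption)
  obtain K0 where K0: "\<And>t. t \<in> E \<Longrightarrow> cmod t \<le> K0" using finite_imp_bounded[OF finite_E] bounded_iff by metis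
  define K where "K = max (max 1 K0) (1 / e)"
  show ?thesis
  proof (rule that[of K \<eta>])
    show "K > 0" by (simp add: K_def less_max_iff_disj)
    show "t \<notin> E" if "K < cmod t" for t using K0[of t] that by (auto simp: K_def)
    fix t x y assume t: "K < cmod t" and xy: "x \<in> roots t" "y \<in> roots t" "x \<noteq> y"
    have t0: "t \<noteq> 0" using t by (auto simp: K_def)
    have "1 / e < cmod t" using t by (simp add: K_def)
    then have s: "1 / t \<in> ball 0 e" using r(1) t0 by (simp add: norm_divide field_simps)
    have rr: "\<eta> \<le> cmod (r w (1 / t) - r w' (1 / t))" if "w \<in> W" "w' \<in> W" "w \<noteq> w'" for w w'
    proof -
      have "3 * \<eta> \<le> cmod (w - w')" using \<eta>(2)[of w w'] that by auto
      also have "w - w' = (r w (1 / t) - r w' (1 / t)) - ((r w (1 / t) - w) - (r w' (1 / t) - w'))" by simp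
      also have "cmod \<dots> \<le> cmod (r w (1 / t) - r w' (1 / t)) + (cmod (r w (1 / t) - w) + cmod (r w' (1 / t) - w'))"
        by (meson add_left_mono norm_triangle_ineq4 order_trans)
      finally show ?thesis using r(5)[OF that(1) s] r(5)[OF that(2) s] by simp
    qed
    have inj: "inj_on (\<lambda>w. t * r w (1 / t)) W"
    proof (rule inj_onI, rule ccontr)
      fix w w' assume "w \<in> W" "w' \<in> W" "t * r w (1 / t) = t * r w' (1 / t)" "w \<noteq> w'"
      then show False using rr[of w w'] t0 \<eta>(1) by simp
    qed
    have "roots t = (\<lambda>w. t * r w (1 / t)) ` W"
    proof (rule roots_eqI)
      show "(\<lambda>w. t * r w (1 / t)) ` W \<subseteq> roots t"
        using r(4)[OF _ s] t0 by (auto simp: roots_def fi)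
      show "card ((\<lambda>w. t * r w (1 / t)) ` W) = d" using W by (simp add: card_image[OF inj])
    qed
    then obtain w w' where w: "w \<in> W" "w' \<in> W" "x = t * r w (1 / t)" "y = t * r w' (1 / t)" using xy by blast
    then have "\<eta> \<le> cmod (r w (1 / t) - r w' (1 / t))" using rr xy(3) by blast
    then have "\<eta> * cmod t \<le> cmod (r w (1 / t) - r w' (1 / t)) * cmod t" by (intro mult_right_mono) auto
    also have "\<dots> = cmod (x - y)" by (simp add: w(3,4) right_diff_distrib[symmetric] norm_mult)
    finally show "\<eta> * cmod t \<le> cmod (x - y)" .
  qed (rule \<eta>(1))
qed

text \<open>If at every point some transposition were missing, \<open>1 / R\<close> would extend to an entire function
  that vanishes at infinity.\<close>

lemma all_transpositions: "\<exists>t. t \<notin> E \<and> N t = {}"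
proof (rule ccontr)
  assume "\<not> ?thesis"
  then have ne: "N t \<noteq> {}" if "t \<notin> E" for t using that by blast
  have "(\<lambda>t. 1 / R t) holomorphic_on - E"
    by (intro holomorphic_on_divide holomorphic_on_const R_holomorphic) (simp add: R_nz)
  then obtain k where k: "k holomorphic_on UNIV" "\<And>z. z \<notin> E \<Longrightarrow> k z = 1 / R z"
    using removable_finite[OF finite_E _ R_near_branch_point] by blast
  obtain K m where K: "K > 0" "m > 0" "\<And>t. K < cmod t \<Longrightarrow> t \<notin> E"
    "\<And>t x y. K < cmod t \<Longrightarrow> x \<in> roots t \<Longrightarrow> y \<in> roots t \<Longrightarrow> x \<noteq> y \<Longrightarrow> m * cmod t \<le> cmod (x - y)"
    by (rule roots_far_apart) (rule that; assumption)
  have bound: "cmod (k t) \<le> 1 / (m * cmod t)" if t: "max K (1 / m) < cmod t" for t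
  proof -
    have tE: "t \<notin> E" using K(3) t by simp
    have mt: "1 \<le> m * cmod t" using t K(2) by (simp add: field_simps)
    \<comment> \<open>At least one pair is missing and the base is at least 1, so the product of the
      distances is no smaller than one factor.\<close>
    have "m * cmod t \<le> (m * cmod t) ^ card (N t)"
      using mt ne[OF tE] finite_N[of t] by (intro self_le_power) (auto simp: card_gt_0_iff)
    also have "\<dots> \<le> cmod (R t)"
      using K(4)[of t] t mt by (intro R_lower) (auto simp: N_def)
    finally have "1 / cmod (R t) \<le> 1 / (m * cmod t)" using mt by (intro frac_le) auto
    then show ?thesis using k(2)[OF tE] by (simp add: norm_divide)
  qed
  have "(k \<longlongrightarrow> 0) at_infinity"
  proof (rule Lim_at_infinityI)
    fix \<epsilon> :: real assume \<epsilon>: "\<epsilon> > 0"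
    show "\<exists>b. \<forall>t. b \<le> cmod t \<longrightarrow> dist (k t) 0 \<le> \<epsilon>"
    proof (intro exI allI impI)
      fix t assume t: "max K (1 / m) + 1 + 1 / (m * \<epsilon>) \<le> cmod t"
      have "1 / (m * \<epsilon>) > 0" using K(2) \<epsilon> by simp
      then have t1: "max K (1 / m) < cmod t" using t by linarith
      have "max K (1 / m) > 0" using K(1) by (simp add: less_max_iff_disj)
      then have "1 / (m * \<epsilon>) \<le> cmod t" using t by linarith
      then have "1 / (m * cmod t) \<le> \<epsilon>" using K(2) \<epsilon> t1 K(1) by (simp add: field_simps)
      then show "dist (k t) 0 \<le> \<epsilon>" using bound[OF t1] by simp
    qed
  qed
  then have z: "k t = 0" for t by (rule Liouville_weak_0[OF k(1)])
  obtain t where "t \<notin> E" using ex_new_if_finite[OF infinite_UNIV_char_0 finite_E] by blast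
  then show False using k(2)[of t] z[of t] R_nz[of t] by simp
qed

text \<open>Transports compose, and the transpositions generate the symmetric group.\<close>

theorem full_monodromy:
  obtains t where "t \<notin> E" "\<And>\<sigma>. \<sigma> permutes roots t \<Longrightarrow> transport t t \<sigma>"
proof -
  obtain t where t: "t \<notin> E" "N t = {}" using all_transpositions by blast
  have tr: "transport t t (Transposition.transpose a b)" if "a \<in> roots t" "b \<in> roots t" "a \<noteq> b" for a b
  proof -
    have "(a, b) \<notin> N t" using t(2) by simp
    then show ?thesis using that by (simp add: N_def)
  qed
  have "transport t t \<sigma>" if "\<sigma> permutes roots t" for \<sigma>
    using that finite_roots[of t]
  proof (induction rule: permutes_induct)
    case id
    show ?case using transport_refl[OF t(1)] by (simp add: id_def)
  next
    case (swap a b p)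
    show ?case using transport_comp[OF swap.IH tr[OF swap.hyps(1-3)]] by (simp add: comp_def)
  qed
  then show ?thesis using that t(1) by blast
qed

end

subsection \<open>Homogeneous polynomials and polynomial functions\<close>

lemma peval_superset:
  assumes "finite S" "Poly_Mapping.keys F \<subseteq> S"
  shows "peval F a = (\<Sum>m\<in>S. Poly_Mapping.lookup F m * (\<Prod>i\<in>UNIV. a $ i ^ Poly_Mapping.lookup m i))"
  unfolding peval_def by (rule sum.mono_neutral_left) (use assms in \<open>auto simp: in_keys_iff\<close>)

lemma peval_add: "peval (F + G) a = peval F a + peval G a"
proof -
  have "finite (Poly_Mapping.keys F \<union> Poly_Mapping.keys G)" by simp
  then show ?thesis
    using peval_superset[of "Poly_Mapping.keys F \<union> Poly_Mapping.keys G" _ a] keys_add[of F G]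
    by (simp add: lookup_add algebra_simps sum.distrib)
qed

lemma peval_0 [simp]: "peval 0 a = 0"
  by (simp add: peval_def)

lemma peval_sum: "peval (\<Sum>i\<in>I. F i) a = (\<Sum>i\<in>I. peval (F i) a)"
  by (induction I rule: infinite_finite_induct) (auto simp: peval_add)

lemma peval_single: "peval (Poly_Mapping.single m c) a = c * (\<Prod>i\<in>UNIV. a $ i ^ Poly_Mapping.lookup m i)"
proof -
  have "peval (Poly_Mapping.single m c) a =
      (\<Sum>m'\<in>{m}. Poly_Mapping.lookup (Poly_Mapping.single m c) m' * (\<Prod>i\<in>UNIV. a $ i ^ Poly_Mapping.lookup m' i))"
    by (rule peval_superset) auto
  then show ?thesis by simp
qed

lemma sum_monomials: "(\<Sum>m\<in>Poly_Mapping.keys F. Poly_Mapping.single m (Poly_Mapping.lookup F m)) = F"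
proof (rule poly_mapping_eqI)
  fix k
  have "Poly_Mapping.lookup (\<Sum>m\<in>Poly_Mapping.keys F. Poly_Mapping.single m (Poly_Mapping.lookup F m)) k =
      (\<Sum>m\<in>Poly_Mapping.keys F. if m = k then Poly_Mapping.lookup F k else 0)"
    unfolding lookup_sum by (intro sum.cong) (auto simp: lookup_single when_def)
  then show "Poly_Mapping.lookup (\<Sum>m\<in>Poly_Mapping.keys F. Poly_Mapping.single m (Poly_Mapping.lookup F m)) k =
      Poly_Mapping.lookup F k"
    by (simp add: in_keys_iff)
qed

lemma peval_mult: "peval (F * G) a = peval F a * peval G a"
proof -
  have "peval (F * G) a = peval ((\<Sum>m\<in>Poly_Mapping.keys F. Poly_Mapping.single m (Poly_Mapping.lookup F m)) *
      (\<Sum>m\<in>Poly_Mapping.keys G. Poly_Mapping.single m (Poly_Mapping.lookup G m))) a"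
    by (simp only: sum_monomials)
  also have "\<dots> = peval F a * peval G a"
    unfolding sum_product peval_sum mult_single peval_single peval_def[of F] peval_def[of G]
    by (intro sum.cong refl) (simp add: lookup_add power_add prod.distrib)
  finally show ?thesis .
qed

lemma peval_scale:
  assumes "homogeneous d F"
  shows "peval F (k *s a) = k ^ d * peval F a"
proof -
  have "(\<Prod>i\<in>UNIV. (k *s a) $ i ^ Poly_Mapping.lookup m i) = k ^ d * (\<Prod>i\<in>UNIV. a $ i ^ Poly_Mapping.lookup m i)"
    if "m \<in> Poly_Mapping.keys F" for m
  proof -
    have "(\<Sum>i\<in>UNIV. Poly_Mapping.lookup m i) = d" using assms that by (simp add: homogeneous_def)
    then show ?thesis by (auto simp: power_mult_distrib prod.distrib power_sum)
  qed
  then show ?thesis unfolding peval_def sum_distrib_left by (intro sum.cong) auto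
qed

lemma polyfun_peval: "polyfun (peval F)"
  unfolding peval_def by (intro polyfun_sum polyfun_mult polyfun_prod polyfun_power polyfun_nth polyfun_const)

lemma homogeneous_sum: "(\<And>i. i \<in> I \<Longrightarrow> homogeneous d (F i)) \<Longrightarrow> homogeneous d (\<Sum>i\<in>I. F i)"
proof (induction I rule: infinite_finite_induct)
  case (insert x I)
  then have "homogeneous d (F x)" "homogeneous d (\<Sum>i\<in>I. F i)" by auto
  then show ?case using insert(1,2) keys_add[of "F x" "\<Sum>i\<in>I. F i"] unfolding homogeneous_def by auto
qed (auto simp: homogeneous_def)

lemma homogeneous_mult: "homogeneous d F \<Longrightarrow> homogeneous d' G \<Longrightarrow> homogeneous (d + d') (F * G)"
  unfolding homogeneous_def using keys_mult[of F G]
  by (force simp: lookup_add sum.distrib)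

text \<open>Elimination produces polynomial functions, while Zariski closed sets are cut out by
  forms. Restriction to the ray \<open>k *s a\<close> gives a polynomial in \<open>k\<close> whose
  coefficients are the homogeneous components.\<close>

lemma homogeneous_components:
  fixes G :: "complex ^ 4 \<Rightarrow> complex"
  assumes "polyfun G"
  obtains C q where "\<And>e. homogeneous e (C e)" "\<And>a k. G (k *s a) = poly (q a) k" "\<And>a e. coeff (q a) e = peval (C e) a"
proof -
  have "\<exists>C q. (\<forall>e. homogeneous e (C e)) \<and> (\<forall>a k. G (k *s a) = poly (q a) k) \<and> (\<forall>a e. coeff (q a) e = peval (C e) a)"
    using assms
  proof induction
    case (polyfun_const c)
    have "homogeneous e (if e = 0 then Poly_Mapping.single 0 c else 0)" for e
      by (simp add: homogeneous_def)
    moreover have "coeff [:c:] e = peval (if e = 0 then Poly_Mapping.single 0 c else 0) a" for e a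
      by (simp add: peval_single coeff_pCons split: nat.split)
    ultimately show ?case
      by (intro exI[of _ "\<lambda>e. if e = 0 then Poly_Mapping.single 0 c else 0"] exI[of _ "\<lambda>_. [:c:]"]) simp
  next
    case (polyfun_coord c)
    then obtain i where i: "c = (\<lambda>a. a $ i)" by (auto simp: coords_vec_def coords_complex_def)
    let ?X = "\<lambda>e::nat. if e = 1 then Poly_Mapping.single (Poly_Mapping.single i (1::nat)) (1::complex) else 0"
    have "homogeneous e (?X e)" for e
      by (simp add: homogeneous_def lookup_single when_def)
    moreover have "coeff [:0, a $ i:] e = peval (?X e) a" for e a
    proof -
      have "(\<Prod>j\<in>UNIV. a $ j ^ Poly_Mapping.lookup (Poly_Mapping.single i (1::nat)) j) = (\<Prod>j\<in>UNIV. if j = i then a $ i else 1)"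
        by (intro prod.cong) (auto simp: lookup_single when_def)
      then show ?thesis by (simp add: peval_single coeff_pCons split: nat.split)
    qed
    ultimately show ?case unfolding i by (intro exI[of _ ?X] exI[of _ "\<lambda>a. [:0, a $ i:]"]) simp
  next
    case (polyfun_add f g)
    then obtain C q C' q' where *: "\<forall>e. homogeneous e (C e)" "\<forall>a k. f (k *s a) = poly (q a) k" "\<forall>a e. coeff (q a) e = peval (C e) a"
      "\<forall>e. homogeneous e (C' e)" "\<forall>a k. g (k *s a) = poly (q' a) k" "\<forall>a e. coeff (q' a) e = peval (C' e) a" by blast
    have "homogeneous e (C e + C' e)" for e
      using homogeneous_sum[of "UNIV :: bool set" e "\<lambda>b. if b then C e else C' e"] *(1,4) by (simp add: UNIV_bool add.commute)
    then show ?case using * by (intro exI[of _ "\<lambda>e. C e + C' e"] exI[of _ "\<lambda>a. q a + q' a"]) (simp add: peval_add)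
  next
    case (polyfun_mult f g)
    then obtain C q C' q' where *: "\<forall>e. homogeneous e (C e)" "\<forall>a k. f (k *s a) = poly (q a) k" "\<forall>a e. coeff (q a) e = peval (C e) a"
      "\<forall>e. homogeneous e (C' e)" "\<forall>a k. g (k *s a) = poly (q' a) k" "\<forall>a e. coeff (q' a) e = peval (C' e) a" by blast
    have "homogeneous e (\<Sum>i\<le>e. C i * C' (e - i))" for e
    proof (rule homogeneous_sum)
      fix i assume "i \<in> {..e}"
      then show "homogeneous e (C i * C' (e - i))"
        using homogeneous_mult[of i "C i" "e - i" "C' (e - i)"] *(1,4) by simp
    qed
    then show ?case using *
      by (intro exI[of _ "\<lambda>e. \<Sum>i\<le>e. C i * C' (e - i)"] exI[of _ "\<lambda>a. q a * q' a"])
         (simp add: peval_sum peval_mult coeff_mult)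
  qed
  then show ?thesis using that by blast
qed

section \<open>Restriction to lines and elimination\<close>

lemma polyfun_along_line:
  fixes h :: "complex ^ 'n \<Rightarrow> complex"
  assumes "polyfun h"
  obtains q where "\<And>a w. h (a + w *s v) = poly (q a) w" "\<And>k. polyfun (\<lambda>a. coeff (q a) k)"
proof -
  have "\<exists>q. (\<forall>a w. h (a + w *s v) = poly (q a) w) \<and> (\<forall>k. polyfun (\<lambda>a. coeff (q a) k))"
    using assms
  proof induction
    case (polyfun_const c)
    show ?case by (intro exI[of _ "\<lambda>_. [:c:]"]) auto
  next
    case (polyfun_coord c)
    then obtain i where i: "c = (\<lambda>a. a $ i)" by (auto simp: coords_vec_def coords_complex_def)
    have "polyfun (\<lambda>a. coeff [:a $ i, v $ i:] k)" for k
      using polyfun_nth[of i] by (cases k) (simp_all add: coeff_pCons)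
    then show ?case unfolding i by (intro exI[of _ "\<lambda>a. [:a $ i, v $ i:]"]) (simp add: mult.commute)
  next
    case (polyfun_add f g)
    then obtain q q' where "\<forall>a w. f (a + w *s v) = poly (q a) w" "\<forall>k. polyfun (\<lambda>a. coeff (q a) k)"
      "\<forall>a w. g (a + w *s v) = poly (q' a) w" "\<forall>k. polyfun (\<lambda>a. coeff (q' a) k)" by blast
    then show ?case by (intro exI[of _ "\<lambda>a. q a + q' a"]) (auto simp: polyfun.polyfun_add)
  next
    case (polyfun_mult f g)
    then obtain q q' where "\<forall>a w. f (a + w *s v) = poly (q a) w" "\<forall>k. polyfun (\<lambda>a. coeff (q a) k)"
      "\<forall>a w. g (a + w *s v) = poly (q' a) w" "\<forall>k. polyfun (\<lambda>a. coeff (q' a) k)" by blast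
    then show ?case
      by (intro exI[of _ "\<lambda>a. q a * q' a"]) (auto simp: coeff_mult intro!: polyfun_sum polyfun.polyfun_mult)
  qed
  then show ?thesis using that by blast
qed

text \<open>Elimination of all but the first unknown, without fractions so that the coefficients stay
  polynomial.\<close>

lemma eliminate_unknowns:
  fixes M :: "nat \<Rightarrow> nat \<Rightarrow> 'a::affine_space \<Rightarrow> complex" and v :: "nat \<Rightarrow> 'b \<Rightarrow> complex" and \<pi> :: "'b \<Rightarrow> 'a"
  assumes "\<And>i j. i < Suc n \<Longrightarrow> j < Suc n \<Longrightarrow> polyfun (M i j)"
    and "\<And>i j. i < Suc n \<Longrightarrow> j < Suc n \<Longrightarrow> M i j a0 = (if i = j then 1 else 0)"
    and "\<And>i x. i < Suc n \<Longrightarrow> x \<in> X \<Longrightarrow> (\<Sum>j<Suc n. M i j (\<pi> x) * v j x) = 0"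
  shows "\<exists>G. polyfun G \<and> G a0 = 1 \<and> (\<forall>x\<in>X. G (\<pi> x) * v 0 x = 0)"
  using assms
proof (induction n arbitrary: M)
  case 0
  show ?case using 0(1)[of 0 0] 0(2)[of 0 0] 0(3)[of 0] by (intro exI[of _ "M 0 0"]) simp
next
  case (Suc n)
  define N where "N = Suc n"
  \<comment> \<open>The last unknown is eliminated by cross-multiplication; the pivot is 1 at
    \<open>a0\<close>, so the reduced matrix is again the identity there.\<close>
  define M' where "M' i j a = M N N a * M i j a - M i N a * M N j a" for i j a
  show ?case
  proof (rule Suc.IH[of M'])
    fix i j assume ij: "i < Suc n" "j < Suc n"
    then have lt: "i < Suc (Suc n)" "j < Suc (Suc n)" "N < Suc (Suc n)" "i \<noteq> N" "j \<noteq> N" by (auto simp: N_def)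
    show "polyfun (M' i j)"
      unfolding M'_def by (intro polyfun_diff polyfun_mult Suc.prems(1) lt)
    show "M' i j a0 = (if i = j then 1 else 0)"
      unfolding M'_def by (simp add: Suc.prems(2) lt)
  next
    fix i x assume i: "i < Suc n" and x: "x \<in> X"
    have s: "(\<Sum>j<Suc n. M k j (\<pi> x) * v j x) = - M k N (\<pi> x) * v N x" if "k < Suc (Suc n)" for k
    proof -
      have "(\<Sum>j<Suc n. M k j (\<pi> x) * v j x) + M k N (\<pi> x) * v N x = 0"
        using Suc.prems(3)[OF that x] unfolding sum.lessThan_Suc[of _ "Suc n"] N_def .
      then show ?thesis by (simp add: eq_neg_iff_add_eq_0)
    qed
    have "(\<Sum>j<Suc n. M' i j (\<pi> x) * v j x) =
        M N N (\<pi> x) * (\<Sum>j<Suc n. M i j (\<pi> x) * v j x) - M i N (\<pi> x) * (\<Sum>j<Suc n. M N j (\<pi> x) * v j x)"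
      unfolding M'_def sum_distrib_left sum_subtractf[symmetric] by (intro sum.cong) (auto simp: algebra_simps)
    also have "\<dots> = 0" using i by (subst (1 2) s) (auto simp: N_def)
    finally show "(\<Sum>j<Suc n. M' i j (\<pi> x) * v j x) = 0" .
  qed
qed

lemma bezout_without_common_root:
  fixes p q :: "complex poly"
  assumes "p \<noteq> 0" "\<And>w. poly p w = 0 \<Longrightarrow> poly q w \<noteq> 0"
  obtains u v where "u * p + v * q = 1"
proof -
  define I where "I = {u * p + v * q |u v. True}"
  have p: "p \<in> I" unfolding I_def by (metis (mono_tags, lifting) add.right_neutral mem_Collect_eq mult_1 mult_zero_left)
  have q: "q \<in> I" unfolding I_def by (metis (mono_tags, lifting) add.left_neutral mem_Collect_eq mult_1 mult_zero_left)
  obtain g where g: "g \<in> I" "g \<noteq> 0" and least: "\<And>h. h \<in> I \<Longrightarrow> h \<noteq> 0 \<Longrightarrow> degree g \<le> degree h"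
    using ex_has_least_nat[of "\<lambda>h. h \<in> I \<and> h \<noteq> 0" p degree] p assms(1) by blast
  have dvd: "g dvd h" if h: "h \<in> I" for h
  proof -
    obtain u v u' v' where uv: "h = u * p + v * q" "g = u' * p + v' * q" using h g(1) unfolding I_def by blast
    define k where "k = h div g"
    have hk: "h mod g = h - g * k" by (simp add: k_def minus_mult_div_eq_mod)
    have "h - g * k = (u - u' * k) * p + (v - v' * k) * q"
      unfolding uv(1) uv(2) by (simp add: algebra_simps)
    then have "h mod g \<in> I" unfolding hk I_def by blast
    then have "h mod g = 0" using least[of "h mod g"] degree_mod_less[OF g(2), of h] by force
    then show ?thesis by (simp add: mod_eq_0_iff_dvd)
  qed
  have "degree g = 0"
  proof (rule ccontr)
    assume "degree g \<noteq> 0"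
    then obtain w where "poly g w = 0"
      using fundamental_theorem_of_algebra[of g] constant_degree[of g] by auto
    then have "poly p w = 0" "poly q w = 0"
      using dvd[OF p] dvd[OF q] by (auto simp: dvd_def)
    then show False using assms(2) by blast
  qed
  then obtain c where c: "g = [:c:]" by (rule degree_eq_zeroE)
  then have "c \<noteq> 0" using g(2) by auto
  obtain u v where g_uv: "g = u * p + v * q" using g(1) unfolding I_def by blast
  have "smult (1 / c) u * p + smult (1 / c) v * q = smult (1 / c) g"
    unfolding g_uv by (simp add: smult_add_right)
  also have "\<dots> = 1" using c \<open>c \<noteq> 0\<close> by (simp add: one_pCons)
  finally have "smult (1 / c) u * p + smult (1 / c) v * q = 1" .
  then show ?thesis using that by blast
qed

text \<open>On the common zeros of \<open>P a\<close> and \<open>Q a\<close>, a Bezout relation at \<open>a0\<close> expresses each power of \<open>w\<close> by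
  the powers below the degree of \<open>P\<close>, with coefficients that vanish at \<open>a0\<close>, as in Nakayama's lemma.\<close>

lemma elimination:
  fixes P Q :: "'a::affine_space \<Rightarrow> complex poly"
  assumes P: "\<And>k. polyfun (\<lambda>a. coeff (P a) k)" and deg: "\<And>a. degree (P a) = Suc n" and lead: "\<And>a. coeff (P a) (Suc n) = c"
    and Q: "\<And>k. polyfun (\<lambda>a. coeff (Q a) k)" and degQ: "\<And>a. degree (Q a) \<le> n"
    and a0: "\<And>w. poly (P a0) w = 0 \<Longrightarrow> poly (Q a0) w \<noteq> 0"
  shows "\<exists>G. polyfun G \<and> G a0 = 1 \<and> (\<forall>a w. poly (P a) w = 0 \<longrightarrow> poly (Q a) w = 0 \<longrightarrow> G a = 0)"
proof -
  define X where "X = {(a, w). poly (P a) w = 0 \<and> poly (Q a) w = 0}"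
  \<comment> \<open>Membership in the submodule of Nakayama's lemma: the powers of \<open>w\<close>
    below the degree generate the module, and the coefficients lie in the ideal of functions
    vanishing at \<open>a0\<close>.\<close>
  define small where "small h \<longleftrightarrow> (\<exists>m. (\<forall>j. polyfun (m j) \<and> m j a0 = 0) \<and>
    (\<forall>a w. (a, w) \<in> X \<longrightarrow> h a w = (\<Sum>j<Suc n. m j a * w ^ j)))" for h :: "'a \<Rightarrow> complex \<Rightarrow> complex"
  have c0: "c \<noteq> 0" using deg[of a0] lead[of a0] by (metis coeff_eq_0 degree_0 leading_coeff_0_iff nat.distinct(1))
  have small_cong: "small h'" if "small h" "\<And>a w. (a, w) \<in> X \<Longrightarrow> h' a w = h a w" for h h'
  proof -
    obtain m where "\<forall>j. polyfun (m j) \<and> m j a0 = 0" "\<forall>a w. (a, w) \<in> X \<longrightarrow> h a w = (\<Sum>j<Suc n. m j a * w ^ j)"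
      using \<open>small h\<close> unfolding small_def by blast
    then show ?thesis using that(2) unfolding small_def by (intro exI[of _ m]) (simp del: sum.lessThan_Suc)
  qed
  have small_add: "small (\<lambda>a w. h a w + h' a w)" if "small h" "small h'" for h h'
  proof -
    obtain m m' where m: "\<forall>j. polyfun (m j) \<and> m j a0 = 0" "\<forall>a w. (a, w) \<in> X \<longrightarrow> h a w = (\<Sum>j<Suc n. m j a * w ^ j)"
      "\<forall>j. polyfun (m' j) \<and> m' j a0 = 0" "\<forall>a w. (a, w) \<in> X \<longrightarrow> h' a w = (\<Sum>j<Suc n. m' j a * w ^ j)"
      using \<open>small h\<close> \<open>small h'\<close> unfolding small_def by blast
    show ?thesis unfolding small_def
      by (rule exI[of _ "\<lambda>j a. m j a + m' j a"]) (use m in \<open>auto simp: sum.distrib distrib_right simp del: sum.lessThan_Suc\<close>)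
  qed
  have small_const: "small (\<lambda>a w. B a)" if "polyfun B" "B a0 = 0" for B
    unfolding small_def
  proof (intro exI[of _ "\<lambda>j a. if j = 0 then B a else 0"] conjI allI)
    show "polyfun (\<lambda>a. if j = 0 then B a else 0)" for j using that(1) by (cases "j = 0") auto
    have "(\<Sum>j<Suc n. (if j = 0 then B a else 0) * w ^ j) = B a" for a w
      unfolding sum.lessThan_Suc_shift by simp
    then show "(a, w) \<in> X \<longrightarrow> B a = (\<Sum>j<Suc n. (if j = 0 then B a else 0) * w ^ j)" for a w by metis
  qed (use that(2) in simp)
  have small_w: "small (\<lambda>a w. w * h a w)" if h: "small h" for h
  proof -
    obtain m where m: "\<And>j. polyfun (m j)" "\<And>j. m j a0 = 0" "\<forall>a w. (a, w) \<in> X \<longrightarrow> h a w = (\<Sum>j<Suc n. m j a * w ^ j)"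
      using h unfolding small_def by blast
    \<comment> \<open>Multiplication by \<open>w\<close> shifts the coefficients; the overflow at
      \<open>w ^ Suc n\<close> is reduced by \<open>P\<close>, which is possible because its leading
      coefficient is a nonzero constant.\<close>
    define m' where "m' j a = (case j of 0 \<Rightarrow> 0 | Suc i \<Rightarrow> m i a) - m n a * (coeff (P a) j / c)" for j a
    show ?thesis unfolding small_def
    proof (rule exI[of _ m'], intro conjI allI impI)
      show "polyfun (m' j)" for j
        unfolding m'_def by (cases j) (auto intro!: polyfun_diff polyfun_mult polyfun_divide P m(1))
      show "m' j a0 = 0" for j unfolding m'_def using m(2) by (cases j) auto
      fix a w assume z: "(a, w) \<in> X"
      show "w * h a w = (\<Sum>j<Suc n. m' j a * w ^ j)"
      proof -
        have "poly (P a) w = 0" using z by (simp add: X_def)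
        then have "c * w ^ Suc n = - (\<Sum>j<Suc n. coeff (P a) j * w ^ j)"
          using lead[of a] by (simp add: poly_altdef deg lessThan_Suc_atMost[symmetric] sum.lessThan_Suc[of _ "Suc n"]
              eq_neg_iff_add_eq_0 add.commute del: sum.lessThan_Suc)
        then have top: "w ^ Suc n = - (\<Sum>j<Suc n. coeff (P a) j * w ^ j) / c" using c0 by (simp add: field_simps)
        have "w * h a w = (\<Sum>j<Suc n. m j a * w ^ Suc j)"
          using m(3) z by (simp add: sum_distrib_left mult.left_commute del: sum.lessThan_Suc)
        also have "\<dots> = (\<Sum>j<n. m j a * w ^ Suc j) + m n a * w ^ Suc n" by simp
        also have "(\<Sum>j<n. m j a * w ^ Suc j) = (\<Sum>j<Suc n. (case j of 0 \<Rightarrow> 0 | Suc i \<Rightarrow> m i a) * w ^ j)"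
          unfolding sum.lessThan_Suc_shift by simp
        also have "m n a * w ^ Suc n = - (\<Sum>j<Suc n. m n a * (coeff (P a) j / c) * w ^ j)"
          unfolding top by (simp add: sum_distrib_left sum_divide_distrib mult.assoc del: sum.lessThan_Suc)
        finally show ?thesis unfolding m'_def by (simp add: sum_subtractf left_diff_distrib del: sum.lessThan_Suc)
      qed
    qed
  qed
  have small_poly: "small (\<lambda>a w. poly q w * h a w)" if h: "small h" for q h
  proof (induction q)
    case 0
    show ?case using small_const[of "\<lambda>_. 0"] by simp
  next
    case (pCons b q)
    have "small (\<lambda>a w. b * h a w)"
    proof -
      obtain m where m: "\<And>j. polyfun (m j)" "\<And>j. m j a0 = 0" "\<forall>a w. (a, w) \<in> X \<longrightarrow> h a w = (\<Sum>j<Suc n. m j a * w ^ j)"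
        using h unfolding small_def by blast
      show ?thesis unfolding small_def
        by (intro exI[of _ "\<lambda>j a. b * m j a"]) (use m in \<open>auto simp: sum_distrib_left mult.assoc simp del: sum.lessThan_Suc\<close>)
    qed
    from small_add[OF this small_w[OF pCons(2)]] show ?case by (simp add: algebra_simps)
  qed
  have small_diff: "small (\<lambda>a w. \<Sum>k<K. (coeff (R a0) k - coeff (R a) k) * w ^ k)"
    if "\<And>k. polyfun (\<lambda>a. coeff (R a) k)" for R :: "'a \<Rightarrow> complex poly" and K
  proof (induction K)
    case 0
    show ?case using small_const[of "\<lambda>_. 0"] by simp
  next
    case (Suc K)
    have "small (\<lambda>a w. coeff (R a0) K - coeff (R a) K)"
      by (intro small_const polyfun_diff polyfun_const that) simp
    from small_add[OF Suc small_poly[OF this, of "monom 1 K"]] show ?case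
      by (simp add: poly_monom mult.commute)
  qed
  have diff: "poly (R a0) w - poly (R a) w = (\<Sum>k<Suc (Suc n). (coeff (R a0) k - coeff (R a) k) * w ^ k)"
    if "\<And>a. degree (R a) \<le> Suc n" for R :: "'a \<Rightarrow> complex poly" and a w
  proof -
    have "poly (R a) w = (\<Sum>k<Suc (Suc n). coeff (R a) k * w ^ k)" for a
      unfolding poly_altdef lessThan_Suc_atMost
      by (rule sum.mono_neutral_left) (use that[of a] in \<open>auto simp: coeff_eq_0\<close>)
    then show ?thesis by (simp add: sum_subtractf left_diff_distrib del: sum.lessThan_Suc)
  qed
  obtain u v where uv: "u * P a0 + v * Q a0 = 1"
  proof (rule bezout_without_common_root[of "P a0" "Q a0"])
    show "P a0 \<noteq> 0" using deg[of a0] by auto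
  qed (use a0 in auto)
  have "small (\<lambda>a w. w ^ i)" for i
  proof -
    have dP: "\<And>a. degree (P a) \<le> Suc n" "\<And>a. degree (Q a) \<le> Suc n" using deg degQ by (simp_all add: le_SucI)
    \<comment> \<open>The Bezout relation at \<open>a0\<close>, multiplied by \<open>w ^ i\<close>.
      On \<open>X\<close> the values of \<open>P a\<close> and \<open>Q a\<close> vanish and may be
      subtracted, and the differences have coefficients that vanish at \<open>a0\<close>.\<close>
    have "small (\<lambda>a w. poly (monom 1 i * u) w * (poly (P a0) w - poly (P a) w) +
        poly (monom 1 i * v) w * (poly (Q a0) w - poly (Q a) w))"
      unfolding diff[of P, OF dP(1)] diff[of Q, OF dP(2)]
      by (intro small_add small_poly small_diff P Q)
    then show ?thesis
    proof (rule small_cong)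
      fix a w assume "(a, w) \<in> X"
      then have 0: "poly (P a) w = 0" "poly (Q a) w = 0" by (auto simp: X_def)
      have "poly u w * poly (P a0) w + poly v w * poly (Q a0) w = 1"
        using arg_cong[OF uv, of "\<lambda>p. poly p w"] by simp
      then have "w ^ i = w ^ i * (poly u w * poly (P a0) w + poly v w * poly (Q a0) w)" by simp
      then show "w ^ i = poly (monom 1 i * u) w * (poly (P a0) w - poly (P a) w) +
        poly (monom 1 i * v) w * (poly (Q a0) w - poly (Q a) w)"
        using 0 by (simp add: poly_monom algebra_simps)
    qed
  qed
  then have "\<forall>i. \<exists>m. (\<forall>j. polyfun (m j) \<and> m j a0 = 0) \<and> (\<forall>a w. (a, w) \<in> X \<longrightarrow> w ^ i = (\<Sum>j<Suc n. m j a * w ^ j))"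
    unfolding small_def by blast
  then obtain m where m: "\<And>i j. polyfun (m i j)" "\<And>i j. m i j a0 = 0"
    "\<And>i a w. (a, w) \<in> X \<Longrightarrow> w ^ i = (\<Sum>j<Suc n. m i j a * w ^ j)"
    using choice[of "\<lambda>i m. (\<forall>j. polyfun (m j) \<and> m j a0 = 0) \<and> (\<forall>a w. (a, w) \<in> X \<longrightarrow> w ^ i = (\<Sum>j<Suc n. m j a * w ^ j))"] by blast
  \<comment> \<open>The determinant trick: the identity minus a matrix vanishing at
    \<open>a0\<close> annihilates the powers of \<open>w\<close>. The unknown that survives the
    elimination is \<open>w ^ 0 = 1\<close>, so the equation left over says that \<open>G\<close>
    vanishes.\<close>
  have "\<exists>G. polyfun G \<and> G a0 = 1 \<and> (\<forall>z\<in>X. G (fst z) * snd z ^ 0 = 0)"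
  proof (rule eliminate_unknowns[of n "\<lambda>i j a. (if i = j then 1 else 0) - m i j a" a0 X fst "\<lambda>j z. snd z ^ j"])
    show "polyfun (\<lambda>a. (if i = j then 1 else 0) - m i j a)" for i j by (intro polyfun_diff polyfun_const m)
    show "(\<Sum>j<Suc n. ((if i = j then 1 else 0) - m i j (fst z)) * snd z ^ j) = 0" if "i < Suc n" "z \<in> X" for i z
    proof -
      have "(\<Sum>j<Suc n. (if i = j then 1 else 0) * snd z ^ j) = (\<Sum>j<Suc n. if j = i then snd z ^ i else 0)"
        by (intro sum.cong) auto
      also have "\<dots> = snd z ^ i" using that(1) by (subst sum.delta) auto
      finally show ?thesis using m(3)[of "fst z" "snd z" i] that(2)
        by (simp add: left_diff_distrib sum_subtractf del: sum.lessThan_Suc)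
    qed
  qed (simp add: m)
  then show ?thesis by (auto simp: X_def)
qed

subsection \<open>The lines through the centre\<close>

text \<open>The nested span makes this literally the quotient map that defines
  \<open>lines_topology\<close>.\<close>

definition line :: "complex ^ 4 \<Rightarrow> complex ^ 4 \<Rightarrow> (complex ^ 4) set" where
  "line L a = vec.span (insert a (vec.span {L}))"

lemma mem_span_singleton: "x \<in> vec.span {a} \<longleftrightarrow> (\<exists>k. x = k *s a)" for a x :: "complex ^ 'n"
  by (auto simp: vec.span_singleton)

lemma mem_line: "x \<in> line L a \<longleftrightarrow> (\<exists>\<alpha> \<beta>. x = \<alpha> *s a + \<beta> *s L)"
proof -
  have "x - \<alpha> *s a = \<beta> *s L \<longleftrightarrow> x = \<alpha> *s a + \<beta> *s L" for \<alpha> \<beta>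
    by (simp add: diff_eq_eq add.commute)
  then show ?thesis
    unfolding line_def vec.span_insert[of a] vec.span_span mem_Collect_eq mem_span_singleton by simp
qed

lemma line_span: "line L a = vec.span {a, L}"
  unfolding line_def by (simp only: vec.span_insert[of a] vec.span_span)

lemma not_in_span_singleton:
  fixes a L :: "complex ^ 4"
  assumes "a \<notin> vec.span {L}" "\<alpha> *s a + \<beta> *s L = 0"
  shows "\<alpha> = 0"
proof (rule ccontr)
  assume \<alpha>: "\<alpha> \<noteq> 0"
  have "\<alpha> *s a = (- \<beta>) *s L" using assms(2) by (simp add: eq_neg_iff_add_eq_0)
  then have "(1 / \<alpha>) *s (\<alpha> *s a) = (1 / \<alpha>) *s ((- \<beta>) *s L)" by (rule arg_cong)
  then have "a = (- \<beta> / \<alpha>) *s L" using \<alpha> by (simp add: vector_smult_assoc)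
  then show False using assms(1) unfolding mem_span_singleton by blast
qed

lemma dim_span_singleton: "a \<noteq> 0 \<Longrightarrow> vec.dim (vec.span {a}) = 1" for a :: "complex ^ 4"
  using vec.dim_eq_card_independent[of "{a}"] by simp

lemma line_in_lines:
  assumes "L \<noteq> 0" "a \<notin> vec.span {L}"
  shows "line L a \<in> lines_through (vec.span {L})"
proof -
  have "a \<noteq> L" using assms(2) by (auto intro: vec.span_base)
  moreover have "vec.independent {a, L}" using assms by (simp add: vec.independent_insert)
  ultimately have "vec.dim (line L a) = 2"
    unfolding line_span vec.dim_span using vec.dim_eq_card_independent[of "{a, L}"] by simp
  moreover have "vec.span {L} \<subseteq> line L a" unfolding line_span by (rule vec.span_mono) auto
  ultimately show ?thesis by (auto simp: lines_through_def line_def)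
qed

lemma lines_through_obtain:
  assumes "L \<noteq> 0" "l \<in> lines_through (vec.span {L})"
  obtains a where "a \<notin> vec.span {L}" "l = line L a"
proof -
  have l: "vec.subspace l" "vec.dim l = 2" "vec.span {L} \<subseteq> l" using assms(2) by (auto simp: lines_through_def)
  have "\<not> l \<subseteq> vec.span {L}"
    using vec.dim_subset[of l "vec.span {L}"] dim_span_singleton[OF assms(1)] l(2) by auto
  then obtain a where a: "a \<in> l" "a \<notin> vec.span {L}" by blast
  have "line L a \<subseteq> l" unfolding line_def using a(1) l by (intro vec.span_minimal) auto
  moreover have "vec.dim (line L a) = 2" "vec.subspace (line L a)"
    using line_in_lines[OF assms(1) a(2)] by (auto simp: lines_through_def)
  ultimately have "line L a = l" using l by (intro vec.subspace_dim_equal) auto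
  then show ?thesis using that a(2) by blast
qed

lemma proj3_eq_span:
  assumes "x \<in> proj3" "a \<in> x" "a \<noteq> 0"
  shows "x = vec.span {a}"
proof -
  have x: "vec.subspace x" "vec.dim x = 1" using assms(1) by (auto simp: proj3_def)
  have "vec.span {a} \<subseteq> x" using x(1) assms(2) by (intro vec.span_minimal) auto
  then have "vec.span {a} = x" using x dim_span_singleton[OF assms(3)] by (intro vec.subspace_dim_equal) auto
  then show ?thesis by simp
qed

lemma span_in_proj3: "a \<noteq> 0 \<Longrightarrow> vec.span {a} \<in> proj3"
  using dim_span_singleton[of a] by (simp add: proj3_def)

lemma proj3_obtain:
  assumes "x \<in> proj3"
  obtains a where "a \<noteq> 0" "x = vec.span {a}"
proof -
  have d: "vec.dim x = 1" using assms by (simp only: proj3_def mem_Collect_eq)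
  have "\<not> x \<subseteq> vec.span {}"
  proof
    assume "x \<subseteq> vec.span {}"
    then have "vec.dim x \<le> card ({} :: (complex ^ 4) set)" by (rule vec.dim_le_card) simp
    then show False unfolding d by simp
  qed
  then obtain a where "a \<in> x" "a \<noteq> 0" by auto
  then show ?thesis using that proj3_eq_span[OF assms] by blast
qed

lemma span_eq_span: "b \<in> vec.span {a} \<Longrightarrow> b \<noteq> 0 \<Longrightarrow> vec.span {b} = vec.span {a}" for a b :: "complex ^ 4"
  using proj3_eq_span[of "vec.span {a}" b] span_in_proj3[of a] by (cases "a = 0") auto

lemma proj_from_span: "proj_from (vec.span {L}) (vec.span {a}) = line L a"
  unfolding proj_from_def vec.span_Un vec.span_span
  by (auto simp: mem_line mem_span_singleton set_eq_iff)

lemma continuous_on_combination: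
  fixes a b c :: "complex ^ 4"
  assumes "continuous_on S k" "continuous_on S m"
  shows "continuous_on S (\<lambda>s. a + k s *s b + m s *s c)"
  unfolding vector_scalar_mult_def by (intro continuous_intros assms)

section \<open>Ramified lines, Zariski density and the fibres of the projection\<close>

locale projection_centre = smooth_form F e g H for F e g H +
  fixes F0 :: cpoly4 and L :: "complex ^ 4"
  assumes F_peval: "F = peval F0" and L_notin: "F L \<noteq> 0"
begin

abbreviation centre :: "(complex ^ 4) set" where "centre \<equiv> vec.span {L}"

lemma L_nonzero: "L \<noteq> 0"
  using L_notin F_0 by auto

lemma zero_notin_centre: "F a = 0 \<Longrightarrow> a \<noteq> 0 \<Longrightarrow> a \<notin> centre"
  using L_notin by (auto simp: mem_span_singleton homogeneous_F)

lemma span_in_surface: "a \<noteq> 0 \<Longrightarrow> vec.span {a} \<in> surface F0 \<longleftrightarrow> F a = 0"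
  unfolding surface_def F_peval[symmetric] using span_in_proj3[of a]
  by (auto simp: mem_span_singleton homogeneous_F intro: vec.span_base)

lemma pdiff_eq: "pdiff F0 a v = dF a v"
  unfolding pdiff_def F_peval[symmetric]
  by (rule DERIV_imp_deriv) (use DERIV_F[OF curve_deriv_line, of a v 0] in simp)

text \<open>A property of the line joining \<open>a\<close> to the centre, phrased for a vector;
  \<open>ramified_combination\<close> makes it independent of the vector chosen.\<close>

definition ramified :: "complex ^ 4 \<Rightarrow> bool" where
  "ramified a \<longleftrightarrow> (\<exists>w. F (a + w *s L) = 0 \<and> dF (a + w *s L) L = 0)"

lemma ramified_combination_imp:
  assumes "\<alpha> \<noteq> 0" "ramified a"
  shows "ramified (\<alpha> *s a + \<beta> *s L)"
proof -
  obtain w where w: "F (a + w *s L) = 0" "dF (a + w *s L) L = 0" using assms(2) by (auto simp: ramified_def)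
  have "\<alpha> *s a + \<beta> *s L + (\<alpha> * w - \<beta>) *s L = \<alpha> *s (a + w *s L)"
    by (simp add: vec_eq_iff algebra_simps)
  then have "F (\<alpha> *s a + \<beta> *s L + (\<alpha> * w - \<beta>) *s L) = 0 \<and> dF (\<alpha> *s a + \<beta> *s L + (\<alpha> * w - \<beta>) *s L) L = 0"
    by (simp only: homogeneous_F dF_homogeneous[OF assms(1)] w) simp
  then show ?thesis unfolding ramified_def by blast
qed

lemma ramified_combination:
  assumes "\<alpha> \<noteq> 0"
  shows "ramified (\<alpha> *s a + \<beta> *s L) \<longleftrightarrow> ramified a"
proof
  assume r: "ramified (\<alpha> *s a + \<beta> *s L)"
  have "(1 / \<alpha>) *s (\<alpha> *s a + \<beta> *s L) + (- \<beta> / \<alpha>) *s L = a"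
    using assms by (simp add: vec_eq_iff field_simps)
  then show "ramified a"
    using ramified_combination_imp[OF _ r, of "1 / \<alpha>" "- \<beta> / \<alpha>"] assms by simp
qed (rule ramified_combination_imp[OF assms])

lemma line_polynomials:
  obtains P where "\<And>a w. poly (P a) w = F (a + w *s L)" "\<And>k. polyfun (\<lambda>a. coeff (P a) k)"
    "\<And>a. degree (P a) = Suc e" "\<And>a. coeff (P a) (Suc e) = F L"
    "\<And>a w. poly (pderiv (P a)) w = dF (a + w *s L) L"
    "\<And>a w. poly (pderiv (pderiv (P a))) w = pairing (\<lambda>i. pairing (\<lambda>j. H i j (a + w *s L)) L) L"
proof -
  obtain P where P: "\<And>a w. F (a + w *s L) = poly (P a) w" "\<And>k. polyfun (\<lambda>a. coeff (P a) k)"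
    by (rule polyfun_along_line[OF polyfun_F, where v = L]) (rule that; assumption)
  have top: "coeff (P a) (Suc e) = F L \<and> (\<forall>k > Suc e. coeff (P a) k = 0)" for a
  proof -
    obtain r where r: "\<And>s. F (L + s *s a) = poly (r L) s"
      by (rule polyfun_along_line[OF polyfun_F, where v = a]) (rule that; assumption)
    define N where "N = degree (r L)"
    \<comment> \<open>Homogeneity expresses \<open>P a\<close> at \<open>w\<close> by
      \<open>r L\<close> at \<open>1 / w\<close>; the reflected polynomial clears the denominators.
      The top coefficient is therefore the value of \<open>r L\<close> at 0, which is
      \<open>F L\<close> for every \<open>a\<close>.\<close>
    have "poly (monom 1 N * P a - monom 1 (Suc e) * reflect_poly (r L)) w = 0" if w: "w \<noteq> 0" for w
    proof -
      have "a + w *s L = w *s (L + (1 / w) *s a)" using w by (simp add: vec_eq_iff field_simps)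
      then have "poly (P a) w = w ^ Suc e * poly (r L) (1 / w)"
        by (simp only: P(1)[symmetric] homogeneous_F r)
      then show ?thesis using w by (simp add: poly_monom poly_reflect_poly_nz N_def inverse_eq_divide)
    qed
    then have "- {0} \<subseteq> {w. poly (monom 1 N * P a - monom 1 (Suc e) * reflect_poly (r L)) w = 0}" by auto
    moreover have "infinite (- {0::complex})"
      using infinite_UNIV_char_0[where 'a = complex] by (simp add: Compl_eq_Diff_UNIV)
    ultimately have "monom 1 N * P a - monom 1 (Suc e) * reflect_poly (r L) = 0"
      using poly_roots_finite finite_subset by blast
    then have eq: "monom 1 N * P a = monom 1 (Suc e) * reflect_poly (r L)" by simp
    have co: "coeff (P a) k = coeff (reflect_poly (r L)) (N + k - Suc e)" if "Suc e \<le> k" for k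
      using arg_cong[OF eq, of "\<lambda>p. coeff p (N + k)"] that by (simp add: coeff_monom_mult)
    have "coeff (reflect_poly (r L)) N = poly (r L) 0" by (simp add: N_def coeff_reflect_poly poly_0_coeff_0)
    moreover have "F L = poly (r L) 0" using r[of 0] by simp
    moreover have "coeff (reflect_poly (r L)) (N + k - Suc e) = 0" if "Suc e < k" for k
      using degree_reflect_poly_le[of "r L"] that by (intro coeff_eq_0) (auto simp: N_def)
    ultimately show ?thesis using co by simp
  qed
  have d1: "poly (pderiv (P a)) w = dF (a + w *s L) L" for a w
  proof -
    have "((\<lambda>w. poly (P a) w) has_field_derivative dF (a + w *s L) L) (at w)"
      unfolding P(1)[symmetric] by (rule DERIV_F[OF curve_deriv_line])
    then show ?thesis using poly_DERIV DERIV_unique by blast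
  qed
  have d2: "poly (pderiv (pderiv (P a))) w = pairing (\<lambda>i. pairing (\<lambda>j. H i j (a + w *s L)) L) L" for a w
  proof -
    have "((\<lambda>w. poly (pderiv (P a)) w) has_field_derivative
        pairing (\<lambda>i. pairing (\<lambda>j. H i j (a + w *s L)) L) L) (at w)"
      unfolding d1 using DERIV_dF[OF curve_deriv_line[of a L w] curve_deriv_const[of L w]] by simp
    then show ?thesis using poly_DERIV DERIV_unique by blast
  qed
  have "degree (P a) = Suc e" for a
  proof (rule antisym)
    show "degree (P a) \<le> Suc e" using top by (intro degree_le) auto
    show "Suc e \<le> degree (P a)" using top[of a] L_notin by (intro le_degree) auto
  qed
  then show ?thesis using that[of P] P top d1 d2 by simp
qed

text \<open>In place of the discriminant: \<open>w\<close> is eliminated between the equation on the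
  line and its derivative, whose common roots are the ramification. The constant leading coefficient
  \<open>F L\<close> is what makes \<open>elimination\<close> applicable.\<close>

lemma separation:
  assumes "\<not> ramified a0"
  shows "\<exists>G. polyfun G \<and> G a0 = 1 \<and> (\<forall>a. ramified a \<longrightarrow> G a = 0)"
proof -
  obtain P where P: "\<And>a w. poly (P a) w = F (a + w *s L)" "\<And>k. polyfun (\<lambda>a. coeff (P a) k)"
    "\<And>a. degree (P a) = Suc e" "\<And>a. coeff (P a) (Suc e) = F L" "\<And>a w. poly (pderiv (P a)) w = dF (a + w *s L) L"
    by (rule line_polynomials) (rule that; assumption)
  have "\<exists>G. polyfun G \<and> G a0 = 1 \<and> (\<forall>a w. poly (P a) w = 0 \<longrightarrow> poly (pderiv (P a)) w = 0 \<longrightarrow> G a = 0)"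
  proof (rule elimination[OF P(2-4)])
    show "polyfun (\<lambda>a. coeff (pderiv (P a)) k)" for k
      unfolding coeff_pderiv by (intro polyfun_mult polyfun_const P(2))
    show "degree (pderiv (P a)) \<le> e" for a by (simp add: degree_pderiv P(3))
    show "poly (pderiv (P a0)) w \<noteq> 0" if "poly (P a0) w = 0" for w
      using assms that unfolding ramified_def P by blast
  qed
  then show ?thesis unfolding ramified_def P by blast
qed

text \<open>Projection along \<open>L\<close> to a coordinate hyperplane makes the separating
  function invariant under the centre. Ramification does not change under scaling, so every
  homogeneous component vanishes on the ramified vectors, and some component is nonzero at
  \<open>a0\<close>.\<close>

lemma separating_form:
  assumes a0: "\<not> ramified a0"
  obtains C k where "homogeneous k C" "\<And>a v. v \<in> centre \<Longrightarrow> peval C (a + v) = peval C a"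
    "peval C a0 \<noteq> 0" "\<And>a. ramified a \<Longrightarrow> peval C a = 0"
proof -
  obtain i where i: "L $ i \<noteq> 0" using L_nonzero by (auto simp: vec_eq_iff)
  define \<pi> where "\<pi> a = a - (a $ i / L $ i) *s L" for a
  have ram: "ramified (\<pi> a) \<longleftrightarrow> ramified a" for a
    using ramified_combination[of 1 a "- (a $ i / L $ i)"] by (simp add: \<pi>_def)
  obtain G where G: "polyfun G" "G (\<pi> a0) = 1" "\<And>a. ramified a \<Longrightarrow> G a = 0"
    using separation[of "\<pi> a0"] a0 ram by blast
  have "polyfun (\<lambda>a. \<pi> a $ j)" for j
    unfolding \<pi>_def by (auto intro!: polyfun_diff polyfun_mult polyfun_divide polyfun_nth)
  then have "polyfun (\<lambda>a. G (\<pi> a))" by (intro polyfun_vec_compose[OF G(1)])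
  then obtain C q where C: "\<And>k. homogeneous k (C k)" "\<And>a k. G (\<pi> (k *s a)) = poly (q a) k"
    "\<And>a k. coeff (q a) k = peval (C k) a"
    by (rule homogeneous_components) (rule that; assumption)
  have "poly (q a0) 1 = 1" using C(2)[of 1 a0] G(2) by simp
  then have "q a0 \<noteq> 0" by auto
  then obtain k where k: "coeff (q a0) k \<noteq> 0" by (auto simp: poly_eq_iff)
  show ?thesis
  proof (rule that[of k "C k"])
    show "peval (C k) a0 \<noteq> 0" using k C(3) by simp
    show "peval (C k) (a + v) = peval (C k) a" if v: "v \<in> centre" for a v
    proof -
      obtain \<beta> where \<beta>: "v = \<beta> *s L" using v by (auto simp: mem_span_singleton)
      have "\<pi> (c *s (a + v)) = \<pi> (c *s a)" for c
        using i by (simp add: \<pi>_def \<beta> vec_eq_iff field_simps)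
      then have "poly (q (a + v)) c = poly (q a) c" for c by (simp add: C(2)[symmetric])
      then have "q (a + v) = q a" by (simp add: poly_eq_poly_eq_iff[symmetric] fun_eq_iff)
      then show ?thesis by (simp add: C(3)[symmetric])
    qed
    show "peval (C k) a = 0" if a: "ramified a" for a
    proof -
      have "poly (q a) c = 0" if "c \<noteq> 0" for c
        using ramified_combination[OF that, of a 0] a G(3) by (simp add: C(2)[symmetric] ram)
      then have "- {0} \<subseteq> {c. poly (q a) c = 0}" by auto
      moreover have "infinite (- {0::complex})"
        using infinite_UNIV_char_0[where 'a = complex] by (simp add: Compl_eq_Diff_UNIV)
      ultimately have "q a = 0" using poly_roots_finite finite_subset by blast
      then show ?thesis by (simp add: C(3)[symmetric])
    qed
  qed (rule C(1))
qed

definition unramified_lines :: "(complex ^ 4) set set" where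
  "unramified_lines = {line L a |a. a \<notin> centre \<and> \<not> ramified a}"

lemma line_unramified: "a \<notin> centre \<Longrightarrow> line L a \<in> unramified_lines \<longleftrightarrow> \<not> ramified a"
proof
  assume a: "a \<notin> centre" and "line L a \<in> unramified_lines"
  then obtain b where b: "b \<notin> centre" "\<not> ramified b" "line L a = line L b" by (auto simp: unramified_lines_def)
  have "a \<in> line L a" by (auto simp: line_def intro: vec.span_base)
  then obtain \<alpha> \<beta> where *: "a = \<alpha> *s b + \<beta> *s L" using b(3) by (auto simp: mem_line)
  then have "\<alpha> \<noteq> 0" using a by (auto simp: mem_span_singleton)
  then show "\<not> ramified a" using b(2) ramified_combination unfolding * by blast
qed (auto simp: unramified_lines_def)

text \<open>All invariant forms that vanish on the ramified vectors are taken at once;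
  \<open>separating_form\<close> says that there are enough of them.\<close>

lemma zariski_closed_ramified: "zariski_closed centre (lines_through centre - unramified_lines)"
  unfolding zariski_closed_def
proof (intro exI conjI)
  let ?S = "{C. (\<exists>k. homogeneous k C) \<and> (\<forall>a. \<forall>v\<in>centre. peval C (a + v) = peval C a) \<and>
    (\<forall>a. ramified a \<longrightarrow> peval C a = 0)}"
  show "\<forall>C\<in>?S. (\<exists>k. homogeneous k C) \<and> (\<forall>a. \<forall>v\<in>centre. peval C (a + v) = peval C a)" by blast
  show "lines_through centre - unramified_lines = {l \<in> lines_through centre. \<forall>C\<in>?S. \<forall>a\<in>l. peval C a = 0}"
  proof (intro equalityI subsetI)
    fix l assume l: "l \<in> lines_through centre - unramified_lines"
    then obtain a where a: "a \<notin> centre" "l = line L a" using lines_through_obtain[OF L_nonzero] by blast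
    then have r: "ramified a" using l line_unramified by blast
    have "peval C x = 0" if C: "C \<in> ?S" and x: "x \<in> l" for C x
    proof -
      obtain \<alpha> \<beta> where x: "x = \<alpha> *s a + \<beta> *s L" using x a(2) by (auto simp: mem_line)
      have "\<beta> *s L \<in> centre" by (auto simp: mem_span_singleton)
      then have "peval C x = peval C (\<alpha> *s a)" using C x by simp
      also have "\<dots> = 0" using C r peval_scale by fastforce
      finally show ?thesis .
    qed
    then show "l \<in> {l \<in> lines_through centre. \<forall>C\<in>?S. \<forall>a\<in>l. peval C a = 0}" using l by blast
  next
    fix l assume l: "l \<in> {l \<in> lines_through centre. \<forall>C\<in>?S. \<forall>a\<in>l. peval C a = 0}"
    have "l \<notin> unramified_lines"
    proof
      assume "l \<in> unramified_lines"
      then obtain a where a: "l = line L a" "\<not> ramified a" by (auto simp: unramified_lines_def)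
      obtain C k where "homogeneous k C" "\<And>a v. v \<in> centre \<Longrightarrow> peval C (a + v) = peval C a"
        "peval C a \<noteq> 0" "\<And>a. ramified a \<Longrightarrow> peval C a = 0"
        by (rule separating_form[OF a(2)]) (rule that; assumption)
      moreover have "a \<in> l" unfolding a(1) line_def by (rule vec.span_base) simp
      ultimately show False using l by blast
    qed
    then show "l \<in> lines_through centre - unramified_lines" using l by blast
  qed
qed

lemma unramified_lines_subset: "unramified_lines \<subseteq> lines_through centre"
  using line_in_lines[OF L_nonzero] by (auto simp: unramified_lines_def)

text \<open>A form \<open>C\<close> of the closed set, multiplied by a separating function
  \<open>G\<close> for \<open>q\<close>, vanishes everywhere. On the line from \<open>q\<close> to
  any \<open>a\<close>, \<open>G\<close> is a nonzero polynomial, so \<open>C\<close> is the zero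
  polynomial there.\<close>

lemma zariski_dense_open_unramified:
  assumes q: "q \<notin> centre" "\<not> ramified q"
  shows "zariski_dense_open centre unramified_lines"
  unfolding zariski_dense_open_def
proof (intro conjI allI impI)
  fix Z assume "zariski_closed centre Z \<and> unramified_lines \<subseteq> Z"
  then obtain S where S: "\<forall>G\<in>S. (\<exists>e. homogeneous e G) \<and> (\<forall>a. \<forall>v\<in>centre. peval G (a + v) = peval G a)"
    and Z: "Z = {l \<in> lines_through centre. \<forall>G\<in>S. \<forall>a\<in>l. peval G a = 0}" and UZ: "unramified_lines \<subseteq> Z"
    unfolding zariski_closed_def by blast
  have "peval C a = 0" if C: "C \<in> S" for C a
  proof -
    have off: "peval C x = 0" if "x \<notin> centre" "\<not> ramified x" for x
    proof -
      have "line L x \<in> Z" using UZ that by (auto simp: unramified_lines_def)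
      moreover have "x \<in> line L x" unfolding line_def by (rule vec.span_base) simp
      ultimately show ?thesis using Z C by blast
    qed
    obtain k where k: "homogeneous k C" using S C by blast
    \<comment> \<open>By invariance the value on the centre is the value at 0, which is obtained
      from the zero at \<open>q\<close> by scaling.\<close>
    have on: "peval C x = 0" if "x \<in> centre" for x
    proof -
      have "peval C (0 + x) = peval C 0" using S C that by blast
      also have "\<dots> = peval C (0 *s q)" by simp
      also have "\<dots> = 0" unfolding peval_scale[OF k] using off[OF q] by simp
      finally show ?thesis by simp
    qed
    obtain G where G: "polyfun G" "G q = 1" "\<And>x. ramified x \<Longrightarrow> G x = 0" using separation[OF q(2)] by blast
    obtain h where h: "\<And>w. G (q + w *s (a - q)) = poly (h q) w"
      by (rule polyfun_along_line[OF G(1), where v = "a - q"]) (rule that; assumption)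
    obtain c where c: "\<And>w. peval C (q + w *s (a - q)) = poly (c q) w"
      by (rule polyfun_along_line[OF polyfun_peval, where v = "a - q"]) (rule that; assumption)
    have "G x * peval C x = 0" for x using G(3) on off by (cases "ramified x"; cases "x \<in> centre") auto
    then have "poly (h q * c q) w = 0" for w by (simp add: h[symmetric] c[symmetric])
    then have "h q * c q = 0" using poly_all_0_iff_0 by blast
    moreover have "poly (h q) 0 = 1" using h[of 0] G(2) by simp
    ultimately have "c q = 0" by auto
    then show ?thesis using c[of 1] by simp
  qed
  then show "Z = lines_through centre" unfolding Z by blast
qed (rule unramified_lines_subset zariski_closed_ramified)+

text \<open>By Euler's relation the differential on the line through \<open>a\<close> and
  \<open>L\<close> only sees the \<open>L\<close>-component, with factor \<open>dF a L\<close>, and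
  this is nonzero on an unramified line.\<close>

lemma etale_over_unramified: "etale_over F0 centre unramified_lines"
  unfolding etale_over_def
proof (intro ballI impI)
  fix x a v assume x: "x \<in> surface F0" "proj_from centre x \<in> unramified_lines" and a: "a \<in> x - {0}"
    and v: "v \<in> proj_from centre x" "pdiff F0 a v = 0"
  have xa: "x = vec.span {a}" using x(1) a proj3_eq_span by (auto simp: surface_def)
  have Fa: "F a = 0" using x(1) a by (auto simp: xa span_in_surface)
  have "\<not> ramified a"
    using x(2) line_unramified[OF zero_notin_centre[OF Fa]] a by (simp add: xa proj_from_span)
  then have dL: "dF a L \<noteq> 0" using Fa unfolding ramified_def by (metis add.right_neutral vec.scale_zero_left)
  obtain \<alpha> \<beta> where *: "v = \<alpha> *s a + \<beta> *s L" using v(1) by (auto simp: xa proj_from_span mem_line)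
  have "dF a v = \<beta> * dF a L" using euler[of a] Fa by (simp add: *)
  then have "\<beta> = 0" using v(2) dL by (simp add: pdiff_eq)
  then show "v \<in> x" by (auto simp: xa * mem_span_singleton)
qed

lemma point_nonzero: "a \<notin> centre \<Longrightarrow> a + w *s L \<noteq> 0"
  using not_in_span_singleton[of a L 1 w] by auto

lemma line_translate: "line L (a + w *s L) = line L a"
proof -
  have "(\<exists>\<alpha> \<beta>. x = \<alpha> *s (a + w *s L) + \<beta> *s L) \<longleftrightarrow> (\<exists>\<alpha> \<beta>. x = \<alpha> *s a + \<beta> *s L)" for x
  proof
    assume "\<exists>\<alpha> \<beta>. x = \<alpha> *s (a + w *s L) + \<beta> *s L"
    then obtain \<alpha> \<beta> where "x = \<alpha> *s (a + w *s L) + \<beta> *s L" by blast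
    then have "x = \<alpha> *s a + (\<alpha> * w + \<beta>) *s L" by (simp add: vec_eq_iff algebra_simps)
    then show "\<exists>\<alpha> \<beta>. x = \<alpha> *s a + \<beta> *s L" by blast
  next
    assume "\<exists>\<alpha> \<beta>. x = \<alpha> *s a + \<beta> *s L"
    then obtain \<alpha> \<beta> where "x = \<alpha> *s a + \<beta> *s L" by blast
    then have "x = \<alpha> *s (a + w *s L) + (\<beta> - \<alpha> * w) *s L" by (simp add: vec_eq_iff algebra_simps)
    then show "\<exists>\<alpha> \<beta>. x = \<alpha> *s (a + w *s L) + \<beta> *s L" by blast
  qed
  then show ?thesis by (auto simp: mem_line)
qed

lemma fibre_bij:
  assumes a: "a \<notin> centre"
  shows "bij_betw (\<lambda>w. vec.span {a + w *s L}) {w. F (a + w *s L) = 0} (proj_fibre F0 centre (line L a))"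
  unfolding bij_betw_def
proof
  show "inj_on (\<lambda>w. vec.span {a + w *s L}) {w. F (a + w *s L) = 0}"
  proof (rule inj_onI)
    fix w w' assume "vec.span {a + w *s L} = vec.span {a + w' *s L}"
    then have "a + w *s L \<in> vec.span {a + w' *s L}" by (metis singletonI vec.span_base)
    then obtain k where k: "a + w *s L = k *s (a + w' *s L)" by (auto simp: mem_span_singleton)
    have "(1 - k) *s a + (w - k * w') *s L = (a + w *s L) - k *s (a + w' *s L)"
      by (simp add: vec_eq_iff algebra_simps)
    then have eq0: "(1 - k) *s a + (w - k * w') *s L = 0" using k by simp
    then have "k = 1" using not_in_span_singleton[OF a eq0] by simp
    then show "w = w'" using eq0 L_nonzero by simp
  qed
  show "(\<lambda>w. vec.span {a + w *s L}) ` {w. F (a + w *s L) = 0} = proj_fibre F0 centre (line L a)"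
  proof (intro equalityI subsetI)
    fix x assume "x \<in> (\<lambda>w. vec.span {a + w *s L}) ` {w. F (a + w *s L) = 0}"
    then obtain w where "x = vec.span {a + w *s L}" "F (a + w *s L) = 0" by blast
    then show "x \<in> proj_fibre F0 centre (line L a)"
      using span_in_surface[OF point_nonzero[OF a, of w]] by (simp add: proj_fibre_def proj_from_span line_translate)
  next
    fix x assume x: "x \<in> proj_fibre F0 centre (line L a)"
    then have "x \<in> proj3" by (simp add: proj_fibre_def surface_def)
    then obtain b where b: "b \<noteq> 0" "x = vec.span {b}" by (rule proj3_obtain)
    have Fb: "F b = 0" and lb: "line L b = line L a"
      using x b span_in_surface[OF b(1)] by (auto simp: proj_fibre_def proj_from_span)
    have "b \<in> line L b" unfolding line_def by (rule vec.span_base) simp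
    then obtain \<alpha> \<beta> where *: "b = \<alpha> *s a + \<beta> *s L" unfolding lb by (auto simp: mem_line)
    have \<alpha>: "\<alpha> \<noteq> 0" using * zero_notin_centre[OF Fb b(1)] by (auto simp: mem_span_singleton)
    then have eq: "a + (\<beta> / \<alpha>) *s L = (1 / \<alpha>) *s b" by (simp add: * vec_eq_iff field_simps)
    then have "a + (\<beta> / \<alpha>) *s L \<in> vec.span {b}" by (auto simp: mem_span_singleton)
    then have "vec.span {a + (\<beta> / \<alpha>) *s L} = x" using span_eq_span point_nonzero[OF a] b(2) by blast
    moreover have "F (a + (\<beta> / \<alpha>) *s L) = 0" using Fb unfolding eq homogeneous_F by simp
    ultimately show "x \<in> (\<lambda>w. vec.span {a + w *s L}) ` {w. F (a + w *s L) = 0}" by blast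
  qed
qed

end

section \<open>Uniformity of nondegenerate centres\<close>

context projection_centre
begin

text \<open>A loop of parameters off the branch points is a loop of unramified lines through the
  centre, and the spans of the lifted vectors lift it to the surface. So the full transport group of
  a good pencil already realises every permutation of one fibre.\<close>

theorem uniform_point_centre:
  assumes nd: "\<not> degenerate_centre L"
  shows "uniform_point (Suc e) F0 centre"
proof -
  obtain p q v where b4: "basis4 p v q L"
    and good: "\<And>t w. F (p + t *s q + w *s L) = 0 \<Longrightarrow> dF (p + t *s q + w *s L) L = 0 \<Longrightarrow>
      dF (p + t *s q + w *s L) q \<noteq> 0 \<and> \<not> degenerate_tangent L (p + t *s q + w *s L)"
    and inf: "\<And>w. F (q + w *s L) = 0 \<Longrightarrow> dF (q + w *s L) L \<noteq> 0"
    and fin: "finite {t. \<exists>w. F (p + t *s q + w *s L) = 0 \<and> dF (p + t *s q + w *s L) L = 0}"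
    by (rule good_pencil[OF L_notin nd]) (rule that; assumption)
  obtain P where P: "\<And>a w. poly (P a) w = F (a + w *s L)" "\<And>a. degree (P a) = Suc e"
    "\<And>a w. poly (pderiv (P a)) w = dF (a + w *s L) L"
    "\<And>a w. poly (pderiv (pderiv (P a))) w = pairing (\<lambda>i. pairing (\<lambda>j. H i j (a + w *s L)) L) L"
    by (rule line_polynomials) (rule that; assumption)
  have P_nz: "P a \<noteq> 0" for a using P(2)[of a] by auto
  have card_unramified: "card {w. F (a + w *s L) = 0} = Suc e" if "\<not> ramified a" for a
    using card_roots_simple[OF P_nz, of a] that unfolding ramified_def P by blast
  have q: "q \<notin> centre" "\<not> ramified q"
  proof -
    show "q \<notin> centre"
    proof
      assume "q \<in> centre"
      then obtain k where "q = k *s L" by (auto simp: mem_span_singleton)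
      then have "0 *s p + 0 *s v + 1 *s q + (- k) *s L = 0" by simp
      from basis4_independent[OF b4 this] show False by simp
    qed
    show "\<not> ramified q" using inf by (auto simp: ramified_def)
  qed
  have pencil_notin: "p + t *s q \<notin> centre" for t
  proof
    assume "p + t *s q \<in> centre"
    then obtain k where "p + t *s q = k *s L" by (auto simp: mem_span_singleton)
    then have "1 *s p + 0 *s v + t *s q + (- k) *s L = 0" by simp
    from basis4_independent[OF b4 this] show False by simp
  qed
  interpret S: simple_pencil "\<lambda>z. F (p + fst z *s q + snd z *s L)" "\<lambda>z. dF (p + fst z *s q + snd z *s L) q"
    "\<lambda>z. F (fst z *s p + q + snd z *s L)" "\<lambda>t. P (p + t *s q)" "Suc e"
  proof
    have pf: "polyfun (\<lambda>z::complex \<times> complex. fst z)" "polyfun (\<lambda>z::complex \<times> complex. snd z)"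
      using polyfun_fst[OF polyfun_id] polyfun_snd[OF polyfun_id] by simp_all
    show "polyfun (\<lambda>z. F (p + fst z *s q + snd z *s L))" "polyfun (\<lambda>z. F (fst z *s p + q + snd z *s L))"
      by (rule polyfun_vec_compose[OF polyfun_F]; simp; intro polyfun_add polyfun_mult polyfun_const pf)+
    show "poly (P (p + t *s q)) w = F (p + fst (t, w) *s q + snd (t, w) *s L)" for t w by (simp add: P)
    show "((\<lambda>t. F (p + fst (t, w) *s q + snd (t, w) *s L)) has_field_derivative
        dF (p + fst (t, w) *s q + snd (t, w) *s L) q) (at t)" for t w
      using DERIV_F[OF curve_deriv_line[of "p + w *s L" q t]] by (simp add: add.commute add.left_commute)
    show "poly (pderiv (pderiv (P (p + t *s q)))) w \<noteq> 0 \<and> dF (p + fst (t, w) *s q + snd (t, w) *s L) q \<noteq> 0"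
      if "F (p + fst (t, w) *s q + snd (t, w) *s L) = 0" "poly (pderiv (P (p + t *s q))) w = 0" for t w
      using good[of t w] that by (simp add: P degenerate_tangent_def)
    show "w = w'" if 1: "F (p + fst (t, w) *s q + snd (t, w) *s L) = 0" "poly (pderiv (P (p + t *s q))) w = 0"
      "F (p + fst (t, w') *s q + snd (t, w') *s L) = 0" "poly (pderiv (P (p + t *s q))) w' = 0" for t w w'
    \<comment> \<open>Two distinct points of tangency on one line through the centre would make it a
      degenerate tangent.\<close>
    proof (rule ccontr)
      assume "w \<noteq> w'"
      then have "w' - w \<noteq> 0" by simp
      moreover have "p + t *s q + w *s L + (w' - w) *s L = p + t *s q + w' *s L" by (simp add: vec_eq_iff algebra_simps)
      ultimately have "degenerate_tangent L (p + t *s q + w *s L)"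
        unfolding degenerate_tangent_def using 1 unfolding P fst_conv snd_conv by metis
      then show False using good[of t w] 1 by (simp add: P)
    qed
    show "finite {t. \<exists>w. F (p + fst (t, w) *s q + snd (t, w) *s L) = 0 \<and> poly (pderiv (P (p + t *s q))) w = 0}"
      using fin by (simp add: P)
    show "F (p + fst (t, w) *s q + snd (t, w) *s L) =
        t ^ Suc e * F (fst (1 / t, w / t) *s p + q + snd (1 / t, w / t) *s L)" if "t \<noteq> 0" for t w
    proof -
      have "p + t *s q + w *s L = t *s ((1 / t) *s p + q + (w / t) *s L)"
        using that by (simp add: vec_eq_iff field_simps)
      then show ?thesis by (simp only: fst_conv snd_conv homogeneous_F)
    qed
    have r0: "{\<rho>. F (fst (0, \<rho>) *s p + q + snd (0, \<rho>) *s L) = 0} = {\<rho>. F (q + \<rho> *s L) = 0}" by simp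
    show "card {\<rho>. F (fst (0, \<rho>) *s p + q + snd (0, \<rho>) *s L) = 0} = Suc e"
      unfolding r0 by (rule card_unramified[OF q(2)])
    then show "finite {\<rho>. F (fst (0, \<rho>) *s p + q + snd (0, \<rho>) *s L) = 0}"
      using card_ge_0_finite by force
    show "\<exists>D. D \<noteq> 0 \<and> ((\<lambda>\<rho>. F (fst (0, \<rho>) *s p + q + snd (0, \<rho>) *s L)) has_field_derivative D) (at \<rho>)"
      if "F (fst (0, \<rho>) *s p + q + snd (0, \<rho>) *s L) = 0" for \<rho>
      using inf[of \<rho>] that DERIV_F[OF curve_deriv_line[of q L \<rho>]]
      by (intro exI[of _ "dF (q + \<rho> *s L) L"]) simp
  qed (rule P(2) P_nz)+
  have E: "t \<in> S.E \<longleftrightarrow> ramified (p + t *s q)" for t unfolding S.E_def by (simp add: ramified_def P)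
  have roots: "S.roots t = {w. F (p + t *s q + w *s L) = 0}" for t unfolding S.roots_def by simp
  obtain t where t: "t \<notin> S.E" and full: "\<And>\<sigma>. \<sigma> permutes S.roots t \<Longrightarrow> S.transport t t \<sigma>"
    by (rule S.full_monodromy) (rule that; assumption)
  define a where "a = p + t *s q"
  define y where "y = line L a"
  define \<Phi> where "\<Phi> w = vec.span {a + w *s L}" for w
  have bij: "bij_betw \<Phi> (S.roots t) (proj_fibre F0 centre y)"
    using fibre_bij[OF pencil_notin, of t] unfolding roots \<Phi>_def y_def a_def .
  have y: "y \<in> unramified_lines"
    using line_unramified[OF pencil_notin, of t] t E unfolding y_def a_def by blast
  let ?X = "subtopology proj3_topology {x \<in> surface F0. proj_from centre x \<in> unramified_lines}"
  let ?B = "subtopology (lines_topology centre) unramified_lines"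
  have top: "topspace proj3_topology = (\<lambda>a. vec.span {a}) ` (- {0})"
    by (simp add: proj3_topology_def topspace_quotient_topology)
  have "surface F0 \<subseteq> topspace proj3_topology"
  proof
    fix x assume "x \<in> surface F0"
    then have "x \<in> proj3" by (simp add: surface_def)
    then obtain b where "b \<noteq> 0" "x = vec.span {b}" by (rule proj3_obtain)
    then show "x \<in> topspace proj3_topology" unfolding top by blast
  qed
  then have fibre: "{x \<in> topspace ?X. proj_from centre x = y} = proj_fibre F0 centre y"
    using y unfolding topspace_subtopology proj_fibre_def by blast
  have "\<exists>\<gamma>. pathin ?B \<gamma> \<and> \<gamma> 0 = y \<and> \<gamma> 1 = y \<and> (\<forall>x\<in>proj_fibre F0 centre y.
      \<exists>\<gamma>'. pathin ?X \<gamma>' \<and> (\<forall>t\<in>{0..1}. proj_from centre (\<gamma>' t) = \<gamma> t) \<and> \<gamma>' 0 = x \<and> \<gamma>' 1 = \<sigma> x)"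
    if \<sigma>: "\<sigma> permutes proj_fibre F0 centre y" for \<sigma>
  proof -
    have inv: "bij_betw (inv_into (S.roots t) \<Phi>) (proj_fibre F0 centre y) (S.roots t)"
      by (rule bij_betw_inv_into[OF bij])
    \<comment> \<open>The permutation \<open>\<sigma>\<close> of points of the surface, read in the
      parameter \<open>w\<close> through \<open>\<Phi>\<close>.\<close>
    define \<beta> where "\<beta> w = (if w \<in> S.roots t
      then inv_into (S.roots t) \<Phi> (\<sigma> (inv_into (proj_fibre F0 centre y) (inv_into (S.roots t) \<Phi>) w)) else w)" for w
    have "\<beta> permutes S.roots t"
      unfolding \<beta>_def by (rule permutes_bij_inv_into[OF \<sigma> inv])
    then obtain \<gamma> where \<gamma>: "path \<gamma>" "path_image \<gamma> \<subseteq> - S.E" "pathstart \<gamma> = t" "pathfinish \<gamma> = t"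
      and lift: "\<And>w. w \<in> S.roots t \<Longrightarrow> \<exists>l. path l \<and> pathstart l = w \<and> pathfinish l = \<beta> w \<and>
        (\<forall>s\<in>{0..1}. F (p + fst (\<gamma> s, l s) *s q + snd (\<gamma> s, l s) *s L) = 0)"
      using full[of \<beta>] unfolding S.transport_def by blast
    have \<Phi>\<beta>: "\<Phi> (\<beta> w) = \<sigma> (\<Phi> w)" if w: "w \<in> S.roots t" for w
    proof -
      have im: "\<Phi> w \<in> proj_fibre F0 centre y" using bij w by (auto simp: bij_betw_def)
      then have "inv_into (proj_fibre F0 centre y) (inv_into (S.roots t) \<Phi>) w = \<Phi> w"
        using inv bij w by (intro inv_into_f_eq) (auto simp: bij_betw_def inv_into_f_f)
      moreover have "\<sigma> (\<Phi> w) \<in> \<Phi> ` S.roots t"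
        using im \<sigma> bij by (simp add: permutes_in_image bij_betw_def)
      ultimately show ?thesis using w by (simp add: \<beta>_def f_inv_into_f)
    qed
    have unram: "\<not> ramified (p + \<gamma> s *s q)" if "s \<in> {0..1}" for s
      using \<gamma>(2) that E unfolding path_image_def by blast
    define \<Gamma> where "\<Gamma> s = line L (p + \<gamma> s *s q)" for s
    have \<gamma>01: "\<gamma> 0 = t" "\<gamma> 1 = t" using \<gamma>(3,4) by (simp_all add: pathstart_def pathfinish_def)
    show ?thesis
    proof (rule exI[of _ \<Gamma>], intro conjI ballI)
      show "\<Gamma> 0 = y" "\<Gamma> 1 = y" using \<gamma>01 by (simp_all add: \<Gamma>_def y_def a_def)
      have "continuous_on {0..1} (\<lambda>s. p + \<gamma> s *s q + 0 *s q)"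
        by (rule continuous_on_combination) (use \<gamma>(1) in \<open>auto simp: path_def\<close>)
      then have "continuous_map (top_of_set {0..1}) (top_of_set (- centre)) (\<lambda>s. p + \<gamma> s *s q)"
        using pencil_notin by auto
      then have "continuous_map (top_of_set {0..1}) (lines_topology centre)
          ((\<lambda>a. vec.span (insert a centre)) \<circ> (\<lambda>s. p + \<gamma> s *s q))"
        unfolding lines_topology_def
        by (rule continuous_map_compose[OF _ quotient_imp_continuous_map[OF quotient_map_quotient_topology]])
      then have "continuous_map (top_of_set {0..1}) (lines_topology centre) \<Gamma>"
        unfolding \<Gamma>_def[abs_def] line_def comp_def .
      moreover have "\<Gamma> s \<in> unramified_lines" if "s \<in> {0..1}" for s
        using line_unramified[OF pencil_notin] unram[OF that] unfolding \<Gamma>_def by blast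
      ultimately show "pathin ?B \<Gamma>" unfolding pathin_def continuous_map_in_subtopology by auto
    next
      fix x assume "x \<in> proj_fibre F0 centre y"
      then obtain w where w: "w \<in> S.roots t" "x = \<Phi> w" using bij by (auto simp: bij_betw_def)
      obtain l where l: "path l" "pathstart l = w" "pathfinish l = \<beta> w"
        "\<forall>s\<in>{0..1}. F (p + fst (\<gamma> s, l s) *s q + snd (\<gamma> s, l s) *s L) = 0" using lift[OF w(1)] by blast
      define \<Lambda> where "\<Lambda> s = vec.span {p + \<gamma> s *s q + l s *s L}" for s
      have l01: "l 0 = w" "l 1 = \<beta> w" using l(2,3) by (simp_all add: pathstart_def pathfinish_def)
      have proj: "proj_from centre (\<Lambda> s) = \<Gamma> s" for s
        by (simp add: \<Lambda>_def \<Gamma>_def proj_from_span line_translate)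
      show "\<exists>\<gamma>'. pathin ?X \<gamma>' \<and> (\<forall>t\<in>{0..1}. proj_from centre (\<gamma>' t) = \<Gamma> t) \<and> \<gamma>' 0 = x \<and> \<gamma>' 1 = \<sigma> x"
      proof (rule exI[of _ \<Lambda>], intro conjI ballI)
        have "continuous_on {0..1} (\<lambda>s. p + \<gamma> s *s q + l s *s L)"
          by (rule continuous_on_combination) (use \<gamma>(1) l(1) in \<open>auto simp: path_def\<close>)
        then have "continuous_map (top_of_set {0..1}) (top_of_set (- {0})) (\<lambda>s. p + \<gamma> s *s q + l s *s L)"
          using point_nonzero[OF pencil_notin] by auto
        then have "continuous_map (top_of_set {0..1}) proj3_topology
            ((\<lambda>a. vec.span {a}) \<circ> (\<lambda>s. p + \<gamma> s *s q + l s *s L))"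
          unfolding proj3_topology_def
          by (rule continuous_map_compose[OF _ quotient_imp_continuous_map[OF quotient_map_quotient_topology]])
        then have "continuous_map (top_of_set {0..1}) proj3_topology \<Lambda>"
          unfolding \<Lambda>_def[abs_def] comp_def .
        moreover have "\<Lambda> s \<in> surface F0 \<and> proj_from centre (\<Lambda> s) \<in> unramified_lines" if s: "s \<in> {0..1}" for s
        proof
          show "\<Lambda> s \<in> surface F0"
            using l(4) s span_in_surface[OF point_nonzero[OF pencil_notin]] by (simp add: \<Lambda>_def)
          show "proj_from centre (\<Lambda> s) \<in> unramified_lines"
            unfolding proj \<Gamma>_def using line_unramified[OF pencil_notin] unram[OF s] by blast
        qed
        ultimately show "pathin ?X \<Lambda>" unfolding pathin_def continuous_map_in_subtopology by auto
        show "\<Lambda> 0 = x" using w(2) by (simp add: \<Lambda>_def \<gamma>01 l01 \<Phi>_def a_def)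
        have "\<Lambda> 1 = \<Phi> (\<beta> w)" by (simp add: \<Lambda>_def \<gamma>01 l01 \<Phi>_def a_def)
        then show "\<Lambda> 1 = \<sigma> x" unfolding w(2) \<Phi>\<beta>[OF w(1)] .
      qed (rule proj)
    qed
  qed
  then have "proj_monodromy_group F0 centre unramified_lines y = {\<sigma>. \<sigma> permutes proj_fibre F0 centre y}"
    unfolding proj_monodromy_group_def monodromy_group_def fibre by blast
  moreover have "card (proj_fibre F0 centre y) = Suc e"
    using bij_betw_same_card[OF bij] card_unramified[of "p + t *s q"] t E unfolding roots by simp
  ultimately show ?thesis
    unfolding uniform_point_def
    using zariski_dense_open_unramified[OF q] etale_over_unramified y by blast
qed

text \<open>In degree 1 the derivative in direction \<open>L\<close> is the constant
  \<open>F L\<close>, which is nonzero, so that no line through the centre is tangent.\<close>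

lemma degenerate_centre_plane: "degenerate_centre L \<Longrightarrow> e > 0"
proof (rule ccontr)
  assume d: "degenerate_centre L" and "\<not> e > 0"
  then have e: "e = 0" by simp
  obtain P where P: "\<And>a. coeff (P a) (Suc e) = F L" "\<And>a w. poly (pderiv (P a)) w = dF (a + w *s L) L"
    by (rule line_polynomials) (rule that; assumption)
  have "dF a L = F L" for a
  proof -
    have "dF a L = poly (pderiv (P a)) 0" using P(2)[of a 0] by simp
    also have "\<dots> = F L" using P(1)[of a] by (simp add: poly_0_coeff_0 coeff_pderiv e)
    finally show ?thesis .
  qed
  then have "\<not> degenerate_tangent L x" for x using L_notin by (simp add: degenerate_tangent_def)
  then show False using d by (simp add: degenerate_centre_def)
qed

end

section \<open>Finiteness of the non-uniform locus\<close>

theorem theorem1p1: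
  fixes F :: cpoly4 and d :: nat
  assumes "homogeneous d F"
    and "irreducible F"
    and "smooth_surface F"
  shows "finite (non_uniform_locus d F)"
proof (cases d)
  case 0
  \<comment> \<open>In degree 0 the polynomial is a constant, hence zero or a unit, against
    irreducibility.\<close>
  have keys: "Poly_Mapping.keys F \<subseteq> {0}"
  proof
    fix m assume "m \<in> Poly_Mapping.keys F"
    then have "(\<Sum>i\<in>UNIV. Poly_Mapping.lookup m i) = 0" using assms(1) 0 by (simp add: homogeneous_def)
    then show "m \<in> {0}" by (auto intro!: poly_mapping_eqI)
  qed
  have F: "F = Poly_Mapping.single 0 (Poly_Mapping.lookup F 0)"
  proof (rule poly_mapping_eqI)
    fix m
    show "Poly_Mapping.lookup F m = Poly_Mapping.lookup (Poly_Mapping.single 0 (Poly_Mapping.lookup F 0)) m"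
      using keys by (cases "m = 0") (auto simp: lookup_single in_keys_iff)
  qed
  have "Poly_Mapping.lookup F 0 \<noteq> 0"
  proof
    assume "Poly_Mapping.lookup F 0 = 0"
    with F have "F = 0" by simp
    then show False using assms(2) by simp
  qed
  then have "F * Poly_Mapping.single 0 (inverse (Poly_Mapping.lookup F 0)) = 1"
    by (subst F) (simp add: mult_single)
  then have "F dvd 1" by (metis dvd_triv_left)
  then show ?thesis using assms(2) by (simp add: irreducible_def)
next
  case (Suc e)
  let ?f = "peval F"
  obtain g where g: "\<And>i. polyfun (g i)" "\<And>x x' t. curve_deriv x x' t \<Longrightarrow>
      ((\<lambda>s. ?f (x s)) has_field_derivative (\<Sum>i\<in>UNIV. g i (x t) * x' $ i)) (at t)"
    using polyfun_gradient[OF polyfun_peval[of F]] by blast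
  have "\<forall>i. \<exists>h. (\<forall>j. polyfun (h j)) \<and> (\<forall>x x' t. curve_deriv x x' t \<longrightarrow>
      ((\<lambda>s. g i (x s)) has_field_derivative (\<Sum>j\<in>UNIV. h j (x t) * x' $ j)) (at t))"
    using polyfun_gradient[OF g(1)] by (rule allI)
  from choice[OF this] obtain H where H: "\<And>i j. polyfun (H i j)" "\<And>i x x' t. curve_deriv x x' t \<Longrightarrow>
      ((\<lambda>s. g i (x s)) has_field_derivative (\<Sum>j\<in>UNIV. H i j (x t) * x' $ j)) (at t)" by blast
  have span_surface: "vec.span {a} \<in> surface F" if "?f a = 0" "a \<noteq> 0" for a
    using that span_in_proj3[of a] peval_scale[OF assms(1)] by (auto simp: surface_def mem_span_singleton)
  interpret smooth_form ?f e g H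
  proof
    show "(\<lambda>i. g i x) \<noteq> (\<lambda>_. 0)" if x: "?f x = 0" "x \<noteq> 0" for x
    proof
      assume 0: "(\<lambda>i. g i x) = (\<lambda>_. 0)"
      have "x \<in> vec.span {x} - {0}" using x(2) by (auto intro: vec.span_base)
      then obtain v where v: "pdiff F x v \<noteq> 0"
        using assms(3) span_surface[OF x] unfolding smooth_surface_def by blast
      have "((\<lambda>t. ?f (x + t *s v)) has_field_derivative (\<Sum>i\<in>UNIV. g i (x + 0 *s v) * v $ i)) (at 0)"
        by (rule g(2)[OF curve_deriv_line])
      then have "pdiff F x v = (\<Sum>i\<in>UNIV. g i x * v $ i)"
        unfolding pdiff_def by (intro DERIV_imp_deriv) simp
      then show False using v fun_cong[OF 0] by simp
    qed
    show "?f (k *s x) = k ^ Suc e * ?f x" for k x using peval_scale[OF assms(1)] Suc by simp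
  qed (use g H in \<open>simp_all add: polyfun_peval pairing_def\<close>)
  have "\<exists>L. x = vec.span {L} \<and> L \<noteq> 0 \<and> ?f L \<noteq> 0 \<and> degenerate_centre L"
    if x: "x \<in> non_uniform_locus d F" for x
  proof -
    have "x \<in> proj3" using x by (simp add: non_uniform_locus_def)
    then obtain L where L: "L \<noteq> 0" "x = vec.span {L}" by (rule proj3_obtain)
    have FL: "?f L \<noteq> 0" using x span_surface L by (auto simp: non_uniform_locus_def)
    interpret projection_centre ?f e g H F L by unfold_locales (simp_all add: FL)
    show ?thesis using x L FL uniform_point_centre Suc by (auto simp: non_uniform_locus_def)
  qed
  then obtain c where c: "\<And>x. x \<in> non_uniform_locus d F \<Longrightarrow>
      x = vec.span {c x} \<and> c x \<noteq> 0 \<and> ?f (c x) \<noteq> 0 \<and> degenerate_centre (c x)"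
    by metis
  have "finite (c ` non_uniform_locus d F)"
  \<comment> \<open>The bound \<open>e > 0\<close> is drawn from the existence of a degenerate
    centre, so an empty locus is treated apart.\<close>
  proof (cases "non_uniform_locus d F = {}")
    case False
    then obtain x where x: "x \<in> non_uniform_locus d F" by blast
    have "?f (c x) \<noteq> 0" using c[OF x] by blast
    then interpret projection_centre ?f e g H F "c x" by unfold_locales simp_all
    have e: "e > 0" using degenerate_centre_plane c[OF x] by blast
    show ?thesis
    proof (rule degenerate_centres_finite[OF e])
      fix K K' k assume K: "K \<in> c ` non_uniform_locus d F" "K' \<in> c ` non_uniform_locus d F" "K \<noteq> K'"
      show "K \<noteq> k *s K'"
      proof
        assume eq: "K = k *s K'"
        obtain x x' where x: "x \<in> non_uniform_locus d F" "K = c x" "x' \<in> non_uniform_locus d F" "K' = c x'"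
          using K by blast
        have "c x \<in> vec.span {c x'}" using eq x by (auto simp: mem_span_singleton)
        then have *: "vec.span {c x} = vec.span {c x'}" using c[OF x(1)] span_eq_span by blast
        have 1: "x = vec.span {c x}" "x' = vec.span {c x'}" using c x by blast+
        have "x = x'" by (rule trans[OF 1(1) trans[OF * sym[OF 1(2)]]])
        then show False using K(3) x by simp
      qed
    qed (use c in blast)+
  qed simp
  then have "finite ((\<lambda>L. vec.span {L}) ` c ` non_uniform_locus d F)" by (rule finite_imageI)
  moreover have "non_uniform_locus d F \<subseteq> (\<lambda>L. vec.span {L}) ` c ` non_uniform_locus d F"
    using c by blast
  ultimately show ?thesis by (rule rev_finite_subset)
qed

end
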